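(* Let $A=\mathcal{A}(E,\sigma_p)$ be a $3$-dimensional standard AS-regular algebra of Type EC, so $E=\mathcal{V}(x^3+y^3+z^3-3\lambda xyz)\subset\mathbb{P}^2$ with $\lambda^3\neq1$ and $p\in E\setminus E[3]$, where $\lambda=0$ if $j(E)=0$ and $\lambda=1+\sqrt3$ if $j(E)=12^3$. Then $Z(E,\sigma_p)$ and $M(E,\sigma_p)$ are as follows. (i) If $j(E)\neq0,12^3$: $Z(E,\sigma_p)=T[3]$ if $p\notin E[2]$, and $Z(E,\sigma_p)={\rm Aut}_k(\mathbb{P}^2\downarrow E)$ if $p\in E[2]$; $M(E,\sigma_p)=T[3]$ if $p\notin E[6]$, and $M(E,\sigma_p)={\rm Aut}_k(\mathbb{P}^2\downarrow E)$ if $p\in E[6]$. (ii) If $j(E)=0$: $Z(E,\sigma_p)=T[3]$ if $p\notin E[2]$, and $Z(E,\sigma_p)=T[3]\rtimes\langle\tau_E^3\rangle$ if $p\in E[2]$; $M(E,\sigma_p)=T[3]$ if $p\notin\mathcal{E}\cup E[6]$, $M(E,\sigma_p)=T[3]\rtimes\langle\tau_E^2\rangle$ if $p\in\mathcal{E}$, and $M(E,\sigma_p)=T[3]\rtimes\langle\tau_E^3\rangle$ if $p\in E[6]$. (iii) If $j(E)=12^3$: $Z(E,\sigma_p)=T[3]$ if $p\notin E[2]$, $Z(E,\sigma_p)=T[3]\rtimes\langle\tau_E^2\rangle$ if $p\in E[2]\setminus\langle(1,1,\lambda)\rangle$, and $Z(E,\sigma_p)={\rm Aut}_k(\mathbb{P}^2\downarrow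 E)$ if $p=(1,1,\lambda)$; $M(E,\sigma_p)=T[3]$ if $p\notin E[6]$, $M(E,\sigma_p)=T[3]\rtimes\langle\tau_E^2\rangle$ if $p\in E[6]\setminus\mathcal{F}$, and $M(E,\sigma_p)={\rm Aut}_k(\mathbb{P}^2\downarrow E)$ if $p\in\mathcal{F}$, where $\mathcal{F}=\langle(1,1,\lambda)\rangle\oplus E[3]$.
   Context: $k$ is an algebraically closed field of characteristic zero. $E=\mathcal{V}(x^3+y^3+z^3-3\lambda xyz)$, $\lambda^3\neq1$, is an elliptic curve with $j$-invariant $j(E)$ (normalized so that $12^3=1728$ is the $j$-invariant of the curve with complex multiplication by $\sqrt{-1}$), with the group law having zero element $o=(1,-1,0)$. By convention the representative with $\lambda=0$ is used when $j(E)=0$ and the one with $\lambda=1+\sqrt3$ when $j(E)=12^3$. $E[n]=\{p\in E\mid np=o\}$; $\sigma_p$ is the translation $q\mapsto p+q$; $T[n]=\{\sigma_p\mid p\in E[n]\}$; $\langle q\rangle$ is the subgroup of $E$ generated by $q$. $\mathcal{E}=\{(a,b,c)\in E\mid a^9=b^9=c^9\}$ (used for $\lambda=0$). ${\rm Aut}_k(E,o)$ is the group of automorphisms of $E$ fixing $o$; it is finite cyclic with generator $\tau_E$ given by: $\tau_E(a,b,c)=(b,a,c)$ if $j(E)\neq0,12^3$; $\tau_E(a,b,c)=(b,a,\varepsilon c)$ if $\lambda=0$; $\tau_E(a,b,c)=(\varepsilon^2a+\varepsilon b+c,\varepsilon a+\varepsilon^2b+c,a+b+c)$ if $\lambda=1+\sqrt3$;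 here $\varepsilon$ is a primitive cube root of unity. $\mathcal{A}(E,\sigma)$ denotes $k\langle x,y,z\rangle/(R)$, where $R$ is the space of degree-two elements $g$ (viewed as bilinear forms) with $g(q,\sigma(q))=0$ for all $q\in E$. The standard AS-regular algebras of Type EC are the $\mathcal{A}(E,\sigma_p)$ with $p=(\alpha,\beta,\gamma)\in E$, $\alpha\beta\gamma\neq0$ (equivalently $p\in E\setminus E[3]$); they are $k\langle x,y,z\rangle/(\alpha yz+\beta zy+\gamma x^2,\ \alpha zx+\beta xz+\gamma y^2,\ \alpha xy+\beta yx+\gamma z^2)$. ${\rm Aut}_k(E\uparrow\mathbb{P}^2)=\{\tau\in{\rm Aut}_kE\mid\tau=\overline{\tau}|_E\text{ for some }\overline{\tau}\in{\rm Aut}_k\mathbb{P}^2\}$; ${\rm Aut}_k(\mathbb{P}^2\downarrow E)=\{\tau\in{\rm Aut}_k\mathbb{P}^2\mid\tau|_E\in{\rm Aut}_kE\}$. The restriction $\tau\mapsto\tau|_E$ is a bijection ${\rm Aut}_k(\mathbb{P}^2\downarrow E)\to{\rm Aut}_k(E\uparrow\mathbb{P}^2)$, and the two are identified; both contain $T[3]$ and ${\rm Aut}_k(E,o)$. $Z(E,\sigma)=\{\tau\in{\rm Aut}_k(\mathbb{P}^2\downarrow E)\mid\sigma\tau|_E\sigma^{-1}=\tau|_E\}$; $M(E,\sigma)=\{\tau\in{\rm Aut}_k(\mathbb{P}^2\downarrow E)\mid(\tau|_E\sigma)^i\sigma^{-i}\in{\rm Aut}_k(E\uparrow\mathbb{P}^2)\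 \forall i\in\mathbb{Z}\}$. *)

theory Defs
  imports
    "HOL-Algebra.Bij"
    "HOL-Algebra.Coset"
    "HOL-Algebra.Generated_Groups"
    "HOL-Algebra.QuotRing"
    "HOL-Computational_Algebra.Computational_Algebra"
begin

section \<open>The projective plane\<close>

type_synonym 'k vec3 = "'k \<times> 'k \<times> 'k"

fun smul3 :: "'k::field \<Rightarrow> 'k vec3 \<Rightarrow> 'k vec3" where
  "smul3 t (a, b, c) = (t * a, t * b, t * c)"

fun add3 :: "'k::field vec3 \<Rightarrow> 'k vec3 \<Rightarrow> 'k vec3" where
  "add3 (a, b, c) (a', b', c') = (a + a', b + b', c + c')"

abbreviation null3 :: "'k::field vec3" where
  "null3 \<equiv> (0, 0, 0)"

definition proj_rel :: "'k::field vec3 \<Rightarrow> 'k vec3 \<Rightarrow> bool" where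
  "proj_rel v w \<longleftrightarrow> v \<noteq> null3 \<and> w \<noteq> null3 \<and> (\<exists>t. t \<noteq> 0 \<and> w = smul3 t v)"

quotient_type (overloaded) 'k plane = "'k::field vec3" / partial: proj_rel
proof (rule part_equivpI)
  show "\<exists>v::'k vec3. proj_rel v v"
    by (rule exI[of _ "(1, 0, 0)"]) (auto simp: proj_rel_def intro: exI[of _ 1])
  show "symp (proj_rel :: 'k vec3 \<Rightarrow> _)"
  proof (rule sympI)
    fix v w :: "'k vec3"
    assume "proj_rel v w"
    then obtain t where "v \<noteq> null3" "w \<noteq> null3" "t \<noteq> 0" "w = smul3 t v"
      by (auto simp: proj_rel_def)
    moreover from this have "v = smul3 (inverse t) w"
      by (cases v) auto
    ultimately show "proj_rel w v"
      unfolding proj_rel_def by (metis inverse_nonzero_iff_nonzero)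
  qed
  show "transp (proj_rel :: 'k vec3 \<Rightarrow> _)"
  proof (rule transpI)
    fix u v w :: "'k vec3"
    assume "proj_rel u v" "proj_rel v w"
    then obtain s t where "u \<noteq> null3" "w \<noteq> null3" "s \<noteq> 0" "t \<noteq> 0"
      "v = smul3 s u" "w = smul3 t v"
      by (auto simp: proj_rel_def)
    moreover from this have "w = smul3 (t * s) u"
      by (cases u) (auto simp: mult.assoc)
    ultimately show "proj_rel u w"
      unfolding proj_rel_def by (metis mult_eq_0_iff)
  qed
qed

text \<open>The point with homogeneous coordinates \<open>v\<close>; meaningful only for \<open>v \<noteq> null3\<close>.\<close>

abbreviation pt :: "'k::field vec3 \<Rightarrow> 'k plane" where
  "pt v \<equiv> abs_plane v"


section \<open>Regular maps and automorphisms\<close>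

text \<open>Value at \<open>(x, y, z)\<close> of the ternary form of degree \<open>d\<close> in which the monomial
  \<open>x^i y^j z^(d - i - j)\<close> has coefficient \<open>c i j\<close>.\<close>

fun eval_form :: "nat \<Rightarrow> (nat \<Rightarrow> nat \<Rightarrow> 'k::field) \<Rightarrow> 'k vec3 \<Rightarrow> 'k" where
  "eval_form d c (x, y, z) = (\<Sum>i\<le>d. \<Sum>j\<le>d - i. c i j * x ^ i * y ^ j * z ^ (d - i - j))"

definition eval_forms ::
  "nat \<Rightarrow> (nat \<Rightarrow> nat \<Rightarrow> 'k::field) \<times> (nat \<Rightarrow> nat \<Rightarrow> 'k) \<times> (nat \<Rightarrow> nat \<Rightarrow> 'k) \<Rightarrow> 'k vec3 \<Rightarrow> 'k vec3" where
  "eval_forms d F v = (case F of (F0, F1, F2) \<Rightarrow> (eval_form d F0 v, eval_form d F1 v, eval_form d F2 v))"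

text \<open>Around each point of \<open>X\<close> the map is given by three forms of one degree, namely on the
  open subset of \<open>X\<close> on which these forms have no common zero.\<close>

definition regular_on :: "'k::field plane set \<Rightarrow> ('k plane \<Rightarrow> 'k plane) \<Rightarrow> bool" where
  "regular_on X f \<longleftrightarrow>
     (\<forall>v. v \<noteq> null3 \<and> pt v \<in> X \<longrightarrow>
       (\<exists>d F. eval_forms d F v \<noteq> null3 \<and>
          (\<forall>w. w \<noteq> null3 \<and> pt w \<in> X \<and> eval_forms d F w \<noteq> null3 \<longrightarrow>
               f (pt w) = pt (eval_forms d F w))))"

text \<open>Automorphisms of the variety \<open>X\<close>, as extensional functions; they are elements of
  \<^const>\<open>BijGroup\<close>.  The plane itself is \<open>UNIV\<close>.\<close>

definition Aut_var :: "'k::field plane set \<Rightarrow> ('k plane \<Rightarrow> 'k plane) set" where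
  "Aut_var X = {f \<in> Bij X. regular_on X f \<and> regular_on X (restrict (inv_into X f) X)}"

definition Aut_up :: "'k::field plane set \<Rightarrow> ('k plane \<Rightarrow> 'k plane) set" where
  "Aut_up E = {\<tau> \<in> Aut_var E. \<exists>\<tau>' \<in> Aut_var UNIV. \<tau> = restrict \<tau>' E}"

definition Aut_down :: "'k::field plane set \<Rightarrow> ('k plane \<Rightarrow> 'k plane) set" where
  "Aut_down E = {\<tau> \<in> Aut_var UNIV. restrict \<tau> E \<in> Aut_var E}"

definition Z_set :: "'k::field plane set \<Rightarrow> ('k plane \<Rightarrow> 'k plane) \<Rightarrow> ('k plane \<Rightarrow> 'k plane) set" where
  "Z_set E \<sigma> = {\<tau> \<in> Aut_down E.
     \<sigma> \<otimes>\<^bsub>BijGroup E\<^esub> restrict \<tau> E \<otimes>\<^bsub>BijGroup E\<^esub> inv\<^bsub>BijGroup E\<^esub> \<sigma> = restrict \<tau> E}"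

definition M_set :: "'k::field plane set \<Rightarrow> ('k plane \<Rightarrow> 'k plane) \<Rightarrow> ('k plane \<Rightarrow> 'k plane) set" where
  "M_set E \<sigma> = {\<tau> \<in> Aut_down E. \<forall>i::int.
     ((restrict \<tau> E \<otimes>\<^bsub>BijGroup E\<^esub> \<sigma>) [^]\<^bsub>BijGroup E\<^esub> i) \<otimes>\<^bsub>BijGroup E\<^esub> (\<sigma> [^]\<^bsub>BijGroup E\<^esub> (- i))
       \<in> Aut_up E}"

text \<open>The restriction map by which \<^const>\<open>Aut_down\<close> is identified with \<^const>\<open>Aut_up\<close>.\<close>

definition restr_on :: "'k plane set \<Rightarrow> ('k plane \<Rightarrow> 'k plane) set \<Rightarrow> ('k::field plane \<Rightarrow> 'k plane) set" where
  "restr_on E S = (\<lambda>\<tau>. restrict \<tau> E) ` S"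


section \<open>Elliptic curves in Hesse form\<close>

fun hesse_form :: "'k::field \<Rightarrow> 'k vec3 \<Rightarrow> 'k" where
  "hesse_form l (x, y, z) = x ^ 3 + y ^ 3 + z ^ 3 - 3 * l * x * y * z"

definition hesse_curve :: "'k::field \<Rightarrow> 'k plane set" where
  "hesse_curve l = {pt v | v. v \<noteq> null3 \<and> hesse_form l v = 0}"

text \<open>\<open>p + q + r\<close> is the divisor cut out on the cubic by a line.  The line is parametrised by
  \<open>s u + t v\<close>, and the cubic form restricted to it is a nonzero multiple of the product of the
  linear forms in \<open>s\<close>, \<open>t\<close> vanishing at the parameters of \<open>p\<close>, \<open>q\<close>, \<open>r\<close>, so that
  tangency is taken into account.\<close>

definition line_section :: "'k::field \<Rightarrow> 'k plane \<Rightarrow> 'k plane \<Rightarrow> 'k plane \<Rightarrow> bool" where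
  "line_section l p q r \<longleftrightarrow>
     (\<exists>u v c p1 p2 q1 q2 r1 r2.
        (\<forall>s t. add3 (smul3 s u) (smul3 t v) = null3 \<longrightarrow> s = 0 \<and> t = 0) \<and>
        c \<noteq> 0 \<and> (p1, p2) \<noteq> (0, 0) \<and> (q1, q2) \<noteq> (0, 0) \<and> (r1, r2) \<noteq> (0, 0) \<and>
        p = pt (add3 (smul3 p1 u) (smul3 p2 v)) \<and>
        q = pt (add3 (smul3 q1 u) (smul3 q2 v)) \<and>
        r = pt (add3 (smul3 r1 u) (smul3 r2 v)) \<and>
        (\<forall>s t. hesse_form l (add3 (smul3 s u) (smul3 t v)) =
           c * (p2 * s - p1 * t) * (q2 * s - q1 * t) * (r2 * s - r1 * t)))"

definition third_point :: "'k::field \<Rightarrow> 'k plane \<Rightarrow> 'k plane \<Rightarrow> 'k plane" where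
  "third_point l p q = (THE r. line_section l p q r)"

definition origin :: "'k::field plane" where
  "origin = pt (1, -1, 0)"

text \<open>The chord-tangent group law; meaningful when \<open>l ^ 3 \<noteq> 1\<close>, i.e. for smooth curves.\<close>

definition ec_group :: "'k::field \<Rightarrow> 'k plane monoid" where
  "ec_group l = \<lparr>carrier = hesse_curve l,
     monoid.mult = (\<lambda>p q. third_point l origin (third_point l p q)),
     one = origin\<rparr>"

definition torsion :: "'k::field \<Rightarrow> nat \<Rightarrow> 'k plane set" where
  "torsion l n = {p \<in> hesse_curve l. p [^]\<^bsub>ec_group l\<^esub> n = origin}"

definition translation :: "'k::field \<Rightarrow> 'k plane \<Rightarrow> 'k plane \<Rightarrow> 'k plane" where
  "translation l p = (\<lambda>q \<in> hesse_curve l. p \<otimes>\<^bsub>ec_group l\<^esub> q)"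

definition translation_group :: "'k::field \<Rightarrow> nat \<Rightarrow> ('k plane \<Rightarrow> 'k plane) set" where
  "translation_group l n = translation l ` torsion l n"

definition ninth_power_points :: "'k::field \<Rightarrow> 'k plane set" where
  "ninth_power_points l = {pt (a, b, c) | a b c.
     (a, b, c) \<noteq> null3 \<and> hesse_form l (a, b, c) = 0 \<and> a ^ 9 = b ^ 9 \<and> b ^ 9 = c ^ 9}"

text \<open>The \<open>j\<close>-invariant of a plane cubic curve with a flex \<open>o\<close> as zero element: move the pair to
  a Weierstrass cubic with zero element \<open>(0 : 1 : 0)\<close> by an automorphism of the plane.\<close>

definition weierstrass_curve :: "'k::field \<Rightarrow> 'k \<Rightarrow> 'k plane set" where
  "weierstrass_curve a b = {pt (x, y, z) | x y z.
     (x, y, z) \<noteq> null3 \<and> y ^ 2 * z = x ^ 3 + a * x * z ^ 2 + b * z ^ 3}"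

definition j_invariant :: "'k::field plane set \<Rightarrow> 'k plane \<Rightarrow> 'k" where
  "j_invariant C o' = (THE j. \<exists>a b. 4 * a ^ 3 + 27 * b ^ 2 \<noteq> 0 \<and>
     (\<exists>\<phi> \<in> Aut_var UNIV. \<phi> ` C = weierstrass_curve a b \<and> \<phi> o' = pt (0, 1, 0)) \<and>
     j = 12 ^ 3 * (4 * a ^ 3) / (4 * a ^ 3 + 27 * b ^ 2))"

text \<open>The self-map of the plane induced by an injective linear map.\<close>

definition induced :: "('k::field vec3 \<Rightarrow> 'k vec3) \<Rightarrow> 'k plane \<Rightarrow> 'k plane" where
  "induced L p = pt (L (rep_plane p))"

text \<open>The generator of the group of automorphisms fixing the origin, for the normalised
  representatives: \<open>l = 0\<close> for \<open>j = 0\<close>, and \<open>l = 1 + sqrt 3\<close>, with either square root, for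
  \<open>j = 12 ^ 3\<close>.  Here \<open>e\<close> is a primitive cube root of unity.\<close>

definition tau_E :: "'k::field \<Rightarrow> 'k \<Rightarrow> 'k plane \<Rightarrow> 'k plane" where
  "tau_E l e = restrict (induced (\<lambda>(a, b, c).
     if l = 0 then (b, a, e * c)
     else if (l - 1) ^ 2 = 3 then (e ^ 2 * a + e * b + c, e * a + e ^ 2 * b + c, a + b + c)
     else (b, a, c))) (hesse_curve l)"


section \<open>Internal products\<close>

definition is_semidirect :: "('a, 'b) monoid_scheme \<Rightarrow> 'a set \<Rightarrow> 'a set \<Rightarrow> 'a set \<Rightarrow> bool" where
  "is_semidirect G S N H \<longleftrightarrow>
     subgroup S G \<and> N \<lhd> (G\<lparr>carrier := S\<rparr>) \<and> subgroup H (G\<lparr>carrier := S\<rparr>) \<and>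
     N \<inter> H = {\<one>\<^bsub>G\<^esub>} \<and> S = N <#>\<^bsub>G\<^esub> H"

definition is_direct_sum :: "('a, 'b) monoid_scheme \<Rightarrow> 'a set \<Rightarrow> 'a set \<Rightarrow> 'a set \<Rightarrow> bool" where
  "is_direct_sum G S A B \<longleftrightarrow>
     subgroup A G \<and> subgroup B G \<and> A \<inter> B = {\<one>\<^bsub>G\<^esub>} \<and> S = A <#>\<^bsub>G\<^esub> B"


section \<open>The quadratic algebra of a pair\<close>

datatype gen3 = Gen_x | Gen_y | Gen_z

fun coord :: "gen3 \<Rightarrow> 'k vec3 \<Rightarrow> 'k" where
  "coord Gen_x (a, b, c) = a"
| "coord Gen_y (a, b, c) = b"
| "coord Gen_z (a, b, c) = c"

text \<open>The free algebra on three generators: finitely supported functions on words.\<close>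

definition free_algebra :: "(gen3 list \<Rightarrow> 'k::field) ring" where
  "free_algebra = \<lparr>carrier = {f. finite {w. f w \<noteq> 0}},
     monoid.mult = (\<lambda>f g w. \<Sum>i\<le>length w. f (take i w) * g (drop i w)),
     one = (\<lambda>w. if w = [] then 1 else 0),
     zero = (\<lambda>w. 0),
     add = (\<lambda>f g w. f w + g w)\<rparr>"

text \<open>Elements of degree two, viewed as bilinear forms vanishing on the graph of \<open>\<sigma>\<close>; the
  vanishing does not depend on the chosen homogeneous coordinates.\<close>

definition quadratic_relations :: "'k::field plane set \<Rightarrow> ('k plane \<Rightarrow> 'k plane) \<Rightarrow> (gen3 list \<Rightarrow> 'k) set" where
  "quadratic_relations E \<sigma> = {g. (\<forall>w. length w \<noteq> 2 \<longrightarrow> g w = 0) \<and>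
     (\<forall>q\<in>E. (\<Sum>i\<in>{Gen_x, Gen_y, Gen_z}. \<Sum>j\<in>{Gen_x, Gen_y, Gen_z}.
        g [i, j] * coord i (rep_plane q) * coord j (rep_plane (\<sigma> q))) = 0)}"

definition geometric_algebra ::
  "'k::field plane set \<Rightarrow> ('k plane \<Rightarrow> 'k plane) \<Rightarrow> ((gen3 list \<Rightarrow> 'k) set) ring" where
  "geometric_algebra E \<sigma> = free_algebra Quot (Idl\<^bsub>free_algebra\<^esub> (quadratic_relations E \<sigma>))"

end

theory Submission
  imports Defs "Berlekamp_Zassenhaus.Unique_Factorization_Poly"
begin

text \<open>
  An automorphism of the plane is linear: polynomial rings are factorial, so a regular map is
  given by one triple of forms without common zeros, and invertibility forces degree one.

  The linear maps preserving \<open>E\<close> form \<open>T[3] \<rtimes> Aut(E, o)\<close>: they permute the nine flexes,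
  translations by flexes are induced by explicit monomial matrices, and a map fixing \<open>o\<close> is
  diagonal in Weierstrass coordinates, hence determined by the Weierstrass coefficients.
  Write such a map as \<open>h = \<sigma>\<^sub>t \<rho>\<close> with \<open>\<rho>\<close> fixing \<open>o\<close>.  Then \<open>h\<close> commutes with \<open>\<sigma>\<^sub>p\<close> iff
  \<open>\<rho> p = p\<close>, and \<open>h \<in> M(E, \<sigma>\<^sub>p)\<close> iff \<open>\<rho> p - p \<in> E[3]\<close>: necessity is the case
  \<open>i = 2\<close> of the definition, and the \<open>h\<close> with this property form a group normalised by \<open>\<sigma>\<^sub>p\<close>.
  Associativity of the group law is only needed when one summand is a flex, where it is linear
  algebra.

  It remains to decide these two conditions for each \<open>\<rho>\<close>.  For \<open>\<rho> = -1\<close> they say \<open>2 p = o\<close>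
  and \<open>6 p = o\<close>.  For \<open>j = 0\<close> and \<open>\<rho>\<close> of order three, comparing \<open>\<rho> p\<close> with the monomial
  translates of \<open>p\<close> gives \<open>a\<^sup>9 = b\<^sup>9 = c\<^sup>9\<close>.  For \<open>j = 12\<^sup>3\<close> and \<open>\<rho> = \<tau>\<close> of order four,
  \<open>\<tau> p - p \<in> E[3]\<close> allows one to correct \<open>p\<close> by a flex to a fixed point of \<open>\<tau>\<close>, and the only
  fixed points are \<open>o\<close> and \<open>(1, 1, \<lambda>)\<close>.
\<close>

section \<open>Automorphisms of the projective plane\<close>

text \<open>The law of \<open>ec_group\<close> is given by two definite descriptions, so the first
  obstacle is to make \<open>third_point\<close> computable. The three trilinear equations
  \<open>tri\<close> do this: every line section satisfies them and, on a smooth Hesse cubic, two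
  points determine the third. Chords, tangents and flex tangents are then treated alike, and
  cancellation becomes a symmetry of the equations. Without general associativity even the
  description of E[6] by 2p in E[3] is not formal; it comes from explicit coordinates of 2p and 3p.
  The second obstacle is the passage from point sets to equations: an automorphism of the plane that
  maps \<open>E\<close> to itself is only known to preserve zeros. The Weierstrass model is chosen
  because it is a double cover of the affine line, on which a vanishing cubic form can be read
  coefficient by coefficient. The same model computes the j-invariant, so the cases of the theorem
  become the vanishing of the coefficients \<open>wA\<close> and \<open>wB\<close>.\<close>

lemma all_gen3: "(\<forall>i. P i) \<longleftrightarrow> P Gen_x \<and> P Gen_y \<and> P Gen_z"
  by (metis gen3.exhaust)

section \<open>Points of the plane and their representatives\<close>

lemma pt_eqI: "v \<noteq> null3 \<Longrightarrow> t \<noteq> 0 \<Longrightarrow> w = smul3 t v \<Longrightarrow> pt v = pt w"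
proof -
  assume *: "v \<noteq> null3" "t \<noteq> 0" "w = smul3 t v"
  then have "w \<noteq> null3" by (cases v) auto
  with * have "proj_rel v w" unfolding proj_rel_def by blast
  then show ?thesis
    using Quotient3_rel_abs[OF Quotient3_plane] by blast
qed

lemma pt_eq_iff:
  assumes "v \<noteq> null3" "w \<noteq> null3"
  shows "pt v = pt w \<longleftrightarrow> (\<exists>t. t \<noteq> 0 \<and> w = smul3 t v)"
proof
  have refl: "proj_rel x x" if "x \<noteq> null3" for x :: "'a vec3"
    using that unfolding proj_rel_def by (cases x) (auto intro!: exI[of _ 1])
  assume "pt v = pt w"
  then have "proj_rel v w"
    using Quotient3_rel[OF Quotient3_plane, of v w] refl assms by blast
  then show "\<exists>t. t \<noteq> 0 \<and> w = smul3 t v" by (auto simp: proj_rel_def)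
next
  assume "\<exists>t. t \<noteq> 0 \<and> w = smul3 t v"
  then show "pt v = pt w" using pt_eqI assms by blast
qed

lemma pt_smul: "v \<noteq> null3 \<Longrightarrow> t \<noteq> 0 \<Longrightarrow> pt (smul3 t v) = pt v"
  using pt_eqI[of v t "smul3 t v"] by simp

lemma plane_rep: "rep_plane p \<noteq> null3" "pt (rep_plane p) = p"
  using Quotient3_rep_reflp[OF Quotient3_plane, of p] Quotient3_abs_rep[OF Quotient3_plane, of p]
  by (auto simp: proj_rel_def)

lemma plane_cases: obtains v where "v \<noteq> null3" "p = pt v"
  using plane_rep[of p] by metis

lemma rep_plane_pt:
  assumes "v \<noteq> null3"
  obtains t where "t \<noteq> 0" "rep_plane (pt v) = smul3 t v"
  using pt_eq_iff[OF assms plane_rep(1)[of "pt v"]] plane_rep(2)[of "pt v"] by metis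

definition lin3 :: "('k::field vec3 \<Rightarrow> 'k vec3) \<Rightarrow> bool" where
  "lin3 L \<longleftrightarrow> (\<forall>u v. L (add3 u v) = add3 (L u) (L v)) \<and> (\<forall>t v. L (smul3 t v) = smul3 t (L v))"

lemma smul3_eq_null [simp]: "smul3 t v = null3 \<longleftrightarrow> t = 0 \<or> v = null3"
  by (cases v) auto

lemma smul3_smul3 [simp]: "smul3 s (smul3 t v) = smul3 (s * t) v"
  by (cases v) (auto simp: mult.assoc)

lemma smul3_1 [simp]: "smul3 1 v = v"
  by (cases v) auto

lemma smul3_0 [simp]: "smul3 0 v = null3"
  by (cases v) auto

lemma add3_null [simp]: "add3 v null3 = v" "add3 null3 v = v"
  by (cases v; auto)+

lemma lin3_null: "lin3 L \<Longrightarrow> L null3 = null3"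
  unfolding lin3_def by (metis smul3_0)

text \<open>Iterated univariate polynomials, since factoriality passes from a ring to its
  polynomials one variable at a time. The outermost variable is the third coordinate, the innermost
  the first.\<close>

definition ev3 :: "'k::field poly poly poly \<Rightarrow> 'k vec3 \<Rightarrow> 'k" where
  "ev3 P v = (case v of (x, y, z) \<Rightarrow> poly (poly (poly P [:[:z:]:]) [:y:]) x)"

lemma ev3_simps [simp]:
  "ev3 (P + Q) v = ev3 P v + ev3 Q v"
  "ev3 (P - Q) v = ev3 P v - ev3 Q v"
  "ev3 (P * Q) v = ev3 P v * ev3 Q v"
  "ev3 0 v = 0"
  "ev3 1 v = 1"
  by (cases v; simp add: ev3_def)+

text \<open>An injective image of an infinite field is infinite. The target is a domain rather than
  the field itself so that the values may be constants inside a polynomial ring.\<close>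

lemma poly_zero_on_range:
  fixes q :: "'a::idom poly" and f :: "'k::field_char_0 \<Rightarrow> 'a"
  assumes "inj f" "\<And>y. poly q (f y) = 0"
  shows "q = 0"
proof (rule ccontr)
  assume "q \<noteq> 0"
  then have "finite {x. poly q x = 0}" by (rule poly_roots_finite)
  moreover have "range f \<subseteq> {x. poly q x = 0}" using assms(2) by auto
  ultimately have "finite (range f)" using finite_subset by blast
  then show False using assms(1) infinite_UNIV_char_0 finite_imageD by blast
qed

lemma ev3_eq_0:
  fixes P :: "'k::field_char_0 poly poly poly"
  assumes "\<And>v. ev3 P v = 0"
  shows "P = 0"
proof -
  have "poly (poly (poly P [:[:z:]:]) [:y:]) x = 0" for x y z
    using assms[of "(x, y, z)"] by (simp add: ev3_def)
  then have "poly (poly P [:[:z:]:]) [:y:] = 0" for y z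
    by (intro poly_zero_on_range[of "\<lambda>x. x"]) auto
  then have "poly P [:[:z:]:] = 0" for z
    by (intro poly_zero_on_range[of "\<lambda>y. [:y:]"]) (auto intro: injI)
  then show ?thesis
    by (intro poly_zero_on_range[of "\<lambda>y. [:[:y:]:]"]) (auto intro: injI)
qed

text \<open>A substitution principle for any class of functions with constants, sums and products;
  it serves both for polynomial functions of vectors and for their restrictions to a line.\<close>

lemma ev3_closed:
  assumes const: "\<And>c. (\<lambda>_. c) \<in> S"
    and add: "\<And>f g. f \<in> S \<Longrightarrow> g \<in> S \<Longrightarrow> (\<lambda>v. f v + g v) \<in> S"
    and mult: "\<And>f g. f \<in> S \<Longrightarrow> g \<in> S \<Longrightarrow> (\<lambda>v. f v * g v) \<in> S"
    and abc: "a \<in> S" "b \<in> S" "c \<in> S"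
  shows "(\<lambda>v. ev3 P (a v, b v, c v)) \<in> S"
proof -
  have 1: "(\<lambda>v. poly q (a v)) \<in> S" for q
    by (induction q) (auto intro!: const add mult abc)
  have 2: "(\<lambda>v. poly (poly q [:b v:]) (a v)) \<in> S" for q
  proof (induction q)
    case 0 then show ?case using const by simp
  next
    case (pCons r q)
    have "(\<lambda>v. poly r (a v) + b v * poly (poly q [:b v:]) (a v)) \<in> S"
      by (intro add mult 1 abc pCons.IH)
    then show ?case by simp
  qed
  have 3: "(\<lambda>v. poly (poly (poly q [:[:c v:]:]) [:b v:]) (a v)) \<in> S" for q
  proof (induction q)
    case 0 then show ?case using const by simp
  next
    case (pCons r q)
    have "(\<lambda>v. poly (poly r [:b v:]) (a v) + c v * poly (poly (poly q [:[:c v:]:]) [:b v:]) (a v)) \<in> S"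
      by (intro add mult 2 abc pCons.IH)
    then show ?case by simp
  qed
  show ?thesis using 3[of P] by (simp add: ev3_def)
qed

section \<open>Polynomial functions on vectors\<close>

definition polyfuns :: "('k::field vec3 \<Rightarrow> 'k) set" where
  "polyfuns = range ev3"

lemma polyfuns_const: "(\<lambda>_. c) \<in> polyfuns"
  unfolding polyfuns_def
  by (rule range_eqI[of _ _ "[:[:[:c:]:]:]"]) (auto simp: ev3_def)

lemma polyfuns_add: "f \<in> polyfuns \<Longrightarrow> g \<in> polyfuns \<Longrightarrow> (\<lambda>v. f v + g v) \<in> polyfuns"
  unfolding polyfuns_def by (elim rangeE, hypsubst, rule range_eqI, rule ext, rule ev3_simps(1)[symmetric])

lemma polyfuns_mult: "f \<in> polyfuns \<Longrightarrow> g \<in> polyfuns \<Longrightarrow> (\<lambda>v. f v * g v) \<in> polyfuns"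
  unfolding polyfuns_def by (elim rangeE, hypsubst, rule range_eqI, rule ext, rule ev3_simps(3)[symmetric])

lemma polyfuns_power: "f \<in> polyfuns \<Longrightarrow> (\<lambda>v. f v ^ n) \<in> polyfuns"
  by (induction n) (auto intro: polyfuns_const polyfuns_mult)

lemma polyfuns_sum: "(\<And>i. i \<in> I \<Longrightarrow> f i \<in> polyfuns) \<Longrightarrow> (\<lambda>v. \<Sum>i\<in>I. f i v) \<in> polyfuns"
  by (induction I rule: infinite_finite_induct) (auto intro: polyfuns_const polyfuns_add)

lemma polyfuns_coord: "coord i \<in> polyfuns"
proof (cases i)
  case Gen_x
  show ?thesis unfolding polyfuns_def Gen_x
    by (rule range_eqI[of _ _ "[:[:[:0, 1:]:]:]"]) (auto simp: ev3_def)
next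
  case Gen_y
  show ?thesis unfolding polyfuns_def Gen_y
    by (rule range_eqI[of _ _ "[:[:0, 1:]:]"]) (auto simp: ev3_def)
next
  case Gen_z
  show ?thesis unfolding polyfuns_def Gen_z
    by (rule range_eqI[of _ _ "[:0, 1:]"]) (auto simp: ev3_def)
qed

lemma polyfuns_compose:
  assumes "f \<in> polyfuns" "a \<in> polyfuns" "b \<in> polyfuns" "c \<in> polyfuns"
  shows "(\<lambda>v. f (a v, b v, c v)) \<in> polyfuns"
proof -
  obtain P where "f = ev3 P" using assms(1) unfolding polyfuns_def by auto
  then show ?thesis
    using ev3_closed[of polyfuns a b c P] assms polyfuns_const polyfuns_add polyfuns_mult by auto
qed

lemma polyfuns_eval_form: "eval_form d c \<in> polyfuns"
proof -
  have "(\<lambda>v. \<Sum>i\<le>d. \<Sum>j\<le>d - i. c i j * coord Gen_x v ^ i * coord Gen_y v ^ j * coord Gen_z v ^ (d - i - j))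
      \<in> polyfuns"
    by (intro polyfuns_sum polyfuns_mult polyfuns_power polyfuns_coord polyfuns_const)
  also have "(\<lambda>v. \<Sum>i\<le>d. \<Sum>j\<le>d - i. c i j * coord Gen_x v ^ i * coord Gen_y v ^ j * coord Gen_z v ^ (d - i - j))
      = eval_form d c"
    by auto
  finally show ?thesis .
qed

text \<open>Restriction to a line is what reduces the later arguments to roots of univariate
  polynomials.\<close>

lemma polyfuns_line:
  assumes "f \<in> polyfuns"
  obtains q where "\<And>t. f (add3 u (smul3 t v)) = poly q t"
proof -
  obtain u1 u2 u3 v1 v2 v3 where uv: "u = (u1, u2, u3)" "v = (v1, v2, v3)"
    by (cases u, cases v) auto
  obtain P where P: "f = ev3 P" using assms unfolding polyfuns_def by auto
  have "(\<lambda>t. ev3 P (u1 + t * v1, u2 + t * v2, u3 + t * v3)) \<in> range poly"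
  proof (rule ev3_closed)
    show "(\<lambda>_. c) \<in> range poly" for c :: 'a
      by (rule range_eqI[of _ _ "[:c:]"]) auto
    show "(\<lambda>v. f v + g v) \<in> range poly" if "f \<in> range poly" "g \<in> range poly" for f g :: "'a \<Rightarrow> 'a"
      using that by (elim rangeE) (hypsubst, intro range_eqI ext, rule poly_add[symmetric])
    show "(\<lambda>v. f v * g v) \<in> range poly" if "f \<in> range poly" "g \<in> range poly" for f g :: "'a \<Rightarrow> 'a"
      using that by (elim rangeE) (hypsubst, intro range_eqI ext, rule poly_mult[symmetric])
    show "(\<lambda>t. c + t * d) \<in> range poly" for c d :: 'a
      by (rule range_eqI[of _ _ "[:c, d:]"]) auto
    then show "(\<lambda>t. c + t * d) \<in> range poly" "(\<lambda>t. c + t * d) \<in> range poly" for c d :: 'a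
      by auto
  qed
  then obtain q where "\<And>t. ev3 P (u1 + t * v1, u2 + t * v2, u3 + t * v3) = poly q t"
    by (metis (no_types, lifting) imageE)
  then show ?thesis using that P uv by simp
qed

section \<open>Primitive families in a factorial ring\<close>

lemma ufd_prime_factors:
  fixes a :: "'a::ufd"
  assumes "a \<noteq> 0"
  obtains u M where "u dvd 1" "\<And>f. f \<in># M \<Longrightarrow> prime_elem f" "a = u * prod_mset M"
proof (cases "a dvd 1")
  case True
  then show ?thesis using that[of a "{#}"] by auto
next
  case False
  then obtain F where "mset_factors F a" using mset_factors_exist assms by blast
  then show ?thesis using that[of 1 F] by (auto simp: mset_factors_def)
qed

text \<open>Common primes are cancelled one by one. Each cancellation shortens the prime
  factorization of the nonzero entry \<open>F i0\<close>, so the process ends, and it ends with a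
  primitive family.\<close>

lemma ufd_primitive_part:
  fixes F :: "'i \<Rightarrow> 'a::ufd"
  assumes "F i0 \<noteq> 0"
  obtains h F' where "F = (\<lambda>i. h * F' i)" "\<And>p. prime_elem p \<Longrightarrow> \<exists>i. \<not> p dvd F' i"
proof -
  \<comment> \<open>Divisibility instead of equality in the invariant absorbs the unit by which the
    common prime \<open>p\<close> and the associated factor in \<open>M\<close> differ.\<close>
  have *: "\<exists>h F'. F = (\<lambda>i. h * F' i) \<and> (\<forall>p. prime_elem p \<longrightarrow> (\<exists>i. \<not> p dvd F' i))"
    if "\<forall>f. f \<in># M \<longrightarrow> prime_elem f" "F i0 dvd prod_mset M" for M and F :: "'i \<Rightarrow> 'a"
    using that
  proof (induction "size M" arbitrary: M F)
    case 0
    then have "F i0 dvd 1" by simp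
    then have "\<not> p dvd F i0" if "prime_elem p" for p
      using that by (meson dvd_trans prime_elem_def)
    then show ?case by (intro exI[of _ 1] exI[of _ F]) auto
  next
    case (Suc n)
    show ?case
    proof (cases "\<exists>p. prime_elem p \<and> (\<forall>i. p dvd F i)")
      case False
      then show ?thesis by (intro exI[of _ 1] exI[of _ F]) auto
    next
      case True
      then obtain p where "prime_elem p \<and> (\<forall>i. p dvd F i)" ..
      then have p: "prime_elem p" "\<And>i. p dvd F i" by simp_all
      from p(1) have p0: "p \<noteq> 0" "\<not> p dvd 1" by (auto dest: irreducible_not_unit)
      from p(2) have "\<forall>i. \<exists>x. F i = p * x" unfolding dvd_def by blast
      then obtain F' where F': "\<And>i. F i = p * F' i" by metis
      have "p dvd prod_mset M" using p(2) Suc.prems(2) dvd_trans by blast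
      moreover have "p dvd prod_mset N \<Longrightarrow> \<exists>f. f \<in># N \<and> p dvd f" for N
      proof (induction N)
        case empty
        then show ?case using p0 by simp
      next
        case (add g N)
        then show ?case using prime_elem_dvd_multD[OF p(1), of g "prod_mset N"] by auto
      qed
      ultimately obtain f where f: "f \<in># M" "p dvd f" by auto
      then obtain r where r: "f = p * r" by (auto elim: dvdE)
      obtain M' where M': "M = add_mset f M'" using f(1) by (metis mset_add)
      have "irreducible f" using Suc.prems(1) f(1) by auto
      then have "r dvd 1" using r p0 by (auto simp: irreducible_def)
      have "p * F' i0 dvd p * (r * prod_mset M')"
        using Suc.prems(2) F'[of i0] M' r by (simp add: mult.assoc)
      then have "F' i0 dvd r * prod_mset M'"
        using p0 by simp
      then have "F' i0 dvd prod_mset M'"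
        using \<open>r dvd 1\<close> by (metis dvd_trans mult_dvd_mono dvd_refl mult_1)
      moreover have "n = size M'" "\<forall>f. f \<in># M' \<longrightarrow> prime_elem f"
        using Suc M' by auto
      ultimately obtain h G where "F' = (\<lambda>i. h * G i)" "\<forall>p. prime_elem p \<longrightarrow> (\<exists>i. \<not> p dvd G i)"
        using Suc.hyps(1)[of M' F'] by blast
      then show ?thesis
        using F' by (intro exI[of _ "p * h"] exI[of _ G]) (auto simp: mult.assoc)
    qed
  qed
  obtain u M where "u dvd 1" "\<And>f. f \<in># M \<Longrightarrow> prime_elem f" "F i0 = u * prod_mset M"
    using ufd_prime_factors[OF assms] by metis
  moreover from this have "F i0 dvd prod_mset M"
    by (metis dvd_refl mult_dvd_mono mult_1)
  ultimately show ?thesis using *[of M F] that by blast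
qed

text \<open>For a primitive family, proportional over the fraction field means proportional over the
  ring: in \<open>F i0 * Q j = Q i0 * F j\<close> every prime of \<open>F i0\<close> misses some
  \<open>F j\<close> and so must divide \<open>Q i0\<close>.\<close>

lemma ufd_primitive_proportional:
  fixes F Q :: "'i \<Rightarrow> 'a::ufd"
  assumes prim: "\<And>p. prime_elem p \<Longrightarrow> \<exists>i. \<not> p dvd F i"
    and nz: "F i0 \<noteq> 0" and eq: "\<And>i j. F i * Q j = Q i * F j"
  obtains c where "\<And>i. Q i = c * F i"
proof -
  have *: "prod_mset M dvd b" if "\<forall>f. f \<in># M \<longrightarrow> prime_elem f" "\<forall>j. prod_mset M * R j = b * F j" for M b R
    using that
  proof (induction M arbitrary: b)
    case (add p M)
    obtain j where j: "\<not> p dvd F j" using prim add.prems(1) by auto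
    have "p dvd b * F j" using add.prems(2)[rule_format, of j, symmetric] by (simp add: mult.assoc)
    then obtain b' where b': "b = p * b'"
      using j add.prems(1) prime_elem_dvd_multD[of p b "F j"] by (auto elim: dvdE)
    have "p \<noteq> 0" using add.prems(1) by (auto simp: prime_elem_def)
    then have "\<forall>j. prod_mset M * R j = b' * F j"
      using add.prems(2) b' by (simp add: mult.assoc)
    then have "prod_mset M dvd b'" using add.IH add.prems(1) by auto
    then show ?case using b' by auto
  qed simp
  obtain u M where M: "u dvd 1" "\<And>f. f \<in># M \<Longrightarrow> prime_elem f" "F i0 = u * prod_mset M"
    using ufd_prime_factors[OF nz] by metis
  \<comment> \<open>The unit \<open>u\<close> is put together with \<open>Q\<close>, so that only
    primes remain to be cancelled.\<close>
  have "\<forall>j. prod_mset M * (u * Q j) = Q i0 * F j"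
    using eq[of i0] M(3) by (simp add: ac_simps)
  then have "prod_mset M dvd Q i0" using *[of M "\<lambda>j. u * Q j" "Q i0"] M(2) by auto
  then have "F i0 dvd Q i0"
    using M by (metis mult_dvd_mono mult_1)
  then obtain c where c: "Q i0 = F i0 * c" by (auto elim: dvdE)
  have "F i0 * Q j = F i0 * (c * F j)" for j using eq[of i0 j] c by (simp add: mult.assoc)
  then have "Q j = c * F j" for j using nz by simp
  then show ?thesis using that by blast
qed

section \<open>Regular maps of the plane as triples of polynomials\<close>

definition evt :: "(gen3 \<Rightarrow> 'k::field poly poly poly) \<Rightarrow> 'k vec3 \<Rightarrow> 'k vec3" where
  "evt F v = (ev3 (F Gen_x) v, ev3 (F Gen_y) v, ev3 (F Gen_z) v)"

lemma coord_evt [simp]: "coord i (evt F v) = ev3 (F i) v"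
  by (cases i) (auto simp: evt_def)

lemma vec3_eqI:
  assumes "\<And>i. coord i v = coord i w"
  shows "v = w"
  using assms[of Gen_x] assms[of Gen_y] assms[of Gen_z] by (cases v; cases w) simp

lemma coord_smul3 [simp]: "coord i (smul3 t v) = t * coord i v"
  by (cases i; cases v) auto

lemma coord_add3 [simp]: "coord i (add3 v w) = coord i v + coord i w"
  by (cases i; cases v; cases w) auto

lemma evt_eq_null: "evt F v = null3 \<longleftrightarrow> (\<forall>i. ev3 (F i) v = 0)"
  by (auto simp: evt_def all_gen3)

lemma evt_mult: "(\<And>i. Q i = c * F i) \<Longrightarrow> evt Q v = smul3 (ev3 c v) (evt F v)"
  by (simp add: evt_def)

lemma polyfunsE:
  assumes "f \<in> polyfuns"
  obtains P where "ev3 P = f"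
  using assms unfolding polyfuns_def by blast

lemma ev3_polyfuns: "ev3 P \<in> polyfuns"
  unfolding polyfuns_def by blast

text \<open>Homogeneity of the representing forms is dropped, so that common factors can be
  cancelled freely; it is recovered in \<open>regular_homogeneous\<close>.\<close>

definition polyrep :: "('k::field plane \<Rightarrow> 'k plane) \<Rightarrow> (gen3 \<Rightarrow> 'k poly poly poly) \<Rightarrow> bool" where
  "polyrep f Q \<longleftrightarrow> (\<forall>w. w \<noteq> null3 \<longrightarrow> evt Q w \<noteq> null3 \<longrightarrow> f (pt w) = pt (evt Q w))"

lemma polyfuns_triple:
  assumes "\<And>i. \<phi> i \<in> polyfuns"
  obtains Q where "\<And>v. evt Q v = (\<phi> Gen_x v, \<phi> Gen_y v, \<phi> Gen_z v)" "\<And>i. ev3 (Q i) = \<phi> i"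
proof -
  have "\<forall>i. \<exists>P. ev3 P = \<phi> i" using assms polyfunsE by metis
  then obtain Q where "\<And>i. ev3 (Q i) = \<phi> i" by metis
  then show ?thesis using that[of Q] by (simp add: evt_def)
qed

lemma regular_polyrep:
  assumes "regular_on UNIV f" "v \<noteq> null3"
  obtains Q where "polyrep f Q" "evt Q v \<noteq> null3"
proof -
  have "\<exists>d F. eval_forms d F v \<noteq> null3 \<and>
      (\<forall>w. w \<noteq> null3 \<and> eval_forms d F w \<noteq> null3 \<longrightarrow> f (pt w) = pt (eval_forms d F w))"
    using assms(1)[unfolded regular_on_def, rule_format, of v] assms(2) by simp
  then obtain d F where F0: "eval_forms d F v \<noteq> null3 \<and>
      (\<forall>w. w \<noteq> null3 \<and> eval_forms d F w \<noteq> null3 \<longrightarrow> f (pt w) = pt (eval_forms d F w))"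
    by (elim exE)
  note F = conjunct1[OF F0] conjunct2[OF F0, rule_format, OF conjI]
  obtain F0 F1 F2 where F012: "F = (F0, F1, F2)" by (cases F) auto
  obtain Q where "\<And>v. evt Q v = (eval_form d F0 v, eval_form d F1 v, eval_form d F2 v)"
    using polyfuns_triple[of "case_gen3 (eval_form d F0) (eval_form d F1) (eval_form d F2)"]
    by (metis (no_types, lifting) gen3.case gen3.exhaust polyfuns_eval_form)
  then have "evt Q = eval_forms d F" by (simp add: eval_forms_def F012 fun_eq_iff)
  then show ?thesis using F that[of Q] by (auto simp: polyrep_def)
qed

lemma polyrep_proportional:
  fixes P Q :: "gen3 \<Rightarrow> 'k::field_char_0 poly poly poly"
  assumes "polyrep f P" "polyrep f Q"
  shows "P i * Q j = Q i * P j"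
proof -
  obtain X :: "'k poly poly poly" where X: "ev3 X = coord Gen_x"
    using polyfunsE[OF polyfuns_coord] by blast
  \<comment> \<open>Nothing is known about the two triples at the null vector; the factor
    \<open>X\<close>, which vanishes there, makes the identity hold at every vector.\<close>
  have "ev3 (X * (P i * Q j - Q i * P j)) v = 0" for v
  proof (cases "v = null3 \<or> evt P v = null3 \<or> evt Q v = null3")
    case True
    then show ?thesis by (auto simp: X evt_eq_null)
  next
    case False
    then have "pt (evt P v) = pt (evt Q v)" using assms by (metis polyrep_def)
    then obtain t where "evt Q v = smul3 t (evt P v)" using False by (auto simp: pt_eq_iff)
    then have "ev3 (Q i) v = t * ev3 (P i) v" for i
      by (metis coord_evt coord_smul3)
    then show ?thesis by simp
  qed
  then have "X * (P i * Q j - Q i * P j) = 0" by (rule ev3_eq_0)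
  moreover have "ev3 X (1, 0, 0) \<noteq> 0" by (simp add: X)
  then have "X \<noteq> 0" by auto
  ultimately show ?thesis by simp
qed

text \<open>Every other polynomial representation of \<open>f\<close> is a multiple of \<open>F\<close>.  Such an \<open>F\<close> is
  obtained by cancelling a greatest common divisor; it has no zero because near each point
  some representation has none.\<close>

definition global_rep :: "('k::field plane \<Rightarrow> 'k plane) \<Rightarrow> (gen3 \<Rightarrow> 'k poly poly poly) \<Rightarrow> bool" where
  "global_rep f F \<longleftrightarrow> (\<forall>w. w \<noteq> null3 \<longrightarrow> evt F w \<noteq> null3) \<and>
     (\<forall>w. w \<noteq> null3 \<longrightarrow> f (pt w) = pt (evt F w)) \<and>
     (\<forall>Q. polyrep f Q \<longrightarrow> (\<exists>c. \<forall>i. Q i = c * F i))"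

lemma global_repD:
  assumes "global_rep f F"
  shows "w \<noteq> null3 \<Longrightarrow> evt F w \<noteq> null3" "w \<noteq> null3 \<Longrightarrow> f (pt w) = pt (evt F w)"
    "polyrep f Q \<Longrightarrow> \<exists>c. \<forall>i. Q i = c * F i"
  using assms by (simp_all add: global_rep_def del: split_paired_All)

lemma regular_global:
  fixes f :: "'k::field_char_0 plane \<Rightarrow> 'k plane"
  assumes "regular_on UNIV f"
  shows "\<exists>F. global_rep f F"
proof -
  obtain P where P: "polyrep f P" "evt P (1, 0, 0) \<noteq> null3"
    using regular_polyrep[OF assms, of "(1, 0, 0)"] by auto
  then obtain i0 where i0: "P i0 \<noteq> 0" by (metis evt_eq_null ev3_simps(4))
  obtain h F where F: "P = (\<lambda>i. h * F i)" "\<And>p. prime_elem p \<Longrightarrow> \<exists>i. \<not> p dvd F i"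
    using ufd_primitive_part[of P i0] i0 by metis
  have nz: "h \<noteq> 0" "F i0 \<noteq> 0" using i0 F(1) by auto
  have *: "\<exists>c. \<forall>i. Q i = c * F i" if "polyrep f Q" for Q
  proof -
    have "F i * Q j = Q i * F j" for i j
      using polyrep_proportional[OF P(1) that, of i j] nz(1) F(1) by (simp add: ac_simps)
    then show ?thesis using ufd_primitive_proportional[of F i0 Q] F(2) nz(2) by metis
  qed
  have "evt F w \<noteq> null3 \<and> f (pt w) = pt (evt F w)" if w: "w \<noteq> null3" for w
  proof -
    obtain Q where Q: "polyrep f Q" "evt Q w \<noteq> null3" using regular_polyrep[OF assms w] by metis
    obtain c where "\<forall>i. Q i = c * F i" using *[OF Q(1)] by blast
    then have c: "evt Q w = smul3 (ev3 c w) (evt F w)" by (simp add: evt_mult)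
    then have "f (pt w) = pt (smul3 (ev3 c w) (evt F w))" using Q w by (metis polyrep_def)
    moreover have "ev3 c w \<noteq> 0" "evt F w \<noteq> null3" using Q(2) c by auto
    ultimately show ?thesis by (simp add: pt_smul)
  qed
  then have "global_rep f F" using * by (simp add: global_rep_def)
  then show ?thesis by (rule exI[of _ F])
qed

text \<open>On the line through two independent vectors, which misses the null vector, the function
  is a univariate polynomial without roots, hence constant because the field is algebraically
  closed.\<close>

lemma nonvanishing_const:
  fixes h :: "'k::{alg_closed_field, field_char_0} vec3 \<Rightarrow> 'k"
  assumes "h \<in> polyfuns" "\<And>w. w \<noteq> null3 \<Longrightarrow> h w \<noteq> 0"
  obtains c where "c \<noteq> 0" "\<And>w. w \<noteq> null3 \<Longrightarrow> h w = c"
proof -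
  have *: "h u = h w" if uw: "\<And>s t. add3 (smul3 s u) (smul3 t w) = null3 \<Longrightarrow> s = 0 \<and> t = 0" for u w
  proof -
    define v where "v = add3 w (smul3 (-1) u)"
    have line: "add3 u (smul3 t v) = add3 (smul3 (1 - t) u) (smul3 t w)" for t
      unfolding v_def by (cases u; cases w) (auto simp: algebra_simps)
    obtain q where q: "\<And>t. h (add3 u (smul3 t v)) = poly q t"
      using polyfuns_line[OF assms(1)] by metis
    have "poly q t \<noteq> 0" for t
    proof -
      have "add3 u (smul3 t v) \<noteq> null3"
        using uw[of "1 - t" t] line[of t] by auto
      then show ?thesis using q assms(2) by metis
    qed
    then have "degree q = 0" using alg_closed_imp_poly_has_root by blast
    then have "poly q 0 = poly q 1" by (metis degree_0_id poly_const_conv degree_eq_zeroE)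
    then show ?thesis using q[of 0, symmetric] q[of 1, symmetric] line[of 0] line[of 1] by simp
  qed
  \<comment> \<open>Dependent vectors are compared through \<open>(1, 0, 0)\<close> or, on the first
    axis, through \<open>(0, 1, 0)\<close>.\<close>
  have a: "h (x, y, z) = h (1, 0, 0)" if "y \<noteq> 0 \<or> z \<noteq> 0" for x y z
    using that by (intro *[symmetric]) auto
  have "h (x, 0, 0) = h (0, 1, 0)" if "x \<noteq> 0" for x
    using that by (intro *) auto
  then have "h (x, y, z) = h (1, 0, 0)" if "(x, y, z) \<noteq> null3" for x y z
    using a that by (metis zero_neq_one)
  then show ?thesis using that[of "h (1, 0, 0)"] assms(2) by (metis prod_cases3 prod.inject zero_neq_one)
qed

text \<open>Once the power of the variable is split off, the cofactor has no root at all and is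
  constant.\<close>

lemma poly_root_only_0:
  fixes q :: "'k::alg_closed_field poly"
  assumes "\<And>t. t \<noteq> 0 \<Longrightarrow> poly q t \<noteq> 0"
  obtains a n where "\<And>t. poly q t = a * t ^ n"
proof -
  have "q \<noteq> 0" using assms[of 1] by auto
  then obtain r where r: "q = [:- 0, 1:] ^ order 0 q * r" "\<not> [:- 0, 1:] dvd r"
    using order_decomp by blast
  have "poly r t \<noteq> 0" for t
  proof (cases "t = 0")
    case True
    then show ?thesis using r(2) by (metis poly_eq_0_iff_dvd)
  next
    case False
    then show ?thesis using assms[of t] r(1) by (metis mult_zero_right poly_mult)
  qed
  then have "degree r = 0" using alg_closed_imp_poly_has_root by blast
  then obtain a where "r = [:a:]" by (auto elim: degree_eq_zeroE)
  then have "poly q t = a * t ^ order 0 q" for t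
    using r(1) by (metis (no_types, lifting) add.left_neutral mult.commute mult_1_right
        minus_zero poly_0 poly_const_conv poly_mult poly_pCons poly_power mult_zero_right add_0_right)
  then show ?thesis using that by blast
qed

text \<open>The triple \<open>F\<close> precomposed with scaling by \<open>t\<close> represents the
  same map, so it is a multiple of \<open>F\<close>, and by \<open>nonvanishing_const\<close> the
  factor depends on \<open>t\<close> only. As a function of \<open>t\<close> this factor is a
  polynomial that vanishes at most at 0, hence a power of \<open>t\<close>; its leading constant is
  fixed at \<open>t = 1\<close>.\<close>

lemma regular_homogeneous:
  fixes f :: "'k::{alg_closed_field, field_char_0} plane \<Rightarrow> 'k plane"
  assumes "global_rep f F"
  shows "\<exists>d. \<forall>t w. t \<noteq> 0 \<longrightarrow> w \<noteq> null3 \<longrightarrow> evt F (smul3 t w) = smul3 (t ^ d) (evt F w)"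
proof -
  note assms = global_repD[OF assms]
  have "\<exists>c. c \<noteq> 0 \<and> (\<forall>w. w \<noteq> null3 \<longrightarrow> evt F (smul3 t w) = smul3 c (evt F w))" if t: "t \<noteq> 0" for t
  proof -
    have "(\<lambda>v. ev3 (F i) (t * coord Gen_x v, t * coord Gen_y v, t * coord Gen_z v)) \<in> polyfuns" for i
      by (rule polyfuns_compose) (intro ev3_polyfuns polyfuns_mult polyfuns_const polyfuns_coord)+
    then obtain Q where Q: "\<And>i. ev3 (Q i) = (\<lambda>v. ev3 (F i) (t * coord Gen_x v, t * coord Gen_y v, t * coord Gen_z v))"
      using polyfuns_triple[of "\<lambda>i v. ev3 (F i) (t * coord Gen_x v, t * coord Gen_y v, t * coord Gen_z v)"]
      by metis
    have scale: "(t * coord Gen_x v, t * coord Gen_y v, t * coord Gen_z v) = smul3 t v" for v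
      by (cases v) auto
    have Qv: "evt Q v = evt F (smul3 t v)" for v
      by (simp add: evt_def Q scale)
    have "polyrep f Q"
      unfolding polyrep_def
    proof (intro allI impI)
      fix w :: "'k vec3" assume w: "w \<noteq> null3"
      then have "f (pt (smul3 t w)) = pt (evt F (smul3 t w))"
        using assms(2)[of "smul3 t w"] t by simp
      then show "f (pt w) = pt (evt Q w)" using w t Qv by (simp add: pt_smul)
    qed
    then obtain c where "\<forall>i. Q i = c * F i" using assms(3)[of Q] by auto
    then have c: "evt F (smul3 t w) = smul3 (ev3 c w) (evt F w)" for w
      using evt_mult[of Q c F w] Qv[of w] by auto
    have "ev3 c w \<noteq> 0" if "w \<noteq> null3" for w
      using assms(1)[of "smul3 t w"] c[of w] t that by auto
    then obtain c' where "c' \<noteq> 0" "\<And>w. w \<noteq> null3 \<Longrightarrow> ev3 c w = c'"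
      using nonvanishing_const[OF ev3_polyfuns, of c] by metis
    then show ?thesis using c by auto
  qed
  then obtain c where c: "\<And>t. t \<noteq> 0 \<Longrightarrow> c t \<noteq> 0"
    "\<And>t w. t \<noteq> 0 \<Longrightarrow> w \<noteq> null3 \<Longrightarrow> evt F (smul3 t w) = smul3 (c t) (evt F w)"
    by metis
  have "evt F (1, 0, 0) \<noteq> null3" using assms(1) by simp
  \<comment> \<open>A coordinate of \<open>F\<close> that does not vanish at
    \<open>(1, 0, 0)\<close> shows that the factor \<open>c t\<close> is polynomial in
    \<open>t\<close>.\<close>
  then obtain i where i: "ev3 (F i) (1, 0, 0) \<noteq> 0" by (auto simp: evt_eq_null)
  obtain q where "\<And>t. ev3 (F i) (add3 null3 (smul3 t (1, 0, 0))) = poly q t"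
    using polyfuns_line[of "ev3 (F i)" null3 "(1, 0, 0)"] by (auto simp: polyfuns_def)
  then have q: "ev3 (F i) (smul3 t (1, 0, 0)) = poly q t" for t by simp
  have qc: "poly q t = c t * ev3 (F i) (1, 0, 0)" if "t \<noteq> 0" for t
    using q[of t] c(2)[OF that, of "(1, 0, 0)"] by (metis coord_evt coord_smul3 prod.inject zero_neq_one)
  then obtain a n where an: "\<And>t. poly q t = a * t ^ n"
    using poly_root_only_0[of q] c(1) i by auto
  have "a = ev3 (F i) (1, 0, 0)" using an[of 1] q[of 1] by simp
  then have "c t = t ^ n" if "t \<noteq> 0" for t
    using qc[OF that] an[of t] i by simp
  then show ?thesis using c by (intro exI[of _ n]) simp
qed

text \<open>Homogeneity exchanges the roles of \<open>u\<close> and \<open>v\<close> on the line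
  through them: with \<open>q\<close> and \<open>r\<close> the two parametrizations, r(t) = t
  q(1/t). Two polynomials related in this way have degree at most one, and additivity is the
  comparison of their coefficients.\<close>

lemma polyfuns_homogeneous_1:
  fixes \<phi> :: "'k::field_char_0 vec3 \<Rightarrow> 'k"
  assumes "\<phi> \<in> polyfuns" "\<And>t w. t \<noteq> 0 \<Longrightarrow> w \<noteq> null3 \<Longrightarrow> \<phi> (smul3 t w) = t * \<phi> w"
  shows "\<phi> (smul3 t w) = t * \<phi> w" "\<phi> (add3 u v) = \<phi> u + \<phi> v"
proof -
  have poly_eqI': "p = q" if "\<And>t. t \<noteq> 0 \<Longrightarrow> poly p t = poly q t" for p q :: "'k poly"
  proof -
    have "[:0, 1:] * (p - q) = 0"
      using that by (intro poly_zero_on_range[of "\<lambda>x. x"]) (auto simp: right_diff_distrib)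
    then show ?thesis by simp
  qed
  have 0: "\<phi> null3 = 0"
  proof -
    obtain q where "\<And>t. \<phi> (add3 null3 (smul3 t (1, 0, 0))) = poly q t"
      using polyfuns_line[OF assms(1)] by metis
    then have q: "\<phi> (smul3 t (1, 0, 0)) = poly q t" for t by simp
    have "q = [:0, \<phi> (1, 0, 0):]"
    proof (rule poly_eqI')
      fix t :: 'k assume "t \<noteq> 0"
      then show "poly q t = poly [:0, \<phi> (1, 0, 0):] t"
        using q[of t] assms(2)[of t "(1, 0, 0)"] by auto
    qed
    then show ?thesis using q[of 0] by simp
  qed
  show hom: "\<phi> (smul3 t w) = t * \<phi> w" for t w
    using assms(2)[of t w] 0 by (cases "t = 0 \<or> w = null3") auto
  show "\<phi> (add3 u v) = \<phi> u + \<phi> v"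
  proof -
    obtain q where q: "\<And>t. \<phi> (add3 u (smul3 t v)) = poly q t"
      using polyfuns_line[OF assms(1)] by metis
    obtain r where r: "\<And>t. \<phi> (add3 v (smul3 t u)) = poly r t"
      using polyfuns_line[OF assms(1)] by metis
    have inv: "poly r t = t * poly q (inverse t)" if "t \<noteq> 0" for t
    proof -
      have "add3 v (smul3 t u) = smul3 t (add3 u (smul3 (inverse t) v))"
        using that by (cases u; cases v) (auto simp: algebra_simps)
      then show ?thesis using hom q r by metis
    qed
    \<comment> \<open>Multiplication by a power of the variable turns r(t) = t q(1/t) into an
      identity of polynomials and so bounds the degree of \<open>r\<close>.\<close>
    have "r * monom 1 (degree q) = [:0, 1:] * reflect_poly q"
    proof (rule poly_eqI')
      fix t :: 'k assume "t \<noteq> 0"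
      then show "poly (r * monom 1 (degree q)) t = poly ([:0, 1:] * reflect_poly q) t"
        using inv[of t] by (simp add: poly_monom poly_reflect_poly_nz)
    qed
    then have deg: "degree (r * monom 1 (degree q)) \<le> 1 + degree q"
      using degree_mult_le[of "[:0, 1:]" "reflect_poly q"] degree_reflect_poly_le[of q]
      by simp
    have "degree r \<le> 1"
    proof (cases "r = 0")
      case False
      then have "degree (r * monom 1 (degree q)) = degree r + degree q"
        by (subst degree_mult_eq) (auto simp: degree_monom_eq)
      then show ?thesis using deg by simp
    qed simp
    then obtain r0 r1 where r01: "r = [:r0, r1:]"
      by (cases r) (metis One_nat_def Suc_le_mono degree_eq_zeroE degree_pCons_eq le_zero_eq pCons_0_0)
    have r0: "r0 = \<phi> v" using r[of 0] r01 by simp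
    have qt: "poly q t = r1 + t * r0" if "t \<noteq> 0" for t
      using inv[of "inverse t"] that r01 by (simp add: field_simps)
    have "q = [:r1, r0:]" by (rule poly_eqI') (simp add: qt)
    then have "r1 = \<phi> u" using q[of 0] by simp
    then show ?thesis using q[of 1] qt[of 1] r0 by simp
  qed
qed

section \<open>Linearity of plane automorphisms\<close>

lemma lin3_add: "lin3 L \<Longrightarrow> L (add3 u v) = add3 (L u) (L v)"
  unfolding lin3_def by blast

lemma lin3_smul: "lin3 L \<Longrightarrow> L (smul3 t v) = smul3 t (L v)"
  unfolding lin3_def by blast

lemma lin3_expand:
  assumes "lin3 L"
  shows "L (x, y, z) = add3 (smul3 x (L (1, 0, 0))) (add3 (smul3 y (L (0, 1, 0))) (smul3 z (L (0, 0, 1))))"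
proof -
  have "(x, y, z) = add3 (smul3 x (1, 0, 0)) (add3 (smul3 y (0, 1, 0)) (smul3 z (0, 0, 1)))" by simp
  then show ?thesis using assms unfolding lin3_def by metis
qed

lemma regular_on_linear:
  fixes L :: "'k::field vec3 \<Rightarrow> 'k vec3"
  assumes "lin3 L" "\<And>v. v \<noteq> null3 \<Longrightarrow> L v \<noteq> null3"
    "\<And>v. v \<noteq> null3 \<Longrightarrow> pt v \<in> X \<Longrightarrow> f (pt v) = pt (L v)"
  shows "regular_on X f"
proof -
  define c where "c k = (\<lambda>(i::nat) (j::nat). if i = 1 then coord k (L (1, 0, 0)) else
    if j = 1 then coord k (L (0, 1, 0)) else coord k (L (0, 0, 1)))" for k
  have c: "eval_form 1 (c k) v = coord k (L v)" for k v
  proof -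
    obtain x y z where v: "v = (x, y, z)" by (cases v)
    show ?thesis
      unfolding v lin3_expand[OF assms(1), of x y z] by (auto simp: c_def algebra_simps atMost_Suc)
  qed
  have "eval_forms 1 (c Gen_x, c Gen_y, c Gen_z) v = L v" for v
    by (rule vec3_eqI, rename_tac i, case_tac i) (simp_all add: eval_forms_def c[unfolded One_nat_def] del: eval_form.simps)
  then show ?thesis
    unfolding regular_on_def using assms(2,3)
    by (intro allI impI exI[of _ 1] exI[of _ "(c Gen_x, c Gen_y, c Gen_z)"]) auto
qed

text \<open>The degrees of an automorphism and of its inverse multiply to the degree of the
  identity, so both are 1, and a homogeneous polynomial map of degree 1 is linear.\<close>

lemma plane_aut_linear:
  fixes f :: "'k::{alg_closed_field, field_char_0} plane \<Rightarrow> 'k plane"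
  assumes "f \<in> Aut_var UNIV"
  obtains L M where "lin3 L" "lin3 M" "\<And>v. M (L v) = v" "\<And>v. L (M v) = v"
    "\<And>v. v \<noteq> null3 \<Longrightarrow> f (pt v) = pt (L v)"
proof -
  define g where "g = inv_into UNIV f"
  have bij: "bij f" "regular_on UNIV f" "regular_on UNIV g"
    using assms by (auto simp: Aut_var_def Bij_def g_def restrict_UNIV)
  have fg: "f (g p) = p" "g (f p) = p" for p
    using bij(1) by (auto simp: g_def bij_is_inj bij_is_surj surj_f_inv_f)
  obtain F where repF: "global_rep f F" using regular_global[OF bij(2)] ..
  note F = global_repD[OF repF]
  obtain d where d: "\<And>t w. t \<noteq> 0 \<Longrightarrow> w \<noteq> null3 \<Longrightarrow> evt F (smul3 t w) = smul3 (t ^ d) (evt F w)"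
    using regular_homogeneous[OF repF] by auto
  obtain G where repG: "global_rep g G" using regular_global[OF bij(3)] ..
  note G = global_repD[OF repG]
  obtain d' where d': "\<And>t w. t \<noteq> 0 \<Longrightarrow> w \<noteq> null3 \<Longrightarrow> evt G (smul3 t w) = smul3 (t ^ d') (evt G w)"
    using regular_homogeneous[OF repG] by auto
  have comp: "\<exists>\<kappa>. \<kappa> \<noteq> 0 \<and> (\<forall>w. w \<noteq> null3 \<longrightarrow> evt B (evt A w) = smul3 \<kappa> w)"
    if A: "\<And>w. w \<noteq> null3 \<Longrightarrow> evt A w \<noteq> null3" and B: "\<And>w. w \<noteq> null3 \<Longrightarrow> evt B w \<noteq> null3"
      and BA: "\<And>w. w \<noteq> null3 \<Longrightarrow> pt (evt B (evt A w)) = pt w"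
    for A B :: "gen3 \<Rightarrow> 'k poly poly poly"
  proof -
    have "(\<lambda>v. ev3 (B i) (evt A v)) \<in> polyfuns" for i
      unfolding evt_def by (intro polyfuns_compose ev3_polyfuns)
    then obtain Q where Q0: "\<And>i. ev3 (Q i) = (\<lambda>v. ev3 (B i) (evt A v))"
      using polyfuns_triple[of "\<lambda>i v. ev3 (B i) (evt A v)"] by metis
    have Q: "evt Q v = evt B (evt A v)" for v
      by (rule vec3_eqI) (simp add: Q0)
    obtain X where X0: "\<And>i. ev3 (X i) = (coord i :: 'k vec3 \<Rightarrow> 'k)"
      using polyfuns_triple[of coord, OF polyfuns_coord] by metis
    have X: "evt X v = v" for v
      by (rule vec3_eqI) (simp add: X0)
    have "polyrep id Q" "polyrep id X"
      using BA by (auto simp: polyrep_def Q X)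
    have reg: "regular_on UNIV (id :: 'k plane \<Rightarrow> _)"
      by (rule regular_on_linear[of "\<lambda>v. v"]) (auto simp: lin3_def)
    \<comment> \<open>The composite and the coordinate triple are both multiples of one global
      representation of the identity, by factors without zeros and hence by constants.\<close>
    obtain I :: "gen3 \<Rightarrow> 'k poly poly poly" where "global_rep id I" using regular_global[OF reg] ..
    then have I: "\<And>Q. polyrep id Q \<Longrightarrow> \<exists>c. \<forall>i. Q i = c * I i" by (simp add: global_rep_def)
    obtain c where c: "\<forall>i. Q i = c * I i" using I \<open>polyrep id Q\<close> by auto
    have Qc: "evt Q w = smul3 (ev3 c w) (evt I w)" for w using evt_mult[of Q c I w] c by auto
    then have "ev3 c w \<noteq> 0" if "w \<noteq> null3" for w
      using A[OF that] B[of "evt A w"] Q[of w] that by auto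
    then obtain c0 where c0: "c0 \<noteq> 0" "\<And>w. w \<noteq> null3 \<Longrightarrow> ev3 c w = c0"
      using nonvanishing_const[OF ev3_polyfuns, of c] by metis
    obtain b where b: "\<forall>i. X i = b * I i" using I \<open>polyrep id X\<close> by auto
    have Xb: "w = smul3 (ev3 b w) (evt I w)" for w using evt_mult[of X b I w] b X by auto
    then have "ev3 b w \<noteq> 0" if "w \<noteq> null3" for w
      using that by (metis smul3_eq_null)
    then obtain b0 where b0: "b0 \<noteq> 0" "\<And>w. w \<noteq> null3 \<Longrightarrow> ev3 b w = b0"
      using nonvanishing_const[OF ev3_polyfuns, of b] by metis
    have "evt B (evt A w) = smul3 (c0 / b0) w" if "w \<noteq> null3" for w
    proof -
      have "w = smul3 b0 (evt I w)" using Xb[of w] b0(2)[OF that] by simp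
      then have "smul3 (c0 / b0) w = smul3 (c0 / b0) (smul3 b0 (evt I w))" by simp
      then show ?thesis using Qc[of w] Q[of w] c0(2)[OF that] b0(1) by simp
    qed
    then show ?thesis using c0(1) b0(1) by (intro exI[of _ "c0 / b0"]) auto
  qed
  have GF0: "pt (evt G (evt F w)) = pt w" if w: "w \<noteq> null3" for w
    using G(2)[OF F(1)[OF w]] F(2)[OF w, symmetric] fg(2)[of "pt w"] by simp
  have FG0: "pt (evt F (evt G w)) = pt w" if w: "w \<noteq> null3" for w
    using F(2)[OF G(1)[OF w]] G(2)[OF w, symmetric] fg(1)[of "pt w"] by simp
  obtain \<kappa> where \<kappa>: "\<kappa> \<noteq> 0" "\<And>w. w \<noteq> null3 \<Longrightarrow> evt G (evt F w) = smul3 \<kappa> w"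
    using comp[OF F(1) G(1) GF0] by auto
  obtain \<kappa>' where \<kappa>': "\<kappa>' \<noteq> 0" "\<And>w. w \<noteq> null3 \<Longrightarrow> evt F (evt G w) = smul3 \<kappa>' w"
    using comp[OF G(1) F(1) FG0] by auto
  have e1: "((1 :: 'k), 0, 0) \<noteq> null3" by simp
  \<comment> \<open>Scaling by 2 suffices to read off the degrees: in characteristic zero a power of
    2 determines its exponent.\<close>
  have "evt G (evt F (smul3 2 (1, 0, 0))) = smul3 ((2 ^ d) ^ d') (smul3 \<kappa> (1, 0, 0))"
    using d[OF _ e1, of 2] d'[of "2 ^ d" "evt F (1, 0, 0)"] F(1)[OF e1] \<kappa>(2)[OF e1] by simp
  then have "((2 :: 'k) ^ d) ^ d' = 2"
    using \<kappa>(2)[of "smul3 2 (1, 0, 0)"] \<kappa>(1) by auto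
  then have "(of_nat (2 ^ (d * d')) :: 'k) = of_nat 2" by (simp add: power_mult)
  then have "(2 :: nat) ^ (d * d') = 2 ^ 1" by (metis of_nat_eq_iff power_one_right)
  then have "d * d' = 1" by (subst (asm) power_inject_exp) auto
  then have dd: "d = 1" "d' = 1" by auto
  have lin: "lin3 (evt A)" if A: "\<And>t w. t \<noteq> 0 \<Longrightarrow> w \<noteq> null3 \<Longrightarrow> evt A (smul3 t w) = smul3 (t ^ 1) (evt A w)"
    for A :: "gen3 \<Rightarrow> 'k poly poly poly"
  proof -
    have "ev3 (A i) (smul3 t w) = t * ev3 (A i) w" if "t \<noteq> 0" "w \<noteq> null3" for i t w
      using arg_cong[OF A[OF that], of "coord i"] by simp
    then have "ev3 (A i) (smul3 t w) = t * ev3 (A i) w" "ev3 (A i) (add3 u v) = ev3 (A i) u + ev3 (A i) v"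
      for i t w u v
      using polyfuns_homogeneous_1[of "ev3 (A i)"] by (auto simp: polyfuns_def)
    then show ?thesis unfolding lin3_def by (auto intro!: vec3_eqI)
  qed
  have linF: "lin3 (evt F)" and linG: "lin3 (evt G)" using lin d d' dd by auto
  have FG_null: "evt F null3 = null3" "evt G null3 = null3"
    using linF linG lin3_null by auto
  have GF: "evt G (evt F w) = smul3 \<kappa> w" for w
    using \<kappa>(2)[of w] FG_null by (cases "w = null3") simp_all
  have FG: "evt F (evt G w) = smul3 \<kappa>' w" for w
    using \<kappa>'(2)[of w] FG_null by (cases "w = null3") simp_all
  \<comment> \<open>Composing three maps in the two possible ways shows that the constants of the
    two composites agree, so one rescaling of \<open>G\<close> inverts \<open>F\<close> on both
    sides.\<close>
  have "smul3 \<kappa> (evt F (1, 0, 0)) = smul3 \<kappa>' (evt F (1, 0, 0))"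
    using FG[of "evt F (1, 0, 0)"] unfolding GF[of "(1, 0, 0)"] lin3_smul[OF linF] .
  then have "\<kappa> = \<kappa>'" using F(1)[OF e1] by (cases "evt F (1, 0, 0)") auto
  define M where "M v = smul3 (inverse \<kappa>) (evt G v)" for v
  have "lin3 M"
    using linG unfolding lin3_def M_def
    by (auto intro!: vec3_eqI simp: algebra_simps)
  moreover have "M (evt F v) = v" for v using GF \<kappa>(1) by (simp add: M_def)
  moreover have "evt F (M v) = v" for v
    using FG \<open>\<kappa> = \<kappa>'\<close> \<kappa>(1) unfolding M_def lin3_smul[OF linF] by simp
  ultimately show ?thesis using that[OF linF _ _ _ F(2)] by simp
qed

section \<open>The chord-tangent law\<close>

fun cross3 :: "'k::field vec3 \<Rightarrow> 'k vec3 \<Rightarrow> 'k vec3" where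
  "cross3 (a, b, c) (a', b', c') = (b * c' - c * b', c * a' - a * c', a * b' - b * a')"

lemma cross3_eq_null:
  assumes "v \<noteq> null3" "cross3 v w = null3"
  obtains t where "w = smul3 t v"
proof -
  obtain a b c a' b' c' where vw: "v = (a, b, c)" "w = (a', b', c')" by (cases v; cases w)
  have *: "b * c' = c * b'" "c * a' = a * c'" "a * b' = b * a'" using assms(2) vw by auto
  consider "a \<noteq> 0" | "b \<noteq> 0" | "c \<noteq> 0" using assms(1) vw by auto
  then show ?thesis
  proof cases
    case 1
    then show ?thesis using that[of "a' / a"] * vw by (simp add: field_simps)
  next
    case 2
    then show ?thesis using that[of "b' / b"] * vw by (simp add: field_simps)
  next
    case 3
    then show ?thesis using that[of "c' / c"] * vw by (simp add: field_simps)
  qed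
qed

lemma pt_eq_iff_cross3:
  assumes "v \<noteq> null3" "w \<noteq> null3"
  shows "pt v = pt w \<longleftrightarrow> cross3 v w = null3"
proof
  assume "pt v = pt w"
  then show "cross3 v w = null3"
    using assms by (cases v) (auto simp: pt_eq_iff)
next
  assume "cross3 v w = null3"
  then obtain t where "w = smul3 t v" using assms(1) cross3_eq_null by blast
  then show "pt v = pt w" using assms pt_smul[of v t] by auto
qed

text \<open>The relation \<open>P + Q + R = o\<close> between points of the curve.  Unlike collinearity these
  equations also account for tangents: \<open>P\<close> and \<open>Q\<close> always determine \<open>R\<close>.  They do not
  involve \<open>\<lambda>\<close>.\<close>

fun tri :: "'k::field vec3 \<Rightarrow> 'k vec3 \<Rightarrow> 'k vec3 \<Rightarrow> bool" where
  "tri (x1, y1, z1) (x2, y2, z2) (x3, y3, z3) \<longleftrightarrow>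
     x1 * y2 * z3 + y1 * z2 * x3 + z1 * x2 * y3 = 0 \<and>
     x1 * z2 * y3 + y1 * x2 * z3 + z1 * y2 * x3 = 0 \<and>
     x1 * x2 * x3 + y1 * y2 * y3 + z1 * z2 * z3 = 0"

lemma tri_commute: "tri P Q R \<longleftrightarrow> tri Q P R"
  by (cases P; cases Q; cases R) (auto simp: ac_simps)

lemma tri_rotate: "tri P Q R \<longleftrightarrow> tri Q R P"
  by (cases P; cases Q; cases R) (auto simp: ac_simps)

lemma tri_smul:
  assumes "a \<noteq> 0" "b \<noteq> 0" "c \<noteq> 0"
  shows "tri (smul3 a P) (smul3 b Q) (smul3 c R) \<longleftrightarrow> tri P Q R"
proof -
  obtain x1 y1 z1 x2 y2 z2 x3 y3 z3 where *: "P = (x1, y1, z1)" "Q = (x2, y2, z2)" "R = (x3, y3, z3)"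
    by (cases P; cases Q; cases R)
  have "a * x1 * (b * y2) * (c * z3) + a * y1 * (b * z2) * (c * x3) + a * z1 * (b * x2) * (c * y3)
      = (a * b * c) * (x1 * y2 * z3 + y1 * z2 * x3 + z1 * x2 * y3)"
    "a * x1 * (b * z2) * (c * y3) + a * y1 * (b * x2) * (c * z3) + a * z1 * (b * y2) * (c * x3)
      = (a * b * c) * (x1 * z2 * y3 + y1 * x2 * z3 + z1 * y2 * x3)"
    "a * x1 * (b * x2) * (c * x3) + a * y1 * (b * y2) * (c * y3) + a * z1 * (b * z2) * (c * z3)
      = (a * b * c) * (x1 * x2 * x3 + y1 * y2 * y3 + z1 * z2 * z3)"
    by (simp_all add: algebra_simps)
  then show ?thesis using assms unfolding * by simp
qed

definition on_hesse :: "'k::field \<Rightarrow> 'k vec3 \<Rightarrow> bool" where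
  "on_hesse l P \<longleftrightarrow> P \<noteq> null3 \<and> hesse_form l P = 0"

lemma hesse_form_smul: "hesse_form l (smul3 t v) = t ^ 3 * hesse_form l v"
  by (cases v) (simp add: algebra_simps power2_eq_square power3_eq_cube)

lemma on_hesse_smul: "on_hesse l P \<Longrightarrow> t \<noteq> 0 \<Longrightarrow> on_hesse l (smul3 t P)"
  by (simp add: on_hesse_def hesse_form_smul)

lemma hesse_curve_pt: 
  assumes "v \<noteq> null3"
  shows "pt v \<in> hesse_curve l \<longleftrightarrow> on_hesse l v"
proof
  assume "pt v \<in> hesse_curve l"
  then obtain w where w: "pt v = pt w" "on_hesse l w" unfolding hesse_curve_def on_hesse_def by auto
  then obtain t where "t \<noteq> 0" "v = smul3 t w" using pt_eq_iff[of w v] assms by (auto simp: on_hesse_def)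
  then show "on_hesse l v" using w on_hesse_smul by blast
next
  assume "on_hesse l v"
  then show "pt v \<in> hesse_curve l" unfolding hesse_curve_def on_hesse_def by blast
qed

lemma hesse_curve_cases:
  assumes "p \<in> hesse_curve l"
  obtains v where "on_hesse l v" "p = pt v"
  using assms unfolding hesse_curve_def on_hesse_def by blast

text \<open>The three vectors are the coefficient rows of \<open>tri\<close> as linear equations for
  the third point. If they had rank at most one, the minors would force the cubes of the coordinates
  of the first point to agree, and then the Hesse equation gives \<open>l ^ 3 = 1\<close>.\<close>

lemma on_hesse_minors:
  fixes l :: "'k::field_char_0"
  assumes P: "on_hesse l (x1, y1, z1)" and Q: "on_hesse l (x2, y2, z2)" and l: "l ^ 3 \<noteq> 1"
    and M12: "cross3 (y1 * z2, z1 * x2, x1 * y2) (z1 * y2, x1 * z2, y1 * x2) = null3"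
    and M13: "cross3 (y1 * z2, z1 * x2, x1 * y2) (x1 * x2, y1 * y2, z1 * z2) = null3"
    and M23: "cross3 (z1 * y2, x1 * z2, y1 * x2) (x1 * x2, y1 * y2, z1 * z2) = null3"
  shows False
proof -
  have a: "y1 * z1 * x2\<^sup>2 = x1\<^sup>2 * y2 * z2" "x1 * z1 * y2\<^sup>2 = y1\<^sup>2 * x2 * z2" "x1 * y1 * z2\<^sup>2 = z1\<^sup>2 * x2 * y2"
    using M12 by (auto simp: power2_eq_square ac_simps)
  have b: "z1\<^sup>2 * x2 * z2 = x1 * y1 * y2\<^sup>2" "x1\<^sup>2 * x2 * y2 = y1 * z1 * z2\<^sup>2" "y1\<^sup>2 * y2 * z2 = x1 * z1 * x2\<^sup>2"
    using M13 by (auto simp: power2_eq_square ac_simps)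
  have c: "x1 * z1 * z2\<^sup>2 = y1\<^sup>2 * x2 * y2" "x1 * y1 * x2\<^sup>2 = z1\<^sup>2 * y2 * z2" "y1 * z1 * y2\<^sup>2 = x1\<^sup>2 * x2 * z2"
    using M23 by (auto simp: power2_eq_square ac_simps)
  have hP: "x1 ^ 3 + y1 ^ 3 + z1 ^ 3 = 3 * l * x1 * y1 * z1" and P0: "x1 \<noteq> 0 \<or> y1 \<noteq> 0 \<or> z1 \<noteq> 0"
    using P by (auto simp: on_hesse_def)
  have hQ: "x2 ^ 3 + y2 ^ 3 + z2 ^ 3 = 3 * l * x2 * y2 * z2" and Q0: "x2 \<noteq> 0 \<or> y2 \<noteq> 0 \<or> z2 \<noteq> 0"
    using Q by (auto simp: on_hesse_def)
  have "x1 \<noteq> 0"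
  proof
    assume x: "x1 = 0"
    then have "y1 \<noteq> 0" "z1 \<noteq> 0" using hP P0 by auto
    then show False using a(1) b(2) c(3) x Q0 by simp
  qed
  have "y1 \<noteq> 0"
  proof
    assume y: "y1 = 0"
    then have "z1 \<noteq> 0" using hP \<open>x1 \<noteq> 0\<close> by auto
    then show False using a(2) b(3) c(1) y Q0 \<open>x1 \<noteq> 0\<close> by simp
  qed
  have "z1 \<noteq> 0"
    using a(3) b(1) c(2) Q0 \<open>x1 \<noteq> 0\<close> \<open>y1 \<noteq> 0\<close> by auto
  note nz = \<open>x1 \<noteq> 0\<close> \<open>y1 \<noteq> 0\<close> \<open>z1 \<noteq> 0\<close>
  have nz2: "y2 \<noteq> 0" "z2 \<noteq> 0"
    using a b c nz Q0 by auto
  have "y1 ^ 3 * (y2 * z2) = y1 * (y1\<^sup>2 * y2 * z2)" "z1 ^ 3 * (y2 * z2) = z1 * (z1\<^sup>2 * y2 * z2)"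
    "x1 ^ 3 * (y2 * z2) = x1 * (x1\<^sup>2 * y2 * z2)"
    by (simp_all add: power2_eq_square power3_eq_cube)
  then have "y1 ^ 3 * (y2 * z2) = x1 ^ 3 * (y2 * z2)" "z1 ^ 3 * (y2 * z2) = x1 ^ 3 * (y2 * z2)"
    unfolding a(1)[symmetric] b(3) c(2)[symmetric] by (simp_all add: ac_simps)
  then have cubes: "y1 ^ 3 = x1 ^ 3" "z1 ^ 3 = x1 ^ 3" using nz2 by auto
  then have "x1 ^ 3 = l * x1 * y1 * z1" using hP by simp
  then have "(x1 ^ 3) ^ 3 = l ^ 3 * x1 ^ 3 * y1 ^ 3 * z1 ^ 3"
    by (metis power_mult_distrib)
  then have "(x1 ^ 3) ^ 3 = l ^ 3 * (x1 ^ 3) ^ 3" unfolding cubes by (simp add: power3_eq_cube)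
  then show False using l nz by simp
qed

text \<open>The expansion of the triple product: (k x m) x r is m (k . r) - k (m . r).\<close>

lemma cross3_orthogonal:
  assumes "k1 * x + k2 * y + k3 * z = 0" "m1 * x + m2 * y + m3 * z = 0"
  shows "cross3 (cross3 (k1, k2, k3) (m1, m2, m3)) (x, y, z) = null3"
proof -
  have "z * (k3 * m1 - k1 * m3) - y * (k1 * m2 - k2 * m1) =
      m1 * (k1 * x + k2 * y + k3 * z) - k1 * (m1 * x + m2 * y + m3 * z)"
    "x * (k1 * m2 - k2 * m1) - z * (k2 * m3 - k3 * m2) =
      m2 * (k1 * x + k2 * y + k3 * z) - k2 * (m1 * x + m2 * y + m3 * z)"
    "y * (k2 * m3 - k3 * m2) - x * (k3 * m1 - k1 * m3) =
      m3 * (k1 * x + k2 * y + k3 * z) - k3 * (m1 * x + m2 * y + m3 * z)"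
    by (simp_all add: algebra_simps)
  then show ?thesis using assms by (simp add: mult.commute)
qed

text \<open>Two of the three coefficient rows are independent, and every solution is proportional to
  their cross product.\<close>

lemma tri_unique:
  fixes l :: "'k::field_char_0"
  assumes "on_hesse l P" "on_hesse l Q" "l ^ 3 \<noteq> 1" "tri P Q R" "tri P Q R'" "R \<noteq> null3" "R' \<noteq> null3"
  shows "pt R = pt R'"
proof -
  obtain x1 y1 z1 x2 y2 z2 where PQ: "P = (x1, y1, z1)" "Q = (x2, y2, z2)" by (cases P; cases Q)
  obtain x y z x' y' z' where R: "R = (x, y, z)" "R' = (x', y', z')" by (cases R; cases R')
  define K1 where "K1 = (y1 * z2, z1 * x2, x1 * y2)"
  define K2 where "K2 = (z1 * y2, x1 * z2, y1 * x2)"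
  define K3 where "K3 = (x1 * x2, y1 * y2, z1 * z2)"
  note K = K1_def K2_def K3_def
  have *: "pt R = pt R'" if n: "n \<noteq> null3" "cross3 n R = null3" "cross3 n R' = null3" for n
    using that assms(6,7) pt_eq_iff_cross3 by metis
  have o: "cross3 (cross3 K1 K2) R = null3" "cross3 (cross3 K1 K3) R = null3" "cross3 (cross3 K2 K3) R = null3"
    using assms(4) unfolding K R PQ
    by (auto intro!: cross3_orthogonal simp del: cross3.simps simp: algebra_simps)
  have o': "cross3 (cross3 K1 K2) R' = null3" "cross3 (cross3 K1 K3) R' = null3" "cross3 (cross3 K2 K3) R' = null3"
    using assms(5) unfolding K R PQ
    by (auto intro!: cross3_orthogonal simp del: cross3.simps simp: algebra_simps)
  have "\<not> (cross3 K1 K2 = null3 \<and> cross3 K1 K3 = null3 \<and> cross3 K2 K3 = null3)"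
    using on_hesse_minors[of l x1 y1 z1 x2 y2 z2] assms(1-3) unfolding K PQ by blast
  then show ?thesis using * o o' by blast
qed

text \<open>The sum of the cubes of three binary linear forms is apolar to their product: pairing a
  cubic with the cube of a linear form evaluates it, up to sign, at the zero of that form, where the
  product vanishes.\<close>

lemma apolar_cubes_product:
  fixes u1 u2 u3 v1 v2 v3 :: "'a::comm_ring_1"
  shows "(u1^3 + u2^3 + u3^3) * (v1*v2*v3) - (u1^2*v1 + u2^2*v2 + u3^2*v3) * (u1*v2*v3 + u2*v1*v3 + u3*v1*v2)
    + (u1*v1^2 + u2*v2^2 + u3*v3^2) * (u1*u2*v3 + u1*u3*v2 + u2*u3*v1) - (v1^3 + v2^3 + v3^3) * (u1*u2*u3) = 0"
  by (simp add: algebra_simps power2_eq_square power3_eq_cube)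

lemma binary_cubic_eq:
  fixes a0 a1 a2 a3 b0 b1 b2 b3 :: "'a::field_char_0"
  assumes "\<And>s t. a0*s^3 + a1*s^2*t + a2*s*t^2 + a3*t^3 = b0*s^3 + b1*s^2*t + b2*s*t^2 + b3*t^3"
  shows "a0 = b0" "a1 = b1" "a2 = b2" "a3 = b3"
proof -
  show 03: "a0 = b0" "a3 = b3" using assms[of 1 0] assms[of 0 1] by simp_all
  have "a1 + a2 = b1 + b2" "a2 - a1 = b2 - b1" using assms[of 1 1] assms[of 1 "-1"] 03 by (simp_all add: algebra_simps)
  moreover from this have "2 * a2 = 2 * b2" by (metis add_diff_cancel_left' add_diff_eq diff_add_cancel mult_2 add.commute)
  ultimately show "a1 = b1" "a2 = b2" by simp_all
qed

text \<open>On the line, \<open>N0\<close> to \<open>N3\<close> are the coefficients of the sum of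
  cubes without binomial factors, \<open>M0\<close> to \<open>M3\<close> those of the product of the
  coordinates, and the \<open>A\<close>s are the symmetrized parameters of the three zeros. The
  hypothesis says that the \<open>A\<close>s are, up to scale and duality, the combination N - l M.
  Pairing them with N yields the last equation of \<open>tri\<close>, pairing with M the sum of the
  first two; the skew self-pairings drop out and apolarity removes the rest.\<close>

lemma tri_of_cubic:
  fixes l c :: "'k::field_char_0"
  assumes c: "c \<noteq> 0"
    and eq: "\<And>s t. hesse_form l (add3 (smul3 s u) (smul3 t v)) =
           c * (p2 * s - p1 * t) * (q2 * s - q1 * t) * (r2 * s - r1 * t)"
  shows "tri (add3 (smul3 p1 u) (smul3 p2 v)) (add3 (smul3 q1 u) (smul3 q2 v)) (add3 (smul3 r1 u) (smul3 r2 v))"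
proof -
  obtain u1 u2 u3 v1 v2 v3 where uv: "u = (u1, u2, u3)" "v = (v1, v2, v3)" by (cases u; cases v)
  define N0 N1 N2 N3 where "N0 = u1^3 + u2^3 + u3^3" and "N1 = u1^2*v1 + u2^2*v2 + u3^2*v3"
    and "N2 = u1*v1^2 + u2*v2^2 + u3*v3^2" and "N3 = v1^3 + v2^3 + v3^3"
  define M0 M1 M2 M3 where "M0 = u1*u2*u3" and "M1 = u1*u2*v3 + u1*u3*v2 + u2*u3*v1"
    and "M2 = u1*v2*v3 + u2*v1*v3 + u3*v1*v2" and "M3 = v1*v2*v3"
  have ap: "N0 * M3 - N1 * M2 + N2 * M1 - N3 * M0 = 0"
    unfolding N0_def N1_def N2_def N3_def M0_def M1_def M2_def M3_def by (rule apolar_cubes_product)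
  have "(N0 - 3*l*M0)*s^3 + (3*N1 - 3*l*M1)*s^2*t + (3*N2 - 3*l*M2)*s*t^2 + (N3 - 3*l*M3)*t^3
     = (c*p2*q2*r2)*s^3 + (-c*(p1*q2*r2 + p2*q1*r2 + p2*q2*r1))*s^2*t
       + (c*(p1*q1*r2 + p1*q2*r1 + p2*q1*r1))*s*t^2 + (-c*p1*q1*r1)*t^3" for s t
  proof -
    have "hesse_form l (add3 (smul3 s u) (smul3 t v)) =
      (N0 - 3*l*M0)*s^3 + (3*N1 - 3*l*M1)*s^2*t + (3*N2 - 3*l*M2)*s*t^2 + (N3 - 3*l*M3)*t^3"
      unfolding uv N0_def N1_def N2_def N3_def M0_def M1_def M2_def M3_def add3.simps smul3.simps hesse_form.simps
      by (simp add: algebra_simps power2_eq_square power3_eq_cube)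
    then show ?thesis using eq[of s t] by (simp add: algebra_simps power2_eq_square power3_eq_cube)
  qed
  note e = binary_cubic_eq[OF this]
  define A0 A1 A2 A3 where "A0 = p1*q1*r1" and "A1 = p1*q1*r2 + p1*q2*r1 + p2*q1*r1"
    and "A2 = p1*q2*r2 + p2*q1*r2 + p2*q2*r1" and "A3 = p2*q2*r2"
  have e': "c * A3 = N0 - 3*l*M0" "c * A2 = - (3*N1 - 3*l*M1)" "c * A1 = 3*N2 - 3*l*M2" "c * A0 = - (N3 - 3*l*M3)"
    using e unfolding A0_def A1_def A2_def A3_def by (auto simp: algebra_simps)
  define x1 y1 z1 where "x1 = p1*u1 + p2*v1" and "y1 = p1*u2 + p2*v2" and "z1 = p1*u3 + p2*v3"
  define x2 y2 z2 where "x2 = q1*u1 + q2*v1" and "y2 = q1*u2 + q2*v2" and "z2 = q1*u3 + q2*v3"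
  define x3 y3 z3 where "x3 = r1*u1 + r2*v1" and "y3 = r1*u2 + r2*v2" and "z3 = r1*u3 + r2*v3"
  note xyz = x1_def y1_def z1_def x2_def y2_def z2_def x3_def y3_def z3_def
  have "x1*x2*x3 + y1*y2*y3 + z1*z2*z3 = A0*N0 + A1*N1 + A2*N2 + A3*N3"
    unfolding xyz N0_def N1_def N2_def N3_def A0_def A1_def A2_def A3_def
    by (simp add: algebra_simps power2_eq_square power3_eq_cube)
  then have "c * (x1*x2*x3 + y1*y2*y3 + z1*z2*z3) = (c*A0)*N0 + (c*A1)*N1 + (c*A2)*N2 + (c*A3)*N3"
    by (simp add: algebra_simps)
  also have "\<dots> = 3 * l * (N0 * M3 - N1 * M2 + N2 * M1 - N3 * M0)"
    unfolding e' by (simp add: algebra_simps)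
  finally have "c * (x1*x2*x3 + y1*y2*y3 + z1*z2*z3) = 0" using ap by simp
  then have diag: "x1*x2*x3 + y1*y2*y3 + z1*z2*z3 = 0" using c by simp
  have "(x1*y2*z3 + y1*z2*x3 + z1*x2*y3) + (x1*z2*y3 + y1*x2*z3 + z1*y2*x3)
    = 6*A0*M0 + 2*A1*M1 + 2*A2*M2 + 6*A3*M3"
    unfolding xyz M0_def M1_def M2_def M3_def A0_def A1_def A2_def A3_def
    by (simp add: algebra_simps)
  then have "c * ((x1*y2*z3 + y1*z2*x3 + z1*x2*y3) + (x1*z2*y3 + y1*x2*z3 + z1*y2*x3))
    = 6*(c*A0)*M0 + 2*(c*A1)*M1 + 2*(c*A2)*M2 + 6*(c*A3)*M3"
    by (simp add: algebra_simps)
  also have "\<dots> = - 6 * (N3 * M0 - N2 * M1 + N1 * M2 - N0 * M3)"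
    unfolding e' by (simp add: algebra_simps)
  also have "\<dots> = 6 * (N0 * M3 - N1 * M2 + N2 * M1 - N3 * M0)"
    by (simp add: algebra_simps)
  finally have "c * ((x1*y2*z3 + y1*z2*x3 + z1*x2*y3) + (x1*z2*y3 + y1*x2*z3 + z1*y2*x3)) = 0" using ap by simp
  then have perm: "(x1*y2*z3 + y1*z2*x3 + z1*x2*y3) + (x1*z2*y3 + y1*x2*z3 + z1*y2*x3) = 0" using c by simp
  \<comment> \<open>The two cyclic sums differ by the determinant of the three points, which lie in
    the span of \<open>u\<close> and \<open>v\<close>; since their sum vanishes too, both
    vanish.\<close>
  have det: "(x1*y2*z3 + y1*z2*x3 + z1*x2*y3) = (x1*z2*y3 + y1*x2*z3 + z1*y2*x3)"
    unfolding xyz by (simp add: algebra_simps)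
  have "2 * (x1*y2*z3 + y1*z2*x3 + z1*x2*y3) = 0"
    using perm unfolding det[symmetric] mult_2 .
  then have "x1*y2*z3 + y1*z2*x3 + z1*x2*y3 = 0" by (metis mult_eq_0_iff zero_neq_numeral)
  then have "tri (x1, y1, z1) (x2, y2, z2) (x3, y3, z3)" using det diag by simp
  then show ?thesis unfolding xyz uv by simp
qed

lemma line_section_tri:
  fixes l :: "'k::field_char_0"
  assumes "line_section l (pt P) (pt Q) (pt R)" "P \<noteq> null3" "Q \<noteq> null3" "R \<noteq> null3"
  shows "tri P Q R"
proof -
  obtain u v c p1 p2 q1 q2 r1 r2 where
    ind: "\<And>s t. add3 (smul3 s u) (smul3 t v) = null3 \<Longrightarrow> s = 0 \<and> t = 0"
    and c: "c \<noteq> 0" and nz: "(p1, p2) \<noteq> (0, 0)" "(q1, q2) \<noteq> (0, 0)" "(r1, r2) \<noteq> (0, 0)"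
    and pts: "pt P = pt (add3 (smul3 p1 u) (smul3 p2 v))"
      "pt Q = pt (add3 (smul3 q1 u) (smul3 q2 v))"
      "pt R = pt (add3 (smul3 r1 u) (smul3 r2 v))"
    and eq: "\<And>s t. hesse_form l (add3 (smul3 s u) (smul3 t v)) =
           c * (p2 * s - p1 * t) * (q2 * s - q1 * t) * (r2 * s - r1 * t)"
    using assms(1) unfolding line_section_def by blast
  have nn: "add3 (smul3 p1 u) (smul3 p2 v) \<noteq> null3" "add3 (smul3 q1 u) (smul3 q2 v) \<noteq> null3"
    "add3 (smul3 r1 u) (smul3 r2 v) \<noteq> null3"
    using ind nz by blast+
  obtain a where a: "a \<noteq> 0" "add3 (smul3 p1 u) (smul3 p2 v) = smul3 a P"
    using pts(1) pt_eq_iff[OF assms(2) nn(1)] by blast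
  obtain b where b: "b \<noteq> 0" "add3 (smul3 q1 u) (smul3 q2 v) = smul3 b Q"
    using pts(2) pt_eq_iff[OF assms(3) nn(2)] by blast
  obtain d where d: "d \<noteq> 0" "add3 (smul3 r1 u) (smul3 r2 v) = smul3 d R"
    using pts(3) pt_eq_iff[OF assms(4) nn(3)] by blast
  show ?thesis using tri_of_cubic[OF c eq] a b d tri_smul by metis
qed

text \<open>A line other than x = 0 would meet x = 0 and y = 0 in points \<open>(0, y, z)\<close>
  and \<open>(X, 0, Z)\<close>. The coefficients of the form on their span give
  \<open>z * Z = l * X * y\<close>, while both points have opposite cubes as coordinates; cubing the
  relation yields \<open>l ^ 3 = 1\<close>. The line x = 0 contains (0, 1, 0), where the form does
  not vanish.\<close>

lemma hesse_no_line:
  fixes l :: "'k::field_char_0"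
  assumes ind: "\<And>s t. add3 (smul3 s u) (smul3 t v) = null3 \<Longrightarrow> s = 0 \<and> t = 0"
    and zero: "\<And>s t. hesse_form l (add3 (smul3 s u) (smul3 t v)) = 0"
  shows "l ^ 3 = 1"
proof -
  obtain u1 u2 u3 v1 v2 v3 where uv: "u = (u1, u2, u3)" "v = (v1, v2, v3)" by (cases u; cases v)
  show ?thesis
  proof (cases "u1 = 0 \<and> v1 = 0")
    case True
    define D where "D = u2 * v3 - u3 * v2"
    have "add3 (smul3 v3 u) (smul3 (- u3) v) = (0, D, 0)"
      using True by (simp add: uv D_def algebra_simps)
    then have "hesse_form l (0, D, 0) = 0" using zero by metis
    then have D: "D = 0" by simp
    then have "v3 = 0 \<and> - u3 = 0" using \<open>add3 _ _ = (0, D, 0)\<close> by (intro ind) simp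
    moreover have "add3 (smul3 v2 u) (smul3 (- u2) v) = null3"
      using True calculation D by (simp add: uv D_def algebra_simps)
    then have "v2 = 0 \<and> - u2 = 0" by (rule ind)
    ultimately have "u = null3" using uv True by simp
    then show ?thesis using ind[of 1 0] by simp
  next
    case False
    define y z where "y = v1 * u2 - u1 * v2" and "z = v1 * u3 - u1 * v3"
    have a: "add3 (smul3 v1 u) (smul3 (- u1) v) = (0, y, z)"
      by (simp add: uv y_def z_def algebra_simps)
    have "(0, y, z) \<noteq> null3"
    proof
      assume "(0, y, z) = null3"
      then have "v1 = 0 \<and> - u1 = 0" using a by (intro ind) simp
      then show False using False by simp
    qed
    moreover have yz: "y ^ 3 + z ^ 3 = 0"
      using zero[of v1 "- u1"] unfolding a by simp
    ultimately have nz: "y \<noteq> 0" "z \<noteq> 0" by auto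
    \<comment> \<open>A point of the line off x = 0; subtracting a multiple of
      \<open>(0, y, z)\<close> from its multiple by \<open>y\<close> clears the second
      coordinate.\<close>
    obtain m n where mn: "m * u1 + n * v1 \<noteq> 0"
      using False by (metis add.left_neutral add.right_neutral mult_1 mult_zero_left)
    define X Z where "X = (m * u1 + n * v1) * y" and "Z = (m * u3 + n * v3) * y - (m * u2 + n * v2) * z"
    have X: "X \<noteq> 0" using mn nz by (simp add: X_def)
    define b where "b = add3 (smul3 (m * y - (m * u2 + n * v2) * v1) u) (smul3 (n * y + (m * u2 + n * v2) * u1) v)"
    have b: "b = (X, 0, Z)"
      by (simp add: b_def uv X_def Z_def y_def z_def algebra_simps)
    have "hesse_form l (add3 (smul3 s (0, y, z)) (smul3 t (X, 0, Z))) = 0" for s t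
    proof -
      have "add3 (smul3 s (0, y, z)) (smul3 t (X, 0, Z)) =
        add3 (smul3 (s * v1 + t * (m * y - (m * u2 + n * v2) * v1)) u)
         (smul3 (s * (- u1) + t * (n * y + (m * u2 + n * v2) * u1)) v)"
        unfolding a[symmetric] b[symmetric] b_def by (simp add: uv algebra_simps)
      then show ?thesis using zero by simp
    qed
    then have "0 * s ^ 3 + (3 * (z\<^sup>2 * Z - l * X * y * z)) * s\<^sup>2 * t + (3 * (z * Z\<^sup>2 - l * X * y * Z)) * s * t\<^sup>2
       + (X ^ 3 + Z ^ 3) * t ^ 3 = 0 * s ^ 3 + 0 * s\<^sup>2 * t + 0 * s * t\<^sup>2 + 0 * t ^ 3" for s t
    proof -
      have "hesse_form l (add3 (smul3 s (0, y, z)) (smul3 t (X, 0, Z))) =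
        (y ^ 3 + z ^ 3) * s ^ 3 + (3 * (z\<^sup>2 * Z - l * X * y * z)) * s\<^sup>2 * t + (3 * (z * Z\<^sup>2 - l * X * y * Z)) * s * t\<^sup>2
       + (X ^ 3 + Z ^ 3) * t ^ 3"
        by (simp add: algebra_simps power2_eq_square power3_eq_cube)
      then show ?thesis using \<open>\<And>s t. hesse_form l (add3 (smul3 s (0, y, z)) (smul3 t (X, 0, Z))) = 0\<close>[of s t] yz
        by simp
    qed
    note e = binary_cubic_eq[OF this]
    have "z * (z * Z - l * X * y) = 0" using e(2) by (simp add: algebra_simps power2_eq_square)
    then have "z * Z = l * X * y" using nz by simp
    then have "z ^ 3 * Z ^ 3 = l ^ 3 * (X ^ 3 * y ^ 3)" by (metis power_mult_distrib mult.assoc)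
    moreover have "z ^ 3 = - (y ^ 3)" using yz by (simp add: eq_neg_iff_add_eq_0 add.commute)
    moreover have "Z ^ 3 = - (X ^ 3)" using e(4) by (simp add: eq_neg_iff_add_eq_0 add.commute)
    ultimately have "1 * (X ^ 3 * y ^ 3) = l ^ 3 * (X ^ 3 * y ^ 3)" by (simp add: mult.commute)
    then show ?thesis using X nz by simp
  qed
qed

section \<open>Existence of line sections: chords, tangents, flex tangents\<close>

lemma independent_of_pt_neq:
  assumes "P \<noteq> null3" "Q \<noteq> null3" "pt P \<noteq> pt Q" "add3 (smul3 s P) (smul3 t Q) = null3"
  shows "s = 0 \<and> t = 0"
proof -
  have "s = 0"
  proof (rule ccontr)
    assume s: "s \<noteq> 0"
    have "P = smul3 (- t / s) Q"
    proof -
      obtain a b c a' b' c' where *: "P = (a, b, c)" "Q = (a', b', c')" by (cases P; cases Q)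
      have "s * a = - (t * a')" "s * b = - (t * b')" "s * c = - (t * c')"
        using assms(4) by (auto simp: * eq_neg_iff_add_eq_0)
      then show ?thesis using s by (simp add: * field_simps)
    qed
    then show False using assms pt_smul[of Q "- t / s"] by auto
  qed
  then show ?thesis using assms(2,4) by simp
qed

text \<open>A third of the polar form \<open>(u \<cdot> \<nabla>h(v))\<close>.\<close>

fun hesse_polar :: "'k::field \<Rightarrow> 'k vec3 \<Rightarrow> 'k vec3 \<Rightarrow> 'k" where
  "hesse_polar l (x1, y1, z1) (x2, y2, z2) =
     x1^2 * x2 + y1^2 * y2 + z1^2 * z2 - l * (x2 * y1 * z1 + x1 * y2 * z1 + x1 * y1 * z2)"

lemma hesse_form_line:
  "hesse_form l (add3 (smul3 s u) (smul3 t v)) =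
     hesse_form l u * s ^ 3 + 3 * hesse_polar l u v * s\<^sup>2 * t + 3 * hesse_polar l v u * s * t\<^sup>2 + hesse_form l v * t ^ 3"
  by (cases u; cases v) (simp add: algebra_simps power2_eq_square power3_eq_cube)

text \<open>On the chord the form has only mixed terms, 3 s t (a s + b t), so the third zero is the
  parameter (b, -a). It exists because a and b cannot both vanish: the curve contains no
  line.\<close>

lemma line_section_distinct:
  fixes l :: "'k::field_char_0"
  assumes "on_hesse l P" "on_hesse l Q" "pt P \<noteq> pt Q" "l ^ 3 \<noteq> 1"
  obtains R where "R \<noteq> null3" "line_section l (pt P) (pt Q) (pt R)"
    "R = add3 (smul3 (hesse_polar l Q P) P) (smul3 (- hesse_polar l P Q) Q)"
proof -
  define a b where "a = hesse_polar l P Q" and "b = hesse_polar l Q P"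
  have nz: "P \<noteq> null3" "Q \<noteq> null3" and h: "hesse_form l P = 0" "hesse_form l Q = 0"
    using assms by (auto simp: on_hesse_def)
  note ind = independent_of_pt_neq[OF nz assms(3)]
  have hl: "hesse_form l (add3 (smul3 s P) (smul3 t Q)) = 3 * s * t * (s * a + t * b)" for s t
    unfolding hesse_form_line h a_def b_def by (simp add: algebra_simps power2_eq_square)
  have ab: "(b, - a) \<noteq> (0, 0)"
    using hesse_no_line[of P Q l] ind hl assms(4) by auto
  define R where "R = add3 (smul3 b P) (smul3 (- a) Q)"
  have "R \<noteq> null3" using ind[of b "- a"] ab unfolding R_def by blast
  moreover have "line_section l (pt P) (pt Q) (pt R)"
    unfolding line_section_def
  proof (rule exI[of _ P], rule exI[of _ Q], rule exI[of _ 3], rule exI[of _ 1], rule exI[of _ 0],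
      rule exI[of _ 0], rule exI[of _ 1], rule exI[of _ b], rule exI[of _ "- a"], intro conjI allI impI)
    show "hesse_form l (add3 (smul3 s P) (smul3 t Q)) =
       3 * (0 * s - 1 * t) * (1 * s - 0 * t) * (- a * s - b * t)" for s t
      unfolding hl by (simp add: algebra_simps)
  qed (use ind ab in \<open>auto simp: R_def\<close>)
  ultimately show ?thesis using that[of R] unfolding R_def a_def b_def by blast
qed

text \<open>The third intersection of the curve with its tangent at \<open>(x, y, z)\<close>.\<close>

fun double3 :: "'k::field vec3 \<Rightarrow> 'k vec3" where
  "double3 (x, y, z) = (x * (y ^ 3 - z ^ 3), y * (z ^ 3 - x ^ 3), z * (x ^ 3 - y ^ 3))"

text \<open>Equal cubes are what a singular point would have. With the equation of the curve they
  give \<open>x ^ 3 = l * x * y * z\<close>, and cubing this once more contradicts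
  smoothness.\<close>

lemma on_hesse_cubes_not_equal:
  fixes l :: "'k::field_char_0"
  assumes "on_hesse l (x, y, z)" "l ^ 3 \<noteq> 1" "x ^ 3 = y ^ 3" "y ^ 3 = z ^ 3"
  shows False
proof -
  have h: "x ^ 3 + y ^ 3 + z ^ 3 = 3 * l * x * y * z" and nz: "x \<noteq> 0 \<or> y \<noteq> 0 \<or> z \<noteq> 0"
    using assms(1) by (auto simp: on_hesse_def)
  have "3 * x ^ 3 = 3 * (l * x * y * z)" using h assms(3,4) by (simp add: algebra_simps)
  then have "x ^ 3 = l * x * y * z" by simp
  then have "(x ^ 3) ^ 3 = l ^ 3 * x ^ 3 * y ^ 3 * z ^ 3" by (metis power_mult_distrib)
  moreover have "y ^ 3 = x ^ 3" "z ^ 3 = x ^ 3" using assms(3,4) by simp_all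
  ultimately have "(x ^ 3) ^ 3 = l ^ 3 * x ^ 3 * x ^ 3 * x ^ 3" by simp
  then have "(x ^ 3) ^ 3 = l ^ 3 * (x ^ 3) ^ 3" unfolding power3_eq_cube[of "x ^ 3"] by (simp only: mult.assoc)
  then have "x = 0" using assms(2) by simp
  then show False using assms(3,4) nz by auto
qed

text \<open>The tangent is spanned by the point and its third intersection. At a flex these two
  coincide, so the flexes are excluded by the condition on \<open>x * y * z\<close>.\<close>

lemma line_section_double:
  fixes l :: "'k::field_char_0"
  assumes "on_hesse l (x, y, z)" "l ^ 3 \<noteq> 1" "x * y * z \<noteq> 0"
  obtains R where "R \<noteq> null3" "line_section l (pt (x, y, z)) (pt (x, y, z)) (pt R)"
proof -
  define P where "P = (x, y, z)"
  define R where "R = double3 P"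
  have h: "hesse_form l P = 0" and nz: "P \<noteq> null3" using assms by (auto simp: on_hesse_def P_def)
  have polar: "hesse_polar l P R = 0"
    by (simp add: P_def R_def algebra_simps power2_eq_square power3_eq_cube)
  have hR: "hesse_form l R = 0"
  proof -
    have "hesse_form l R = (y ^ 3 - z ^ 3) * (z ^ 3 - x ^ 3) * (x ^ 3 - y ^ 3) * hesse_form l P"
      by (simp add: P_def R_def algebra_simps power3_eq_cube)
    then show ?thesis using h by simp
  qed
  have R0: "R \<noteq> null3"
    using on_hesse_cubes_not_equal[OF assms(1,2)] assms(3) by (auto simp: R_def P_def)
  have PR: "pt P \<noteq> pt R"
  proof
    assume "pt P = pt R"
    then obtain t where "R = smul3 t P" using pt_eq_iff[OF nz R0] by auto
    then have t: "y ^ 3 - z ^ 3 = t" "z ^ 3 - x ^ 3 = t" "x ^ 3 - y ^ 3 = t"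
      using assms(3) by (auto simp: R_def P_def)
    then have "3 * t = (y ^ 3 - z ^ 3) + (z ^ 3 - x ^ 3) + (x ^ 3 - y ^ 3)" by simp
    then have "t = 0" by simp
    then show False using t on_hesse_cubes_not_equal[OF assms(1,2)] by simp
  qed
  note ind = independent_of_pt_neq[OF nz R0 PR]
  define b where "b = hesse_polar l R P"
  \<comment> \<open>The polar of \<open>P\<close> vanishes at \<open>R\<close>, which makes
    \<open>P\<close> a double zero; only the term with \<open>t\<close> squared survives.\<close>
  have hl: "hesse_form l (add3 (smul3 s P) (smul3 t R)) = 3 * b * s * t\<^sup>2" for s t
    unfolding hesse_form_line h hR polar b_def by simp
  have b: "b \<noteq> 0"
    using hesse_no_line[of P R l] ind hl assms(2) by auto
  have "line_section l (pt P) (pt P) (pt R)"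
    unfolding line_section_def
  proof (rule exI[of _ P], rule exI[of _ R], rule exI[of _ "3 * b"], rule exI[of _ 1], rule exI[of _ 0],
      rule exI[of _ 1], rule exI[of _ 0], rule exI[of _ 0], rule exI[of _ 1], intro conjI allI impI)
    show "hesse_form l (add3 (smul3 s P) (smul3 t R)) =
       3 * b * (0 * s - 1 * t) * (0 * s - 1 * t) * (1 * s - 0 * t)" for s t
      unfolding hl by (simp add: algebra_simps power2_eq_square)
  qed (use ind b in auto)
  then show ?thesis using that R0 unfolding P_def by blast
qed

lemma line_section_flex_z:
  fixes l :: "'k::field_char_0"
  assumes "on_hesse l (x, y, 0)" "l ^ 3 \<noteq> 1"
  shows "line_section l (pt (x, y, 0)) (pt (x, y, 0)) (pt (x, y, 0))"
proof -
  have xy: "y ^ 3 = - (x ^ 3)" "x \<noteq> 0" "y \<noteq> 0"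
    using assms(1) by (auto simp: on_hesse_def eq_neg_iff_add_eq_0 add.commute)
  \<comment> \<open>\<open>V\<close> is the point of the tangent at \<open>P\<close> with second
    coordinate 0. On the tangent the form becomes a constant times \<open>t ^ 3\<close>, and the
    constant is nonzero by smoothness.\<close>
  define P V where "P = (x, y, 0 :: 'k)" and "V = (l * y, 0 :: 'k, x)"
  have hV: "hesse_form l V = x ^ 3 * (1 - l ^ 3)"
    using xy(1) by (simp add: V_def power_mult_distrib algebra_simps)
  have polar: "hesse_polar l P V = 0" "hesse_polar l V P = 0"
    by (simp_all add: P_def V_def algebra_simps power2_eq_square)
  have hP: "hesse_form l P = 0" using assms(1) by (simp add: on_hesse_def P_def)
  have hl: "hesse_form l (add3 (smul3 s P) (smul3 t V)) = x ^ 3 * (1 - l ^ 3) * t ^ 3" for s t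
    unfolding hesse_form_line hP polar hV by simp
  have "line_section l (pt P) (pt P) (pt P)"
    unfolding line_section_def
  proof (rule exI[of _ P], rule exI[of _ V], rule exI[of _ "- (x ^ 3 * (1 - l ^ 3))"], rule exI[of _ 1], rule exI[of _ 0],
      rule exI[of _ 1], rule exI[of _ 0], rule exI[of _ 1], rule exI[of _ 0], intro conjI allI impI)
    show "hesse_form l (add3 (smul3 s P) (smul3 t V)) =
       - (x ^ 3 * (1 - l ^ 3)) * (0 * s - 1 * t) * (0 * s - 1 * t) * (0 * s - 1 * t)" for s t
      unfolding hl by (simp add: algebra_simps power3_eq_cube)
  qed (use xy assms(2) in \<open>auto simp: P_def V_def\<close>)
  then show ?thesis unfolding P_def .
qed

lemma line_section_linear:
  assumes ls: "line_section l (pt P) (pt Q) (pt R)" and nz: "P \<noteq> null3" "Q \<noteq> null3" "R \<noteq> null3"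
    and L: "lin3 L" "\<And>v. L v = null3 \<Longrightarrow> v = null3"
    and k: "k \<noteq> 0" "\<And>v. hesse_form l (L v) = k * hesse_form l v"
  shows "line_section l (pt (L P)) (pt (L Q)) (pt (L R))"
proof -
  obtain u v c p1 p2 q1 q2 r1 r2 where
    ind: "\<And>s t. add3 (smul3 s u) (smul3 t v) = null3 \<Longrightarrow> s = 0 \<and> t = 0"
    and c: "c \<noteq> 0" and pqr: "(p1, p2) \<noteq> (0, 0)" "(q1, q2) \<noteq> (0, 0)" "(r1, r2) \<noteq> (0, 0)"
    and pts: "pt P = pt (add3 (smul3 p1 u) (smul3 p2 v))"
      "pt Q = pt (add3 (smul3 q1 u) (smul3 q2 v))"
      "pt R = pt (add3 (smul3 r1 u) (smul3 r2 v))"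
    and eq: "\<And>s t. hesse_form l (add3 (smul3 s u) (smul3 t v)) =
           c * (p2 * s - p1 * t) * (q2 * s - q1 * t) * (r2 * s - r1 * t)"
    using ls unfolding line_section_def by blast
  have L': "L (add3 (smul3 s u) (smul3 t v)) = add3 (smul3 s (L u)) (smul3 t (L v))" for s t
    by (simp only: lin3_add[OF L(1)] lin3_smul[OF L(1)])
  have *: "pt (L P) = pt (add3 (smul3 p1 (L u)) (smul3 p2 (L v)))"
    if P: "P \<noteq> null3" "(p1, p2) \<noteq> (0, 0)" "pt P = pt (add3 (smul3 p1 u) (smul3 p2 v))" for P p1 p2
  proof -
    have "add3 (smul3 p1 u) (smul3 p2 v) \<noteq> null3" using ind P(2) by blast
    then obtain t where t: "t \<noteq> 0" "add3 (smul3 p1 u) (smul3 p2 v) = smul3 t P"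
      using P(3) pt_eq_iff[OF P(1)] by blast
    have "L P \<noteq> null3" using L(2) P(1) by blast
    then have "pt (smul3 t (L P)) = pt (L P)" using t(1) by (rule pt_smul)
    then show ?thesis using L'[of p1 p2] t(2) lin3_smul[OF L(1), of t P] by simp
  qed
  show ?thesis
    unfolding line_section_def
  proof (rule exI[of _ "L u"], rule exI[of _ "L v"], rule exI[of _ "k * c"], rule exI[of _ p1], rule exI[of _ p2],
      rule exI[of _ q1], rule exI[of _ q2], rule exI[of _ r1], rule exI[of _ r2], intro conjI allI impI)
    show "s = 0" "t = 0" if "add3 (smul3 s (L u)) (smul3 t (L v)) = null3" for s t
      using ind[OF L(2)[of "add3 (smul3 s u) (smul3 t v)"]] that L'[of s t] by simp_all
    show "pt (L P) = pt (add3 (smul3 p1 (L u)) (smul3 p2 (L v)))" using * nz pqr pts by blast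
    show "pt (L Q) = pt (add3 (smul3 q1 (L u)) (smul3 q2 (L v)))" using * nz pqr pts by blast
    show "pt (L R) = pt (add3 (smul3 r1 (L u)) (smul3 r2 (L v)))" using * nz pqr pts by blast
    show "hesse_form l (add3 (smul3 s (L u)) (smul3 t (L v))) =
      k * c * (p2 * s - p1 * t) * (q2 * s - q1 * t) * (r2 * s - r1 * t)" for s t
      using k(2)[of "add3 (smul3 s u) (smul3 t v)"] L'[of s t] eq[of s t] by (simp add: mult.assoc)
  qed (use c k pqr in auto)
qed

fun cyc3 :: "'k vec3 \<Rightarrow> 'k vec3" where
  "cyc3 (x, y, z) = (y, z, x)"

lemma cyc3_linear: "lin3 cyc3" "cyc3 v = null3 \<Longrightarrow> v = null3" "hesse_form l (cyc3 v) = hesse_form l v"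
  by (auto simp: lin3_def) (cases v; auto simp: algebra_simps)+

lemma line_section_flex:
  fixes l :: "'k::field_char_0"
  assumes "on_hesse l (x, y, z)" "l ^ 3 \<noteq> 1" "x * y * z = 0"
  shows "line_section l (pt (x, y, z)) (pt (x, y, z)) (pt (x, y, z))"
proof -
  have cyc: "line_section l (pt (cyc3 P)) (pt (cyc3 P)) (pt (cyc3 P))"
    if "line_section l (pt P) (pt P) (pt P)" "P \<noteq> null3" for P
    by (rule line_section_linear[OF that(1) that(2) that(2) that(2) cyc3_linear(1,2), where k = 1])
      (simp_all add: cyc3_linear(3))
  consider "z = 0" | "x = 0" | "y = 0" using assms(3) by auto
  then show ?thesis
  proof cases
    case 1
    then show ?thesis using line_section_flex_z assms(1,2) by blast
  next
    case 2
    have "on_hesse l (y, z, 0)" using assms(1) 2 by (simp add: on_hesse_def algebra_simps)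
    then show ?thesis
      using cyc[OF cyc, of "(y, z, 0)"] line_section_flex_z[of l y z] assms(2) 2 by (auto simp: on_hesse_def)
  next
    case 3
    have "on_hesse l (z, x, 0)" using assms(1) 3 by (auto simp: on_hesse_def algebra_simps)
    then show ?thesis
      using cyc[of "(z, x, 0)"] line_section_flex_z[of l z x] assms(2) 3 by (auto simp: on_hesse_def)
  qed
qed

lemma line_section_exists:
  fixes l :: "'k::field_char_0"
  assumes "on_hesse l P" "on_hesse l Q" "l ^ 3 \<noteq> 1"
  obtains R where "R \<noteq> null3" "line_section l (pt P) (pt Q) (pt R)"
proof (cases "pt P = pt Q")
  case False
  then show ?thesis using line_section_distinct[OF assms(1,2) False assms(3)] that by blast
next
  case True
  obtain x y z where P: "P = (x, y, z)" by (cases P)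
  show ?thesis
  proof (cases "x * y * z = 0")
    case z: True
    have "line_section l (pt P) (pt P) (pt P)" using line_section_flex assms(1,3) z unfolding P by blast
    then show ?thesis using that[of P] True assms(1) by (simp add: on_hesse_def)
  next
    case False
    obtain R where "R \<noteq> null3" "line_section l (pt P) (pt P) (pt R)"
      using line_section_double[of l x y z] assms(1,3) False unfolding P by blast
    then show ?thesis using that[of R] True by simp
  qed
qed

lemma line_section_on_hesse:
  assumes "line_section l p q (pt R)" "R \<noteq> null3"
  shows "on_hesse l R"
proof -
  obtain u v c p1 p2 q1 q2 r1 r2 where
    ind: "\<forall>s t. add3 (smul3 s u) (smul3 t v) = null3 \<longrightarrow> s = 0 \<and> t = 0"
    and r: "(r1, r2) \<noteq> (0, 0)" "pt R = pt (add3 (smul3 r1 u) (smul3 r2 v))"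
    and eq: "\<forall>s t. hesse_form l (add3 (smul3 s u) (smul3 t v)) =
           c * (p2 * s - p1 * t) * (q2 * s - q1 * t) * (r2 * s - r1 * t)"
    using assms(1) unfolding line_section_def by blast
  have "hesse_form l (add3 (smul3 r1 u) (smul3 r2 v)) = 0"
    using eq[rule_format, of r1 r2] by (simp add: mult.commute)
  moreover have "add3 (smul3 r1 u) (smul3 r2 v) \<noteq> null3" using ind r(1) by blast
  ultimately have "on_hesse l (add3 (smul3 r1 u) (smul3 r2 v))" unfolding on_hesse_def by blast
  moreover from this obtain t where "t \<noteq> 0" "R = smul3 t (add3 (smul3 r1 u) (smul3 r2 v))"
    using r(2) pt_eq_iff[OF _ assms(2)] on_hesse_def by metis
  ultimately show ?thesis using on_hesse_smul by blast
qed

text \<open>The bridge from the definite description to equations: some line section exists, its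
  third point solves \<open>tri\<close>, and the solution is unique.\<close>

lemma third_point_eq:
  fixes l :: "'k::field_char_0"
  assumes P: "on_hesse l P" and Q: "on_hesse l Q" and l: "l ^ 3 \<noteq> 1"
    and R: "R \<noteq> null3" "tri P Q R"
  shows "third_point l (pt P) (pt Q) = pt R" "on_hesse l R"
proof -
  have nz: "P \<noteq> null3" "Q \<noteq> null3" using P Q by (auto simp: on_hesse_def)
  obtain R0 where R0: "R0 \<noteq> null3" "line_section l (pt P) (pt Q) (pt R0)"
    using line_section_exists[OF P Q l] by blast
  have uniq: "r = pt R" if "line_section l (pt P) (pt Q) r" for r
  proof -
    obtain r' where r': "r' \<noteq> null3" "r = pt r'" using plane_cases by blast
    then have "tri P Q r'" using line_section_tri[of l P Q r'] that nz by blast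
    then show ?thesis using tri_unique[OF P Q l _ R(2) r'(1) R(1)] r'(2) by blast
  qed
  then have "pt R0 = pt R" using R0(2) by blast
  then have ls: "line_section l (pt P) (pt Q) (pt R)" using R0(2) by simp
  then show "third_point l (pt P) (pt Q) = pt R"
    unfolding third_point_def using uniq by (rule the_equality)
  show "on_hesse l R" using line_section_on_hesse[OF ls R(1)] .
qed

lemma third_point_exists:
  fixes l :: "'k::field_char_0"
  assumes P: "on_hesse l P" and Q: "on_hesse l Q" and l: "l ^ 3 \<noteq> 1"
  obtains R where "on_hesse l R" "tri P Q R" "third_point l (pt P) (pt Q) = pt R"
proof -
  have nz: "P \<noteq> null3" "Q \<noteq> null3" using P Q by (auto simp: on_hesse_def)
  obtain R where R: "R \<noteq> null3" "line_section l (pt P) (pt Q) (pt R)"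
    using line_section_exists[OF P Q l] by blast
  then have "tri P Q R" using line_section_tri nz by blast
  then show ?thesis using third_point_eq[OF P Q l R(1)] that by blast
qed

section \<open>Negation, flexes and the addition law\<close>

fun swap3 :: "'k vec3 \<Rightarrow> 'k vec3" where
  "swap3 (x, y, z) = (y, x, z)"

lemma swap3_swap3 [simp]: "swap3 (swap3 v) = v"
  by (cases v) auto

lemma swap3_null [simp]: "swap3 v = null3 \<longleftrightarrow> v = null3"
  by (cases v) auto

lemma swap3_linear: "lin3 swap3"
  by (auto simp: lin3_def)

lemma hesse_form_swap3 [simp]: "hesse_form l (swap3 v) = hesse_form l v"
  by (cases v) (auto simp: algebra_simps)

lemma on_hesse_swap3: "on_hesse l (swap3 v) \<longleftrightarrow> on_hesse l v"
  by (simp add: on_hesse_def)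

lemma tri_swap3: "tri (swap3 P) (swap3 Q) (swap3 R) \<longleftrightarrow> tri P Q R"
  by (cases P; cases Q; cases R) (auto simp: ac_simps)

text \<open>The line through \<open>o\<close> and a point meets the curve again in the point with
  its first two coordinates exchanged. Hence negation is linear and a sum is the swapped third
  point.\<close>

lemma tri_origin: "tri (1, -1, 0) Q (swap3 Q)"
  by (cases Q) (auto simp: algebra_simps)

lemma tri_swap3_swap3: "tri (swap3 P) (swap3 Q) R \<longleftrightarrow> tri P Q (swap3 R)"
  using tri_swap3[of P Q "swap3 R"] by simp

lemma induced_pt:
  assumes "lin3 L" "v \<noteq> null3" "L v \<noteq> null3"
  shows "induced L (pt v) = pt (L v)"
proof -
  obtain t where t: "t \<noteq> 0" "rep_plane (pt v) = smul3 t v" using rep_plane_pt[OF assms(2)] by blast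
  then have "induced L (pt v) = pt (smul3 t (L v))" unfolding induced_def using lin3_smul[OF assms(1)] by metis
  then show ?thesis using pt_smul[OF assms(3) t(1)] by simp
qed

definition neg :: "'k::field plane \<Rightarrow> 'k plane" where
  "neg = induced swap3"

lemma neg_pt: "v \<noteq> null3 \<Longrightarrow> neg (pt v) = pt (swap3 v)"
  unfolding neg_def by (rule induced_pt) (auto simp: swap3_linear)

definition flex :: "'k::field \<Rightarrow> 'k vec3 \<Rightarrow> bool" where
  "flex l P \<longleftrightarrow> on_hesse l P \<and> tri P P P"

text \<open>For three equal points the first two equations of \<open>tri\<close> both read 3 x y z =
  0; the third then follows from the equation of the curve.\<close>

lemma flex_iff:
  fixes l :: "'k::field_char_0"
  shows "flex l (x, y, z) \<longleftrightarrow> on_hesse l (x, y, z) \<and> x * y * z = 0"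
proof -
  have "x * y * z + y * z * x + z * x * y = 3 * (x * y * z)"
    "x * z * y + y * x * z + z * y * x = 3 * (x * y * z)" by (simp_all add: algebra_simps)
  then have "tri (x, y, z) (x, y, z) (x, y, z) \<longleftrightarrow> x * y * z = 0 \<and> x ^ 3 + y ^ 3 + z ^ 3 = 0"
    by (simp only: tri.simps power3_eq_cube) auto
  moreover have "on_hesse l (x, y, z) \<Longrightarrow> x * y * z = 0 \<Longrightarrow> x ^ 3 + y ^ 3 + z ^ 3 = 0"
    by (auto simp: on_hesse_def mult.assoc)
  ultimately show ?thesis unfolding flex_def by blast
qed

locale hesse_cubic =
  fixes l :: "'k::{alg_closed_field, field_char_0}"
  assumes l: "l ^ 3 \<noteq> 1"
begin

abbreviation "E \<equiv> hesse_curve l"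

definition add :: "'k plane \<Rightarrow> 'k plane \<Rightarrow> 'k plane" (infixl \<open>\<oplus>\<^sub>E\<close> 65) where
  "p \<oplus>\<^sub>E q = third_point l origin (third_point l p q)"

lemma mult_ec_group: "p \<otimes>\<^bsub>ec_group l\<^esub> q = p \<oplus>\<^sub>E q"
  by (simp add: ec_group_def add_def)

lemma carrier_ec_group: "carrier (ec_group l) = E" "\<one>\<^bsub>ec_group l\<^esub> = origin"
  by (simp_all add: ec_group_def)

lemma on_hesse_origin: "on_hesse l (1, -1, 0)"
  by (simp add: on_hesse_def)

lemma origin_in: "origin \<in> E"
  using on_hesse_origin by (simp add: origin_def hesse_curve_pt)

lemma add_pt:
  assumes "on_hesse l P" "on_hesse l Q" "S \<noteq> null3" "tri P Q (swap3 S)"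
  shows "pt P \<oplus>\<^sub>E pt Q = pt S" "on_hesse l S"
proof -
  have "third_point l (pt P) (pt Q) = pt (swap3 S)" "on_hesse l (swap3 S)"
    using third_point_eq[OF assms(1,2) l _ assms(4)] assms(3) by auto
  then show "pt P \<oplus>\<^sub>E pt Q = pt S" "on_hesse l S"
    using third_point_eq[OF on_hesse_origin _ l assms(3), of "swap3 S"] tri_origin[of "swap3 S"]
    by (simp_all add: add_def origin_def on_hesse_swap3)
qed

lemma add_exists:
  assumes "on_hesse l P" "on_hesse l Q"
  obtains S where "on_hesse l S" "tri P Q (swap3 S)" "pt P \<oplus>\<^sub>E pt Q = pt S"
proof -
  obtain R where R: "on_hesse l R" "tri P Q R" using third_point_exists[OF assms l] by blast
  then have "tri P Q (swap3 (swap3 R))" "swap3 R \<noteq> null3" by (auto simp: on_hesse_def)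
  then show ?thesis using that[of "swap3 R"] add_pt[OF assms, of "swap3 R"] by auto
qed

text \<open>Any nonzero vector can be tested as a sum: the equation itself forces it onto the
  curve.\<close>

lemma add_iff:
  assumes "on_hesse l P" "on_hesse l Q" "S \<noteq> null3"
  shows "pt P \<oplus>\<^sub>E pt Q = pt S \<longleftrightarrow> tri P Q (swap3 S)"
proof
  assume *: "pt P \<oplus>\<^sub>E pt Q = pt S"
  obtain S' where S': "on_hesse l S'" "tri P Q (swap3 S')" "pt P \<oplus>\<^sub>E pt Q = pt S'"
    using add_exists[OF assms(1,2)] by blast
  then have "pt S = pt S'" "S' \<noteq> null3" using * by (auto simp: on_hesse_def)
  then obtain t where "t \<noteq> 0" "S' = smul3 t S" using pt_eq_iff assms(3) by blast
  then show "tri P Q (swap3 S)"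
    using S'(2) tri_smul[of 1 1 t P Q "swap3 S"] by (simp add: lin3_smul[OF swap3_linear])
next
  assume "tri P Q (swap3 S)"
  then show "pt P \<oplus>\<^sub>E pt Q = pt S" using add_pt assms by blast
qed

lemma add_closed: "p \<in> E \<Longrightarrow> q \<in> E \<Longrightarrow> p \<oplus>\<^sub>E q \<in> E"
proof (elim hesse_curve_cases)
  fix P Q assume *: "on_hesse l P" "on_hesse l Q" "p = pt P" "q = pt Q"
  obtain S where "on_hesse l S" "pt P \<oplus>\<^sub>E pt Q = pt S" using add_exists * by blast
  then show ?thesis using * hesse_curve_pt[of S l] by (simp add: on_hesse_def)
qed

lemma neg_closed: "p \<in> E \<Longrightarrow> neg p \<in> E"
proof (elim hesse_curve_cases)
  fix P assume *: "on_hesse l P" "p = pt P"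
  then show ?thesis using hesse_curve_pt[of "swap3 P" l] by (simp add: neg_pt on_hesse_def)
qed

lemma neg_neg: "neg (neg p) = (p :: 'k plane)"
  by (rule plane_cases[of p]) (simp add: neg_pt)

lemma neg_origin: "neg (origin :: 'k plane) = origin"
  using pt_smul[of "(1, -1, 0) :: 'k vec3" "-1"] by (simp add: origin_def neg_pt)

lemma add_commute: "p \<in> E \<Longrightarrow> q \<in> E \<Longrightarrow> p \<oplus>\<^sub>E q = q \<oplus>\<^sub>E p"
proof (elim hesse_curve_cases)
  fix P Q assume *: "on_hesse l P" "on_hesse l Q" "p = pt P" "q = pt Q"
  obtain S where S: "on_hesse l S" "tri P Q (swap3 S)" "pt P \<oplus>\<^sub>E pt Q = pt S" using add_exists * by blast
  then have "pt Q \<oplus>\<^sub>E pt P = pt S"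
    using add_iff[OF *(2,1), of S] tri_commute[of P Q "swap3 S"] by (auto simp: on_hesse_def)
  then show ?thesis using S * by simp
qed

lemma add_origin: "p \<in> E \<Longrightarrow> origin \<oplus>\<^sub>E p = p"
proof (elim hesse_curve_cases)
  fix P assume *: "on_hesse l P" "p = pt P"
  then show ?thesis
    using add_iff[OF on_hesse_origin *(1), of P] tri_origin[of P] by (simp add: origin_def on_hesse_def)
qed

lemma add_origin_right: "p \<in> E \<Longrightarrow> p \<oplus>\<^sub>E origin = p"
  using add_origin[of p] add_commute[OF _ origin_in, of p] by simp

text \<open>This rests on the symmetry of \<open>tri\<close> under permutations and under swapping
  all three points, so it holds for arbitrary points without the associative law. All cancellation
  rules derive from it.\<close>

lemma add_neg_cancel: "p \<in> E \<Longrightarrow> q \<in> E \<Longrightarrow> (p \<oplus>\<^sub>E q) \<oplus>\<^sub>E neg q = p"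
proof (elim hesse_curve_cases)
  fix P Q assume *: "on_hesse l P" "on_hesse l Q" "p = pt P" "q = pt Q"
  obtain S where S: "on_hesse l S" "tri P Q (swap3 S)" "pt P \<oplus>\<^sub>E pt Q = pt S" using add_exists * by blast
  have "tri (swap3 S) Q P" using S(2) tri_rotate tri_commute by blast
  then have "tri S (swap3 Q) (swap3 P)" using tri_swap3_swap3[of "swap3 S" Q P] tri_swap3 by (metis swap3_swap3)
  then have "pt S \<oplus>\<^sub>E pt (swap3 Q) = pt P"
    using add_iff[of S "swap3 Q" P] S(1) * by (simp add: on_hesse_swap3 on_hesse_def)
  then show ?thesis using S(3) * by (simp add: on_hesse_def neg_pt)
qed

lemma add_neg_cancel': "p \<in> E \<Longrightarrow> q \<in> E \<Longrightarrow> (p \<oplus>\<^sub>E neg q) \<oplus>\<^sub>E q = p"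
  using add_neg_cancel[of p "neg q"] by (simp add: neg_closed neg_neg)

lemma add_right_cancel: "p \<in> E \<Longrightarrow> p' \<in> E \<Longrightarrow> q \<in> E \<Longrightarrow> p \<oplus>\<^sub>E q = p' \<oplus>\<^sub>E q \<longleftrightarrow> p = p'"
proof
  assume *: "p \<in> E" "p' \<in> E" "q \<in> E" "p \<oplus>\<^sub>E q = p' \<oplus>\<^sub>E q"
  have "p = (p \<oplus>\<^sub>E q) \<oplus>\<^sub>E neg q" using add_neg_cancel *(1,3) by simp
  also have "\<dots> = p'" unfolding *(4) using add_neg_cancel *(2,3) by simp
  finally show "p = p'" .
qed simp

lemma add_left_cancel: "p \<in> E \<Longrightarrow> p' \<in> E \<Longrightarrow> q \<in> E \<Longrightarrow> q \<oplus>\<^sub>E p = q \<oplus>\<^sub>E p' \<longleftrightarrow> p = p'"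
  using add_right_cancel[of p p' q] add_commute[of q p] add_commute[of q p'] by simp

lemma add_neg_self: "p \<in> E \<Longrightarrow> p \<oplus>\<^sub>E neg p = origin" "p \<in> E \<Longrightarrow> neg p \<oplus>\<^sub>E p = origin"
proof -
  assume p: "p \<in> E"
  then have "p \<oplus>\<^sub>E neg p = origin" using add_neg_cancel[OF origin_in p] add_origin[OF p] by simp
  then show "p \<oplus>\<^sub>E neg p = origin" "neg p \<oplus>\<^sub>E p = origin"
    using add_commute[OF p neg_closed[OF p]] by simp_all
qed

lemma neg_add: "p \<in> E \<Longrightarrow> q \<in> E \<Longrightarrow> neg (p \<oplus>\<^sub>E q) = neg p \<oplus>\<^sub>E neg q"
proof (elim hesse_curve_cases)
  fix P Q assume *: "on_hesse l P" "on_hesse l Q" "p = pt P" "q = pt Q"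
  obtain S where S: "on_hesse l S" "tri P Q (swap3 S)" "pt P \<oplus>\<^sub>E pt Q = pt S" using add_exists * by blast
  then have "tri (swap3 P) (swap3 Q) (swap3 (swap3 S))" using tri_swap3 by blast
  then have "pt (swap3 P) \<oplus>\<^sub>E pt (swap3 Q) = pt (swap3 S)"
    using add_iff[of "swap3 P" "swap3 Q" "swap3 S"] S(1) * by (simp add: on_hesse_swap3 on_hesse_def)
  then show ?thesis using S * by (simp add: on_hesse_def neg_pt)
qed

lemma add_eq_origin_iff: "p \<in> E \<Longrightarrow> q \<in> E \<Longrightarrow> p \<oplus>\<^sub>E q = origin \<longleftrightarrow> p = neg q"
  using add_neg_self(2)[of q] add_right_cancel[of p "neg q" q] by (simp add: neg_closed)

text \<open>\<open>L\<close> induces a translation: \<open>L P + Q = L (P + Q)\<close>.\<close>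

definition transl_lin :: "('k vec3 \<Rightarrow> 'k vec3) \<Rightarrow> bool" where
  "transl_lin L \<longleftrightarrow> lin3 L \<and> (\<exists>M. lin3 M \<and> (\<forall>v. M (L v) = v) \<and> (\<forall>v. L (M v) = v)) \<and>
     (\<exists>k. k \<noteq> 0 \<and> (\<forall>v. hesse_form l (L v) = k * hesse_form l v)) \<and>
     (\<forall>P Q R. tri P Q (swap3 R) \<longrightarrow> tri (L P) Q (swap3 (L R))) \<and>
     (\<forall>P. tri P P P \<longrightarrow> tri (L P) (L P) (L P))"

section \<open>Translations by flexes as linear maps\<close>

lemma transl_lin_comp:
  assumes "transl_lin L" "transl_lin L'"
  shows "transl_lin (L \<circ> L')"
proof -
  obtain M M' where M: "lin3 M" "\<And>v. M (L v) = v" "\<And>v. L (M v) = v" "lin3 M'" "\<And>v. M' (L' v) = v" "\<And>v. L' (M' v) = v"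
    using assms unfolding transl_lin_def by blast
  obtain k k' where k: "k \<noteq> 0" "\<And>v. hesse_form l (L v) = k * hesse_form l v"
    "k' \<noteq> 0" "\<And>v. hesse_form l (L' v) = k' * hesse_form l v"
    using assms unfolding transl_lin_def by blast
  have lin_comp: "lin3 (A \<circ> B)" if "lin3 A" "lin3 B" for A B :: "'k vec3 \<Rightarrow> 'k vec3"
    unfolding lin3_def using lin3_add[OF that(1)] lin3_add[OF that(2)] lin3_smul[OF that(1)] lin3_smul[OF that(2)]
    by (simp del: add3.simps smul3.simps split_paired_All)
  have "\<exists>N. lin3 N \<and> (\<forall>v. N ((L \<circ> L') v) = v) \<and> (\<forall>v. (L \<circ> L') (N v) = v)"
    by (rule exI[of _ "M' \<circ> M"]) (simp add: lin_comp M del: split_paired_All)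
  moreover have "\<exists>c. c \<noteq> 0 \<and> (\<forall>v. hesse_form l ((L \<circ> L') v) = c * hesse_form l v)"
    by (rule exI[of _ "k * k'"]) (simp add: k mult.assoc del: split_paired_All)
  moreover have "lin3 (L \<circ> L')" using assms lin_comp unfolding transl_lin_def by blast
  moreover have "\<forall>P Q R. tri P Q (swap3 R) \<longrightarrow> tri ((L \<circ> L') P) Q (swap3 ((L \<circ> L') R))"
    "\<forall>P. tri P P P \<longrightarrow> tri ((L \<circ> L') P) ((L \<circ> L') P) ((L \<circ> L') P)"
    using assms unfolding transl_lin_def comp_def by blast+
  ultimately show ?thesis unfolding transl_lin_def by blast
qed

lemma transl_lin_cyc3: "transl_lin cyc3"
  unfolding transl_lin_def
proof (intro conjI exI[of _ "\<lambda>v. cyc3 (cyc3 v)"] exI[of _ "1 :: 'k"])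
  show "lin3 (\<lambda>v :: 'k vec3. cyc3 (cyc3 v))" by (auto simp: lin3_def)
  show "\<forall>P Q R :: 'k vec3. tri P Q (swap3 R) \<longrightarrow> tri (cyc3 P) Q (swap3 (cyc3 R))"
    by (simp add: algebra_simps)
  show "\<forall>P :: 'k vec3. tri P P P \<longrightarrow> tri (cyc3 P) (cyc3 P) (cyc3 P)"
    by (simp add: algebra_simps)
qed (auto simp: cyc3_linear(1,3))

definition diag3 :: "'k \<Rightarrow> 'k vec3 \<Rightarrow> 'k vec3" where
  "diag3 k v = (case v of (x, y, z) \<Rightarrow> (x, k * y, k\<^sup>2 * z))"

text \<open>Each monomial of one equation in \<open>tri P Q (swap3 R)\<close> acquires the same
  power of \<open>k\<close>, because the exponents 0, 1, 2 of the diagonal are compared modulo 3.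
  The inverse is the diagonal map of \<open>k\<^sup>2\<close>.\<close>

lemma transl_lin_diag3:
  assumes k: "k ^ 3 = 1"
  shows "transl_lin (diag3 k)"
proof -
  have kkk: "k * (k * k) = 1" using k by (simp add: power3_eq_cube mult.assoc)
  have "(k\<^sup>2) ^ 3 = (k ^ 3)\<^sup>2" by (simp add: power_mult[symmetric])
  then have k6: "(k\<^sup>2) ^ 3 = 1" "k * k\<^sup>2 = 1" "k\<^sup>2 * k = 1" "k * k * k = 1"
    using k kkk by (simp_all add: power2_eq_square mult.assoc)
  then have k6': "k\<^sup>2 * k\<^sup>2 * k\<^sup>2 = 1" by (simp only: power3_eq_cube)
  have inv: "diag3 (k\<^sup>2) (diag3 k v) = v" "diag3 k (diag3 (k\<^sup>2) v) = v" for v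
  proof -
    obtain x y z where v: "v = (x, y, z)" by (cases v)
    have "k\<^sup>2 * (k * y) = (k\<^sup>2 * k) * y" "(k\<^sup>2)\<^sup>2 * (k\<^sup>2 * z) = (k\<^sup>2 * k\<^sup>2 * k\<^sup>2) * z"
      "k * (k\<^sup>2 * y) = (k * k\<^sup>2) * y" "k\<^sup>2 * ((k\<^sup>2)\<^sup>2 * z) = (k\<^sup>2 * k\<^sup>2 * k\<^sup>2) * z"
      by (simp_all add: power2_eq_square mult.assoc)
    then show "diag3 (k\<^sup>2) (diag3 k v) = v" "diag3 k (diag3 (k\<^sup>2) v) = v"
      by (simp_all only: v diag3_def prod.case k6 k6' mult_1)
  qed
  have lin: "lin3 (diag3 c)" for c by (auto simp: lin3_def diag3_def algebra_simps)
  have form: "hesse_form l (diag3 k v) = 1 * hesse_form l v" for v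
  proof -
    obtain x y z where v: "v = (x, y, z)" by (cases v)
    have "3 * l * x * (k * y) * (k\<^sup>2 * z) = 3 * l * x * y * z * (k * k\<^sup>2)" by (simp add: ac_simps)
    then show ?thesis
      unfolding v diag3_def prod.case hesse_form.simps power_mult_distrib k k6 by simp
  qed
  have tri1: "tri (diag3 k P) Q (swap3 (diag3 k R))" if "tri P Q (swap3 R)" for P Q R
  proof -
    obtain x1 y1 z1 x2 y2 z2 x3 y3 z3 where *: "P = (x1, y1, z1)" "Q = (x2, y2, z2)" "R = (x3, y3, z3)"
      by (cases P; cases Q; cases R)
    have "x1 * y2 * (k\<^sup>2 * z3) + k * y1 * z2 * (k * y3) + k\<^sup>2 * z1 * x2 * x3
      = k\<^sup>2 * (x1 * y2 * z3 + y1 * z2 * y3 + z1 * x2 * x3)" by (simp add: algebra_simps power2_eq_square)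
    moreover have "x1 * z2 * x3 + k * y1 * x2 * (k\<^sup>2 * z3) + k\<^sup>2 * z1 * y2 * (k * y3)
      = x1 * z2 * x3 + (k * k\<^sup>2) * (y1 * x2 * z3 + z1 * y2 * y3)" by (simp add: algebra_simps)
    moreover have "x1 * x2 * (k * y3) + k * y1 * y2 * x3 + k\<^sup>2 * z1 * z2 * (k\<^sup>2 * z3)
      = k * (x1 * x2 * y3 + y1 * y2 * x3 + (k * k\<^sup>2) * (z1 * z2 * z3))" by (simp add: algebra_simps power2_eq_square)
    ultimately show ?thesis
      using that unfolding * diag3_def prod.case swap3.simps tri.simps k6 by (simp add: add.assoc)
  qed
  have tri2: "tri (diag3 k P) (diag3 k P) (diag3 k P)" if "tri P P P" for P
  proof -
    obtain x y z where P: "P = (x, y, z)" by (cases P)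
    have e: "x * (k * y) * (k\<^sup>2 * z) + k * y * (k\<^sup>2 * z) * x + k\<^sup>2 * z * x * (k * y)
      = (k * k\<^sup>2) * (x * y * z + y * z * x + z * x * y)"
      "x * (k\<^sup>2 * z) * (k * y) + k * y * x * (k\<^sup>2 * z) + k\<^sup>2 * z * (k * y) * x
      = (k * k\<^sup>2) * (x * z * y + y * x * z + z * y * x)"
      "x * x * x + k * y * (k * y) * (k * y) + k\<^sup>2 * z * (k\<^sup>2 * z) * (k\<^sup>2 * z)
      = x * x * x + (k * k * k) * (y * y * y) + (k\<^sup>2 * k\<^sup>2 * k\<^sup>2) * (z * z * z)"
      by (simp_all add: algebra_simps)
    show ?thesis
      unfolding P diag3_def prod.case tri.simps e
      unfolding k6 k6' mult_1 using that[unfolded P tri.simps] .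
  qed
  show ?thesis
    unfolding transl_lin_def using lin inv form tri1 tri2
    by (intro conjI allI impI exI[of _ "diag3 (k\<^sup>2)"] exI[of _ "1 :: 'k"]) simp_all
qed

text \<open>The action of E[3] by monomial matrices: the three diagonal maps combined with the three
  cyclic shifts, that is, the Heisenberg group modulo scalars.\<close>

definition flex_maps :: "('k vec3 \<Rightarrow> 'k vec3) set" where
  "flex_maps = (\<Union>k \<in> {k. k ^ 3 = 1}. {diag3 k, cyc3 \<circ> diag3 k, cyc3 \<circ> (cyc3 \<circ> diag3 k)})"

lemma flex_maps_transl_lin: "L \<in> flex_maps \<Longrightarrow> transl_lin L"
  unfolding flex_maps_def using transl_lin_comp transl_lin_cyc3 transl_lin_diag3 by auto

lemma flex_transl_lin:
  assumes "flex l P"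
  obtains L c where "L \<in> flex_maps" "c \<noteq> 0" "P = smul3 c (L (1, -1, 0))"
proof -
  have *: "\<exists>k c. k ^ 3 = 1 \<and> c \<noteq> 0 \<and> (x, y, 0) = smul3 c (diag3 k (1, -1, 0))" if "on_hesse l (x, y, 0)" for x y
  proof -
    have xy: "y ^ 3 = - (x ^ 3)" "x \<noteq> 0"
      using that by (auto simp: on_hesse_def eq_neg_iff_add_eq_0 add.commute)
    have "(- y / x) ^ 3 = - (y ^ 3) / x ^ 3" by (simp add: power3_eq_cube)
    then have "(- y / x) ^ 3 = 1" using xy by simp
    then show ?thesis using xy(2) by (intro exI[of _ "- y / x"] exI[of _ x]) (simp add: diag3_def)
  qed
  obtain x y z where P: "P = (x, y, z)" by (cases P)
  have on: "on_hesse l (x, y, z)" and "x * y * z = 0" using assms flex_iff unfolding P by blast+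
  then consider "z = 0" | "x = 0" | "y = 0" by auto
  then show ?thesis
  proof cases
    case 1
    then obtain k c where kc: "k ^ 3 = 1" "c \<noteq> 0" "(x, y, 0) = smul3 c (diag3 k (1, -1, 0))" using * on by blast
    have "diag3 k \<in> flex_maps" using kc(1) unfolding flex_maps_def by blast
    then show ?thesis using that[of "diag3 k" c] kc 1 unfolding P by simp
  next
    case 2
    have "on_hesse l (y, z, 0)" using on 2 by (simp add: on_hesse_def)
    then obtain k c where kc: "k ^ 3 = 1" "c \<noteq> 0" "(y, z, 0) = smul3 c (diag3 k (1, -1, 0))" using * by blast
    have "P = cyc3 (cyc3 (y, z, 0))" by (simp add: P 2)
    also have "\<dots> = smul3 c ((cyc3 \<circ> (cyc3 \<circ> diag3 k)) (1, -1, 0))"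
      unfolding kc(3) by (simp add: diag3_def)
    finally show ?thesis using that[OF _ kc(2)] kc(1) unfolding flex_maps_def by blast
  next
    case 3
    have "on_hesse l (z, x, 0)" using on 3 by (auto simp: on_hesse_def algebra_simps)
    then obtain k c where kc: "k ^ 3 = 1" "c \<noteq> 0" "(z, x, 0) = smul3 c (diag3 k (1, -1, 0))" using * by blast
    have "P = cyc3 (z, x, 0)" by (simp add: P 3)
    also have "\<dots> = smul3 c ((cyc3 \<circ> diag3 k) (1, -1, 0))"
      unfolding kc(3) by (simp add: diag3_def)
    finally show ?thesis using that[OF _ kc(2)] kc(1) unfolding flex_maps_def by blast
  qed
qed

text \<open>The condition 3p = o, written so that no bracketing of three summands has to be
  chosen.\<close>

definition flexes :: "'k plane set" where
  "flexes = {p \<in> E. p \<oplus>\<^sub>E p = neg p}"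

lemma flexes_pt:
  assumes "on_hesse l P"
  shows "pt P \<in> flexes \<longleftrightarrow> flex l P"
proof -
  have "P \<noteq> null3" using assms by (simp add: on_hesse_def)
  then show ?thesis
    using add_iff[OF assms assms, of "swap3 P"] assms by (simp add: flexes_def flex_def hesse_curve_pt neg_pt)
qed

lemma flexes_cases:
  assumes "p \<in> flexes"
  obtains P where "flex l P" "p = pt P"
proof -
  obtain P where "on_hesse l P" "p = pt P" using assms hesse_curve_cases unfolding flexes_def by blast
  then show ?thesis using that assms flexes_pt by blast
qed

lemma flexes_E: "t \<in> flexes \<Longrightarrow> t \<in> E"
  by (simp add: flexes_def)

text \<open>The flex is \<open>L\<close> applied to the origin, up to scale. Applying the invariance
  of \<open>tri\<close> under \<open>L\<close> to the relation between \<open>o\<close>, Q and -Q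
  gives the sum with Q as \<open>L Q\<close>.\<close>

lemma flexes_translation:
  assumes "t \<in> flexes"
  obtains L where "L \<in> flex_maps" "transl_lin L" "\<And>q. q \<in> E \<Longrightarrow> t \<oplus>\<^sub>E q = induced L q"
    "\<And>Q. on_hesse l Q \<Longrightarrow> on_hesse l (L Q)"
    "\<And>Q. on_hesse l Q \<Longrightarrow> t \<oplus>\<^sub>E pt Q = pt (L Q)"
proof -
  obtain P where P: "flex l P" "t = pt P" using assms flexes_cases by blast
  obtain L c where fm: "L \<in> flex_maps" and c: "c \<noteq> 0" "P = smul3 c (L (1, -1, 0))" using flex_transl_lin P(1) by blast
  note L = flex_maps_transl_lin[OF fm] c
  have onP: "on_hesse l P" using P(1) by (simp add: flex_def)
  have lin: "lin3 L" using L(1) by (simp add: transl_lin_def)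
  have on: "on_hesse l (L Q)" if "on_hesse l Q" for Q
  proof -
    obtain k M where k: "\<And>v. hesse_form l (L v) = k * hesse_form l v" "\<And>v. M (L v) = v" "lin3 M"
      using L(1) unfolding transl_lin_def by blast
    have "L Q \<noteq> null3" using k(2)[of Q] lin3_null[OF k(3)] that by (auto simp: on_hesse_def)
    then show ?thesis using that k(1) by (simp add: on_hesse_def)
  qed
  have add: "t \<oplus>\<^sub>E pt Q = pt (L Q)" if Q: "on_hesse l Q" for Q
  proof -
    have "tri (L (1, -1, 0)) Q (swap3 (L Q))"
      using L(1) tri_origin[of Q] unfolding transl_lin_def by blast
    then have "tri P Q (swap3 (L Q))"
      using tri_smul[OF L(2), of 1 1 "L (1, -1, 0)" Q "swap3 (L Q)"] L(3) by simp
    then show ?thesis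
      using add_iff[OF onP Q, of "L Q"] on[OF Q] P(2) by (simp add: on_hesse_def)
  qed
  have "t \<oplus>\<^sub>E q = induced L q" if "q \<in> E" for q
    using that
  proof (rule hesse_curve_cases)
    fix Q assume Q: "on_hesse l Q" "q = pt Q"
    then show ?thesis using add on induced_pt[OF lin, of Q] by (simp add: on_hesse_def)
  qed
  then show ?thesis using that[OF fm L(1)] on add by blast
qed

lemma flexes_assoc:
  assumes "t \<in> flexes" "p \<in> E" "q \<in> E"
  shows "t \<oplus>\<^sub>E (p \<oplus>\<^sub>E q) = (t \<oplus>\<^sub>E p) \<oplus>\<^sub>E q"
proof -
  obtain L where L: "transl_lin L" "\<And>Q. on_hesse l Q \<Longrightarrow> on_hesse l (L Q)"
    "\<And>Q. on_hesse l Q \<Longrightarrow> t \<oplus>\<^sub>E pt Q = pt (L Q)"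
    using flexes_translation[OF assms(1)] by metis
  obtain P where P: "on_hesse l P" "p = pt P" using assms(2) hesse_curve_cases by blast
  obtain Q where Q: "on_hesse l Q" "q = pt Q" using assms(3) hesse_curve_cases by blast
  obtain S where S: "on_hesse l S" "tri P Q (swap3 S)" "pt P \<oplus>\<^sub>E pt Q = pt S" using add_exists P Q by blast
  have "tri (L P) Q (swap3 (L S))" using S(2) L(1) unfolding transl_lin_def by blast
  then have "pt (L P) \<oplus>\<^sub>E pt Q = pt (L S)"
    using add_iff[OF L(2)[OF P(1)] Q(1), of "L S"] L(2)[OF S(1)] by (simp add: on_hesse_def)
  then show ?thesis using L(3) P Q S by simp
qed

lemma flexes_assoc':
  assumes "t \<in> flexes" "p \<in> E" "q \<in> E"
  shows "p \<oplus>\<^sub>E (t \<oplus>\<^sub>E q) = t \<oplus>\<^sub>E (p \<oplus>\<^sub>E q)"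
proof -
  have t: "t \<in> E" using assms(1) flexes_E by simp
  have "p \<oplus>\<^sub>E (t \<oplus>\<^sub>E q) = (t \<oplus>\<^sub>E q) \<oplus>\<^sub>E p" using add_commute add_closed t assms by simp
  also have "\<dots> = t \<oplus>\<^sub>E (q \<oplus>\<^sub>E p)" using flexes_assoc[OF assms(1,3,2)] by simp
  finally show ?thesis using add_commute assms by simp
qed

lemma flexes_origin: "origin \<in> flexes"
  by (simp add: flexes_def origin_in add_origin neg_origin)

lemma flexes_neg: "t \<in> flexes \<Longrightarrow> neg t \<in> flexes"
  using neg_add[of t t] by (simp add: flexes_def neg_closed neg_neg)

lemma flexes_add: "t \<in> flexes \<Longrightarrow> t' \<in> flexes \<Longrightarrow> t \<oplus>\<^sub>E t' \<in> flexes"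
proof -
  assume t: "t \<in> flexes" and t': "t' \<in> flexes"
  obtain L where L: "transl_lin L" "\<And>Q. on_hesse l Q \<Longrightarrow> on_hesse l (L Q)"
    "\<And>Q. on_hesse l Q \<Longrightarrow> t \<oplus>\<^sub>E pt Q = pt (L Q)"
    using flexes_translation[OF t] by metis
  obtain P where P: "flex l P" "t' = pt P" using t' flexes_cases by blast
  then have "flex l (L P)" using L(1,2) unfolding flex_def transl_lin_def by blast
  then show ?thesis using L(3)[of P] P flexes_pt by (simp add: flex_def)
qed

lemma flexes_3: "t \<in> flexes \<Longrightarrow> t \<oplus>\<^sub>E (t \<oplus>\<^sub>E t) = origin"
  using add_neg_self(1)[of t] by (simp add: flexes_def)

lemma torsion_3: "torsion l 3 = flexes"
proof -
  have "p [^]\<^bsub>ec_group l\<^esub> (3::nat) = origin \<longleftrightarrow> p \<oplus>\<^sub>E p = neg p" if "p \<in> E" for p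
    using that by (simp add: nat_pow_def numeral_eq_Suc mult_ec_group carrier_ec_group add_origin
        add_eq_origin_iff add_closed)
  then show ?thesis by (auto simp: torsion_def flexes_def)
qed

section \<open>Torsion of order two and six\<close>

lemma torsion_2: "torsion l 2 = {p \<in> E. neg p = p}"
proof -
  have "p [^]\<^bsub>ec_group l\<^esub> (2::nat) = origin \<longleftrightarrow> neg p = p" if "p \<in> E" for p
    using that by (simp add: nat_pow_def numeral_eq_Suc mult_ec_group carrier_ec_group add_origin
        add_eq_origin_iff eq_commute[of p])
  then show ?thesis by (auto simp: torsion_def)
qed

text \<open>The swap has eigenvalues 1 and -1: the eigenspace of -1 is spanned by the origin, and
  that of 1 is the plane of vectors with equal first two coordinates.\<close>

lemma neg_fixed_cases:
  assumes "on_hesse l P" "neg (pt P) = pt P"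
  obtains "pt P = origin" | a c where "P = (a, a, c)"
proof -
  obtain a b c where P: "P = (a, b, c)" by (cases P)
  have nz: "P \<noteq> null3" using assms(1) by (simp add: on_hesse_def)
  have "pt P = pt (swap3 P)" using assms(2) nz by (simp add: neg_pt)
  then obtain t where "t \<noteq> 0" "swap3 P = smul3 t P" using pt_eq_iff[of P "swap3 P"] nz by auto
  then have "(b, a, c) = (t * a, t * b, t * c)" by (simp only: P swap3.simps smul3.simps)
  then have h: "b = t * a \<and> a = t * b \<and> c = t * c" unfolding prod.inject .
  note t = h[THEN conjunct1, symmetric] h[THEN conjunct2, THEN conjunct1, symmetric]
    h[THEN conjunct2, THEN conjunct2, symmetric]
  show ?thesis
  proof (cases "a = b")
    case True
    then show ?thesis using that(2) P by blast
  next
    case False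
    then have "t \<noteq> 1" using t by auto
    then have c: "c = 0" using t(3) by auto
    have "(a - b) * (1 + t) = a + t * a - b - t * b" by (simp add: algebra_simps)
    then have "(a - b) * (1 + t) = 0" unfolding t by simp
    then have "t = -1" using False by (simp add: eq_neg_iff_add_eq_0 add.commute)
    then have "P = smul3 a (1, -1, 0)" "a \<noteq> 0" using t(1) c False by (auto simp: P)
    then show ?thesis using that(1) pt_smul[of "(1, -1, 0)" a] by (simp add: origin_def)
  qed
qed

text \<open>In terms of \<open>tri\<close> the formula covers flexes as well, since no tangent line
  has to be spanned. Only the nonvanishing of \<open>double3\<close> needs the curve.\<close>

lemma double_pt:
  assumes "on_hesse l P"
  shows "pt P \<oplus>\<^sub>E pt P = pt (swap3 (double3 P))" "on_hesse l (double3 P)"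
proof -
  obtain x y z where P: "P = (x, y, z)" by (cases P)
  have "double3 P \<noteq> null3"
  proof
    assume "double3 P = null3"
    then have *: "x = 0 \<or> y ^ 3 = z ^ 3" "y = 0 \<or> z ^ 3 = x ^ 3" "z = 0 \<or> x ^ 3 = y ^ 3" by (auto simp: P)
    have on: "x ^ 3 + y ^ 3 + z ^ 3 = 3 * l * x * y * z" "x \<noteq> 0 \<or> y \<noteq> 0 \<or> z \<noteq> 0"
      using assms by (auto simp: P on_hesse_def)
    have "x \<noteq> 0" using * on by (cases "x = 0"; cases "y = 0"; cases "z = 0") auto
    moreover have "y \<noteq> 0" using * on calculation by (cases "y = 0"; cases "z = 0") auto
    moreover have "z \<noteq> 0" using * on calculation by (cases "z = 0") auto
    ultimately show False using * on_hesse_cubes_not_equal[OF assms[unfolded P] l] by auto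
  qed
  moreover have "tri P P (swap3 (swap3 (double3 P)))"
    by (simp add: P algebra_simps power3_eq_cube)
  ultimately show "pt P \<oplus>\<^sub>E pt P = pt (swap3 (double3 P))" "on_hesse l (double3 P)"
    using add_pt[OF assms assms, of "swap3 (double3 P)"] by (simp_all add: on_hesse_swap3)
qed

text \<open>A flex has a vanishing coordinate, and each coordinate of the double is a product of two
  factors.\<close>

lemma double_flex_iff:
  assumes "on_hesse l (x, y, z)"
  shows "pt (x, y, z) \<oplus>\<^sub>E pt (x, y, z) \<in> flexes \<longleftrightarrow>
    x = 0 \<or> y = 0 \<or> z = 0 \<or> x ^ 3 = y ^ 3 \<or> y ^ 3 = z ^ 3 \<or> z ^ 3 = x ^ 3"
  using double_pt[OF assms] flexes_pt[of "swap3 (double3 (x, y, z))"] on_hesse_swap3[of l "double3 (x, y, z)"]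
  by (auto simp: flex_iff)

text \<open>Powers are nested to the left, so 6p = o cannot be regrouped as 2p + 2p + 2p = o.
  Cancelling one summand at a time leads instead to 3p = -3p, which restricts 3p to the origin or to
  a point (a, a, c); in the second case explicit coordinates of 2p + p decide.\<close>

lemma torsion_6: "torsion l 6 = {p \<in> E. p \<oplus>\<^sub>E p \<in> flexes}"
proof -
  have "p [^]\<^bsub>ec_group l\<^esub> (6::nat) = origin \<longleftrightarrow> p \<oplus>\<^sub>E p \<in> flexes" if p: "p \<in> E" for p
  proof -
    define p2 p3 p4 p5 where "p2 = p \<oplus>\<^sub>E p" and "p3 = p2 \<oplus>\<^sub>E p" and "p4 = p3 \<oplus>\<^sub>E p" and "p5 = p4 \<oplus>\<^sub>E p"
    have cl: "p2 \<in> E" "p3 \<in> E" "p4 \<in> E" "p5 \<in> E"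
      using p add_closed unfolding p2_def p3_def p4_def p5_def by blast+
    have pow: "p [^]\<^bsub>ec_group l\<^esub> (6::nat) = p5 \<oplus>\<^sub>E p"
      using p by (simp add: nat_pow_def numeral_eq_Suc mult_ec_group carrier_ec_group add_origin
          p2_def p3_def p4_def p5_def)
    show ?thesis
    proof
      assume "p \<oplus>\<^sub>E p \<in> flexes"
      then have t: "p2 \<in> flexes" by (simp add: p2_def)
      have "p4 = p2 \<oplus>\<^sub>E p2"
        unfolding p4_def p3_def using flexes_assoc[OF t p p] by (simp add: p2_def)
      moreover have "p4 \<in> flexes" using calculation flexes_add t by simp
      then have "p5 \<oplus>\<^sub>E p = p4 \<oplus>\<^sub>E p2"
        unfolding p5_def using flexes_assoc[of p4 p p] p by (simp add: p2_def)
      ultimately show "p [^]\<^bsub>ec_group l\<^esub> (6::nat) = origin"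
        using pow flexes_3[OF t] add_commute cl by simp
    next
      assume "p [^]\<^bsub>ec_group l\<^esub> (6::nat) = origin"
      \<comment> \<open>Each removed summand reappears negated on the other side, until three remain
        on both.\<close>
      then have "p5 = neg p" using pow add_eq_origin_iff p cl by simp
      then have "p4 = neg p \<oplus>\<^sub>E neg p" using add_neg_cancel[OF cl(3) p] unfolding p5_def by simp
      then have "p4 = neg p2" using neg_add p by (simp add: p2_def)
      then have "p3 = neg p2 \<oplus>\<^sub>E neg p" using add_neg_cancel[OF cl(2) p] unfolding p4_def by simp
      then have p3: "neg p3 = p3" using neg_add[OF cl(1) p] unfolding p3_def by simp
      obtain x y z where P: "on_hesse l (x, y, z)" "p = pt (x, y, z)"
        using hesse_curve_cases[OF p] by (metis prod_cases3)
      obtain W where W: "on_hesse l W" "p3 = pt W" using hesse_curve_cases[OF cl(2)] by blast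
      show "p \<oplus>\<^sub>E p \<in> flexes"
      proof (cases "pt W = origin")
        case True
        then have "p2 = neg p" using W(2) add_eq_origin_iff p cl unfolding p3_def by simp
        then have "p \<in> flexes" using p by (simp add: flexes_def p2_def)
        then show ?thesis using flexes_add by blast
      next
        case False
        then obtain a c where ac: "W = (a, a, c)" using neg_fixed_cases[OF W(1)] p3 W(2) by metis
        have "p2 = pt (swap3 (double3 (x, y, z)))" using double_pt(1)[OF P(1)] P(2) by (simp add: p2_def)
        then have "pt (swap3 (double3 (x, y, z))) \<oplus>\<^sub>E pt (x, y, z) = pt W"
          using W(2) P(2) unfolding p3_def by simp
        moreover have "on_hesse l (swap3 (double3 (x, y, z)))"
          using double_pt(2)[OF P(1)] on_hesse_swap3 by blast
        moreover have "W \<noteq> null3" using W(1) unfolding on_hesse_def by blast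
        ultimately have "tri (swap3 (double3 (x, y, z))) (x, y, z) (swap3 W)"
          using add_iff P(1) by blast
        then have "tri (swap3 (double3 (x, y, z))) (x, y, z) (a, a, c)" by (simp only: ac swap3.simps)
        then have e1: "y * (z ^ 3 - x ^ 3) * y * c + x * (y ^ 3 - z ^ 3) * z * a + z * (x ^ 3 - y ^ 3) * x * a = 0"
          and e2: "y * (z ^ 3 - x ^ 3) * x * a + x * (y ^ 3 - z ^ 3) * y * a + z * (x ^ 3 - y ^ 3) * z * c = 0"
          by simp_all
        \<comment> \<open>In \<open>e2\<close> the two terms with \<open>a\<close> combine, as the
          differences of cubes add up to zero.\<close>
        have "(x ^ 3 - y ^ 3) * (z\<^sup>2 * c - x * y * a) = 0"
          using e2 by (simp add: algebra_simps power2_eq_square)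
        moreover have "x * y * z \<noteq> 0 \<Longrightarrow> z\<^sup>2 * c = x * y * a \<Longrightarrow> y ^ 3 = z ^ 3 \<or> z ^ 3 = x ^ 3"
        proof -
          assume nz: "x * y * z \<noteq> 0" and zc: "z\<^sup>2 * c = x * y * a"
          have "a \<noteq> 0" using W(1) zc nz by (auto simp: ac on_hesse_def)
          \<comment> \<open>Multiplying \<open>e1\<close> by the square of \<open>z\<close> allows
            \<open>c\<close> to be eliminated; what remains is the product of the other two
            differences of cubes.\<close>
          have "y * (z ^ 3 - x ^ 3) * y * (z\<^sup>2 * c) + z\<^sup>2 * (x * (y ^ 3 - z ^ 3) * z * a + z * (x ^ 3 - y ^ 3) * x * a) = 0"
            using arg_cong[OF e1, of "\<lambda>u. z\<^sup>2 * u"] by (simp add: algebra_simps)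
          then have "a * x * ((y ^ 3 - z ^ 3) * (z ^ 3 - x ^ 3)) = 0"
            unfolding zc by (simp add: algebra_simps power2_eq_square power3_eq_cube)
          then show "y ^ 3 = z ^ 3 \<or> z ^ 3 = x ^ 3" using nz \<open>a \<noteq> 0\<close> by auto
        qed
        ultimately show ?thesis using double_flex_iff[OF P(1)] P(2) by auto
      qed
    qed
  qed
  then show ?thesis by (auto simp: torsion_def)
qed

end

section \<open>Weierstrass coordinates\<close>

definition linf :: "('k::field vec3 \<Rightarrow> 'k) \<Rightarrow> bool" where
  "linf f \<longleftrightarrow> (\<exists>a b c. \<forall>x y z. f (x, y, z) = a * x + b * y + c * z)"

definition cubic_form :: "('k::field vec3 \<Rightarrow> 'k) \<Rightarrow> bool" where
  "cubic_form g \<longleftrightarrow> (\<exists>c0 c1 c2 c3 c4 c5 c6 c7 c8 c9. \<forall>x y z. g (x, y, z) =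
     c0 * x * y * z + c1 * x ^ 3 + c2 * y ^ 3 + c3 * z ^ 3 + c4 * x\<^sup>2 * y + c5 * x\<^sup>2 * z
     + c6 * x * y\<^sup>2 + c7 * y\<^sup>2 * z + c8 * x * z\<^sup>2 + c9 * y * z\<^sup>2)"

lemma cubic_form_add:
  assumes "cubic_form f" "cubic_form g"
  shows "cubic_form (\<lambda>v. f v + g v)"
proof -
  obtain c0 c1 c2 c3 c4 c5 c6 c7 c8 c9 where f: "\<And>x y z. f (x, y, z) =
     c0 * x * y * z + c1 * x ^ 3 + c2 * y ^ 3 + c3 * z ^ 3 + c4 * x\<^sup>2 * y + c5 * x\<^sup>2 * z
     + c6 * x * y\<^sup>2 + c7 * y\<^sup>2 * z + c8 * x * z\<^sup>2 + c9 * y * z\<^sup>2"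
    using assms(1) unfolding cubic_form_def by blast
  obtain d0 d1 d2 d3 d4 d5 d6 d7 d8 d9 where g: "\<And>x y z. g (x, y, z) =
     d0 * x * y * z + d1 * x ^ 3 + d2 * y ^ 3 + d3 * z ^ 3 + d4 * x\<^sup>2 * y + d5 * x\<^sup>2 * z
     + d6 * x * y\<^sup>2 + d7 * y\<^sup>2 * z + d8 * x * z\<^sup>2 + d9 * y * z\<^sup>2"
    using assms(2) unfolding cubic_form_def by blast
  show ?thesis
    unfolding cubic_form_def
    by (rule exI[of _ "c0 + d0"], rule exI[of _ "c1 + d1"], rule exI[of _ "c2 + d2"], rule exI[of _ "c3 + d3"],
      rule exI[of _ "c4 + d4"], rule exI[of _ "c5 + d5"], rule exI[of _ "c6 + d6"], rule exI[of _ "c7 + d7"],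
      rule exI[of _ "c8 + d8"], rule exI[of _ "c9 + d9"]) (simp add: f g algebra_simps)
qed

lemma cubic_form_prod:
  assumes "linf f" "linf g" "linf h"
  shows "cubic_form (\<lambda>v. m * (f v * g v * h v))"
proof -
  obtain f1 f2 f3 where f: "\<And>x y z. f (x, y, z) = f1 * x + f2 * y + f3 * z"
    using assms(1) unfolding linf_def by blast
  obtain g1 g2 g3 where g: "\<And>x y z. g (x, y, z) = g1 * x + g2 * y + g3 * z"
    using assms(2) unfolding linf_def by blast
  obtain h1 h2 h3 where h: "\<And>x y z. h (x, y, z) = h1 * x + h2 * y + h3 * z"
    using assms(3) unfolding linf_def by blast
  show ?thesis
    unfolding cubic_form_def
    by (rule exI[of _ "m * (f1*g2*h3 + f1*g3*h2 + f2*g1*h3 + f2*g3*h1 + f3*g1*h2 + f3*g2*h1)"],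
      rule exI[of _ "m * (f1*g1*h1)"], rule exI[of _ "m * (f2*g2*h2)"], rule exI[of _ "m * (f3*g3*h3)"],
      rule exI[of _ "m * (f1*g1*h2 + f1*g2*h1 + f2*g1*h1)"], rule exI[of _ "m * (f1*g1*h3 + f1*g3*h1 + f3*g1*h1)"],
      rule exI[of _ "m * (f1*g2*h2 + f2*g1*h2 + f2*g2*h1)"], rule exI[of _ "m * (f2*g2*h3 + f2*g3*h2 + f3*g2*h2)"],
      rule exI[of _ "m * (f1*g3*h3 + f3*g1*h3 + f3*g3*h1)"], rule exI[of _ "m * (f2*g3*h3 + f3*g2*h3 + f3*g3*h2)"])
      (simp add: f g h algebra_simps power2_eq_square power3_eq_cube)
qed

lemma linf_coord:
  assumes "lin3 N"
  shows "linf (\<lambda>v. coord i (N v))"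
  unfolding linf_def
  by (rule exI[of _ "coord i (N (1, 0, 0))"], rule exI[of _ "coord i (N (0, 1, 0))"],
      rule exI[of _ "coord i (N (0, 0, 1))"], intro allI, subst lin3_expand[OF assms]) (simp add: algebra_simps)

fun weierstrass_form :: "'k::field \<Rightarrow> 'k \<Rightarrow> 'k vec3 \<Rightarrow> 'k" where
  "weierstrass_form a b (x, y, z) = y ^ 2 * z - (x ^ 3 + a * x * z ^ 2 + b * z ^ 3)"

lemma cubic_form_weierstrass:
  assumes "lin3 N"
  shows "cubic_form (\<lambda>v. weierstrass_form a b (N v))"
proof -
  let ?x = "\<lambda>v. coord Gen_x (N v)" and ?y = "\<lambda>v. coord Gen_y (N v)" and ?z = "\<lambda>v. coord Gen_z (N v)"
  have "cubic_form (\<lambda>v. 1 * (?y v * ?y v * ?z v) + ((-1) * (?x v * ?x v * ?x v)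
      + ((- a) * (?x v * ?z v * ?z v) + (- b) * (?z v * ?z v * ?z v))))"
    by (intro cubic_form_add cubic_form_prod linf_coord assms)
  also have "(\<lambda>v. 1 * (?y v * ?y v * ?z v) + ((-1) * (?x v * ?x v * ?x v)
      + ((- a) * (?x v * ?z v * ?z v) + (- b) * (?z v * ?z v * ?z v)))) = (\<lambda>v. weierstrass_form a b (N v))"
  proof
    fix v
    show "1 * (?y v * ?y v * ?z v) + ((-1) * (?x v * ?x v * ?x v)
      + ((- a) * (?x v * ?z v * ?z v) + (- b) * (?z v * ?z v * ?z v))) = weierstrass_form a b (N v)"
      by (cases "N v") (simp add: algebra_simps power2_eq_square power3_eq_cube)
  qed
  finally show ?thesis .
qed

lemma cubic_form_hesse:
  assumes "lin3 N"
  shows "cubic_form (\<lambda>v. hesse_form l (N v))"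
proof -
  let ?x = "\<lambda>v. coord Gen_x (N v)" and ?y = "\<lambda>v. coord Gen_y (N v)" and ?z = "\<lambda>v. coord Gen_z (N v)"
  have "cubic_form (\<lambda>v. 1 * (?x v * ?x v * ?x v) + (1 * (?y v * ?y v * ?y v)
      + (1 * (?z v * ?z v * ?z v) + (- 3 * l) * (?x v * ?y v * ?z v))))"
    by (intro cubic_form_add cubic_form_prod linf_coord assms)
  also have "(\<lambda>v. 1 * (?x v * ?x v * ?x v) + (1 * (?y v * ?y v * ?y v)
      + (1 * (?z v * ?z v * ?z v) + (- 3 * l) * (?x v * ?y v * ?z v)))) = (\<lambda>v. hesse_form l (N v))"
  proof
    fix v
    show "1 * (?x v * ?x v * ?x v) + (1 * (?y v * ?y v * ?y v)
      + (1 * (?z v * ?z v * ?z v) + (- 3 * l) * (?x v * ?y v * ?z v))) = hesse_form l (N v)"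
      by (cases "N v") (simp add: algebra_simps power2_eq_square power3_eq_cube)
  qed
  finally show ?thesis .
qed

lemma alg_closed_sqrt:
  fixes c :: "'k::alg_closed_field"
  obtains y where "y\<^sup>2 = c"
proof -
  have "degree [:- c, 0, 1:] > 0" by simp
  then obtain y where "poly [:- c, 0, 1:] y = 0" using alg_closed_imp_poly_has_root by blast
  then have "y\<^sup>2 = c" by (simp add: power2_eq_square)
  then show ?thesis using that by blast
qed

text \<open>Comparing even and odd parts in \<open>y\<close> on the affine curve replaces the Nullstellensatz.\<close>

lemma cubic_form_vanishing_on_weierstrass:
  fixes g :: "'k::{alg_closed_field, field_char_0} vec3 \<Rightarrow> 'k"
  assumes "cubic_form g" and van: "\<And>v. v \<noteq> null3 \<Longrightarrow> weierstrass_form a b v = 0 \<Longrightarrow> g v = 0"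
  shows "\<exists>c. \<forall>v. g v = c * weierstrass_form a b v"
proof -
  obtain c0 c1 c2 c3 c4 c5 c6 c7 c8 c9 where g: "\<And>x y z. g (x, y, z) =
     c0 * x * y * z + c1 * x ^ 3 + c2 * y ^ 3 + c3 * z ^ 3 + c4 * x\<^sup>2 * y + c5 * x\<^sup>2 * z
     + c6 * x * y\<^sup>2 + c7 * y\<^sup>2 * z + c8 * x * z\<^sup>2 + c9 * y * z\<^sup>2"
    using assms(1) unfolding cubic_form_def by blast
  \<comment> \<open>Above \<open>x\<close> lie the points with second coordinate y and -y, so even
    and odd parts vanish separately. Where y = 0 the odd part is invisible, hence the extra factor
    in the second equation; it is cancelled later as a nonzero polynomial.\<close>
  have *: "(x ^ 3 + a * x + b) * (c6 * x + c7) + (c1 * x ^ 3 + c5 * x\<^sup>2 + c8 * x + c3) = 0 \<and>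
    (x ^ 3 + a * x + b) * (c2 * (x ^ 3 + a * x + b) + (c4 * x\<^sup>2 + c0 * x + c9)) = 0" for x
  proof -
    define f where "f = x ^ 3 + a * x + b"
    obtain y where y: "y\<^sup>2 = f" by (rule alg_closed_sqrt)
    define ev where "ev = f * (c6 * x + c7) + (c1 * x ^ 3 + c5 * x\<^sup>2 + c8 * x + c3)"
    define od where "od = c2 * f + (c4 * x\<^sup>2 + c0 * x + c9)"
    have eo: "ev + od * u = 0" if u: "u\<^sup>2 = f" for u
    proof -
      have "weierstrass_form a b (x, u, 1) = 0" by (simp add: u f_def)
      then have "g (x, u, 1) = 0" by (intro van) simp_all
      moreover have "g (x, u, 1) = u\<^sup>2 * (c6 * x + c7) + (c1 * x ^ 3 + c5 * x\<^sup>2 + c8 * x + c3) +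
          (c2 * u\<^sup>2 + (c4 * x\<^sup>2 + c0 * x + c9)) * u"
        unfolding g by (simp add: algebra_simps power2_eq_square power3_eq_cube)
      ultimately show ?thesis unfolding u ev_def od_def by simp
    qed
    have 1: "ev + od * y = 0" "ev - od * y = 0" using eo[of y] eo[of "- y"] y by simp_all
    then have "2 * ev = (ev + od * y) + (ev - od * y)" by (simp only: mult_2) simp
    then have ev0: "ev = 0" using 1 by simp
    have "f * od = y * (od * y)" unfolding y[symmetric] by (simp add: power2_eq_square)
    also have "\<dots> = 0" using 1 ev0 by simp
    finally show ?thesis using ev0 unfolding ev_def od_def f_def by simp
  qed
  have e1: "[:b * c7 + c3, b * c6 + a * c7 + c8, a * c6 + c5, c7 + c1, c6:] = 0"
  proof (rule poly_zero_on_range[of "\<lambda>x. x"])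
    show "poly [:b * c7 + c3, b * c6 + a * c7 + c8, a * c6 + c5, c7 + c1, c6:] x = 0" for x
      using *[of x] by (simp add: algebra_simps power2_eq_square power3_eq_cube)
  qed simp
  then have c6: "c6 = 0" by simp
  then have e1': "c6 = 0" "c1 = - c7" "c5 = 0" "c8 = - (a * c7)" "c3 = - (b * c7)"
    using e1 by (simp_all add: eq_neg_iff_add_eq_0 add.commute)
  have "[:b, a, 0, 1:] * [:c2 * b + c9, c2 * a + c0, c4, c2:] = 0"
  proof (rule poly_zero_on_range[of "\<lambda>x. x"])
    have "poly ([:b, a, 0, 1:] * [:c2 * b + c9, c2 * a + c0, c4, c2:]) x =
      (x ^ 3 + a * x + b) * (c2 * (x ^ 3 + a * x + b) + (c4 * x\<^sup>2 + c0 * x + c9))" for x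
    proof -
      have "poly [:b, a, 0, 1:] x = x ^ 3 + a * x + b"
        by (simp add: algebra_simps power3_eq_cube)
      moreover have "poly [:c2 * b + c9, c2 * a + c0, c4, c2:] x =
          c2 * (x ^ 3 + a * x + b) + (c4 * x\<^sup>2 + c0 * x + c9)"
        by (simp add: algebra_simps power2_eq_square power3_eq_cube)
      ultimately show ?thesis unfolding poly_mult by (simp only:)
    qed
    then show "poly ([:b, a, 0, 1:] * [:c2 * b + c9, c2 * a + c0, c4, c2:]) x = 0" for x
      using *[of x] by simp
  qed simp
  then have "[:b, a, 0, 1:] = 0 \<or> [:c2 * b + c9, c2 * a + c0, c4, c2:] = 0"
    by (rule mult_eq_0_iff[THEN iffD1])
  moreover have "[:b, a, 0, 1:] \<noteq> 0" by simp
  ultimately have "[:c2 * b + c9, c2 * a + c0, c4, c2:] = 0" by blast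
  moreover from this have "c2 = 0" by simp
  ultimately have e2: "c2 = 0" "c4 = 0" "c0 = 0" "c9 = 0" by simp_all
  have "g v = c7 * weierstrass_form a b v" for v
  proof -
    obtain x y z where v: "v = (x, y, z)" by (cases v)
    show ?thesis unfolding v g e1' e2 by (simp add: algebra_simps)
  qed
  then show ?thesis by blast
qed

text \<open>A substitution that fixes (0 : 1 : 0) and carries one Weierstrass form to a multiple of
  another is diagonal. The coefficient of y squared shows that the line z = 0 is preserved, the
  missing linear term in y removes the shear in y, and the missing term in x squared removes the
  shear in x.\<close>

lemma weierstrass_form_linear_pullback:
  fixes N :: "'k::field_char_0 vec3 \<Rightarrow> 'k vec3"
  assumes N: "lin3 N" "N (0, 1, 0) = (0, n, 0)" and n: "n \<noteq> 0" and c: "c \<noteq> 0"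
    and eq: "\<And>v. weierstrass_form a' b' (N v) = c * weierstrass_form a b v"
  shows "\<exists>\<alpha> \<gamma>. (\<forall>x y z. N (x, y, z) = (\<alpha> * x, n * y, \<gamma> * z)) \<and>
    n\<^sup>2 * \<gamma> = c \<and> \<alpha> ^ 3 = c \<and> a' * \<alpha> * \<gamma>\<^sup>2 = c * a \<and> b' * \<gamma> ^ 3 = c * b"
proof -
  obtain n11 n21 n31 where N1: "N (1, 0, 0) = (n11, n21, n31)" by (cases "N (1, 0, 0)")
  obtain n13 n23 n33 where N3: "N (0, 0, 1) = (n13, n23, n33)" by (cases "N (0, 0, 1)")
  have Nv: "N (x, y, z) = (n11 * x + n13 * z, n21 * x + n * y + n23 * z, n31 * x + n33 * z)" for x y z
    by (subst lin3_expand[OF N(1)]) (simp add: N1 N3 N(2) algebra_simps)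
  define F where "F x y z = weierstrass_form a' b' (n11 * x + n13 * z, n21 * x + n * y + n23 * z, n31 * x + n33 * z)" for x y z
  have F: "F x y z = c * weierstrass_form a b (x, y, z)" for x y z
    unfolding F_def using eq[of "(x, y, z)"] unfolding Nv .
  \<comment> \<open>Second and first differences at y = 1, 0, -1 isolate the coefficients of y
    squared and of y.\<close>
  have second: "F x 1 z + F x (- 1) z - 2 * F x 0 z = 2 * n\<^sup>2 * (n31 * x + n33 * z)" for x z
    unfolding F_def by (simp add: algebra_simps power2_eq_square)
  have first: "F x 1 z - F x (- 1) z = 4 * n * (n21 * x + n23 * z) * (n31 * x + n33 * z)" for x z
    unfolding F_def by (simp add: algebra_simps power2_eq_square)
  have "2 * n\<^sup>2 * (n31 * x + n33 * z) = 2 * (c * z)" for x z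
    unfolding second[symmetric] F by (simp add: algebra_simps)
  then have s: "n\<^sup>2 * (n31 * x + n33 * z) = c * z" for x z
    by (metis mult.assoc mult_left_cancel zero_neq_numeral)
  have n31: "n31 = 0" and n33: "n\<^sup>2 * n33 = c" using s[of 1 0] s[of 0 1] n by simp_all
  then have n33_0: "n33 \<noteq> 0" using c by auto
  have "4 * n * (n21 * x + n23 * z) * (n31 * x + n33 * z) = 0" for x z
    unfolding first[symmetric] F by (simp add: algebra_simps)
  then have t: "(n21 * x + n23 * z) * z = 0" for x z using n n31 n33_0 by (auto simp: mult.assoc)
  have n23: "n23 = 0" using t[of 0 1] by simp
  then have n21: "n21 = 0" using t[of 1 1] by simp
  have "n11 ^ 3 * x ^ 3 + (3 * n11\<^sup>2 * n13) * x\<^sup>2 * z + (3 * n11 * n13\<^sup>2 + a' * n11 * n33\<^sup>2) * x * z\<^sup>2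
      + (n13 ^ 3 + a' * n13 * n33\<^sup>2 + b' * n33 ^ 3) * z ^ 3
    = c * x ^ 3 + 0 * x\<^sup>2 * z + (c * a) * x * z\<^sup>2 + (c * b) * z ^ 3" for x z
  proof -
    have "n11 ^ 3 * x ^ 3 + (3 * n11\<^sup>2 * n13) * x\<^sup>2 * z + (3 * n11 * n13\<^sup>2 + a' * n11 * n33\<^sup>2) * x * z\<^sup>2
      + (n13 ^ 3 + a' * n13 * n33\<^sup>2 + b' * n33 ^ 3) * z ^ 3 = - F x 0 z"
      unfolding F_def n21 n23 n31 by (simp add: algebra_simps power2_eq_square power3_eq_cube)
    also have "\<dots> = c * x ^ 3 + 0 * x\<^sup>2 * z + (c * a) * x * z\<^sup>2 + (c * b) * z ^ 3"
      unfolding F by (simp add: algebra_simps)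
    finally show ?thesis .
  qed
  note e = binary_cubic_eq[OF this]
  have n13: "n13 = 0" using e(1,2) c by auto
  show ?thesis
  proof (rule exI[of _ n11], rule exI[of _ n33], intro conjI allI)
    show "N (x, y, z) = (n11 * x, n * y, n33 * z)" for x y z unfolding Nv n13 n21 n23 n31 by simp
  qed (use n33 e n13 in auto)
qed

lemma weierstrass_curve_pt:
  assumes "v \<noteq> null3"
  shows "pt v \<in> weierstrass_curve a b \<longleftrightarrow> weierstrass_form a b v = 0"
proof
  assume "pt v \<in> weierstrass_curve a b"
  then obtain x y z where w: "pt v = pt (x, y, z)" "(x, y, z) \<noteq> null3" "y ^ 2 * z = x ^ 3 + a * x * z ^ 2 + b * z ^ 3"
    unfolding weierstrass_curve_def by blast
  then obtain t where t: "v = smul3 t (x, y, z)" using pt_eq_iff[OF w(2) assms] by auto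
  have "weierstrass_form a b v = t ^ 3 * (y ^ 2 * z - (x ^ 3 + a * x * z ^ 2 + b * z ^ 3))"
    unfolding t by (simp add: algebra_simps power2_eq_square power3_eq_cube)
  then show "weierstrass_form a b v = 0" using w(3) by simp
next
  assume *: "weierstrass_form a b v = 0"
  obtain x y z where v: "v = (x, y, z)" by (cases v)
  then show "pt v \<in> weierstrass_curve a b"
    using * assms unfolding weierstrass_curve_def v by (intro CollectI exI[of _ x] exI[of _ y] exI[of _ z]) simp
qed

section \<open>Linear isomorphisms as automorphisms of the plane\<close>

definition lin_iso :: "('k::field vec3 \<Rightarrow> 'k vec3) \<Rightarrow> bool" where
  "lin_iso L \<longleftrightarrow> lin3 L \<and> (\<exists>M. lin3 M \<and> (\<forall>v. M (L v) = v) \<and> (\<forall>v. L (M v) = v))"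

lemma lin_isoI: "lin3 L \<Longrightarrow> lin3 M \<Longrightarrow> (\<And>v. M (L v) = v) \<Longrightarrow> (\<And>v. L (M v) = v) \<Longrightarrow> lin_iso L"
  unfolding lin_iso_def by blast

lemma lin_isoD:
  assumes "lin_iso L"
  shows "lin3 L" "lin3 (inv_into UNIV L)" "inv_into UNIV L (L v) = v" "L (inv_into UNIV L v) = v"
proof -
  obtain M where M: "lin3 L \<and> lin3 M \<and> (\<forall>v. M (L v) = v) \<and> (\<forall>v. L (M v) = v)"
    using assms unfolding lin_iso_def by (elim exE conjE, intro that conjI)
  then have "inv_into UNIV L = M" by (intro inv_equality) (simp_all del: split_paired_All)
  then show "lin3 L" "lin3 (inv_into UNIV L)" "inv_into UNIV L (L v) = v" "L (inv_into UNIV L v) = v"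
    using M by (simp_all del: split_paired_All)
qed

lemma lin_iso_lin3: "lin_iso L \<Longrightarrow> lin3 L"
  by (simp add: lin_iso_def)

lemma lin_iso_null:
  assumes "lin_iso L"
  shows "L v = null3 \<longleftrightarrow> v = null3"
proof
  show "v = null3" if "L v = null3"
    using lin_isoD(3)[OF assms, of v] lin3_null[OF lin_isoD(2)[OF assms]] that by simp
  show "L v = null3" if "v = null3" using lin3_null[OF lin_isoD(1)[OF assms]] that by simp
qed

lemma lin3_comp: "lin3 L \<Longrightarrow> lin3 L' \<Longrightarrow> lin3 (\<lambda>v. L (L' v))"
  unfolding lin3_def by (simp del: add3.simps smul3.simps split_paired_All)

lemma lin_iso_comp:
  assumes "lin_iso L" "lin_iso L'"
  shows "lin_iso (\<lambda>v. L (L' v))"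
proof -
  note L = lin_isoD[OF assms(1)] and L' = lin_isoD[OF assms(2)]
  show ?thesis
  proof (rule lin_isoI)
    show "lin3 (\<lambda>v. L (L' v))" using L(1) L'(1) by (rule lin3_comp)
    show "lin3 (\<lambda>v. inv_into UNIV L' (inv_into UNIV L v))" using L'(2) L(2) by (rule lin3_comp)
  qed (simp_all only: L(3,4) L'(3,4))
qed

lemma lin_iso_inv: "lin_iso L \<Longrightarrow> lin_iso (inv_into UNIV L)"
  using lin_isoI[of "inv_into UNIV L" L] lin_isoD[of L] by blast

lemma induced_lin_iso:
  assumes "lin_iso L" "v \<noteq> null3"
  shows "induced L (pt v) = pt (L v)"
  using induced_pt[OF lin_iso_lin3[OF assms(1)] assms(2)] lin_iso_null[OF assms(1), of v] assms(2) by simp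

lemma induced_inverse:
  assumes "lin_iso L" "lin_iso M" "\<And>v. M (L v) = v"
  shows "induced M (induced L p) = p"
proof -
  obtain v where v: "v \<noteq> null3" "p = pt v" by (rule plane_cases)
  have "L v \<noteq> null3" using lin_iso_null[OF assms(1), of v] v(1) by simp
  then show ?thesis using induced_lin_iso[OF assms(1) v(1)] induced_lin_iso[OF assms(2), of "L v"] v(2) assms(3) by simp
qed

lemma bij_induced:
  assumes "lin_iso L"
  shows "bij (induced L)" "inv_into UNIV (induced L) = induced (inv_into UNIV L)"
proof -
  have inv: "induced (inv_into UNIV L) (induced L p) = p" "induced L (induced (inv_into UNIV L) p) = p" for p
    using induced_inverse[OF assms lin_iso_inv[OF assms] lin_isoD(3)[OF assms]]
      induced_inverse[OF lin_iso_inv[OF assms] assms lin_isoD(4)[OF assms]] by auto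
  show "bij (induced L)" by (rule bij_betw_byWitness[of _ "induced (inv_into UNIV L)"]) (auto simp: inv)
  show "inv_into UNIV (induced L) = induced (inv_into UNIV L)" by (rule inv_equality) (simp_all add: inv)
qed

lemma regular_on_induced:
  assumes "lin_iso L" "\<And>p. p \<in> X \<Longrightarrow> f p = induced L p"
  shows "regular_on X f"
  by (rule regular_on_linear[OF lin_iso_lin3[OF assms(1)]])
    (simp_all add: lin_iso_null[OF assms(1)] assms(2) induced_lin_iso[OF assms(1)])

lemma induced_Aut_plane:
  assumes "lin_iso L"
  shows "induced L \<in> Aut_var UNIV"
proof -
  have "regular_on UNIV (induced L)" "regular_on UNIV (induced (inv_into UNIV L))"
    using regular_on_induced assms lin_iso_inv by blast+
  then show ?thesis
    unfolding Aut_var_def Bij_def using bij_induced[OF assms] by (simp add: restrict_UNIV)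
qed

lemma Aut_plane_cases:
  fixes f :: "'k::{alg_closed_field, field_char_0} plane \<Rightarrow> 'k plane"
  assumes "f \<in> Aut_var UNIV"
  obtains L where "lin_iso L" "f = induced L"
proof (rule plane_aut_linear[OF assms])
  fix L M :: "'k vec3 \<Rightarrow> 'k vec3"
  assume L: "lin3 L" "lin3 M" "\<And>v. M (L v) = v" "\<And>v. L (M v) = v"
    and f: "\<And>v. v \<noteq> null3 \<Longrightarrow> f (pt v) = pt (L v)"
  have iso: "lin_iso L" using L by (rule lin_isoI)
  have "f p = induced L p" for p
  proof -
    obtain v where v: "v \<noteq> null3" "p = pt v" by (rule plane_cases)
    show ?thesis unfolding v(2) f[OF v(1)] induced_lin_iso[OF iso v(1)] ..
  qed
  then have "f = induced L" by (rule ext)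
  with iso show thesis by (rule that)
qed

section \<open>The Weierstrass model of the Hesse cubic and the j-invariant\<close>

context hesse_cubic
begin

text \<open>The tangent \<open>x + y + \<lambda> z = 0\<close> at the flex \<open>o\<close> becomes the line at infinity, and \<open>neg\<close>,
  which exchanges \<open>x\<close> and \<open>y\<close>, becomes a change of sign of the second coordinate.\<close>

definition kap :: 'k where "kap = - 3 / (4 * (1 - l ^ 3))"
text \<open>Up to constants, \<open>wA\<close> and \<open>wB\<close> are the Aronhold invariants of
  degrees four and six of the Hesse cubic.\<close>

definition wA :: 'k where "wA = - l * (l ^ 3 + 8) / 3"
definition wB :: 'k where "wB = 2 * (l ^ 6 - 20 * l ^ 3 - 8) / 27"

fun to_w :: "'k vec3 \<Rightarrow> 'k vec3" where
  "to_w (x, y, z) = (z - l\<^sup>2 * (kap * (x + y + l * z)), x - y, kap * (x + y + l * z))"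

fun of_w :: "'k vec3 \<Rightarrow> 'k vec3" where
  "of_w (x, y, z) = ((y + z / kap - l * (x + l\<^sup>2 * z)) / 2, (z / kap - l * (x + l\<^sup>2 * z) - y) / 2, x + l\<^sup>2 * z)"

lemma kap: "kap \<noteq> 0" "4 * kap * (1 - l ^ 3) = - 3"
proof -
  define d where "d = 1 - l ^ 3"
  have "d \<noteq> 0" using l by (simp add: d_def)
  then show "kap \<noteq> 0" "4 * kap * (1 - l ^ 3) = - 3" unfolding kap_def d_def[symmetric] by simp_all
qed

lemma to_w_linear: "lin3 to_w"
  by (auto simp: lin3_def algebra_simps)

lemma of_w_linear: "lin3 of_w"
  by (auto simp: lin3_def algebra_simps add_divide_distrib diff_divide_distrib)

lemma of_w_to_w: "of_w (to_w v) = v"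
  using kap(1) by (cases v) (simp add: field_simps)

lemma to_w_of_w: "to_w (of_w v) = v"
  using kap(1) by (cases v) (simp add: field_simps)

lemma to_w_null: "to_w v = null3 \<longleftrightarrow> v = null3"
proof
  assume "to_w v = null3"
  then have "of_w (to_w v) = null3" using lin3_null[OF of_w_linear] by simp
  then show "v = null3" unfolding of_w_to_w .
qed simp

lemma of_w_null: "of_w v = null3 \<longleftrightarrow> v = null3"
proof
  assume "of_w v = null3"
  then have "to_w (of_w v) = null3" using lin3_null[OF to_w_linear] by simp
  then show "v = null3" unfolding to_w_of_w .
qed simp

text \<open>In the coordinates m = x + y + l z, u = x - y and z, the Hesse form involves u only
  through u^2 m. Shifting z by \<open>l\<^sup>2 * kap\<close> times m removes the term in z^2 m, and
  \<open>kap\<close> adjusts the ratio of u^2 m to z^3.\<close>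

lemma weierstrass_form_to_w: "weierstrass_form wA wB (to_w v) = (4 * kap / 3) * hesse_form l v"
proof -
  obtain x y z where v: "v = (x, y, z)" by (cases v)
  define m u d where "m = x + y + l * z" and "u = x - y" and "d = 1 - l ^ 3"
  have h: "4 * hesse_form l v = m ^ 3 - 6 * l * m\<^sup>2 * z + 9 * l\<^sup>2 * m * z\<^sup>2 + 4 * d * z ^ 3 + 3 * u\<^sup>2 * m"
    unfolding v m_def u_def d_def by (simp add: algebra_simps power2_eq_square power3_eq_cube)
  have kd: "kap * d = - 3 / 4" using kap(2) unfolding d_def by (simp add: field_simps)
  have k1: "(3 * l ^ 4 + wA) * kap = 2 * l"
  proof -
    have "3 * l ^ 4 + wA = - (8 / 3) * l * d"
      unfolding wA_def d_def by (simp add: field_simps power_numeral_reduce)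
    then have "(3 * l ^ 4 + wA) * kap = - (8 / 3) * l * (kap * d)" by (simp add: mult.commute mult.left_commute)
    then show ?thesis unfolding kd by simp
  qed
  have k2: "(wB - wA * l\<^sup>2 - l ^ 6) * kap\<^sup>2 = - 1 / 3"
  proof -
    have "wB - wA * l\<^sup>2 - l ^ 6 = - (16 / 27) * d\<^sup>2"
      unfolding wA_def wB_def d_def by (simp add: field_simps power_numeral_reduce)
    then have "(wB - wA * l\<^sup>2 - l ^ 6) * kap\<^sup>2 = - (16 / 27) * (kap * d)\<^sup>2"
      by (simp add: power_mult_distrib mult.commute mult.left_commute)
    then show ?thesis unfolding kd by (simp add: power2_eq_square)
  qed
  have "weierstrass_form wA wB (to_w v) = u\<^sup>2 * (kap * m) - (z ^ 3 - 3 * l\<^sup>2 * z\<^sup>2 * (kap * m)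
      + ((3 * l ^ 4 + wA) * kap) * (z * m\<^sup>2 * kap) + ((wB - wA * l\<^sup>2 - l ^ 6) * kap\<^sup>2) * (m ^ 3 * kap))"
    unfolding v to_w.simps m_def[symmetric] u_def[symmetric] weierstrass_form.simps
    by (simp add: algebra_simps power_numeral_reduce)
  also have "\<dots> = (kap / 3) * (m ^ 3 - 6 * l * m\<^sup>2 * z + 9 * l\<^sup>2 * m * z\<^sup>2 + 3 * u\<^sup>2 * m) - z ^ 3"
    unfolding k1 k2 by (simp add: field_simps power2_eq_square)
  also have "z ^ 3 = - (4 / 3) * (kap * d) * z ^ 3" unfolding kd by simp
  also have "(kap / 3) * (m ^ 3 - 6 * l * m\<^sup>2 * z + 9 * l\<^sup>2 * m * z\<^sup>2 + 3 * u\<^sup>2 * m) - - (4 / 3) * (kap * d) * z ^ 3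
    = (kap / 3) * (4 * hesse_form l v)"
    unfolding h by (simp add: field_simps)
  finally show ?thesis by simp
qed

lemma weierstrass_form_to_w_0: "weierstrass_form wA wB (to_w v) = 0 \<longleftrightarrow> hesse_form l v = 0"
  using kap(1) by (simp add: weierstrass_form_to_w)

lemma wAB_discriminant: "4 * wA ^ 3 + 27 * wB\<^sup>2 = (256 / 27) * (1 - l ^ 3) ^ 3"
proof -
  define L where "L = l ^ 3"
  have "l ^ 6 = L\<^sup>2" unfolding L_def by (simp add: power_mult[symmetric])
  moreover have "wA ^ 3 = - L * (L + 8) ^ 3 / 27" unfolding wA_def L_def by (simp add: power_mult_distrib power_divide)
  ultimately have "4 * wA ^ 3 + 27 * wB\<^sup>2 = 4 * (- L * (L + 8) ^ 3 / 27) + 27 * (2 * (L\<^sup>2 - 20 * L - 8) / 27)\<^sup>2"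
    unfolding wB_def L_def by (simp only:)
  also have "\<dots> = (256 / 27) * (1 - L) ^ 3"
    by (simp add: field_simps power_numeral_reduce)
  finally show ?thesis unfolding L_def .
qed

lemma wAB_nonsingular: "4 * wA ^ 3 + 27 * wB\<^sup>2 \<noteq> 0"
  using l unfolding wAB_discriminant by simp

lemma to_w_iso: "lin_iso to_w"
  using to_w_linear of_w_linear of_w_to_w to_w_of_w by (rule lin_isoI)

lemma hesse_form_of_w_0: "hesse_form l (of_w v) = 0 \<longleftrightarrow> weierstrass_form wA wB v = 0"
  using weierstrass_form_to_w_0[of "of_w v"] unfolding to_w_of_w by simp

text \<open>The pulled back form vanishes on the curve and so is a multiple of the original one. The
  factor is nonzero because the form does not vanish at (1, 0, 0), which is a value of
  \<open>L\<close>.\<close>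

lemma preserves_hesse_form:
  assumes L: "lin_iso L" and pres: "\<And>v. on_hesse l v \<Longrightarrow> on_hesse l (L v)"
  obtains k where "k \<noteq> 0" "\<And>v. hesse_form l (L v) = k * hesse_form l v"
proof -
  note M = lin_isoD(4)[OF L]
  have "lin3 (\<lambda>v. L (of_w v))" using lin_isoD(1)[OF L] of_w_linear by (rule lin3_comp)
  then have "cubic_form (\<lambda>v. hesse_form l (L (of_w v)))" by (rule cubic_form_hesse)
  moreover have "hesse_form l (L (of_w v)) = 0" if "v \<noteq> null3" "weierstrass_form wA wB v = 0" for v
  proof -
    have "on_hesse l (of_w v)" using that by (simp add: on_hesse_def of_w_null hesse_form_of_w_0)
    then show ?thesis using pres on_hesse_def by blast
  qed
  ultimately obtain c where c: "\<And>v. hesse_form l (L (of_w v)) = c * weierstrass_form wA wB v"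
    using cubic_form_vanishing_on_weierstrass[of "\<lambda>v. hesse_form l (L (of_w v))" wA wB] by blast
  have k: "hesse_form l (L v) = (c * (4 * kap / 3)) * hesse_form l v" for v
    using c[of "to_w v"] unfolding of_w_to_w weierstrass_form_to_w by simp
  have "c * (4 * kap / 3) \<noteq> 0"
  proof
    assume *: "c * (4 * kap / 3) = 0"
    have "hesse_form l (L (inv_into UNIV L (1, 0, 0))) = 0" unfolding k * by simp
    then show False unfolding M by simp
  qed
  then show ?thesis using that k by blast
qed

text \<open>Stated for a general target \<open>to_w'\<close> to serve twice: with
  \<open>to_w\<close> it describes maps fixing the origin, with the identity it compares two
  Weierstrass models.\<close>

lemma to_w_conjugate_diagonal:
  assumes L: "lin_iso L" and k: "k \<noteq> 0" "\<And>v. weierstrass_form a b (to_w' (L v)) = k * hesse_form l v"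
    and to_w': "lin3 to_w'" and o: "to_w' (L (1, -1, 0)) = (0, n, 0)" "n \<noteq> 0"
  shows "\<exists>\<alpha> \<gamma> c m. (\<forall>v X Y Z. to_w v = (X, Y, Z) \<longrightarrow> to_w' (L v) = (\<alpha> * X, m * Y, \<gamma> * Z)) \<and>
    c \<noteq> 0 \<and> m \<noteq> 0 \<and> m\<^sup>2 * \<gamma> = c \<and> \<alpha> ^ 3 = c \<and> a * \<alpha> * \<gamma>\<^sup>2 = c * wA \<and> b * \<gamma> ^ 3 = c * wB"
proof -
  have lin: "lin3 (\<lambda>v. to_w' (L (of_w v)))"
    using lin3_comp[OF to_w' lin3_comp[OF lin_iso_lin3[OF L] of_w_linear]] .
  have "of_w (0, 1, 0) = smul3 (1 / 2) (1, -1, 0)" by simp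
  then have "to_w' (L (of_w (0, 1, 0))) = smul3 (1 / 2) (to_w' (L (1, -1, 0)))"
    by (simp only: lin3_smul[OF lin_iso_lin3[OF L]] lin3_smul[OF to_w'])
  then have o': "to_w' (L (of_w (0, 1, 0))) = (0, n / 2, 0)" unfolding o(1) by simp
  define q where "q = 4 * kap / 3"
  define c where "c = k / q"
  have q: "q \<noteq> 0" using kap(1) by (simp add: q_def)
  have c: "c \<noteq> 0" using k(1) q by (simp add: c_def)
  have "weierstrass_form wA wB v = q * hesse_form l (of_w v)" for v
    using weierstrass_form_to_w[of "of_w v"] unfolding to_w_of_w q_def .
  then have eq: "weierstrass_form a b (to_w' (L (of_w v))) = c * weierstrass_form wA wB v" for v
    using q unfolding k(2) c_def by simp
  have n2: "n / 2 \<noteq> 0" using o(2) by simp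
  obtain \<alpha> \<gamma> where *: "\<And>x y z. to_w' (L (of_w (x, y, z))) = (\<alpha> * x, n / 2 * y, \<gamma> * z)"
    "(n / 2)\<^sup>2 * \<gamma> = c" "\<alpha> ^ 3 = c" "a * \<alpha> * \<gamma>\<^sup>2 = c * wA" "b * \<gamma> ^ 3 = c * wB"
    using weierstrass_form_linear_pullback[OF lin o' n2 c eq] by (elim exE conjE) (rule that, simp_all)
  have "to_w' (L v) = (\<alpha> * X, n / 2 * Y, \<gamma> * Z)" if "to_w v = (X, Y, Z)" for v X Y Z
    using *(1)[of X Y Z] unfolding that[symmetric] of_w_to_w .
  then show ?thesis
    using c n2 *(2-5)
    by (intro exI[of _ \<alpha>] exI[of _ \<gamma>] exI[of _ c] exI[of _ "n / 2"]) (simp del: to_w.simps split_paired_All)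
qed

text \<open>Here the three cases of the theorem separate. If \<open>wA\<close> and \<open>wB\<close>
  are nonzero, then \<alpha> = 1 and \<beta> is 1 or -1; if \<open>wA = 0\<close>, then \<alpha>^3 =
  1 and \<beta>^2 = 1; if \<open>wB = 0\<close>, then \<alpha> = \<beta>^2 and \<beta>^4 =
  1.\<close>

lemma stabilizer_diagonal:
  assumes L: "lin_iso L" and pres: "\<And>v. on_hesse l v \<Longrightarrow> on_hesse l (L v)" and o: "pt (L (1, -1, 0)) = origin"
  obtains \<alpha> \<beta> \<gamma> where "\<gamma> \<noteq> 0" "\<And>v X Y Z. to_w v = (X, Y, Z) \<Longrightarrow> to_w (L v) = smul3 \<gamma> (\<alpha> * X, \<beta> * Y, Z)"
    "\<alpha> ^ 3 = \<beta>\<^sup>2" "wA * \<alpha> = \<beta>\<^sup>2 * wA" "wB = \<beta>\<^sup>2 * wB" "\<beta> \<noteq> 0"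
proof -
  obtain k where k: "k \<noteq> 0" "\<And>v. hesse_form l (L v) = k * hesse_form l v"
    using preserves_hesse_form[OF L pres] by blast
  have Lo: "L (1, -1, 0) \<noteq> null3" using lin_iso_null[OF L] by simp
  obtain t where t: "t \<noteq> 0" "L (1, -1, 0) = smul3 t (1, -1, 0)"
    using o pt_eq_iff[of "(1, -1, 0)" "L (1, -1, 0)"] Lo unfolding origin_def by auto
  have wo: "to_w (L (1, -1, 0)) = (0, 2 * t, 0)" unfolding t(2) by simp
  have eq: "weierstrass_form wA wB (to_w (L v)) = (4 * kap / 3 * k) * hesse_form l v" for v
    unfolding weierstrass_form_to_w k(2) by simp
  have K0: "4 * kap / 3 * k \<noteq> 0" and t2: "2 * t \<noteq> 0" using k(1) kap(1) t(1) by simp_all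
  obtain \<alpha> \<gamma> c m where *: "\<And>v X Y Z. to_w v = (X, Y, Z) \<Longrightarrow> to_w (L v) = (\<alpha> * X, m * Y, \<gamma> * Z)"
    "c \<noteq> 0" "m \<noteq> 0" "m\<^sup>2 * \<gamma> = c" "\<alpha> ^ 3 = c" "wA * \<alpha> * \<gamma>\<^sup>2 = c * wA" "wB * \<gamma> ^ 3 = c * wB"
    using to_w_conjugate_diagonal[OF L K0 eq to_w_linear wo t2]
    by (elim exE conjE) (rule that, simp_all del: to_w.simps split_paired_All)
  have \<gamma>: "\<gamma> \<noteq> 0" using *(2,4) by auto
  have b2: "(m / \<gamma>)\<^sup>2 = c / \<gamma> ^ 3" using \<gamma> *(4) by (simp add: power_divide field_simps power2_eq_square power3_eq_cube)
  show ?thesis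
  proof (rule that[OF \<gamma>, of "\<alpha> / \<gamma>" "m / \<gamma>"])
    show "to_w (L v) = smul3 \<gamma> (\<alpha> / \<gamma> * X, m / \<gamma> * Y, Z)" if "to_w v = (X, Y, Z)" for v X Y Z
      using *(1)[OF that] \<gamma> by simp
    show "(\<alpha> / \<gamma>) ^ 3 = (m / \<gamma>)\<^sup>2" unfolding b2 using *(5) by (simp add: power_divide)
    show "wA * (\<alpha> / \<gamma>) = (m / \<gamma>)\<^sup>2 * wA"
      unfolding b2 using *(6) \<gamma> by (simp add: field_simps power2_eq_square power3_eq_cube)
    show "wB = (m / \<gamma>)\<^sup>2 * wB"
      unfolding b2 using *(7) \<gamma> by (simp add: field_simps)
    show "m / \<gamma> \<noteq> 0" using *(3) \<gamma> by simp
  qed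
qed

text \<open>Two Weierstrass models of the same pointed curve differ by a diagonal substitution,
  which multiplies the cube of the first coefficient and the square of the second by a common
  factor.\<close>

lemma j_invariant_hesse: "j_invariant E origin = 12 ^ 3 * (4 * wA ^ 3) / (4 * wA ^ 3 + 27 * wB\<^sup>2)"
  unfolding j_invariant_def
proof (rule the_equality)
  have img: "induced to_w ` E = weierstrass_curve wA wB"
  proof
    show "induced to_w ` E \<subseteq> weierstrass_curve wA wB"
    proof
      fix q assume "q \<in> induced to_w ` E"
      then obtain p where "p \<in> E" "q = induced to_w p" by blast
      then obtain v where "on_hesse l v" "q = induced to_w (pt v)" using hesse_curve_cases by metis
      then show "q \<in> weierstrass_curve wA wB"
        using weierstrass_curve_pt[of "to_w v" wA wB] induced_lin_iso[OF to_w_iso, of v]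
        by (simp add: on_hesse_def to_w_null weierstrass_form_to_w_0 del: to_w.simps)
    qed
    show "weierstrass_curve wA wB \<subseteq> induced to_w ` E"
    proof
      fix q assume q: "q \<in> weierstrass_curve wA wB"
      obtain v where v: "v \<noteq> null3" "q = pt v" by (rule plane_cases)
      then have "on_hesse l (of_w v)"
        using weierstrass_curve_pt[of v wA wB] q by (simp add: on_hesse_def of_w_null hesse_form_of_w_0 del: of_w.simps)
      moreover have "q = induced to_w (pt (of_w v))"
        using induced_lin_iso[OF to_w_iso, of "of_w v"] v by (simp add: of_w_null to_w_of_w del: to_w.simps of_w.simps)
      ultimately show "q \<in> induced to_w ` E" using hesse_curve_pt[of "of_w v" l] on_hesse_def by blast
    qed
  qed
  have "induced to_w origin = pt (0, 1, 0)"
    using induced_lin_iso[OF to_w_iso, of "(1, -1, 0)"] pt_smul[of "(0, 1, 0)" "2 :: 'k"]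
    by (simp add: origin_def)
  then show "\<exists>a b. 4 * a ^ 3 + 27 * b ^ 2 \<noteq> 0 \<and>
     (\<exists>\<phi> \<in> Aut_var UNIV. \<phi> ` E = weierstrass_curve a b \<and> \<phi> origin = pt (0, 1, 0)) \<and>
     12 ^ 3 * (4 * wA ^ 3) / (4 * wA ^ 3 + 27 * wB\<^sup>2) = 12 ^ 3 * (4 * a ^ 3) / (4 * a ^ 3 + 27 * b ^ 2)"
    using img wAB_nonsingular induced_Aut_plane[OF to_w_iso]
    by (intro exI[of _ wA] exI[of _ wB] conjI bexI[of _ "induced to_w"] refl)
next
  fix j
  assume "\<exists>a b. 4 * a ^ 3 + 27 * b ^ 2 \<noteq> 0 \<and>
     (\<exists>\<phi> \<in> Aut_var UNIV. \<phi> ` E = weierstrass_curve a b \<and> \<phi> origin = pt (0, 1, 0)) \<and>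
     j = 12 ^ 3 * (4 * a ^ 3) / (4 * a ^ 3 + 27 * b ^ 2)"
  then obtain a b \<phi> where ab: "4 * a ^ 3 + 27 * b ^ 2 \<noteq> 0" and \<phi>: "\<phi> \<in> Aut_var UNIV" "\<phi> ` E = weierstrass_curve a b"
    "\<phi> origin = pt (0, 1, 0)" and j: "j = 12 ^ 3 * (4 * a ^ 3) / (4 * a ^ 3 + 27 * b ^ 2)"
    by blast
  obtain L where L: "lin_iso L" "\<phi> = induced L" using \<phi>(1) by (rule Aut_plane_cases)
  note M = lin_isoD(4)[OF L(1)]
  have "pt (L (1, -1, 0)) = pt (0, 1, 0)"
    using \<phi>(3) induced_lin_iso[OF L(1), of "(1, -1, 0)"] by (simp add: L(2) origin_def)
  moreover have "L (1, -1, 0) \<noteq> null3" using lin_iso_null[OF L(1)] by simp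
  ultimately obtain t where t: "t \<noteq> 0" "L (1, -1, 0) = (0, t, 0)"
    using pt_eq_iff[of "(0, 1, 0)" "L (1, -1, 0)"] by auto
  have van: "weierstrass_form a b (L (of_w v)) = 0" if "v \<noteq> null3" "weierstrass_form wA wB v = 0" for v
  proof -
    have on: "of_w v \<noteq> null3" "on_hesse l (of_w v)" using that by (simp_all add: on_hesse_def of_w_null hesse_form_of_w_0 del: of_w.simps)
    then have "\<phi> (pt (of_w v)) \<in> weierstrass_curve a b" using \<phi>(2) hesse_curve_pt[of "of_w v" l] by blast
    then show ?thesis
      using induced_lin_iso[OF L(1) on(1)] lin_iso_null[OF L(1), of "of_w v"] on(1) weierstrass_curve_pt[of "L (of_w v)" a b]
      by (simp add: L(2) del: of_w.simps)
  qed
  have "lin3 (\<lambda>v. L (of_w v))" using lin_isoD(1)[OF L(1)] of_w_linear by (rule lin3_comp)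
  then have "cubic_form (\<lambda>v. weierstrass_form a b (L (of_w v)))" by (rule cubic_form_weierstrass)
  then obtain c where c: "\<And>v. weierstrass_form a b (L (of_w v)) = c * weierstrass_form wA wB v"
    using cubic_form_vanishing_on_weierstrass[of "\<lambda>v. weierstrass_form a b (L (of_w v))" wA wB] van by blast
  have k: "weierstrass_form a b (L v) = (c * (4 * kap / 3)) * hesse_form l v" for v
    using c[of "to_w v"] unfolding of_w_to_w weierstrass_form_to_w by simp
  have k0: "c * (4 * kap / 3) \<noteq> 0"
  proof
    assume *: "c * (4 * kap / 3) = 0"
    have "weierstrass_form a b (L (inv_into UNIV L (1, 0, 0))) = 0" unfolding k * by simp
    then show False unfolding M by simp
  qed
  have id: "lin3 (\<lambda>v :: 'k vec3. v)" by (simp add: lin3_def)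
  obtain \<alpha> \<gamma> d m where *: "d \<noteq> 0" "m\<^sup>2 * \<gamma> = d" "\<alpha> ^ 3 = d" "a * \<alpha> * \<gamma>\<^sup>2 = d * wA" "b * \<gamma> ^ 3 = d * wB"
    using to_w_conjugate_diagonal[of L _ a b "\<lambda>v. v", OF L(1) k0 k id t(2,1)]
    by (elim exE conjE) (rule that)
  have \<gamma>: "\<gamma> \<noteq> 0" using *(1,2) by auto
  have "(a * \<alpha> * \<gamma>\<^sup>2) ^ 3 = a ^ 3 * d * \<gamma> ^ 6"
    unfolding *(3)[symmetric] by (simp add: power_mult_distrib power_mult[symmetric])
  then have "a ^ 3 * d * \<gamma> ^ 6 = (d * wA) ^ 3" unfolding *(4) by (rule sym)
  moreover have "a ^ 3 * d * \<gamma> ^ 6 = d * (a ^ 3 * \<gamma> ^ 6)" by (simp only: ac_simps)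
  moreover have "(d * wA) ^ 3 = d * (d\<^sup>2 * wA ^ 3)"
    by (simp add: power_mult_distrib power2_eq_square power3_eq_cube)
  ultimately have "d * (a ^ 3 * \<gamma> ^ 6) = d * (d\<^sup>2 * wA ^ 3)" by (simp only:)
  then have a3: "a ^ 3 * \<gamma> ^ 6 = d\<^sup>2 * wA ^ 3" using *(1) by simp
  have "(b * \<gamma> ^ 3)\<^sup>2 = b\<^sup>2 * \<gamma> ^ 6"
    by (simp add: power_mult_distrib power_mult[symmetric])
  then have b2: "b\<^sup>2 * \<gamma> ^ 6 = d\<^sup>2 * wB\<^sup>2" unfolding *(5) by (simp add: power_mult_distrib)
  have "j = (12 ^ 3 * (4 * a ^ 3) * \<gamma> ^ 6) / ((4 * a ^ 3 + 27 * b ^ 2) * \<gamma> ^ 6)"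
    unfolding j using \<gamma> by (subst mult_divide_mult_cancel_right) simp_all
  also have "\<dots> = (12 ^ 3 * 4 * (a ^ 3 * \<gamma> ^ 6)) / (4 * (a ^ 3 * \<gamma> ^ 6) + 27 * (b\<^sup>2 * \<gamma> ^ 6))"
    by (simp only: distrib_right mult.assoc)
  also have "\<dots> = (12 ^ 3 * (4 * wA ^ 3) * d\<^sup>2) / ((4 * wA ^ 3 + 27 * wB\<^sup>2) * d\<^sup>2)"
    unfolding a3 b2 by (simp add: algebra_simps)
  also have "\<dots> = 12 ^ 3 * (4 * wA ^ 3) / (4 * wA ^ 3 + 27 * wB\<^sup>2)"
    using *(1) by (subst mult_divide_mult_cancel_right) simp_all
  finally show "j = 12 ^ 3 * (4 * wA ^ 3) / (4 * wA ^ 3 + 27 * wB\<^sup>2)" .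
qed

end

section \<open>Linear automorphisms of the curve\<close>

text \<open>\<open>(h s)\<^sup>i s\<^sup>-\<^sup>i\<close> is a product of conjugates of \<open>h\<close> by powers of \<open>s\<close>.\<close>

lemma (in group) int_pow_twisted_mem:
  assumes N: "subgroup N G" and s: "s \<in> carrier G"
    and conj: "\<And>h. h \<in> N \<Longrightarrow> s \<otimes> h \<otimes> inv s \<in> N" "\<And>h. h \<in> N \<Longrightarrow> inv s \<otimes> h \<otimes> s \<in> N"
    and h: "h \<in> N"
  shows "(h \<otimes> s) [^] (i::int) \<otimes> s [^] (- i) \<in> N"
proof -
  have NG: "x \<in> carrier G" if "x \<in> N" for x using subgroup.mem_carrier[OF N that] .
  have conj_pow: "s [^] n \<otimes> x \<otimes> inv (s [^] n) \<in> N \<and> inv (s [^] n) \<otimes> x \<otimes> s [^] n \<in> N" if "x \<in> N" for x and n :: nat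
    using that
  proof (induction n arbitrary: x)
    case 0
    then show ?case using NG by simp
  next
    case (Suc n)
    have x: "x \<in> carrier G" using Suc.prems NG by blast
    have "s [^] Suc n \<otimes> x \<otimes> inv (s [^] Suc n) = s [^] n \<otimes> (s \<otimes> x \<otimes> inv s) \<otimes> inv (s [^] n)"
      using s x by (simp add: inv_mult_group m_assoc)
    moreover have "inv (s [^] Suc n) \<otimes> x \<otimes> s [^] Suc n = inv s \<otimes> (inv (s [^] n) \<otimes> x \<otimes> s [^] n) \<otimes> s"
      using s x by (simp add: inv_mult_group m_assoc)
    ultimately show ?case
      using Suc.IH[OF conj(1)[OF Suc.prems]] conj(2) Suc.IH[OF Suc.prems] by simp
  qed
  have hG: "h \<in> carrier G" using NG h by blast
  have pow: "(h \<otimes> s) [^] n \<otimes> inv (s [^] n) \<in> N" for n :: nat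
  proof (induction n)
    case 0
    then show ?case using subgroup.one_closed[OF N] by simp
  next
    case (Suc n)
    have "(h \<otimes> s) [^] Suc n \<otimes> inv (s [^] Suc n)
      = ((h \<otimes> s) [^] n \<otimes> inv (s [^] n)) \<otimes> (s [^] n \<otimes> h \<otimes> inv (s [^] n))"
    proof -
      have a: "(h \<otimes> s) [^] n \<in> carrier G" "s [^] n \<in> carrier G" using s hG by simp_all
      have "inv (s [^] n) \<otimes> (s [^] n \<otimes> (h \<otimes> inv (s [^] n))) = h \<otimes> inv (s [^] n)"
        using a hG by (simp add: m_assoc[symmetric])
      moreover have "s \<otimes> (inv s \<otimes> inv (s [^] n)) = inv (s [^] n)"
        using a s by (simp add: m_assoc[symmetric])
      ultimately show ?thesis using s hG a by (simp add: inv_mult_group m_assoc)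
    qed
    then show ?case using subgroup.m_closed[OF N Suc.IH] conj_pow[OF h, of n] by simp
  qed
  show ?thesis
  proof (cases i)
    case (nonneg n)
    then show ?thesis using pow[of n] s by (simp add: int_pow_neg int_pow_int)
  next
    case (neg n)
    have a: "(h \<otimes> s) [^] Suc n \<in> carrier G" "s [^] Suc n \<in> carrier G" using s hG by (simp_all del: nat_pow_Suc)
    \<comment> \<open>For negative exponents the inverse of the positive product is conjugated back
      by the power of \<open>s\<close>.\<close>
    have "inv ((h \<otimes> s) [^] Suc n \<otimes> inv (s [^] Suc n)) \<in> N"
      using subgroup.m_inv_closed[OF N pow] .
    then have "s [^] Suc n \<otimes> inv ((h \<otimes> s) [^] Suc n) \<in> N"
      using a by (simp add: inv_mult_group del: nat_pow_Suc)
    from conj_pow[OF this, of "Suc n"]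
    have "inv (s [^] Suc n) \<otimes> (s [^] Suc n \<otimes> inv ((h \<otimes> s) [^] Suc n)) \<otimes> s [^] Suc n \<in> N" by blast
    moreover have "inv (s [^] Suc n) \<otimes> (s [^] Suc n \<otimes> inv ((h \<otimes> s) [^] Suc n)) \<otimes> s [^] Suc n
      = inv ((h \<otimes> s) [^] Suc n) \<otimes> s [^] Suc n"
      using a by (simp add: m_assoc[symmetric] del: nat_pow_Suc)
    moreover have "(h \<otimes> s) [^] i = inv ((h \<otimes> s) [^] Suc n)" "s [^] (- i) = s [^] Suc n"
      using neg s hG by (simp_all add: int_pow_neg int_pow_int del: nat_pow_Suc of_nat_Suc)
    ultimately show ?thesis by (simp del: nat_pow_Suc)
  qed
qed

section \<open>Bijections of the curve\<close>

lemma BijGroup_mult: "f \<in> Bij S \<Longrightarrow> g \<in> Bij S \<Longrightarrow> f \<otimes>\<^bsub>BijGroup S\<^esub> g = compose S f g"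
  by (simp add: BijGroup_def)

lemma BijGroup_carrier: "carrier (BijGroup S) = Bij S"
  by (simp add: BijGroup_def)

lemma BijGroup_one: "\<one>\<^bsub>BijGroup S\<^esub> = (\<lambda>x\<in>S. x)"
  by (simp add: BijGroup_def)

lemma BijGroup_apply:
  "f \<in> Bij S \<Longrightarrow> g \<in> Bij S \<Longrightarrow> q \<in> S \<Longrightarrow> (f \<otimes>\<^bsub>BijGroup S\<^esub> g) q = f (g q)"
  by (simp add: BijGroup_mult compose_eq)

lemma Bij_mem: "f \<in> Bij S \<Longrightarrow> q \<in> S \<Longrightarrow> f q \<in> S"
  using Bij_imp_funcset by blast

lemma Bij_eqI: "f \<in> Bij S \<Longrightarrow> g \<in> Bij S \<Longrightarrow> (\<And>q. q \<in> S \<Longrightarrow> f q = g q) \<Longrightarrow> f = g"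
  using Bij_imp_extensional extensionalityI by blast

lemma Bij_mult_closed: "f \<in> Bij S \<Longrightarrow> g \<in> Bij S \<Longrightarrow> f \<otimes>\<^bsub>BijGroup S\<^esub> g \<in> Bij S"
  using compose_Bij BijGroup_mult by metis

lemma Bij_witness:
  assumes "\<And>q. q \<in> S \<Longrightarrow> f q \<in> S" "\<And>q. q \<in> S \<Longrightarrow> g q \<in> S" "\<And>q. q \<in> S \<Longrightarrow> g (f q) = q" "\<And>q. q \<in> S \<Longrightarrow> f (g q) = q"
  shows "restrict f S \<in> Bij S" "restrict (inv_into S (restrict f S)) S = restrict g S"
proof -
  have bij: "bij_betw (restrict f S) S S"
    by (rule bij_betw_byWitness[of _ g]) (use assms in auto)
  then show "restrict f S \<in> Bij S" by (simp add: Bij_def)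
  have "inv_into S (restrict f S) q = g q" if "q \<in> S" for q
    by (rule inv_into_f_eq) (use bij that assms in \<open>auto simp: bij_betw_def\<close>)
  then show "restrict (inv_into S (restrict f S)) S = restrict g S" by auto
qed

lemma Bij_inv_witness:
  assumes "\<And>q. q \<in> S \<Longrightarrow> f q \<in> S" "\<And>q. q \<in> S \<Longrightarrow> g q \<in> S" "\<And>q. q \<in> S \<Longrightarrow> g (f q) = q" "\<And>q. q \<in> S \<Longrightarrow> f (g q) = q"
  shows "inv\<^bsub>BijGroup S\<^esub> (restrict f S) = restrict g S"
  using inv_BijGroup[OF Bij_witness(1)[OF assms]] Bij_witness(2)[OF assms] by simp

context hesse_cubic
begin

abbreviation "G \<equiv> BijGroup E"

sublocale G: group G
  by (rule group_BijGroup)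

abbreviation tr :: "'k plane \<Rightarrow> 'k plane \<Rightarrow> 'k plane" where
  "tr \<equiv> translation l"

lemma tr_def: "tr p = restrict (\<lambda>q. p \<oplus>\<^sub>E q) E"
  by (simp add: translation_def mult_ec_group)

lemma tr_apply: "q \<in> E \<Longrightarrow> tr p q = p \<oplus>\<^sub>E q"
  by (simp add: tr_def)

lemma neg_add_cancel: "p \<in> E \<Longrightarrow> q \<in> E \<Longrightarrow> neg p \<oplus>\<^sub>E (p \<oplus>\<^sub>E q) = q" "p \<in> E \<Longrightarrow> q \<in> E \<Longrightarrow> p \<oplus>\<^sub>E (neg p \<oplus>\<^sub>E q) = q"
proof -
  assume pq: "p \<in> E" "q \<in> E"
  show "neg p \<oplus>\<^sub>E (p \<oplus>\<^sub>E q) = q"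
    using add_neg_cancel[OF pq(2,1)] add_commute[of "neg p" "p \<oplus>\<^sub>E q"] add_commute[OF pq]
    by (simp add: pq add_closed neg_closed)
  show "p \<oplus>\<^sub>E (neg p \<oplus>\<^sub>E q) = q"
    using add_neg_cancel'[OF pq(2,1)] add_commute[of p "neg p \<oplus>\<^sub>E q"] add_commute[of "neg p" q]
    by (simp add: pq add_closed neg_closed)
qed

lemma tr_Bij: "p \<in> E \<Longrightarrow> tr p \<in> Bij E"
  unfolding tr_def by (rule Bij_witness(1)[of _ _ "\<lambda>q. neg p \<oplus>\<^sub>E q"]) (simp_all add: add_closed neg_closed neg_add_cancel)

lemma tr_inv: "p \<in> E \<Longrightarrow> inv\<^bsub>G\<^esub> (tr p) = tr (neg p)"
  unfolding tr_def by (rule Bij_inv_witness) (simp_all add: add_closed neg_closed neg_add_cancel)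

lemma tr_origin: "tr origin = \<one>\<^bsub>G\<^esub>"
  by (rule Bij_eqI[of _ E]) (simp_all add: tr_Bij origin_in BijGroup_one id_Bij tr_apply add_origin)

text \<open>The equivalence, rather than one implication, makes the class visibly closed under
  inverses.\<close>

definition hesse_iso :: "('k vec3 \<Rightarrow> 'k vec3) \<Rightarrow> bool" where
  "hesse_iso L \<longleftrightarrow> lin_iso L \<and> (\<forall>v. on_hesse l (L v) \<longleftrightarrow> on_hesse l v)"

lemma hesse_isoI:
  assumes "lin_iso L" "k \<noteq> 0" "\<And>v. hesse_form l (L v) = k * hesse_form l v"
  shows "hesse_iso L"
  using assms lin_iso_null[OF assms(1)] unfolding hesse_iso_def on_hesse_def by auto

lemma hesse_isoD: "hesse_iso L \<Longrightarrow> lin_iso L" "hesse_iso L \<Longrightarrow> on_hesse l (L v) \<longleftrightarrow> on_hesse l v"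
  unfolding hesse_iso_def by blast+

lemma hesse_iso_inv: "hesse_iso L \<Longrightarrow> hesse_iso (inv_into UNIV L)"
  unfolding hesse_iso_def using lin_iso_inv[of L] lin_isoD(4)[of L] by metis

lemma hesse_iso_comp: "hesse_iso L \<Longrightarrow> hesse_iso L' \<Longrightarrow> hesse_iso (\<lambda>v. L (L' v))"
  unfolding hesse_iso_def using lin_iso_comp[of L L'] by blast

lemma transl_lin_hesse_iso: "transl_lin L \<Longrightarrow> hesse_iso L"
  using hesse_isoI[of L] unfolding transl_lin_def lin_iso_def by blast

lemma induced_hesse_iso:
  assumes "hesse_iso L" "on_hesse l v"
  shows "induced L (pt v) = pt (L v)"
  using induced_lin_iso[OF hesse_isoD(1)[OF assms(1)], of v] assms(2) unfolding on_hesse_def by blast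

lemma pt_in_E: "on_hesse l v \<Longrightarrow> pt v \<in> E"
  using hesse_curve_pt[of v l] unfolding on_hesse_def by blast

lemma induced_E:
  assumes "hesse_iso L" "q \<in> E"
  shows "induced L q \<in> E"
proof -
  obtain v where v: "on_hesse l v" "q = pt v" using assms(2) by (rule hesse_curve_cases)
  then show ?thesis using induced_hesse_iso[OF assms(1) v(1)] hesse_isoD(2)[OF assms(1)] pt_in_E by simp
qed

lemma induced_inv:
  assumes "hesse_iso L"
  shows "induced (inv_into UNIV L) (induced L q) = q" "induced L (induced (inv_into UNIV L) q) = q"
  using induced_inverse[OF hesse_isoD(1)[OF assms] hesse_isoD(1)[OF hesse_iso_inv[OF assms]] lin_isoD(3)[OF hesse_isoD(1)[OF assms]]]
    induced_inverse[OF hesse_isoD(1)[OF hesse_iso_inv[OF assms]] hesse_isoD(1)[OF assms] lin_isoD(4)[OF hesse_isoD(1)[OF assms]]]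
  by blast+

section \<open>The group of linear automorphisms and the stabilizer of the origin\<close>

definition lin_auts :: "('k plane \<Rightarrow> 'k plane) set" where
  "lin_auts = {restrict (induced L) E |L. hesse_iso L}"

lemma hesse_iso_Bij:
  assumes "hesse_iso L"
  shows "restrict (induced L) E \<in> Bij E" "inv\<^bsub>G\<^esub> (restrict (induced L) E) = restrict (induced (inv_into UNIV L)) E"
  "restrict (inv_into E (restrict (induced L) E)) E = restrict (induced (inv_into UNIV L)) E"
proof -
  note * = induced_E[OF assms] induced_E[OF hesse_iso_inv[OF assms]] induced_inv[OF assms]
  show "restrict (induced L) E \<in> Bij E"
    by (rule Bij_witness(1)[of _ _ "induced (inv_into UNIV L)"]) (simp_all add: *)
  show "inv\<^bsub>G\<^esub> (restrict (induced L) E) = restrict (induced (inv_into UNIV L)) E" by (rule Bij_inv_witness) (simp_all add: *)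
  show "restrict (inv_into E (restrict (induced L) E)) E = restrict (induced (inv_into UNIV L)) E"
    by (rule Bij_witness(2)) (simp_all add: *)
qed

lemma hesse_iso_Aut_var:
  assumes "hesse_iso L"
  shows "restrict (induced L) E \<in> Aut_var E"
proof -
  have "regular_on E (restrict (induced L) E)"
    by (rule regular_on_induced[OF hesse_isoD(1)[OF assms]]) simp
  moreover have "regular_on E (restrict (induced (inv_into UNIV L)) E)"
    by (rule regular_on_induced[OF hesse_isoD(1)[OF hesse_iso_inv[OF assms]]]) simp
  ultimately show ?thesis unfolding Aut_var_def using hesse_iso_Bij[OF assms] by simp
qed

lemma Aut_down_cases:
  assumes "\<tau> \<in> Aut_down E"
  obtains L where "hesse_iso L" "\<tau> = induced L"
proof -
  have "\<tau> \<in> Aut_var UNIV" and bij: "bij_betw (restrict \<tau> E) E E"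
    using assms unfolding Aut_down_def Aut_var_def[of E] Bij_def by simp_all
  then obtain L where L: "lin_iso L" "\<tau> = induced L" using Aut_plane_cases by blast
  have "on_hesse l (L v) \<longleftrightarrow> on_hesse l v" for v
  proof (cases "v = null3")
    case True
    then show ?thesis using lin_iso_null[OF L(1), of v] by (simp add: on_hesse_def)
  next
    case False
    have Lv: "L v \<noteq> null3" using lin_iso_null[OF L(1), of v] False by simp
    have pt: "\<tau> (pt v) = pt (L v)" using induced_lin_iso[OF L(1) False] L(2) by simp
    show ?thesis
    proof
      assume "on_hesse l v"
      then have "pt v \<in> E" by (rule pt_in_E)
      then have "\<tau> (pt v) \<in> E" using bij_betwE[OF bij] by auto
      then show "on_hesse l (L v)" using pt hesse_curve_pt[OF Lv] by simp
    next
      \<comment> \<open>This direction uses that \<open>\<tau>\<close> maps the curve onto itself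
        and is injective on the whole plane.\<close>
      assume "on_hesse l (L v)"
      then have "pt (L v) \<in> E" by (rule pt_in_E)
      then obtain q where q: "q \<in> E" "pt (L v) = \<tau> q" using bij unfolding bij_betw_def by auto
      obtain w where w: "on_hesse l w" "q = pt w" using q(1) by (rule hesse_curve_cases)
      have "w \<noteq> null3" using w(1) by (simp add: on_hesse_def)
      have "inj \<tau>" using bij_induced(1)[OF L(1)] L(2) by (simp add: bij_is_inj)
      then have "pt v = pt w" using q(2) pt w(2) by (auto dest: injD)
      then show "on_hesse l v" using q(1) w(2) hesse_curve_pt[OF False, of l] by simp
    qed
  qed
  then show ?thesis using that L unfolding hesse_iso_def by blast
qed

lemma induced_Aut_down: "hesse_iso L \<Longrightarrow> induced L \<in> Aut_down E"
  unfolding Aut_down_def using induced_Aut_plane[OF hesse_isoD(1)] hesse_iso_Aut_var by simp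

lemma restr_Aut_down: "restrict \<tau> E \<in> lin_auts" if "\<tau> \<in> Aut_down E"
  using Aut_down_cases[OF that] unfolding lin_auts_def by blast

lemma lin_auts_cases:
  assumes "h \<in> lin_auts"
  obtains L where "hesse_iso L" "h = restrict (induced L) E" "induced L \<in> Aut_down E"
  using assms induced_Aut_down unfolding lin_auts_def by blast

lemma Aut_up_eq: "Aut_up E = lin_auts"
proof
  show "Aut_up E \<subseteq> lin_auts"
  proof
    fix \<tau> assume "\<tau> \<in> Aut_up E"
    then obtain \<tau>' where *: "\<tau>' \<in> Aut_var UNIV" "\<tau> = restrict \<tau>' E" "\<tau> \<in> Aut_var E" unfolding Aut_up_def by blast
    then have "\<tau>' \<in> Aut_down E" unfolding Aut_down_def by simp
    then show "\<tau> \<in> lin_auts" using restr_Aut_down *(2) by simp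
  qed
  show "lin_auts \<subseteq> Aut_up E"
  proof
    fix h assume "h \<in> lin_auts"
    then obtain L where L: "hesse_iso L" "h = restrict (induced L) E" by (rule lin_auts_cases)
    then show "h \<in> Aut_up E"
      unfolding Aut_up_def using hesse_iso_Aut_var[OF L(1)] induced_Aut_plane[OF hesse_isoD(1)[OF L(1)]] by blast
  qed
qed

lemma lin_auts_Bij: "h \<in> lin_auts \<Longrightarrow> h \<in> Bij E"
  using lin_auts_cases hesse_iso_Bij by metis

lemma lin_auts_pt:
  assumes "h \<in> lin_auts"
  obtains L where "hesse_iso L" "\<And>v. on_hesse l v \<Longrightarrow> h (pt v) = pt (L v)"
proof -
  obtain L where L: "hesse_iso L" "h = restrict (induced L) E" using assms by (rule lin_auts_cases)
  have "h (pt v) = pt (L v)" if "on_hesse l v" for v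
    using induced_hesse_iso[OF L(1) that] pt_in_E[OF that] L(2) by simp
  with L(1) show ?thesis by (rule that)
qed

lemma subgroup_lin_auts: "subgroup lin_auts G"
proof (rule G.subgroupI)
  show "lin_auts \<subseteq> carrier G" using lin_auts_Bij by (auto simp: BijGroup_carrier)
  have "lin_iso (\<lambda>v :: 'k vec3. v)" by (rule lin_isoI[of _ "\<lambda>v. v"]) (auto simp: lin3_def)
  then have "hesse_iso (\<lambda>v. v)" unfolding hesse_iso_def by simp
  then show "lin_auts \<noteq> {}" unfolding lin_auts_def by blast
  show "inv\<^bsub>G\<^esub> h \<in> lin_auts" if "h \<in> lin_auts" for h
    using that
  proof (rule lin_auts_cases)
    fix L assume "hesse_iso L" "h = restrict (induced L) E"
    then show ?thesis using hesse_iso_Bij(2) hesse_iso_inv unfolding lin_auts_def by auto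
  qed
  show "h \<otimes>\<^bsub>G\<^esub> h' \<in> lin_auts" if hh: "h \<in> lin_auts" "h' \<in> lin_auts" for h h'
  proof -
    obtain L where L: "hesse_iso L" "\<And>v. on_hesse l v \<Longrightarrow> h (pt v) = pt (L v)" using lin_auts_pt[OF hh(1)] by metis
    obtain L' where L': "hesse_iso L'" "\<And>v. on_hesse l v \<Longrightarrow> h' (pt v) = pt (L' v)" using lin_auts_pt[OF hh(2)] by metis
    have c: "hesse_iso (\<lambda>v. L (L' v))" using L(1) L'(1) by (rule hesse_iso_comp)
    have "h \<otimes>\<^bsub>G\<^esub> h' = restrict (induced (\<lambda>v. L (L' v))) E"
    proof (rule Bij_eqI)
      show "h \<otimes>\<^bsub>G\<^esub> h' \<in> Bij E" by (intro Bij_mult_closed lin_auts_Bij hh)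
      show "restrict (induced (\<lambda>v. L (L' v))) E \<in> Bij E" using hesse_iso_Bij(1)[OF c] .
      fix q assume q: "q \<in> E"
      then obtain v where v: "on_hesse l v" "q = pt v" by (rule hesse_curve_cases)
      have "(h \<otimes>\<^bsub>G\<^esub> h') q = h (h' q)" using hh lin_auts_Bij q by (simp add: BijGroup_apply)
      also have "\<dots> = pt (L (L' v))" using v L' L hesse_isoD(2)[OF L'(1)] by simp
      finally show "(h \<otimes>\<^bsub>G\<^esub> h') q = restrict (induced (\<lambda>v. L (L' v))) E q"
        using induced_hesse_iso[OF c v(1)] q v(2) by simp
    qed
    then show ?thesis using c unfolding lin_auts_def by blast
  qed
qed

text \<open>The equations \<open>tri\<close> are tied to the coordinates, so their invariance is
  inherited from \<open>line_section\<close>, whose definition is compatible with linear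
  maps.\<close>

lemma hesse_iso_tri:
  assumes L: "hesse_iso L" and P: "on_hesse l P" and Q: "on_hesse l Q" and R: "R \<noteq> null3" "tri P Q R"
  shows "tri (L P) (L Q) (L R)"
proof -
  have nz: "P \<noteq> null3" "Q \<noteq> null3" using P Q by (simp_all add: on_hesse_def)
  obtain k where k: "k \<noteq> 0" "\<And>v. hesse_form l (L v) = k * hesse_form l v"
    using preserves_hesse_form[OF hesse_isoD(1)[OF L]] hesse_isoD(2)[OF L] by blast
  obtain R0 where R0: "R0 \<noteq> null3" "line_section l (pt P) (pt Q) (pt R0)"
    using line_section_exists[OF P Q l] by blast
  have "tri P Q R0" using line_section_tri[OF R0(2) nz R0(1)] .
  then have "pt R0 = pt R" using tri_unique[OF P Q l _ R(2) R0(1) R(1)] by blast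
  then have ls: "line_section l (pt P) (pt Q) (pt R)" using R0(2) by simp
  have null: "L v = null3 \<Longrightarrow> v = null3" for v using lin_iso_null[OF hesse_isoD(1)[OF L]] by blast
  have "line_section l (pt (L P)) (pt (L Q)) (pt (L R))"
    using line_section_linear[OF ls nz R(1) lin_iso_lin3[OF hesse_isoD(1)[OF L]] null k] .
  then show ?thesis using line_section_tri[of l "L P" "L Q" "L R"] null nz R(1) by blast
qed

lemma lin_auts_third:
  assumes h: "h \<in> lin_auts" and "p \<in> E" "q \<in> E"
  shows "h (third_point l p q) = third_point l (h p) (h q)" "third_point l p q \<in> E"
proof -
  obtain P where P: "on_hesse l P" "p = pt P" using assms(2) by (rule hesse_curve_cases)
  obtain Q where Q: "on_hesse l Q" "q = pt Q" using assms(3) by (rule hesse_curve_cases)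
  obtain R where R: "on_hesse l R" "tri P Q R" "third_point l (pt P) (pt Q) = pt R"
    using third_point_exists[OF P(1) Q(1) l] by blast
  then show "third_point l p q \<in> E" using P Q pt_in_E by simp
  obtain L where L: "hesse_iso L" "\<And>v. on_hesse l v \<Longrightarrow> h (pt v) = pt (L v)" using lin_auts_pt[OF h] by metis
  have on: "on_hesse l (L P)" "on_hesse l (L Q)" "on_hesse l (L R)" using hesse_isoD(2)[OF L(1)] P Q R by simp_all
  have "tri (L P) (L Q) (L R)" using hesse_iso_tri[OF L(1) P(1) Q(1) _ R(2)] R(1) by (simp add: on_hesse_def)
  then have "third_point l (pt (L P)) (pt (L Q)) = pt (L R)"
    using third_point_eq(1)[OF on(1,2) l, of "L R"] on(3) by (simp add: on_hesse_def)
  then show "h (third_point l p q) = third_point l (h p) (h q)" using L(2) P Q R by simp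
qed

lemma lin_auts_origin: "h \<in> lin_auts \<Longrightarrow> h origin \<in> flexes"
proof -
  assume "h \<in> lin_auts"
  then obtain L where L: "hesse_iso L" "\<And>v. on_hesse l v \<Longrightarrow> h (pt v) = pt (L v)" using lin_auts_pt[of h] by metis
  have on: "on_hesse l (L (1, -1, 0))" using hesse_isoD(2)[OF L(1)] on_hesse_origin by simp
  have "tri (1, -1, 0) (1, -1, 0) ((1, -1, 0) :: 'k vec3)" by simp
  then have "tri (L (1, -1, 0)) (L (1, -1, 0)) (L (1, -1, 0))"
    by (intro hesse_iso_tri[OF L(1) on_hesse_origin on_hesse_origin]) simp_all
  then show ?thesis using flexes_pt[OF on] on L(2)[OF on_hesse_origin] by (simp add: origin_def flex_def)
qed

definition stab :: "('k plane \<Rightarrow> 'k plane) set" where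
  "stab = {h \<in> lin_auts. h origin = origin}"

lemma stab_Bij: "h \<in> stab \<Longrightarrow> h \<in> Bij E"
  using lin_auts_Bij unfolding stab_def by blast

lemma stab_E: "h \<in> stab \<Longrightarrow> q \<in> E \<Longrightarrow> h q \<in> E"
  by (rule Bij_mem[OF stab_Bij])

text \<open>A linear automorphism commutes with \<open>third_point\<close>; fixing the origin, it
  respects both steps of the addition.\<close>

lemma stab_add:
  assumes "h \<in> stab" "p \<in> E" "q \<in> E"
  shows "h (p \<oplus>\<^sub>E q) = h p \<oplus>\<^sub>E h q"
proof -
  have h: "h \<in> lin_auts" "h origin = origin" using assms(1) by (auto simp: stab_def)
  show ?thesis
    unfolding add_def
    using lin_auts_third[OF h(1) assms(2,3)] lin_auts_third(1)[OF h(1) origin_in, of "third_point l p q"] h(2) by simp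
qed

lemma stab_neg:
  assumes "h \<in> stab" "p \<in> E"
  shows "h (neg p) = neg (h p)"
proof -
  have "h (neg p) \<oplus>\<^sub>E h p = h (neg p \<oplus>\<^sub>E p)" using stab_add[OF assms(1) neg_closed[OF assms(2)] assms(2)] by simp
  also have "\<dots> = origin" using add_neg_self(2)[OF assms(2)] assms(1) by (simp add: stab_def)
  finally show ?thesis using add_eq_origin_iff stab_E[OF assms(1)] assms(2) neg_closed by simp
qed

lemma stab_flexes:
  assumes "h \<in> stab" "t \<in> flexes"
  shows "h t \<in> flexes"
proof -
  have t: "t \<in> E" "t \<oplus>\<^sub>E t = neg t" using assms(2) by (simp_all add: flexes_def)
  have "h t \<oplus>\<^sub>E h t = neg (h t)" using stab_add[OF assms(1) t(1) t(1)] stab_neg[OF assms(1) t(1)] t(2) by simp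
  then show ?thesis using stab_E[OF assms(1) t(1)] by (simp add: flexes_def)
qed

lemma subgroup_stab: "subgroup stab G"
proof (rule G.subgroupI)
  note sub = subgroup_lin_auts
  show "stab \<subseteq> carrier G" using stab_Bij by (auto simp: BijGroup_carrier)
  have "\<one>\<^bsub>G\<^esub> \<in> stab" using subgroup.one_closed[OF sub] by (simp add: stab_def BijGroup_one origin_in)
  then show "stab \<noteq> {}" by blast
  show "inv\<^bsub>G\<^esub> h \<in> stab" if h: "h \<in> stab" for h
  proof -
    have B: "h \<in> carrier G" "inv\<^bsub>G\<^esub> h \<in> carrier G" using stab_Bij[OF h] by (simp_all add: BijGroup_carrier[symmetric])
    have "(inv\<^bsub>G\<^esub> h \<otimes>\<^bsub>G\<^esub> h) origin = origin" using B by (simp add: BijGroup_one origin_in)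
    then have "(inv\<^bsub>G\<^esub> h) origin = origin"
      using B h BijGroup_apply[of "inv\<^bsub>G\<^esub> h" E h origin] by (simp add: BijGroup_carrier origin_in stab_def)
    then show ?thesis using subgroup.m_inv_closed[OF sub] h by (simp add: stab_def)
  qed
  show "h \<otimes>\<^bsub>G\<^esub> h' \<in> stab" if h: "h \<in> stab" "h' \<in> stab" for h h'
    using subgroup.m_closed[OF sub] h BijGroup_apply[OF stab_Bij stab_Bij, of h h' origin]
    by (simp add: stab_def origin_in)
qed

lemma tr_lin_auts: "t \<in> flexes \<Longrightarrow> tr t \<in> lin_auts"
proof (rule flexes_translation)
  fix L assume L: "transl_lin L" "\<And>q. q \<in> E \<Longrightarrow> t \<oplus>\<^sub>E q = induced L q"
  have "tr t = restrict (induced L) E" unfolding tr_def using L(2) by auto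
  then show ?thesis using transl_lin_hesse_iso[OF L(1)] unfolding lin_auts_def by blast
qed

section \<open>Products of a translation by a flex and a map fixing the origin\<close>

definition comb :: "'k plane \<Rightarrow> ('k plane \<Rightarrow> 'k plane) \<Rightarrow> 'k plane \<Rightarrow> 'k plane" where
  "comb t \<rho> = tr t \<otimes>\<^bsub>G\<^esub> \<rho>"

lemma comb_apply: "t \<in> flexes \<Longrightarrow> \<rho> \<in> stab \<Longrightarrow> q \<in> E \<Longrightarrow> comb t \<rho> q = t \<oplus>\<^sub>E \<rho> q"
  unfolding comb_def using BijGroup_apply[OF tr_Bij stab_Bij, of t \<rho> q] by (simp add: flexes_E tr_apply stab_E)

lemma comb_lin_auts: "t \<in> flexes \<Longrightarrow> \<rho> \<in> stab \<Longrightarrow> comb t \<rho> \<in> lin_auts"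
  unfolding comb_def using subgroup.m_closed[OF subgroup_lin_auts] tr_lin_auts by (simp add: stab_def)

lemma comb_Bij: "t \<in> flexes \<Longrightarrow> \<rho> \<in> stab \<Longrightarrow> comb t \<rho> \<in> Bij E"
  by (rule lin_auts_Bij[OF comb_lin_auts])

lemma lin_auts_comb:
  assumes h: "h \<in> lin_auts"
  obtains t \<rho> where "t \<in> flexes" "\<rho> \<in> stab" "h = comb t \<rho>"
proof -
  define t where "t = h origin"
  have t: "t \<in> flexes" using lin_auts_origin[OF h] by (simp add: t_def)
  define \<rho> where "\<rho> = tr (neg t) \<otimes>\<^bsub>G\<^esub> h"
  have "\<rho> \<in> lin_auts" unfolding \<rho>_def using subgroup.m_closed[OF subgroup_lin_auts] tr_lin_auts flexes_neg t h by simp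
  moreover have "\<rho> origin = origin"
    unfolding \<rho>_def using BijGroup_apply[OF tr_Bij lin_auts_Bij[OF h] origin_in, of "neg t"] flexes_E[OF t]
    by (simp add: neg_closed t_def[symmetric] tr_apply add_neg_self)
  ultimately have "\<rho> \<in> stab" by (simp add: stab_def)
  moreover have "h = comb t \<rho>"
  proof -
    have "inv\<^bsub>G\<^esub> (tr (neg t)) = tr t" using tr_inv[OF neg_closed[OF flexes_E[OF t]]] by (simp add: neg_neg)
    moreover have "tr (neg t) \<in> carrier G" "h \<in> carrier G"
      using tr_Bij[OF neg_closed[OF flexes_E[OF t]]] lin_auts_Bij[OF h] by (simp_all add: BijGroup_carrier)
    ultimately show ?thesis unfolding comb_def \<rho>_def using G.inv_solve_left' by (metis G.inv_closed G.m_closed G.inv_inv)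
  qed
  ultimately show ?thesis using that t by blast
qed

text \<open>Z and M are cut out of \<open>Aut_down E\<close> by conditions on restrictions alone, so
  they can be computed inside \<open>lin_auts\<close>.\<close>

lemma restr_on_eq: "restr_on E {\<tau> \<in> Aut_down E. P (restrict \<tau> E)} = {h \<in> lin_auts. P h}"
proof
  show "restr_on E {\<tau> \<in> Aut_down E. P (restrict \<tau> E)} \<subseteq> {h \<in> lin_auts. P h}"
    unfolding restr_on_def using restr_Aut_down by auto
  show "{h \<in> lin_auts. P h} \<subseteq> restr_on E {\<tau> \<in> Aut_down E. P (restrict \<tau> E)}"
  proof
    fix h assume "h \<in> {h \<in> lin_auts. P h}"
    then have h: "h \<in> lin_auts" "P h" by auto
    from h(1) obtain L where "hesse_iso L" "h = restrict (induced L) E" "induced L \<in> Aut_down E" by (rule lin_auts_cases)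
    then show "h \<in> restr_on E {\<tau> \<in> Aut_down E. P (restrict \<tau> E)}"
      unfolding restr_on_def using h(2) by blast
  qed
qed

text \<open>Both composites evaluated at the origin give p + t and t + \<rho> p, so commuting forces
  \<rho> p = p; conversely only the flex \<open>t\<close> has to be moved past other
  summands.\<close>

lemma tr_comm_iff:
  assumes p: "p \<in> E" and t: "t \<in> flexes" and \<rho>: "\<rho> \<in> stab"
  shows "tr p \<otimes>\<^bsub>G\<^esub> comb t \<rho> \<otimes>\<^bsub>G\<^esub> inv\<^bsub>G\<^esub> (tr p) = comb t \<rho> \<longleftrightarrow> \<rho> p = p"
proof -
  have c: "tr p \<in> carrier G" "comb t \<rho> \<in> carrier G" using tr_Bij p comb_Bij t \<rho> by (simp_all add: BijGroup_carrier)
  note B = c[unfolded BijGroup_carrier]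
  have "tr p \<otimes>\<^bsub>G\<^esub> comb t \<rho> \<otimes>\<^bsub>G\<^esub> inv\<^bsub>G\<^esub> (tr p) = comb t \<rho> \<longleftrightarrow>
    tr p \<otimes>\<^bsub>G\<^esub> comb t \<rho> = comb t \<rho> \<otimes>\<^bsub>G\<^esub> tr p"
    using c G.inv_solve_right[of "comb t \<rho>" "tr p \<otimes>\<^bsub>G\<^esub> comb t \<rho>" "tr p"] by auto
  also have "\<dots> \<longleftrightarrow> \<rho> p = p"
  proof
    assume *: "tr p \<otimes>\<^bsub>G\<^esub> comb t \<rho> = comb t \<rho> \<otimes>\<^bsub>G\<^esub> tr p"
    have "p \<oplus>\<^sub>E t = (tr p \<otimes>\<^bsub>G\<^esub> comb t \<rho>) origin"
      using BijGroup_apply[OF B origin_in] Bij_mem[OF B(2) origin_in] comb_apply[OF t \<rho> origin_in] \<rho>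
      by (simp add: tr_apply stab_def add_origin_right flexes_E t)
    also have "\<dots> = t \<oplus>\<^sub>E \<rho> p"
      using * BijGroup_apply[OF B(2,1) origin_in] comb_apply[OF t \<rho> p] p by (simp add: tr_apply origin_in add_origin_right)
    finally show "\<rho> p = p"
      using add_commute[OF p flexes_E[OF t]] add_left_cancel[OF p stab_E[OF \<rho> p] flexes_E[OF t]] by simp
  next
    assume fp: "\<rho> p = p"
    show "tr p \<otimes>\<^bsub>G\<^esub> comb t \<rho> = comb t \<rho> \<otimes>\<^bsub>G\<^esub> tr p"
    proof (rule Bij_eqI)
      show "tr p \<otimes>\<^bsub>G\<^esub> comb t \<rho> \<in> Bij E" "comb t \<rho> \<otimes>\<^bsub>G\<^esub> tr p \<in> Bij E" by (intro Bij_mult_closed B)+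
      fix q assume q: "q \<in> E"
      have "(tr p \<otimes>\<^bsub>G\<^esub> comb t \<rho>) q = p \<oplus>\<^sub>E (t \<oplus>\<^sub>E \<rho> q)"
        using BijGroup_apply[OF B q] Bij_mem[OF B(2) q] comb_apply[OF t \<rho> q] by (simp add: tr_apply)
      also have "\<dots> = t \<oplus>\<^sub>E (p \<oplus>\<^sub>E \<rho> q)" using flexes_assoc'[OF t p stab_E[OF \<rho> q]] .
      also have "\<dots> = t \<oplus>\<^sub>E \<rho> (p \<oplus>\<^sub>E q)" using stab_add[OF \<rho> p q] fp by simp
      also have "\<dots> = (comb t \<rho> \<otimes>\<^bsub>G\<^esub> tr p) q"
        using BijGroup_apply[OF B(2,1) q] comb_apply[OF t \<rho> add_closed[OF p q]] by (simp add: tr_apply q)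
      finally show "(tr p \<otimes>\<^bsub>G\<^esub> comb t \<rho>) q = (comb t \<rho> \<otimes>\<^bsub>G\<^esub> tr p) q" .
    qed
  qed
  finally show ?thesis .
qed

text \<open>The condition that \<rho> p - p lies in E[3], with p moved to the other side.\<close>

definition twisted_fix :: "'k plane \<Rightarrow> ('k plane \<Rightarrow> 'k plane) \<Rightarrow> bool" where
  "twisted_fix p \<rho> \<longleftrightarrow> (\<exists>t \<in> flexes. \<rho> p = t \<oplus>\<^sub>E p)"

text \<open>If \<rho> p - p is the flex t', conjugation by the translation by p keeps \<rho> and
  changes the translation part by t' only. This is why the maps with this property are normalized by
  that translation.\<close>

lemma conj_tr_comb:
  assumes p: "p \<in> E" and t: "t \<in> flexes" and \<rho>: "\<rho> \<in> stab" and t': "t' \<in> flexes" "\<rho> p = t' \<oplus>\<^sub>E p"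
  shows "tr p \<otimes>\<^bsub>G\<^esub> comb t \<rho> = comb (neg t' \<oplus>\<^sub>E t) \<rho> \<otimes>\<^bsub>G\<^esub> tr p"
    "comb t \<rho> \<otimes>\<^bsub>G\<^esub> tr p = tr p \<otimes>\<^bsub>G\<^esub> comb (t' \<oplus>\<^sub>E t) \<rho>"
proof -
  have *: "tr p \<otimes>\<^bsub>G\<^esub> comb s \<rho> = comb (neg t' \<oplus>\<^sub>E s) \<rho> \<otimes>\<^bsub>G\<^esub> tr p" if s: "s \<in> flexes" for s
  proof (rule Bij_eqI)
    have ns: "neg t' \<oplus>\<^sub>E s \<in> flexes" using flexes_add flexes_neg t' s by blast
    note B = tr_Bij[OF p] comb_Bij[OF s \<rho>] comb_Bij[OF ns \<rho>]
    show "tr p \<otimes>\<^bsub>G\<^esub> comb s \<rho> \<in> Bij E" "comb (neg t' \<oplus>\<^sub>E s) \<rho> \<otimes>\<^bsub>G\<^esub> tr p \<in> Bij E" by (intro Bij_mult_closed B)+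
    fix q assume q: "q \<in> E"
    have \<rho>q: "\<rho> q \<in> E" using stab_E[OF \<rho> q] .
    have "(comb (neg t' \<oplus>\<^sub>E s) \<rho> \<otimes>\<^bsub>G\<^esub> tr p) q = (neg t' \<oplus>\<^sub>E s) \<oplus>\<^sub>E ((t' \<oplus>\<^sub>E p) \<oplus>\<^sub>E \<rho> q)"
      using BijGroup_apply[OF B(3,1) q] comb_apply[OF ns \<rho> add_closed[OF p q]] stab_add[OF \<rho> p q] t'(2)
      by (simp add: tr_apply q)
    also have "(t' \<oplus>\<^sub>E p) \<oplus>\<^sub>E \<rho> q = t' \<oplus>\<^sub>E (p \<oplus>\<^sub>E \<rho> q)" using flexes_assoc[OF t'(1) p \<rho>q] by simp
    also have "(neg t' \<oplus>\<^sub>E s) \<oplus>\<^sub>E (t' \<oplus>\<^sub>E (p \<oplus>\<^sub>E \<rho> q)) = s \<oplus>\<^sub>E (neg t' \<oplus>\<^sub>E (t' \<oplus>\<^sub>E (p \<oplus>\<^sub>E \<rho> q)))"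
      using flexes_assoc[OF s, of "neg t'" "t' \<oplus>\<^sub>E (p \<oplus>\<^sub>E \<rho> q)"] add_commute[of s "neg t'"]
      by (simp add: flexes_E s t' neg_closed add_closed p \<rho>q)
    also have "\<dots> = s \<oplus>\<^sub>E (p \<oplus>\<^sub>E \<rho> q)" using neg_add_cancel(1)[OF flexes_E[OF t'(1)] add_closed[OF p \<rho>q]] by simp
    also have "\<dots> = p \<oplus>\<^sub>E (s \<oplus>\<^sub>E \<rho> q)" using flexes_assoc'[OF s p \<rho>q] by simp
    also have "\<dots> = (tr p \<otimes>\<^bsub>G\<^esub> comb s \<rho>) q"
      using BijGroup_apply[OF B(1,2) q] Bij_mem[OF B(2) q] comb_apply[OF s \<rho> q] by (simp add: tr_apply)
    finally show "(tr p \<otimes>\<^bsub>G\<^esub> comb s \<rho>) q = (comb (neg t' \<oplus>\<^sub>E s) \<rho> \<otimes>\<^bsub>G\<^esub> tr p) q" by simp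
  qed
  show "tr p \<otimes>\<^bsub>G\<^esub> comb t \<rho> = comb (neg t' \<oplus>\<^sub>E t) \<rho> \<otimes>\<^bsub>G\<^esub> tr p" using *[OF t] .
  have "neg t' \<oplus>\<^sub>E (t' \<oplus>\<^sub>E t) = t" using neg_add_cancel(1) flexes_E t t' by simp
  then show "comb t \<rho> \<otimes>\<^bsub>G\<^esub> tr p = tr p \<otimes>\<^bsub>G\<^esub> comb (t' \<oplus>\<^sub>E t) \<rho>" using *[OF flexes_add[OF t'(1) t]] by simp
qed

definition combs :: "('k plane \<Rightarrow> 'k plane) set \<Rightarrow> ('k plane \<Rightarrow> 'k plane) set" where
  "combs K = {comb t \<rho> |t \<rho>. t \<in> flexes \<and> \<rho> \<in> K}"

lemma comb_mult:
  assumes "t \<in> flexes" "\<rho> \<in> stab" "t' \<in> flexes" "\<rho>' \<in> stab"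
  shows "comb t \<rho> \<otimes>\<^bsub>G\<^esub> comb t' \<rho>' = comb (t \<oplus>\<^sub>E \<rho> t') (\<rho> \<otimes>\<^bsub>G\<^esub> \<rho>')"
proof (rule Bij_eqI)
  have r: "\<rho> \<otimes>\<^bsub>G\<^esub> \<rho>' \<in> stab" using subgroup.m_closed[OF subgroup_stab] assms by blast
  have t: "\<rho> t' \<in> flexes" "t \<oplus>\<^sub>E \<rho> t' \<in> flexes" using stab_flexes[OF assms(2,3)] flexes_add[OF assms(1) stab_flexes[OF assms(2,3)]] by simp_all
  show "comb t \<rho> \<otimes>\<^bsub>G\<^esub> comb t' \<rho>' \<in> Bij E" "comb (t \<oplus>\<^sub>E \<rho> t') (\<rho> \<otimes>\<^bsub>G\<^esub> \<rho>') \<in> Bij E"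
    by (intro Bij_mult_closed comb_Bij assms r t)+
  fix q assume q: "q \<in> E"
  have q': "\<rho>' q \<in> E" "\<rho> (\<rho>' q) \<in> E" using stab_E[OF assms(4) q] stab_E[OF assms(2) stab_E[OF assms(4) q]] by simp_all
  have "(comb t \<rho> \<otimes>\<^bsub>G\<^esub> comb t' \<rho>') q = t \<oplus>\<^sub>E \<rho> (t' \<oplus>\<^sub>E \<rho>' q)"
    using BijGroup_apply[OF comb_Bij[OF assms(1,2)] comb_Bij[OF assms(3,4)] q] comb_apply[OF assms(3,4) q]
      comb_apply[OF assms(1,2) add_closed[OF flexes_E[OF assms(3)] q'(1)]] by simp
  also have "\<dots> = (t \<oplus>\<^sub>E \<rho> t') \<oplus>\<^sub>E \<rho> (\<rho>' q)"
    using stab_add[OF assms(2) flexes_E[OF assms(3)] q'(1)] flexes_assoc[OF assms(1) flexes_E[OF t(1)] q'(2)] by simp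
  also have "\<dots> = comb (t \<oplus>\<^sub>E \<rho> t') (\<rho> \<otimes>\<^bsub>G\<^esub> \<rho>') q"
    using comb_apply[OF t(2) r q] BijGroup_apply[OF stab_Bij[OF assms(2)] stab_Bij[OF assms(4)] q] by simp
  finally show "(comb t \<rho> \<otimes>\<^bsub>G\<^esub> comb t' \<rho>') q = comb (t \<oplus>\<^sub>E \<rho> t') (\<rho> \<otimes>\<^bsub>G\<^esub> \<rho>') q" .
qed

lemma one_stab: "\<one>\<^bsub>G\<^esub> \<in> stab"
  using subgroup.one_closed[OF subgroup_stab] .

lemma comb_one: "t \<in> flexes \<Longrightarrow> comb t \<one>\<^bsub>G\<^esub> = tr t"
  unfolding comb_def using tr_Bij[OF flexes_E] by (simp add: BijGroup_carrier[symmetric])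

lemma comb_origin: "\<rho> \<in> stab \<Longrightarrow> comb origin \<rho> = \<rho>"
  unfolding comb_def tr_origin using stab_Bij by (simp add: BijGroup_carrier[symmetric])

lemma translation_group_3: "translation_group l 3 = combs {\<one>\<^bsub>G\<^esub>}"
proof -
  have "combs {\<one>\<^bsub>G\<^esub>} = (\<lambda>t. comb t \<one>\<^bsub>G\<^esub>) ` flexes" unfolding combs_def by auto
  also have "\<dots> = tr ` flexes" using comb_one by (intro image_cong) simp_all
  finally show ?thesis unfolding translation_group_def torsion_3 by (rule sym)
qed

lemma subgroup_combs:
  assumes K: "subgroup K G" "K \<subseteq> stab"
  shows "subgroup (combs K) G"
proof (rule G.subgroupI)
  show "combs K \<subseteq> carrier G"
    using K(2) unfolding combs_def BijGroup_carrier by (auto intro: comb_Bij)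
  show "combs K \<noteq> {}" unfolding combs_def using flexes_origin subgroup.one_closed[OF K(1)] by blast
  show "h \<otimes>\<^bsub>G\<^esub> h' \<in> combs K" if hh: "h \<in> combs K" "h' \<in> combs K" for h h'
  proof -
    obtain t \<rho> where h: "h = comb t \<rho>" "t \<in> flexes" "\<rho> \<in> K" using hh unfolding combs_def by blast
    obtain t' \<rho>' where h': "h' = comb t' \<rho>'" "t' \<in> flexes" "\<rho>' \<in> K" using hh unfolding combs_def by blast
    have s: "\<rho> \<in> stab" "\<rho>' \<in> stab" using h h' K by blast+
    have "h \<otimes>\<^bsub>G\<^esub> h' = comb (t \<oplus>\<^sub>E \<rho> t') (\<rho> \<otimes>\<^bsub>G\<^esub> \<rho>')" using comb_mult h h' s by simp
    moreover have "t \<oplus>\<^sub>E \<rho> t' \<in> flexes" "\<rho> \<otimes>\<^bsub>G\<^esub> \<rho>' \<in> K"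
      using flexes_add[OF h(2) stab_flexes[OF s(1) h'(2)]] subgroup.m_closed[OF K(1) h(3) h'(3)] by simp_all
    ultimately show ?thesis unfolding combs_def by blast
  qed
  show "inv\<^bsub>G\<^esub> h \<in> combs K" if hh: "h \<in> combs K" for h
  proof -
    obtain t \<rho> where h: "h = comb t \<rho>" "t \<in> flexes" "\<rho> \<in> K" using hh unfolding combs_def by blast
    have s: "\<rho> \<in> stab" using h K by blast
    have i: "inv\<^bsub>G\<^esub> \<rho> \<in> K" "inv\<^bsub>G\<^esub> \<rho> \<in> stab" using subgroup.m_inv_closed[OF K(1) h(3)] K(2) by blast+
    have "inv\<^bsub>G\<^esub> h = inv\<^bsub>G\<^esub> \<rho> \<otimes>\<^bsub>G\<^esub> inv\<^bsub>G\<^esub> (tr t)"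
      unfolding h(1) comb_def using G.inv_mult_group tr_Bij[OF flexes_E[OF h(2)]] stab_Bij[OF s] by (simp add: BijGroup_carrier)
    also have "\<dots> = comb origin (inv\<^bsub>G\<^esub> \<rho>) \<otimes>\<^bsub>G\<^esub> comb (neg t) \<one>\<^bsub>G\<^esub>"
      using tr_inv[OF flexes_E[OF h(2)]] comb_origin[OF i(2)] comb_one[OF flexes_neg[OF h(2)]] by simp
    also have "\<dots> = comb (origin \<oplus>\<^sub>E (inv\<^bsub>G\<^esub> \<rho>) (neg t)) (inv\<^bsub>G\<^esub> \<rho> \<otimes>\<^bsub>G\<^esub> \<one>\<^bsub>G\<^esub>)"
      using comb_mult[OF flexes_origin i(2) flexes_neg[OF h(2)] one_stab] .
    finally show ?thesis
      using flexes_add[OF flexes_origin stab_flexes[OF i(2) flexes_neg[OF h(2)]]]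
        subgroup.m_closed[OF K(1) i(1) subgroup.one_closed[OF K(1)]]
      unfolding combs_def by blast
  qed
qed

text \<open>Conjugation by \<open>comb t \<rho>\<close> takes the translation by a flex
  \<open>s\<close> to that by \<open>\<rho> s\<close>; the two factors meet trivially because a
  translation is determined by its value at the origin.\<close>

lemma semidirect_combs:
  assumes K: "subgroup K G" "K \<subseteq> stab"
  shows "is_semidirect G (combs K) (translation_group l 3) K"
proof -
  have one: "subgroup {\<one>\<^bsub>G\<^esub>} G" using G.triv_subgroup .
  have T: "subgroup (translation_group l 3) G"
    unfolding translation_group_3 using subgroup_combs[OF one] one_stab by blast
  have C: "subgroup (combs K) G" using subgroup_combs[OF K] .
  have TC: "translation_group l 3 \<subseteq> combs K"
    unfolding translation_group_3 combs_def using subgroup.one_closed[OF K(1)] by blast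
  have KC: "K \<subseteq> combs K"
  proof
    fix \<rho> assume \<rho>: "\<rho> \<in> K"
    then have "\<rho> = comb origin \<rho>" using comb_origin[of \<rho>] K(2) by auto
    then show "\<rho> \<in> combs K" unfolding combs_def using flexes_origin \<rho> by blast
  qed
  interpret GC: group "G\<lparr>carrier := combs K\<rparr>" using subgroup.subgroup_is_group[OF C group_BijGroup] .
  have "translation_group l 3 \<lhd> G\<lparr>carrier := combs K\<rparr>"
    unfolding GC.normal_inv_iff
  proof (intro conjI ballI)
    show "subgroup (translation_group l 3) (G\<lparr>carrier := combs K\<rparr>)" using G.subgroup_incl[OF T C TC] .
    fix x h assume x: "x \<in> carrier (G\<lparr>carrier := combs K\<rparr>)" and h: "h \<in> translation_group l 3"
    have inv: "inv\<^bsub>G\<lparr>carrier := combs K\<rparr>\<^esub> x = inv\<^bsub>G\<^esub> x" using G.m_inv_consistent[OF C] x by simp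
    obtain t \<rho> where x': "x = comb t \<rho>" "t \<in> flexes" "\<rho> \<in> K" using x unfolding combs_def by auto
    obtain s where s: "h = tr s" "s \<in> flexes" using h unfolding translation_group_def torsion_3 by blast
    have \<rho>: "\<rho> \<in> stab" using x' K by blast
    have \<rho>s: "\<rho> s \<in> flexes" using stab_flexes[OF \<rho> s(2)] .
    have "x \<otimes>\<^bsub>G\<^esub> h = comb (t \<oplus>\<^sub>E \<rho> s) (\<rho> \<otimes>\<^bsub>G\<^esub> \<one>\<^bsub>G\<^esub>)"
      using comb_mult[OF x'(2) \<rho> s(2) one_stab] comb_one[OF s(2)] x'(1) s(1) by simp
    also have "\<dots> = comb (\<rho> s \<oplus>\<^sub>E \<one>\<^bsub>G\<^esub> t) (\<one>\<^bsub>G\<^esub> \<otimes>\<^bsub>G\<^esub> \<rho>)"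
      using stab_Bij[OF \<rho>] add_commute[OF flexes_E[OF x'(2)] flexes_E[OF \<rho>s]] flexes_E[OF x'(2)]
      by (simp add: BijGroup_carrier[symmetric]) (simp add: BijGroup_one)
    also have "\<dots> = comb (\<rho> s) \<one>\<^bsub>G\<^esub> \<otimes>\<^bsub>G\<^esub> comb t \<rho>"
      using comb_mult[OF \<rho>s one_stab x'(2) \<rho>] by simp
    finally have "x \<otimes>\<^bsub>G\<^esub> h = tr (\<rho> s) \<otimes>\<^bsub>G\<^esub> x" using comb_one[OF \<rho>s] x'(1) by simp
    moreover have "x \<in> carrier G" "tr (\<rho> s) \<in> carrier G"
      using comb_Bij[OF x'(2) \<rho>] x'(1) tr_Bij[OF flexes_E[OF \<rho>s]] by (simp_all add: BijGroup_carrier)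
    ultimately have "x \<otimes>\<^bsub>G\<^esub> h \<otimes>\<^bsub>G\<^esub> inv\<^bsub>G\<^esub> x = tr (\<rho> s)" by (simp add: G.m_assoc)
    then show "x \<otimes>\<^bsub>G\<lparr>carrier := combs K\<rparr>\<^esub> h \<otimes>\<^bsub>G\<lparr>carrier := combs K\<rparr>\<^esub> inv\<^bsub>G\<lparr>carrier := combs K\<rparr>\<^esub> x \<in> translation_group l 3"
      unfolding inv using \<rho>s unfolding translation_group_def torsion_3 by simp
  qed
  moreover have "subgroup K (G\<lparr>carrier := combs K\<rparr>)" using G.subgroup_incl[OF K(1) C KC] .
  moreover have "translation_group l 3 \<inter> K = {\<one>\<^bsub>G\<^esub>}"
  proof
    show "{\<one>\<^bsub>G\<^esub>} \<subseteq> translation_group l 3 \<inter> K" using subgroup.one_closed[OF T] subgroup.one_closed[OF K(1)] by blast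
    show "translation_group l 3 \<inter> K \<subseteq> {\<one>\<^bsub>G\<^esub>}"
    proof
      fix h assume h: "h \<in> translation_group l 3 \<inter> K"
      then obtain t where t: "h = tr t" "t \<in> flexes" unfolding translation_group_def torsion_3 by blast
      have "h origin = origin" using h K unfolding stab_def by blast
      then have "t = origin" using t by (simp add: tr_apply origin_in add_origin_right flexes_E)
      then show "h \<in> {\<one>\<^bsub>G\<^esub>}" using t(1) tr_origin by simp
    qed
  qed
  moreover have "combs K = translation_group l 3 <#>\<^bsub>G\<^esub> K"
    unfolding set_mult_def translation_group_def torsion_3 combs_def comb_def by blast
  ultimately show ?thesis unfolding is_semidirect_def using C by blast
qed

section \<open>Z and M in terms of the stabilizer\<close>

lemma restr_Z_set:
  assumes p: "p \<in> E"
  shows "restr_on E (Z_set E (tr p)) = combs {\<rho> \<in> stab. \<rho> p = p}"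
proof -
  have "restr_on E (Z_set E (tr p)) = {h \<in> lin_auts. tr p \<otimes>\<^bsub>G\<^esub> h \<otimes>\<^bsub>G\<^esub> inv\<^bsub>G\<^esub> (tr p) = h}"
    unfolding Z_set_def by (rule restr_on_eq)
  also have "\<dots> = combs {\<rho> \<in> stab. \<rho> p = p}"
  proof
    show "{h \<in> lin_auts. tr p \<otimes>\<^bsub>G\<^esub> h \<otimes>\<^bsub>G\<^esub> inv\<^bsub>G\<^esub> (tr p) = h} \<subseteq> combs {\<rho> \<in> stab. \<rho> p = p}"
    proof
      fix h assume "h \<in> {h \<in> lin_auts. tr p \<otimes>\<^bsub>G\<^esub> h \<otimes>\<^bsub>G\<^esub> inv\<^bsub>G\<^esub> (tr p) = h}"
      then have h: "h \<in> lin_auts" "tr p \<otimes>\<^bsub>G\<^esub> h \<otimes>\<^bsub>G\<^esub> inv\<^bsub>G\<^esub> (tr p) = h" by auto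
      from h(1) obtain t \<rho> where *: "t \<in> flexes" "\<rho> \<in> stab" "h = comb t \<rho>" by (rule lin_auts_comb)
      then show "h \<in> combs {\<rho> \<in> stab. \<rho> p = p}" using tr_comm_iff[OF p *(1,2)] h(2) unfolding combs_def by blast
    qed
    show "combs {\<rho> \<in> stab. \<rho> p = p} \<subseteq> {h \<in> lin_auts. tr p \<otimes>\<^bsub>G\<^esub> h \<otimes>\<^bsub>G\<^esub> inv\<^bsub>G\<^esub> (tr p) = h}"
      unfolding combs_def using tr_comm_iff[OF p] comb_lin_auts by auto
  qed
  finally show ?thesis .
qed

lemma twisted_fix_comp:
  assumes "p \<in> E" "\<rho> \<in> stab" "\<rho>' \<in> stab" "twisted_fix p \<rho>" "twisted_fix p \<rho>'"
  shows "twisted_fix p (\<rho> \<otimes>\<^bsub>G\<^esub> \<rho>')"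
proof -
  obtain t where t: "t \<in> flexes" "\<rho> p = t \<oplus>\<^sub>E p" using assms(4) unfolding twisted_fix_def by blast
  obtain t' where t': "t' \<in> flexes" "\<rho>' p = t' \<oplus>\<^sub>E p" using assms(5) unfolding twisted_fix_def by blast
  have "(\<rho> \<otimes>\<^bsub>G\<^esub> \<rho>') p = \<rho> t' \<oplus>\<^sub>E (t \<oplus>\<^sub>E p)"
    using BijGroup_apply[OF stab_Bij[OF assms(2)] stab_Bij[OF assms(3)] assms(1)] stab_add[OF assms(2) flexes_E[OF t'(1)] assms(1)]
      t t' by simp
  also have "\<dots> = (\<rho> t' \<oplus>\<^sub>E t) \<oplus>\<^sub>E p"
    using flexes_assoc[OF stab_flexes[OF assms(2) t'(1)] flexes_E[OF t(1)] assms(1)] .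
  finally show ?thesis
    unfolding twisted_fix_def using flexes_add[OF stab_flexes[OF assms(2) t'(1)] t(1)] by blast
qed

lemma twisted_fix_inv:
  assumes "p \<in> E" "\<rho> \<in> stab" "twisted_fix p \<rho>"
  shows "twisted_fix p (inv\<^bsub>G\<^esub> \<rho>)"
proof -
  obtain t where t: "t \<in> flexes" "\<rho> p = t \<oplus>\<^sub>E p" using assms(3) unfolding twisted_fix_def by blast
  have i: "inv\<^bsub>G\<^esub> \<rho> \<in> stab" using subgroup.m_inv_closed[OF subgroup_stab assms(2)] .
  note tE = flexes_E[OF t(1)] and s = stab_flexes[OF i t(1)]
  have "p = (inv\<^bsub>G\<^esub> \<rho> \<otimes>\<^bsub>G\<^esub> \<rho>) p"
    using stab_Bij[OF assms(2)] assms(1) by (simp add: BijGroup_carrier[symmetric]) (simp add: BijGroup_one)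
  also have "\<dots> = (inv\<^bsub>G\<^esub> \<rho>) t \<oplus>\<^sub>E (inv\<^bsub>G\<^esub> \<rho>) p"
    using BijGroup_apply[OF stab_Bij[OF i] stab_Bij[OF assms(2)] assms(1)] t(2) stab_add[OF i tE assms(1)] by simp
  finally have "neg ((inv\<^bsub>G\<^esub> \<rho>) t) \<oplus>\<^sub>E p = (inv\<^bsub>G\<^esub> \<rho>) p"
    using neg_add_cancel(1)[OF flexes_E[OF s] stab_E[OF i assms(1)]] by simp
  then show ?thesis unfolding twisted_fix_def using flexes_neg[OF s] by metis
qed

lemma subgroup_twisted_fix: "p \<in> E \<Longrightarrow> subgroup {\<rho> \<in> stab. twisted_fix p \<rho>} G"
proof (rule G.subgroupI)
  assume p: "p \<in> E"
  show "{\<rho> \<in> stab. twisted_fix p \<rho>} \<subseteq> carrier G" using stab_Bij by (auto simp: BijGroup_carrier)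
  have "twisted_fix p \<one>\<^bsub>G\<^esub>" 
    unfolding twisted_fix_def BijGroup_one by (intro bexI[OF _ flexes_origin]) (simp add: add_origin p)
  then show "{\<rho> \<in> stab. twisted_fix p \<rho>} \<noteq> {}" using one_stab by blast
qed (use twisted_fix_inv twisted_fix_comp subgroup.m_inv_closed[OF subgroup_stab] subgroup.m_closed[OF subgroup_stab] in auto)

lemma restr_M_set:
  assumes p: "p \<in> E"
  shows "restr_on E (M_set E (tr p)) = combs {\<rho> \<in> stab. twisted_fix p \<rho>}"
proof -
  have trB: "tr p \<in> Bij E" and trG: "tr p \<in> carrier G" using tr_Bij[OF p] by (simp_all add: BijGroup_carrier)
  let ?N = "combs {\<rho> \<in> stab. twisted_fix p \<rho>}"
  have N: "subgroup ?N G" using subgroup_combs[OF subgroup_twisted_fix[OF p]] by blast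
  have NH: "?N \<subseteq> lin_auts" unfolding combs_def using comb_lin_auts by blast
  have "restr_on E (M_set E (tr p)) =
    {h \<in> lin_auts. \<forall>i::int. (h \<otimes>\<^bsub>G\<^esub> tr p) [^]\<^bsub>G\<^esub> i \<otimes>\<^bsub>G\<^esub> (tr p) [^]\<^bsub>G\<^esub> (- i) \<in> Aut_up E}"
    unfolding M_set_def by (rule restr_on_eq)
  also have "\<dots> = ?N"
  proof
    show "?N \<subseteq> {h \<in> lin_auts. \<forall>i::int. (h \<otimes>\<^bsub>G\<^esub> tr p) [^]\<^bsub>G\<^esub> i \<otimes>\<^bsub>G\<^esub> (tr p) [^]\<^bsub>G\<^esub> (- i) \<in> Aut_up E}"
    proof
      fix h assume h: "h \<in> ?N"
      have conj: "tr p \<otimes>\<^bsub>G\<^esub> x \<otimes>\<^bsub>G\<^esub> inv\<^bsub>G\<^esub> (tr p) \<in> ?N" "inv\<^bsub>G\<^esub> (tr p) \<otimes>\<^bsub>G\<^esub> x \<otimes>\<^bsub>G\<^esub> tr p \<in> ?N" if xN: "x \<in> ?N" for x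
      proof -
        obtain t \<rho> where x: "x = comb t \<rho>" "t \<in> flexes" "\<rho> \<in> stab" "twisted_fix p \<rho>"
          using xN unfolding combs_def by blast
        obtain t' where t': "t' \<in> flexes" "\<rho> p = t' \<oplus>\<^sub>E p" using x(4) unfolding twisted_fix_def by blast
        note c = conj_tr_comb[OF p x(2,3) t']
        have nt: "neg t' \<oplus>\<^sub>E t \<in> flexes" "t' \<oplus>\<^sub>E t \<in> flexes" using flexes_add flexes_neg t' x(2) by blast+
        have cc: "comb (neg t' \<oplus>\<^sub>E t) \<rho> \<in> carrier G" "comb (t' \<oplus>\<^sub>E t) \<rho> \<in> carrier G"
          using comb_Bij nt x(3) by (simp_all add: BijGroup_carrier)
        have "tr p \<otimes>\<^bsub>G\<^esub> x \<otimes>\<^bsub>G\<^esub> inv\<^bsub>G\<^esub> (tr p) = comb (neg t' \<oplus>\<^sub>E t) \<rho>"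
          unfolding x(1) c(1) using cc trG by (simp add: G.m_assoc)
        then show "tr p \<otimes>\<^bsub>G\<^esub> x \<otimes>\<^bsub>G\<^esub> inv\<^bsub>G\<^esub> (tr p) \<in> ?N" using nt x unfolding combs_def by blast
        have "comb t \<rho> \<in> carrier G" using comb_Bij x by (simp add: BijGroup_carrier)
        then have "inv\<^bsub>G\<^esub> (tr p) \<otimes>\<^bsub>G\<^esub> x \<otimes>\<^bsub>G\<^esub> tr p = inv\<^bsub>G\<^esub> (tr p) \<otimes>\<^bsub>G\<^esub> (comb t \<rho> \<otimes>\<^bsub>G\<^esub> tr p)"
          unfolding x(1) using trG by (simp add: G.m_assoc)
        also have "\<dots> = comb (t' \<oplus>\<^sub>E t) \<rho>" unfolding c(2) using cc trG by (simp add: G.m_assoc[symmetric])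
        finally show "inv\<^bsub>G\<^esub> (tr p) \<otimes>\<^bsub>G\<^esub> x \<otimes>\<^bsub>G\<^esub> tr p \<in> ?N" using nt x unfolding combs_def by blast
      qed
      have "(h \<otimes>\<^bsub>G\<^esub> tr p) [^]\<^bsub>G\<^esub> i \<otimes>\<^bsub>G\<^esub> (tr p) [^]\<^bsub>G\<^esub> (- i) \<in> ?N" for i :: int
        using G.int_pow_twisted_mem[OF N trG conj h] .
      then show "h \<in> {h \<in> lin_auts. \<forall>i::int. (h \<otimes>\<^bsub>G\<^esub> tr p) [^]\<^bsub>G\<^esub> i \<otimes>\<^bsub>G\<^esub> (tr p) [^]\<^bsub>G\<^esub> (- i) \<in> Aut_up E}"
        using h NH unfolding Aut_up_eq by blast
    qed
    show "{h \<in> lin_auts. \<forall>i::int. (h \<otimes>\<^bsub>G\<^esub> tr p) [^]\<^bsub>G\<^esub> i \<otimes>\<^bsub>G\<^esub> (tr p) [^]\<^bsub>G\<^esub> (- i) \<in> Aut_up E} \<subseteq> ?N"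
    proof
      fix h assume "h \<in> {h \<in> lin_auts. \<forall>i::int. (h \<otimes>\<^bsub>G\<^esub> tr p) [^]\<^bsub>G\<^esub> i \<otimes>\<^bsub>G\<^esub> (tr p) [^]\<^bsub>G\<^esub> (- i) \<in> Aut_up E}"
      then have h: "h \<in> lin_auts" and h2: "(h \<otimes>\<^bsub>G\<^esub> tr p) [^]\<^bsub>G\<^esub> (2::int) \<otimes>\<^bsub>G\<^esub> (tr p) [^]\<^bsub>G\<^esub> (- 2::int) \<in> lin_auts"
        unfolding Aut_up_eq by auto
      have hG: "h \<in> carrier G" using lin_auts_Bij[OF h] by (simp add: BijGroup_carrier)
      \<comment> \<open>The case of exponent 2 is the product of \<open>h\<close> with this
        conjugate; both the product and \<open>h\<close> are linear, hence so is
        \<open>g\<close>.\<close>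
      define g where "g = tr p \<otimes>\<^bsub>G\<^esub> h \<otimes>\<^bsub>G\<^esub> inv\<^bsub>G\<^esub> (tr p)"
      have gG: "g \<in> carrier G" unfolding g_def using hG trG by simp
      have pow2: "x [^]\<^bsub>G\<^esub> (2::int) = x \<otimes>\<^bsub>G\<^esub> x" if "x \<in> carrier G" for x
        using that int_pow_int[of G x 2] by (simp add: numeral_2_eq_2)
      have "(h \<otimes>\<^bsub>G\<^esub> tr p) [^]\<^bsub>G\<^esub> (2::int) \<otimes>\<^bsub>G\<^esub> (tr p) [^]\<^bsub>G\<^esub> (- 2::int) = h \<otimes>\<^bsub>G\<^esub> g"
      proof -
        have "(tr p) [^]\<^bsub>G\<^esub> (- 2::int) = inv\<^bsub>G\<^esub> (tr p) \<otimes>\<^bsub>G\<^esub> inv\<^bsub>G\<^esub> (tr p)"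
          using G.int_pow_neg[OF trG, of 2] pow2[OF trG] trG by (simp add: G.inv_mult_group)
        moreover have "tr p \<otimes>\<^bsub>G\<^esub> (inv\<^bsub>G\<^esub> (tr p) \<otimes>\<^bsub>G\<^esub> inv\<^bsub>G\<^esub> (tr p)) = inv\<^bsub>G\<^esub> (tr p)"
          using trG by (simp add: G.m_assoc[symmetric])
        ultimately show ?thesis
          using pow2[of "h \<otimes>\<^bsub>G\<^esub> tr p"] hG trG unfolding g_def by (simp add: G.m_assoc)
      qed
      then have "h \<otimes>\<^bsub>G\<^esub> g \<in> lin_auts" using h2 by simp
      then have "inv\<^bsub>G\<^esub> h \<otimes>\<^bsub>G\<^esub> (h \<otimes>\<^bsub>G\<^esub> g) \<in> lin_auts"
        using subgroup.m_closed[OF subgroup_lin_auts subgroup.m_inv_closed[OF subgroup_lin_auts h]] by blast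
      moreover have "inv\<^bsub>G\<^esub> h \<otimes>\<^bsub>G\<^esub> (h \<otimes>\<^bsub>G\<^esub> g) = g" using hG gG by (simp add: G.m_assoc[symmetric])
      ultimately have g: "g \<in> lin_auts" by simp
      have comm: "tr p \<otimes>\<^bsub>G\<^esub> h = g \<otimes>\<^bsub>G\<^esub> tr p" unfolding g_def using hG trG by (simp add: G.m_assoc)
      obtain t \<rho> where c: "t \<in> flexes" "\<rho> \<in> stab" "h = comb t \<rho>" using h by (rule lin_auts_comb)
      obtain t1 \<rho>1 where c1: "t1 \<in> flexes" "\<rho>1 \<in> stab" "g = comb t1 \<rho>1" using g by (rule lin_auts_comb)
      note B = trB comb_Bij[OF c(1,2)] comb_Bij[OF c1(1,2)]
      \<comment> \<open>Evaluation at the origin and then at a general point shows that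
        \<open>h\<close> and its conjugate have the same part in \<open>stab\<close>, so conjugation
        has only changed the flex; that change is the required difference.\<close>
      have eq: "p \<oplus>\<^sub>E (t \<oplus>\<^sub>E \<rho> q) = t1 \<oplus>\<^sub>E (\<rho>1 p \<oplus>\<^sub>E \<rho>1 q)" if q: "q \<in> E" for q
      proof -
        have "p \<oplus>\<^sub>E (t \<oplus>\<^sub>E \<rho> q) = (tr p \<otimes>\<^bsub>G\<^esub> comb t \<rho>) q"
          using BijGroup_apply[OF B(1,2) q] Bij_mem[OF B(2) q] comb_apply[OF c(1,2) q] by (simp add: tr_apply)
        also have "\<dots> = (comb t1 \<rho>1 \<otimes>\<^bsub>G\<^esub> tr p) q" using comm c(3) c1(3) by simp
        also have "\<dots> = t1 \<oplus>\<^sub>E (\<rho>1 p \<oplus>\<^sub>E \<rho>1 q)"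
          using BijGroup_apply[OF B(3,1) q] comb_apply[OF c1(1,2) add_closed[OF p q]] stab_add[OF c1(2) p q] by (simp add: tr_apply q)
        finally show ?thesis .
      qed
      note E = flexes_E[OF c(1)] flexes_E[OF c1(1)] stab_E[OF c(2) p] stab_E[OF c1(2) p]
      have "p \<oplus>\<^sub>E t = t1 \<oplus>\<^sub>E \<rho>1 p"
        using eq[OF origin_in] c(2) c1(2) E by (simp add: stab_def add_origin_right)
      then have tp: "t \<oplus>\<^sub>E p = t1 \<oplus>\<^sub>E \<rho>1 p" using add_commute[OF p E(1)] by simp
      have "\<rho> q = \<rho>1 q" if q: "q \<in> E" for q
      proof -
        note Eq = stab_E[OF c(2) q] stab_E[OF c1(2) q]
        have "(t \<oplus>\<^sub>E p) \<oplus>\<^sub>E \<rho> q = p \<oplus>\<^sub>E (t \<oplus>\<^sub>E \<rho> q)"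
          using flexes_assoc[OF c(1) p Eq(1)] flexes_assoc'[OF c(1) p Eq(1)] by simp
        also have "\<dots> = (t1 \<oplus>\<^sub>E \<rho>1 p) \<oplus>\<^sub>E \<rho>1 q" using eq[OF q] flexes_assoc[OF c1(1) E(4) Eq(2)] by simp
        finally have "(t \<oplus>\<^sub>E p) \<oplus>\<^sub>E \<rho> q = (t \<oplus>\<^sub>E p) \<oplus>\<^sub>E \<rho>1 q" using tp by simp
        then show ?thesis using add_left_cancel[OF Eq add_closed[OF E(1) p]] by simp
      qed
      then have "\<rho>1 p = \<rho> p" using p by simp
      then have "neg t1 \<oplus>\<^sub>E (t \<oplus>\<^sub>E p) = \<rho> p" using tp neg_add_cancel(1)[OF E(2,3)] by simp
      then have "\<rho> p = (neg t1 \<oplus>\<^sub>E t) \<oplus>\<^sub>E p" using flexes_assoc[OF flexes_neg[OF c1(1)] E(1) p] by simp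
      then have "twisted_fix p \<rho>" unfolding twisted_fix_def using flexes_add[OF flexes_neg[OF c1(1)] c(1)] by blast
      then show "h \<in> ?N" using c unfolding combs_def by blast
    qed
  qed
  finally show ?thesis .
qed

lemma restr_Aut_down_eq: "restr_on E (Aut_down E) = combs stab"
proof -
  have "restr_on E (Aut_down E) = {h \<in> lin_auts. True}" using restr_on_eq[of "\<lambda>_. True"] by simp
  also have "\<dots> = combs stab"
  proof
    show "{h \<in> lin_auts. True} \<subseteq> combs stab"
    proof
      fix h assume "h \<in> {h \<in> lin_auts. True}"
      then have "h \<in> lin_auts" by simp
      then obtain t \<rho> where "t \<in> flexes" "\<rho> \<in> stab" "h = comb t \<rho>" by (rule lin_auts_comb)
      then show "h \<in> combs stab" unfolding combs_def by blast
    qed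
    show "combs stab \<subseteq> {h \<in> lin_auts. True}" unfolding combs_def using comb_lin_auts by auto
  qed
  finally show ?thesis .
qed

text \<open>Membership in \<open>S\<close> depends only on the restriction, so equality of the sets
  of restrictions lifts to the automorphisms of the plane.\<close>

lemma eq_Aut_down:
  assumes "S = {\<tau> \<in> Aut_down E. P (restrict \<tau> E)}" "restr_on E S = combs stab"
  shows "S = Aut_down E"
proof
  show "S \<subseteq> Aut_down E" using assms(1) by blast
  show "Aut_down E \<subseteq> S"
  proof
    fix \<tau> assume \<tau>: "\<tau> \<in> Aut_down E"
    have "restrict \<tau> E \<in> restr_on E S"
      using \<tau> assms(2) unfolding restr_Aut_down_eq[symmetric] restr_on_def by blast
    then have "P (restrict \<tau> E)" unfolding assms(1) restr_on_eq by blast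
    then show "\<tau> \<in> S" using \<tau> assms(1) by blast
  qed
qed

lemma Z_set_full:
  assumes "p \<in> E" "\<And>\<rho>. \<rho> \<in> stab \<Longrightarrow> \<rho> p = p"
  shows "Z_set E (tr p) = Aut_down E"
proof (rule eq_Aut_down)
  show "Z_set E (tr p) = {\<tau> \<in> Aut_down E. tr p \<otimes>\<^bsub>G\<^esub> restrict \<tau> E \<otimes>\<^bsub>G\<^esub> inv\<^bsub>G\<^esub> (tr p) = restrict \<tau> E}"
    by (rule Z_set_def)
  have "{\<rho> \<in> stab. \<rho> p = p} = stab" using assms(2) by blast
  then show "restr_on E (Z_set E (tr p)) = combs stab" using restr_Z_set[OF assms(1)] by simp
qed

lemma M_set_full:
  assumes "p \<in> E" "\<And>\<rho>. \<rho> \<in> stab \<Longrightarrow> twisted_fix p \<rho>"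
  shows "M_set E (tr p) = Aut_down E"
proof (rule eq_Aut_down)
  show "M_set E (tr p) = {\<tau> \<in> Aut_down E. \<forall>i::int. (restrict \<tau> E \<otimes>\<^bsub>G\<^esub> tr p) [^]\<^bsub>G\<^esub> i \<otimes>\<^bsub>G\<^esub> tr p [^]\<^bsub>G\<^esub> (- i) \<in> Aut_up E}"
    by (rule M_set_def)
  have "{\<rho> \<in> stab. twisted_fix p \<rho>} = stab" using assms(2) by blast
  then show "restr_on E (M_set E (tr p)) = combs stab" using restr_M_set[OF assms(1)] by simp
qed

end

section \<open>Cyclic groups of order two and three\<close>

context group
begin

lemma generate_involution:
  assumes "a \<in> carrier G" "a \<otimes> a = \<one>"
  shows "generate G {a} = {\<one>, a}"
proof
  have "subgroup {\<one>, a} G"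
    using assms inv_equality[OF assms(2)] by (intro subgroupI) auto
  then show "generate G {a} \<subseteq> {\<one>, a}" by (intro generate_subgroup_incl) auto
  show "{\<one>, a} \<subseteq> generate G {a}" by (auto intro: generate.one generate.incl)
qed

lemma generate_order_3:
  assumes "a \<in> carrier G" "a \<otimes> (a \<otimes> a) = \<one>"
  shows "generate G {a} = {\<one>, a, a \<otimes> a}"
proof
  have "a \<otimes> a \<otimes> a = \<one>" using assms by (simp add: m_assoc)
  then have "inv a = a \<otimes> a" "inv (a \<otimes> a) = a" "a \<otimes> a \<otimes> (a \<otimes> a) = a"
    using assms inv_equality[of "a \<otimes> a" a] inv_equality[of a "a \<otimes> a"] by (simp_all add: m_assoc)
  then have "subgroup {\<one>, a, a \<otimes> a} G"
    using assms \<open>a \<otimes> a \<otimes> a = \<one>\<close> by (intro subgroupI) auto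
  then show "generate G {a} \<subseteq> {\<one>, a, a \<otimes> a}" by (intro generate_subgroup_incl) auto
  show "{\<one>, a, a \<otimes> a} \<subseteq> generate G {a}"
    by (auto intro: generate.one generate.incl generate.eng)
qed

end

section \<open>Recognizing stabilizer elements, and the generic curve\<close>

context hesse_cubic
begin

definition lift :: "('k vec3 \<Rightarrow> 'k vec3) \<Rightarrow> 'k plane \<Rightarrow> 'k plane" where
  "lift L = restrict (induced L) E"

lemma lift_pt: "hesse_iso L \<Longrightarrow> on_hesse l v \<Longrightarrow> lift L (pt v) = pt (L v)"
  using induced_hesse_iso[of L v] pt_in_E[of v] by (simp add: lift_def)

lemma lift_stab:
  assumes "hesse_iso L" "pt (L (1, -1, 0)) = origin"
  shows "lift L \<in> stab"
proof -
  have "lift L \<in> lin_auts" unfolding lin_auts_def lift_def using assms(1) by blast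
  moreover have "lift L origin = origin"
    using assms(2) lift_pt[OF assms(1) on_hesse_origin] by (simp add: origin_def)
  ultimately show ?thesis by (simp add: stab_def)
qed

lemma stab_eqI:
  assumes "\<rho> \<in> stab" "\<rho>' \<in> stab" "\<And>v. on_hesse l v \<Longrightarrow> \<rho> (pt v) = \<rho>' (pt v)"
  shows "\<rho> = \<rho>'"
proof (rule Bij_eqI[OF stab_Bij[OF assms(1)] stab_Bij[OF assms(2)]])
  fix q assume "q \<in> E"
  then obtain v where "on_hesse l v" "q = pt v" by (rule hesse_curve_cases)
  then show "\<rho> q = \<rho>' q" using assms(3) by simp
qed

lemma stab_mult:
  assumes "\<rho> \<in> stab" "\<rho>' \<in> stab"
  shows "\<rho> \<otimes>\<^bsub>G\<^esub> \<rho>' \<in> stab" "q \<in> E \<Longrightarrow> (\<rho> \<otimes>\<^bsub>G\<^esub> \<rho>') q = \<rho> (\<rho>' q)"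
  using subgroup.m_closed[OF subgroup_stab assms] BijGroup_apply[OF stab_Bij[OF assms(1)] stab_Bij[OF assms(2)]]
  by blast+

lemma stab_carrier: "\<rho> \<in> stab \<Longrightarrow> \<rho> \<in> carrier G"
  using stab_Bij BijGroup_carrier by blast

text \<open>The constant \<open>c\<close> allows for relations that hold between the matrices only
  up to a scalar, such as the square of \<open>tauL\<close>.\<close>

lemma lift_comp:
  assumes "lift L \<in> stab" "lift L' \<in> stab" "hesse_iso L" "hesse_iso L'" "lift L'' \<in> stab" "hesse_iso L''"
    "c \<noteq> 0" "\<And>v. L (L' v) = smul3 c (L'' v)"
  shows "lift L \<otimes>\<^bsub>G\<^esub> lift L' = lift L''"
proof (rule stab_eqI[OF stab_mult(1)[OF assms(1,2)] assms(5)])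
  fix v assume v: "on_hesse l v"
  have "L'' v \<noteq> null3" using hesse_isoD(2)[OF assms(6), of v] v by (simp add: on_hesse_def)
  have "(lift L \<otimes>\<^bsub>G\<^esub> lift L') (pt v) = pt (L (L' v))"
    using stab_mult(2)[OF assms(1,2) pt_in_E[OF v]] lift_pt[OF assms(4) v] lift_pt[OF assms(3), of "L' v"]
      hesse_isoD(2)[OF assms(4), of v] v by simp
  also have "\<dots> = lift L'' (pt v)"
    using pt_smul[OF \<open>L'' v \<noteq> null3\<close> assms(7)] lift_pt[OF assms(6) v] assms(8) by simp
  finally show "(lift L \<otimes>\<^bsub>G\<^esub> lift L') (pt v) = lift L'' (pt v)" .
qed

lemma lift_one:
  assumes "lift L \<in> stab" "hesse_iso L" "\<And>v. L v = v"
  shows "lift L = \<one>\<^bsub>G\<^esub>"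
  by (rule stab_eqI[OF assms(1) one_stab]) (use lift_pt[OF assms(2)] assms(3) pt_in_E in \<open>simp add: BijGroup_one\<close>)

text \<open>The last clause is a recognition principle: a known map with the same diagonal in
  Weierstrass coordinates, up to scale, is equal to \<open>\<rho>\<close>.\<close>

lemma stab_diagonal:
  assumes "\<rho> \<in> stab"
  obtains \<alpha> \<beta> where "\<alpha> ^ 3 = \<beta>\<^sup>2" "wA * \<alpha> = \<beta>\<^sup>2 * wA" "wB = \<beta>\<^sup>2 * wB" "\<beta> \<noteq> 0"
    "\<And>L c. hesse_iso L \<Longrightarrow> lift L \<in> stab \<Longrightarrow> c \<noteq> 0 \<Longrightarrow>
       (\<And>v X Y Z. to_w v = (X, Y, Z) \<Longrightarrow> to_w (L v) = smul3 c (\<alpha> * X, \<beta> * Y, Z)) \<Longrightarrow> \<rho> = lift L"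
proof -
  have "\<rho> \<in> lin_auts" "\<rho> origin = origin" using assms by (simp_all add: stab_def)
  then obtain L where L: "hesse_iso L" "\<And>v. on_hesse l v \<Longrightarrow> \<rho> (pt v) = pt (L v)"
    using lin_auts_pt by metis
  have o: "pt (L (1, -1, 0)) = origin"
    using L(2)[OF on_hesse_origin] \<open>\<rho> origin = origin\<close> by (simp add: origin_def)
  obtain \<alpha> \<beta> \<gamma> where *: "\<gamma> \<noteq> 0" "\<And>v X Y Z. to_w v = (X, Y, Z) \<Longrightarrow> to_w (L v) = smul3 \<gamma> (\<alpha> * X, \<beta> * Y, Z)"
    "\<alpha> ^ 3 = \<beta>\<^sup>2" "wA * \<alpha> = \<beta>\<^sup>2 * wA" "wB = \<beta>\<^sup>2 * wB" "\<beta> \<noteq> 0"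
    using stabilizer_diagonal[OF hesse_isoD(1)[OF L(1)] _ o] hesse_isoD(2)[OF L(1)] by metis
  show ?thesis
  proof (rule that[OF *(3-6)])
    fix L' c
    assume L': "hesse_iso L'" "lift L' \<in> stab" "c \<noteq> 0"
      "\<And>v X Y Z. to_w v = (X, Y, Z) \<Longrightarrow> to_w (L' v) = smul3 c (\<alpha> * X, \<beta> * Y, Z)"
    show "\<rho> = lift L'"
    proof (rule stab_eqI[OF assms L'(2)])
      fix v assume v: "on_hesse l v"
      obtain X Y Z where w: "to_w v = (X, Y, Z)" by (cases "to_w v")
      have "L v = of_w (to_w (L v))" by (simp only: of_w_to_w)
      also have "\<dots> = of_w (smul3 \<gamma> (smul3 (1 / c) (to_w (L' v))))"
        using *(2)[OF w] L'(4)[OF w] L'(3) by (simp del: of_w.simps)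
      also have "\<dots> = of_w (to_w (smul3 (\<gamma> / c) (L' v)))"
        using lin3_smul[OF to_w_linear] by (simp add: smul3_smul3 del: of_w.simps to_w.simps)
      also have "\<dots> = smul3 (\<gamma> / c) (L' v)" by (simp only: of_w_to_w)
      finally have "L v = smul3 (\<gamma> / c) (L' v)" .
      moreover have "L' v \<noteq> null3" using hesse_isoD(2)[OF L'(1), of v] v by (simp add: on_hesse_def)
      ultimately have "pt (L v) = pt (L' v)" using pt_smul *(1) L'(3) by (metis divide_eq_0_iff)
      then show "\<rho> (pt v) = lift L' (pt v)" using L(2)[OF v] lift_pt[OF L'(1) v] by simp
    qed
  qed
qed

lemma lin_iso_id: "lin_iso (\<lambda>v :: 'k vec3. v)"
  by (rule lin_isoI) (simp_all add: lin3_def)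

lemma hesse_iso_id: "hesse_iso (\<lambda>v. v)"
  by (simp add: hesse_iso_def lin_iso_id)

lemma lift_id: "lift (\<lambda>v. v) \<in> stab" "lift (\<lambda>v. v) = \<one>\<^bsub>G\<^esub>"
proof -
  show 1: "lift (\<lambda>v. v) \<in> stab" by (rule lift_stab[OF hesse_iso_id]) (simp add: origin_def)
  show "lift (\<lambda>v. v) = \<one>\<^bsub>G\<^esub>" by (rule lift_one[OF 1 hesse_iso_id]) simp
qed

lemma hesse_iso_swap3: "hesse_iso swap3"
  by (rule hesse_isoI[of _ 1]) (simp_all add: lin_isoI[OF swap3_linear swap3_linear] swap3_swap3 hesse_form_swap3 del: split_paired_All)

lemma swap3_origin: "pt (swap3 (1, -1, 0)) = (origin :: 'k plane)"
  using pt_smul[of "(1, -1, 0)" "-1 :: 'k"] by (simp add: origin_def)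

abbreviation "negE \<equiv> lift swap3"

lemma negE_stab: "negE \<in> stab"
  by (rule lift_stab[OF hesse_iso_swap3 swap3_origin])

lemma negE_apply: "q \<in> E \<Longrightarrow> negE q = neg q"
  by (simp add: lift_def neg_def)

lemma negE_square: "negE \<otimes>\<^bsub>G\<^esub> negE = \<one>\<^bsub>G\<^esub>"
  using lift_comp[OF negE_stab negE_stab hesse_iso_swap3 hesse_iso_swap3 lift_id(1) hesse_iso_id, of 1]
  by (simp add: swap3_swap3 lift_id(2) del: swap3.simps split_paired_All)

text \<open>Moving summands across, -p = t + p with a flex t says 2p = -t.\<close>

lemma twisted_fix_negE:
  assumes "p \<in> E"
  shows "twisted_fix p negE \<longleftrightarrow> p \<oplus>\<^sub>E p \<in> flexes"
proof
  assume "twisted_fix p negE"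
  then obtain t where t: "t \<in> flexes" "neg p = t \<oplus>\<^sub>E p" unfolding twisted_fix_def negE_apply[OF assms] by blast
  have "origin = t \<oplus>\<^sub>E (p \<oplus>\<^sub>E p)"
    using t(2) add_neg_self[OF assms] flexes_assoc[OF t(1) assms assms] by simp
  then have "p \<oplus>\<^sub>E p = neg t"
    using neg_add_cancel(1)[OF flexes_E[OF t(1)] add_closed[OF assms assms]]
    by (simp add: add_origin_right neg_closed flexes_E[OF t(1)])
  then show "p \<oplus>\<^sub>E p \<in> flexes" using flexes_neg[OF t(1)] by simp
next
  assume *: "p \<oplus>\<^sub>E p \<in> flexes"
  have "neg (p \<oplus>\<^sub>E p) \<oplus>\<^sub>E p = neg p"
    using add_neg_cancel(1)[OF neg_closed[OF assms] assms] neg_add[OF assms assms]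
    by (metis add_neg_cancel add_commute assms neg_closed neg_neg)
  then show "twisted_fix p negE" unfolding twisted_fix_def negE_apply[OF assms] using flexes_neg[OF *] by metis
qed

lemma twisted_fix_one: "p \<in> E \<Longrightarrow> twisted_fix p \<one>\<^bsub>G\<^esub>"
  unfolding twisted_fix_def BijGroup_one
  by (rule bexI[OF _ flexes_origin]) (simp add: add_origin)

lemma to_w_swap3: "to_w v = (X, Y, Z) \<Longrightarrow> to_w (swap3 v) = smul3 1 (1 * X, - 1 * Y, Z)"
  by (cases v) (auto simp: algebra_simps)

lemma to_w_id: "to_w v = (X, Y, Z) \<Longrightarrow> to_w v = smul3 1 (1 * X, 1 * Y, Z)"
  by simp

lemma stab_generic:
  assumes "wA \<noteq> 0" "wB \<noteq> 0"
  shows "stab = {\<one>\<^bsub>G\<^esub>, negE}"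
proof
  show "stab \<subseteq> {\<one>\<^bsub>G\<^esub>, negE}"
  proof
    fix \<rho> assume "\<rho> \<in> stab"
    then obtain \<alpha> \<beta> where *: "wA * \<alpha> = \<beta>\<^sup>2 * wA" "wB = \<beta>\<^sup>2 * wB"
      "\<And>L c. hesse_iso L \<Longrightarrow> lift L \<in> stab \<Longrightarrow> c \<noteq> 0 \<Longrightarrow>
       (\<And>v X Y Z. to_w v = (X, Y, Z) \<Longrightarrow> to_w (L v) = smul3 c (\<alpha> * X, \<beta> * Y, Z)) \<Longrightarrow> \<rho> = lift L"
      using stab_diagonal by metis
    have b: "\<beta>\<^sup>2 = 1" using *(2) assms(2) by simp
    then have a: "\<alpha> = 1" using *(1) assms(1) by simp
    from b consider "\<beta> = 1" | "\<beta> = - 1" by (auto simp: power2_eq_1_iff)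
    then show "\<rho> \<in> {\<one>\<^bsub>G\<^esub>, negE}"
    proof cases
      case 1
      have "\<rho> = lift (\<lambda>v. v)" by (rule *(3)[OF hesse_iso_id lift_id(1), of 1]) (unfold a 1, simp, rule to_w_id)
      then show ?thesis using lift_id(2) by simp
    next
      case 2
      have "\<rho> = negE" by (rule *(3)[OF hesse_iso_swap3 negE_stab, of 1]) (unfold a 2, simp, rule to_w_swap3)
      then show ?thesis by simp
    qed
  qed
  show "{\<one>\<^bsub>G\<^esub>, negE} \<subseteq> stab" using one_stab negE_stab by simp
qed

lemma generic_Z_M:
  assumes "wA \<noteq> 0" "wB \<noteq> 0" "p \<in> E"
  shows "neg p \<noteq> p \<Longrightarrow> restr_on E (Z_set E (tr p)) = translation_group l 3"
    "neg p = p \<Longrightarrow> Z_set E (tr p) = Aut_down E"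
    "p \<oplus>\<^sub>E p \<notin> flexes \<Longrightarrow> restr_on E (M_set E (tr p)) = translation_group l 3"
    "p \<oplus>\<^sub>E p \<in> flexes \<Longrightarrow> M_set E (tr p) = Aut_down E"
proof -
  note S = stab_generic[OF assms(1,2)]
  have one: "\<one>\<^bsub>G\<^esub> p = p" using assms(3) by (simp add: BijGroup_one)
  show "restr_on E (Z_set E (tr p)) = translation_group l 3" if "neg p \<noteq> p"
  proof -
    have "{\<rho> \<in> stab. \<rho> p = p} = {\<one>\<^bsub>G\<^esub>}" using that one negE_apply[OF assms(3)] unfolding S by auto
    then show ?thesis using restr_Z_set[OF assms(3)] translation_group_3 by simp
  qed
  show "Z_set E (tr p) = Aut_down E" if "neg p = p"
  proof (rule Z_set_full[OF assms(3)])
    fix \<rho> assume "\<rho> \<in> stab"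
    then show "\<rho> p = p" using that one negE_apply[OF assms(3)] unfolding S by auto
  qed
  show "restr_on E (M_set E (tr p)) = translation_group l 3" if "p \<oplus>\<^sub>E p \<notin> flexes"
  proof -
    have "{\<rho> \<in> stab. twisted_fix p \<rho>} = {\<one>\<^bsub>G\<^esub>}"
      using that twisted_fix_one[OF assms(3)] twisted_fix_negE[OF assms(3)] unfolding S by auto
    then show ?thesis using restr_M_set[OF assms(3)] translation_group_3 by simp
  qed
  show "M_set E (tr p) = Aut_down E" if "p \<oplus>\<^sub>E p \<in> flexes"
  proof (rule M_set_full[OF assms(3)])
    fix \<rho> assume "\<rho> \<in> stab"
    then show "twisted_fix p \<rho>"
      using that twisted_fix_one[OF assms(3)] twisted_fix_negE[OF assms(3)] unfolding S by auto
  qed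
qed

end

section \<open>The curve with \<open>j = 0\<close>\<close>

lemma cube_root_of_unity_sum:
  fixes u :: "'k::field"
  assumes "u ^ 3 = 1" "u \<noteq> 1"
  shows "u\<^sup>2 + u + 1 = 0"
proof -
  have "(u - 1) * (u\<^sup>2 + u + 1) = u ^ 3 - 1" by (simp add: algebra_simps power2_eq_square power3_eq_cube)
  then show ?thesis using assms by (metis eq_iff_diff_eq_0 mult_eq_0_iff)
qed

lemma cube_root_of_unity_cases:
  fixes x u :: "'k::field"
  assumes "x ^ 3 = 1" "u ^ 3 = 1" "u \<noteq> 1"
  shows "x = 1 \<or> x = u \<or> x = u\<^sup>2"
proof -
  have u: "u + u\<^sup>2 = - 1"
    using cube_root_of_unity_sum[OF assms(2,3)] by (simp add: eq_neg_iff_add_eq_0 add.commute)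
  have "(x - u) * (x - u\<^sup>2) = x\<^sup>2 - x * (u + u\<^sup>2) + u ^ 3"
    by (simp add: algebra_simps power2_eq_square power3_eq_cube)
  also have "\<dots> = x\<^sup>2 + x + 1" unfolding u assms(2) by simp
  finally have "(x - 1) * ((x - u) * (x - u\<^sup>2)) = x ^ 3 - 1"
    by (simp add: algebra_simps power2_eq_square power3_eq_cube)
  then show ?thesis using assms(1) by simp
qed

context hesse_cubic
begin

text \<open>The converse of \<open>flexes_translation\<close>: each of the monomial maps is the
  translation by its value at the origin.\<close>

lemma flex_maps_translation:
  assumes "L \<in> flex_maps"
  obtains t where "t \<in> flexes" "\<And>Q. on_hesse l Q \<Longrightarrow> t \<oplus>\<^sub>E pt Q = pt (L Q)"
proof -
  define P where "P = L (1, -1, 0)"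
  have L: "transl_lin L" using flex_maps_transl_lin assms by blast
  note on = hesse_isoD(2)[OF transl_lin_hesse_iso[OF L]]
  have P: "on_hesse l P" unfolding P_def using on on_hesse_origin by blast
  have "tri (1, -1, 0) (1, -1, 0) (1 :: 'k, -1, 0)" by simp
  then have "tri P P P" using L unfolding P_def transl_lin_def by blast
  then have "pt P \<in> flexes" using flexes_pt[OF P] P by (simp add: flex_def)
  moreover have "pt P \<oplus>\<^sub>E pt Q = pt (L Q)" if Q: "on_hesse l Q" for Q
  proof -
    have "tri P Q (swap3 (L Q))" using L tri_origin[of Q] unfolding P_def transl_lin_def by blast
    moreover have "L Q \<noteq> null3" using Q on[of Q] by (simp add: on_hesse_def)
    ultimately show ?thesis using add_iff[OF P Q, of "L Q"] by simp
  qed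
  ultimately show ?thesis by (rule that)
qed

end

locale fermat_cubic = hesse_cubic l for l :: "'k::{alg_closed_field, field_char_0}" +
  fixes e :: 'k
  assumes l0: "l = 0" and e: "e ^ 3 = 1" "e \<noteq> 1"
begin

fun rotL :: "'k \<Rightarrow> 'k vec3 \<Rightarrow> 'k vec3" where
  "rotL \<alpha> (a, b, c) = (a, b, \<alpha> * c)"

lemma rotL_linear: "lin3 (rotL \<alpha>)"
  by (auto simp: lin3_def algebra_simps)

lemma rotL_iso: "\<alpha> ^ 3 = 1 \<Longrightarrow> hesse_iso (rotL \<alpha>)"
proof (rule hesse_isoI[of _ 1])
  assume \<alpha>: "\<alpha> ^ 3 = 1"
  then have 1: "\<alpha>\<^sup>2 * \<alpha> = 1" by (simp add: power2_eq_square power3_eq_cube)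
  then have "\<alpha>\<^sup>2 * (\<alpha> * c) = c" "\<alpha> * (\<alpha>\<^sup>2 * c) = c" for c
    by (simp_all only: mult.assoc[symmetric] mult.commute[of \<alpha> "\<alpha>\<^sup>2"] mult_1_left)
  then show "lin_iso (rotL \<alpha>)"
    by (intro lin_isoI[OF rotL_linear rotL_linear[of "\<alpha>\<^sup>2"]]) auto
  show "hesse_form l (rotL \<alpha> v) = 1 * hesse_form l v" for v
    using \<alpha> by (cases v) (simp add: l0 power_mult_distrib)
qed simp

lemma negrotL_iso: "\<alpha> ^ 3 = 1 \<Longrightarrow> hesse_iso (\<lambda>v. swap3 (rotL \<alpha> v))"
  by (rule hesse_iso_comp[OF hesse_iso_swap3 rotL_iso])

abbreviation "rot \<alpha> \<equiv> lift (rotL \<alpha>)"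
abbreviation "negrot \<alpha> \<equiv> lift (\<lambda>v. swap3 (rotL \<alpha> v))"

lemma rot_stab: "\<alpha> ^ 3 = 1 \<Longrightarrow> rot \<alpha> \<in> stab"
  by (rule lift_stab[OF rotL_iso]) (simp_all add: origin_def)

lemma negrot_stab: "\<alpha> ^ 3 = 1 \<Longrightarrow> negrot \<alpha> \<in> stab"
  by (rule lift_stab[OF negrotL_iso]) (use swap3_origin in simp_all)

lemma rot_one: "rot 1 = \<one>\<^bsub>G\<^esub>"
  by (rule lift_one[OF rot_stab rotL_iso]) (auto)

lemma negrot_one: "negrot 1 = negE"
proof -
  have "(\<lambda>v :: 'k vec3. swap3 (rotL 1 v)) = swap3" by auto
  then show ?thesis by simp
qed

lemma power_mult_one: "\<alpha> ^ 3 = 1 \<Longrightarrow> \<beta> ^ 3 = 1 \<Longrightarrow> (\<alpha> * \<beta>) ^ 3 = (1 :: 'k)"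
  by (simp add: power_mult_distrib)

lemma rot_mult:
  assumes "\<alpha> ^ 3 = 1" "\<beta> ^ 3 = 1"
  shows "rot \<alpha> \<otimes>\<^bsub>G\<^esub> rot \<beta> = rot (\<alpha> * \<beta>)" "negrot \<alpha> \<otimes>\<^bsub>G\<^esub> rot \<beta> = negrot (\<alpha> * \<beta>)"
    "negrot \<alpha> \<otimes>\<^bsub>G\<^esub> negrot \<beta> = rot (\<alpha> * \<beta>)"
proof -
  note p = power_mult_one[OF assms]
  show "rot \<alpha> \<otimes>\<^bsub>G\<^esub> rot \<beta> = rot (\<alpha> * \<beta>)"
    by (rule lift_comp[of _ _ _ 1]) (use assms p in \<open>auto intro!: rot_stab rotL_iso simp: algebra_simps\<close>)
  show "negrot \<alpha> \<otimes>\<^bsub>G\<^esub> rot \<beta> = negrot (\<alpha> * \<beta>)"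
    by (rule lift_comp[of _ _ _ 1]) (use assms p in \<open>auto intro!: rot_stab rotL_iso negrot_stab negrotL_iso simp: algebra_simps\<close>)
  show "negrot \<alpha> \<otimes>\<^bsub>G\<^esub> negrot \<beta> = rot (\<alpha> * \<beta>)"
    by (rule lift_comp[of _ _ _ 1]) (use assms p in \<open>auto intro!: rot_stab rotL_iso negrot_stab negrotL_iso simp: algebra_simps\<close>)
qed

lemma wB_nonzero: "wB \<noteq> 0"
  unfolding wB_def unfolding l0 by simp

lemma to_w_rotL: "to_w v = (X, Y, Z) \<Longrightarrow> to_w (rotL \<alpha> v) = smul3 1 (\<alpha> * X, 1 * Y, Z)"
proof -
  obtain a b c where v: "v = (a, b, c)" by (cases v)
  assume "to_w v = (X, Y, Z)"
  then have "X = c - l\<^sup>2 * (kap * (a + b + l * c))" "Y = a - b" "Z = kap * (a + b + l * c)"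
    unfolding v by auto
  moreover have "to_w (rotL \<alpha> v) = (\<alpha> * c - l\<^sup>2 * (kap * (a + b + l * (\<alpha> * c))), a - b, kap * (a + b + l * (\<alpha> * c)))"
    unfolding v by simp
  ultimately show ?thesis using l0 by simp
qed

lemma to_w_negrotL:
  assumes "to_w v = (X, Y, Z)"
  shows "to_w (swap3 (rotL \<alpha> v)) = smul3 1 (\<alpha> * X, - 1 * Y, Z)"
proof -
  have "to_w (rotL \<alpha> v) = (\<alpha> * X, Y, Z)" using to_w_rotL[OF assms] by simp
  from to_w_swap3[OF this] show ?thesis by simp
qed

lemma stab_fermat:
  assumes "\<rho> \<in> stab"
  obtains \<alpha> where "\<alpha> ^ 3 = 1" "\<rho> = rot \<alpha> \<or> \<rho> = negrot \<alpha>"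
proof -
  obtain \<alpha> \<beta> where *: "\<alpha> ^ 3 = \<beta>\<^sup>2" "wB = \<beta>\<^sup>2 * wB"
      "\<And>L c. hesse_iso L \<Longrightarrow> lift L \<in> stab \<Longrightarrow> c \<noteq> 0 \<Longrightarrow>
       (\<And>v X Y Z. to_w v = (X, Y, Z) \<Longrightarrow> to_w (L v) = smul3 c (\<alpha> * X, \<beta> * Y, Z)) \<Longrightarrow> \<rho> = lift L"
      using stab_diagonal[OF assms] by metis
  have b: "\<beta>\<^sup>2 = 1" using *(2) wB_nonzero by simp
  then have a: "\<alpha> ^ 3 = 1" using *(1) by simp
  from b consider "\<beta> = 1" | "\<beta> = - 1" by (auto simp: power2_eq_1_iff)
  then have "\<rho> = rot \<alpha> \<or> \<rho> = negrot \<alpha>"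
  proof cases
    case 1
    have "\<rho> = rot \<alpha>" by (rule *(3)[OF rotL_iso[OF a] rot_stab[OF a], of 1]) (unfold 1, simp, rule to_w_rotL)
    then show ?thesis ..
  next
    case 2
    have "\<rho> = negrot \<alpha>" by (rule *(3)[OF negrotL_iso[OF a] negrot_stab[OF a], of 1]) (unfold 2, simp, rule to_w_negrotL)
    then show ?thesis ..
  qed
  then show ?thesis using that a by blast
qed

lemma tau_eq: "tau_E l e = negrot e"
proof -
  have "(\<lambda>(a, b, c). if l = 0 then (b, a, e * c)
     else if (l - 1) ^ 2 = 3 then (e ^ 2 * a + e * b + c, e * a + e ^ 2 * b + c, a + b + c)
     else (b, a, c)) = (\<lambda>v. swap3 (rotL e v))"
    by (auto simp: l0)
  then show ?thesis unfolding tau_E_def lift_def by simp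
qed

lemma e2: "(e\<^sup>2) ^ 3 = 1"
  using e(1) by (simp add: power_mult_distrib power2_eq_square)

text \<open>The two swaps in the square of \<tau> cancel and leave the rotation by e^2, of order
  three.\<close>

lemma generate_tau_2: "generate G {tau_E l e [^]\<^bsub>G\<^esub> (2::nat)} = {rot \<alpha> |\<alpha>. \<alpha> ^ 3 = 1}"
proof -
  have t: "tau_E l e [^]\<^bsub>G\<^esub> (2::nat) = rot (e\<^sup>2)"
    using rot_mult(3)[OF e(1) e(1)] stab_carrier[OF negrot_stab[OF e(1)]] by (simp add: tau_eq numeral_2_eq_2)
  have "e\<^sup>2 * e\<^sup>2 = e ^ 3 * e" by (simp add: power2_eq_square power3_eq_cube)
  then have ee: "e\<^sup>2 * e\<^sup>2 = e" using e(1) by simp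
  have s: "rot (e\<^sup>2) \<otimes>\<^bsub>G\<^esub> rot (e\<^sup>2) = rot e" using rot_mult(1)[OF e2 e2] ee by simp
  have "e\<^sup>2 * e = 1" using e(1) by (simp add: power2_eq_square power3_eq_cube)
  then have c: "rot (e\<^sup>2) \<otimes>\<^bsub>G\<^esub> rot e = \<one>\<^bsub>G\<^esub>" using rot_mult(1)[OF e2 e(1)] rot_one by simp
  have "generate G {rot (e\<^sup>2)} = {\<one>\<^bsub>G\<^esub>, rot (e\<^sup>2), rot e}"
    using G.generate_order_3[OF stab_carrier[OF rot_stab[OF e2]]] s c by simp
  also have "\<dots> = {rot \<alpha> |\<alpha>. \<alpha> ^ 3 = 1}"
    unfolding rot_one[symmetric] using e(1) e2 cube_root_of_unity_cases[OF _ e] by auto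
  finally show ?thesis unfolding t .
qed

text \<open>Of three swaps one is left, while the rotations multiply to e^3 = 1.\<close>

lemma generate_tau_3: "generate G {tau_E l e [^]\<^bsub>G\<^esub> (3::nat)} = {\<one>\<^bsub>G\<^esub>, negE}"
proof -
  have "e * e * e = 1" using e(1) by (simp add: power3_eq_cube)
  then have "e * (e * e) = 1" by (simp add: mult.assoc)
  moreover have "tau_E l e [^]\<^bsub>G\<^esub> (3::nat) = negrot e \<otimes>\<^bsub>G\<^esub> (negrot e \<otimes>\<^bsub>G\<^esub> negrot e)"
    using stab_carrier[OF negrot_stab[OF e(1)]] by (simp add: tau_eq numeral_3_eq_3 G.m_assoc)
  ultimately have "tau_E l e [^]\<^bsub>G\<^esub> (3::nat) = negE"
    using rot_mult(3)[OF e(1) e(1)] rot_mult(2)[OF e(1) power_mult_one[OF e(1) e(1)]] by (simp add: negrot_one)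
  then show ?thesis using G.generate_involution[OF stab_carrier[OF negE_stab] negE_square] by simp
qed

text \<open>Off the flexes all coordinates are nonzero, so their ratios determine
  \<open>\<alpha>\<close>; with the swap they give \<alpha>^2 = 1 besides \<alpha>^3 = 1.\<close>

lemma rot_fixed:
  assumes "\<alpha> ^ 3 = 1" "p \<in> E" "p \<notin> flexes"
  shows "rot \<alpha> p = p \<Longrightarrow> \<alpha> = 1" "negrot \<alpha> p = p \<Longrightarrow> \<alpha> = 1"
proof -
  obtain v where v: "on_hesse l v" "p = pt v" using assms(2) by (rule hesse_curve_cases)
  obtain a b c where abc: "v = (a, b, c)" by (cases v)
  have nz: "a \<noteq> 0" "b \<noteq> 0" "c \<noteq> 0"
    using assms(3) v flexes_pt[OF v(1)] unfolding abc by (auto simp: flex_iff)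
  have n: "v \<noteq> null3" "rotL \<alpha> v \<noteq> null3" "swap3 (rotL \<alpha> v) \<noteq> null3" using nz by (simp_all add: abc)
  show "\<alpha> = 1" if "rot \<alpha> p = p"
  proof -
    have "pt v = pt (rotL \<alpha> v)" using that lift_pt[OF rotL_iso[OF assms(1)] v(1)] v(2) by simp
    then have "cross3 v (rotL \<alpha> v) = null3" using pt_eq_iff_cross3[OF n(1,2)] by blast
    then have "b * (\<alpha> * c) = c * b" by (simp add: abc)
    then show ?thesis using nz by simp
  qed
  show "\<alpha> = 1" if "negrot \<alpha> p = p"
  proof -
    have "pt v = pt (swap3 (rotL \<alpha> v))" using that lift_pt[OF negrotL_iso[OF assms(1)] v(1)] v(2) by simp
    then have "cross3 v (swap3 (rotL \<alpha> v)) = null3" using pt_eq_iff_cross3[OF n(1,3)] by blast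
    then have *: "b * (\<alpha> * c) = c * a" "c * b = a * (\<alpha> * c)" by (simp_all add: abc)
    then have "c * (b * \<alpha>) = c * a" "c * b = c * (a * \<alpha>)" by (simp_all add: ac_simps)
    then have "b * \<alpha> = a" "b = a * \<alpha>" using nz(3) by simp_all
    then have "b * (\<alpha> * \<alpha>) = b * 1" by (simp add: ac_simps)
    then have "\<alpha> * \<alpha> = 1" using nz(2) by simp
    then show ?thesis using assms(1) by (simp add: power3_eq_cube)
  qed
qed

text \<open>The ratios of the cubes of the coordinates are cube roots of unity whose sum with 1
  vanishes by the equation of the curve, so they are the two primitive ones.\<close>

lemma ninth_power_point_cases:
  assumes "p \<in> ninth_power_points l"
  obtains a b c u where "on_hesse l (a, b, c)" "p = pt (a, b, c)" "a \<noteq> 0" "b \<noteq> 0" "c \<noteq> 0"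
    "b ^ 3 = u * a ^ 3" "c ^ 3 = u\<^sup>2 * a ^ 3" "u ^ 3 = 1" "u \<noteq> 1"
proof -
  obtain a b c where p: "p = pt (a, b, c)" "on_hesse l (a, b, c)" and
    ab: "a ^ 9 = b ^ 9" "b ^ 9 = c ^ 9" and n: "(a, b, c) \<noteq> null3"
    using assms unfolding ninth_power_points_def on_hesse_def by blast
  have nz: "a \<noteq> 0" "b \<noteq> 0" "c \<noteq> 0" using ab n by (auto simp: power_0_left)
  define u v where "u = b ^ 3 / a ^ 3" and "v = c ^ 3 / a ^ 3"
  have b: "b ^ 3 = u * a ^ 3" and c: "c ^ 3 = v * a ^ 3" using nz(1) by (simp_all add: u_def v_def)
  have nine: "x ^ 9 = (x ^ 3) ^ 3" for x :: 'k by (simp flip: power_mult)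
  have "u ^ 3 * a ^ 9 = b ^ 9" "v ^ 3 * a ^ 9 = c ^ 9" unfolding nine b c by (simp_all add: power_mult_distrib)
  then have u3: "u ^ 3 = 1" and v3: "v ^ 3 = 1" using ab nz by simp_all
  have "a ^ 3 + b ^ 3 + c ^ 3 = 0" using p(2) by (simp add: on_hesse_def l0)
  then have "(1 + u + v) * a ^ 3 = 0" unfolding b c by (simp add: algebra_simps)
  then have sum: "1 + u + v = 0" using nz(1) by simp
  have u1: "u \<noteq> 1"
  proof
    assume "u = 1"
    then have "v = - 2" using sum by (simp add: eq_neg_iff_add_eq_0 add.commute)
    then show False using v3 by simp
  qed
  have v: "v = u\<^sup>2"
  proof -
    have "u\<^sup>2 + (u + 1) = v + (u + 1)" using sum cube_root_of_unity_sum[OF u3 u1] by (simp add: ac_simps)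
    then show ?thesis by simp
  qed
  show ?thesis by (rule that[OF p(2,1) nz b c[unfolded v] u3 u1])
qed

text \<open>A factor that permutes the three cubes cyclically is itself a cube root of unity, which
  makes the ninth powers agree. The two orders belong to the two nontrivial cyclic shifts.\<close>

lemma ninth_power_pointI:
  assumes "on_hesse l (a, b, c)" "s * x = y" "s * y = z" "s * z = x" "x \<noteq> 0"
    "x = a ^ 3 \<and> y = b ^ 3 \<and> z = c ^ 3 \<or> x = a ^ 3 \<and> y = c ^ 3 \<and> z = b ^ 3"
  shows "pt (a, b, c) \<in> ninth_power_points l"
proof -
  have "s * (s * s) * x = 1 * x" using assms(2-4) by (simp add: mult.assoc)
  then have "s ^ 3 = 1" using assms(5) by (simp add: power3_eq_cube mult.assoc)
  then have "y ^ 3 = x ^ 3" "z ^ 3 = x ^ 3"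
    unfolding assms(3)[symmetric] assms(2)[symmetric] by (simp_all add: power_mult_distrib)
  moreover have "w ^ 9 = (w ^ 3) ^ 3" for w :: 'k by (simp flip: power_mult)
  ultimately have "a ^ 9 = b ^ 9" "b ^ 9 = c ^ 9" using assms(6) by auto
  then show ?thesis using assms(1) unfolding ninth_power_points_def on_hesse_def by blast
qed

text \<open>Cubing the coordinate equations removes all roots of unity. A diagonal translate would
  force \<open>\<alpha> = 1\<close>; for a cyclic shift the cubed scale factor permutes the cubes of
  the coordinates.\<close>

lemma twisted_fix_rot_ninth:
  assumes \<alpha>: "\<alpha> ^ 3 = 1" "\<alpha> \<noteq> 1" and p: "p \<in> E" "p \<notin> flexes" and tw: "twisted_fix p (rot \<alpha>)"
  shows "p \<in> ninth_power_points l"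
proof -
  obtain v where v: "on_hesse l v" "p = pt v" using p(1) by (rule hesse_curve_cases)
  obtain a b c where abc: "v = (a, b, c)" by (cases v)
  have nz: "a \<noteq> 0" "b \<noteq> 0" "c \<noteq> 0"
    using p(2) v flexes_pt[OF v(1)] unfolding abc by (auto simp: flex_iff)
  obtain t where t: "t \<in> flexes" "rot \<alpha> p = t \<oplus>\<^sub>E p" using tw unfolding twisted_fix_def by blast
  obtain L where L: "L \<in> flex_maps" "t \<oplus>\<^sub>E pt v = pt (L v)" "on_hesse l (L v)"
    using flexes_translation[OF t(1)] v(1) by metis
  have "pt (rotL \<alpha> v) = pt (L v)" using t(2) L(2) lift_pt[OF rotL_iso[OF \<alpha>(1)] v(1)] v(2) by simp
  then obtain s where s: "s \<noteq> 0" "L v = smul3 s (rotL \<alpha> v)"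
    using pt_eq_iff[of "rotL \<alpha> v" "L v"] nz L(3) by (auto simp: abc on_hesse_def)
  obtain k where k: "k ^ 3 = 1" "L = diag3 k \<or> L = cyc3 \<circ> diag3 k \<or> L = cyc3 \<circ> (cyc3 \<circ> diag3 k)"
    using L(1) unfolding flex_maps_def by blast
  have "(k\<^sup>2) ^ 3 = (k ^ 3)\<^sup>2" by (simp only: power_mult[symmetric] mult.commute)
  then have k2: "(k\<^sup>2) ^ 3 = 1" using k(1) by simp
  have cube: "(k * x) ^ 3 = x ^ 3" "(k\<^sup>2 * x) ^ 3 = x ^ 3" "(\<alpha> * x) ^ 3 = x ^ 3" for x
    using k(1) k2 \<alpha>(1) by (simp_all only: power_mult_distrib mult_1_left)
  consider "L = diag3 k" | "L = cyc3 \<circ> diag3 k" | "L = cyc3 \<circ> (cyc3 \<circ> diag3 k)" using k(2) by blast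
  then show ?thesis
  proof cases
    case 1
    then have *: "a = s * a" "k * b = s * b" "k\<^sup>2 * c = s * (\<alpha> * c)" using s(2) by (simp_all add: abc diag3_def)
    then have "s = 1" "k = s" using nz by simp_all
    then show ?thesis using *(3) \<alpha>(2) nz(3) by simp
  next
    case 2
    then have *: "k * b = s * a" "k\<^sup>2 * c = s * b" "a = s * (\<alpha> * c)" using s(2) by (simp_all add: abc diag3_def)
    have "s ^ 3 * a ^ 3 = b ^ 3" using arg_cong[OF *(1), of "\<lambda>x. x ^ 3"] by (simp add: cube(1) power_mult_distrib[of s])
    moreover have "s ^ 3 * b ^ 3 = c ^ 3" using arg_cong[OF *(2), of "\<lambda>x. x ^ 3"] by (simp add: cube(2) power_mult_distrib[of s])
    moreover have "s ^ 3 * c ^ 3 = a ^ 3" using arg_cong[OF *(3), of "\<lambda>x. x ^ 3"] by (simp add: cube(3) power_mult_distrib[of s])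
    ultimately show ?thesis
      unfolding v(2) abc using v(1) nz(1) by (intro ninth_power_pointI[of a b c "s ^ 3" "a ^ 3" "b ^ 3" "c ^ 3"]) (simp_all add: abc)
  next
    case 3
    then have *: "k\<^sup>2 * c = s * a" "a = s * b" "k * b = s * (\<alpha> * c)" using s(2) by (simp_all add: abc diag3_def)
    have "s ^ 3 * a ^ 3 = c ^ 3" using arg_cong[OF *(1), of "\<lambda>x. x ^ 3"] by (simp add: cube(2) power_mult_distrib[of s])
    moreover have "s ^ 3 * b ^ 3 = a ^ 3" using arg_cong[OF *(2), of "\<lambda>x. x ^ 3"] by (simp add: power_mult_distrib[of s])
    moreover have "s ^ 3 * c ^ 3 = b ^ 3" using arg_cong[OF *(3), of "\<lambda>x. x ^ 3"] by (simp add: cube power_mult_distrib[of s])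
    ultimately show ?thesis
      unfolding v(2) abc using v(1) nz(1) by (intro ninth_power_pointI[of a b c "s ^ 3" "a ^ 3" "c ^ 3" "b ^ 3"]) (simp_all add: abc)
  qed
qed

lemma ninth_twisted_fix_rot:
  assumes "p \<in> ninth_power_points l" "\<alpha> ^ 3 = 1"
  shows "twisted_fix p (rot \<alpha>)"
proof -
  obtain a b c u where p: "on_hesse l (a, b, c)" "p = pt (a, b, c)" and nz: "a \<noteq> 0" "b \<noteq> 0" "c \<noteq> 0"
    and u: "b ^ 3 = u * a ^ 3" "c ^ 3 = u\<^sup>2 * a ^ 3" "u ^ 3 = 1" "u \<noteq> 1"
    using assms(1) by (rule ninth_power_point_cases)
  have pE: "p \<in> E" using p pt_in_E by simp
  \<comment> \<open>\<open>k\<close> and \<open>s\<close> solve the equations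
    \<open>k\<^sup>2 * c = s * a\<close>, \<open>a = s * b\<close> and
    \<open>k * b = s * (u * c)\<close> expressing that the shifted diagonal map agrees with the
    rotation by \<open>u\<close>; the relations between the cubes leave only powers of
    \<open>a\<close> in the denominators.\<close>
  define k where "k = b * c / a\<^sup>2"
  define s where "s = b\<^sup>2 * c ^ 3 / a ^ 5"
  have a: "a ^ 5 = a\<^sup>2 * a ^ 3" by (simp flip: power_add)
  have s: "s = (u * b) * (u * b) / a\<^sup>2" unfolding s_def a u(2) using nz by (simp add: power2_eq_square)
  have uu: "u * u\<^sup>2 = 1" "u * (u * u) = 1" using u(3) by (simp_all add: power2_eq_square power3_eq_cube mult.assoc)
  have bb: "b * (b * b) = u * (a * (a * a))" and cc: "c * (c * c) = u\<^sup>2 * (a * (a * a))"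
    using u(1,2) by (simp_all add: power3_eq_cube mult.assoc)
  have "k ^ 3 = b ^ 3 * c ^ 3 / (a\<^sup>2) ^ 3" by (simp add: k_def power_divide power_mult_distrib)
  also have "\<dots> = u ^ 3 * (a ^ 3 * a ^ 3) / (a\<^sup>2) ^ 3" unfolding u(1,2) by (simp add: power2_eq_square power3_eq_cube)
  also have "a ^ 3 * a ^ 3 = (a\<^sup>2) ^ 3" by (simp add: power2_eq_square power3_eq_cube)
  finally have k: "k ^ 3 = 1" using nz(1) u(3) by simp
  define L where "L = cyc3 \<circ> (cyc3 \<circ> diag3 k)"
  have "L \<in> flex_maps" unfolding L_def flex_maps_def using k by blast
  then obtain t where t: "t \<in> flexes" "t \<oplus>\<^sub>E p = pt (L (a, b, c))" using flex_maps_translation p by metis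
  have 1: "k\<^sup>2 * c = s * a"
    unfolding s_def k_def a using nz by (simp add: field_simps power2_eq_square power3_eq_cube)
  have 2: "a = s * b"
  proof -
    have "s * b = (u * u) * (b * (b * b)) / a\<^sup>2" unfolding s by (simp add: ac_simps)
    also have "\<dots> = (u * (u * u)) * (a * (a * a)) / a\<^sup>2" unfolding bb by (simp add: ac_simps)
    finally show ?thesis using nz(1) uu(2) by (simp add: power2_eq_square)
  qed
  have 3: "k * b = s * (u * c)"
  proof -
    have "s * (u * c) = (u * (u * u)) * (b * b * c / a\<^sup>2)" unfolding s by (simp add: ac_simps)
    then show ?thesis using uu(2) unfolding k_def by (simp add: ac_simps)
  qed
  have s0: "s \<noteq> 0" using 2 nz by auto
  have "L (a, b, c) = smul3 s (rotL u (a, b, c))"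
    unfolding L_def using 1 2[symmetric] 3 by (simp add: diag3_def)
  then have "pt (L (a, b, c)) = pt (rotL u (a, b, c))" using pt_smul[of "rotL u (a, b, c)" s] s0 nz by simp
  then have ru: "twisted_fix p (rot u)"
    unfolding twisted_fix_def using t lift_pt[OF rotL_iso[OF u(3)] p(1)] p(2) by metis
  \<comment> \<open>The rotation by the ratio \<open>u\<close> attached to the point is found
    directly; every other one is a power of it.\<close>
  then have "twisted_fix p (rot (u * u))"
    using twisted_fix_comp[OF pE rot_stab[OF u(3)] rot_stab[OF u(3)]] rot_mult(1)[OF u(3) u(3)] by simp
  moreover have "twisted_fix p (rot 1)" using twisted_fix_one[OF pE] rot_one by simp
  ultimately show ?thesis using ru cube_root_of_unity_cases[OF assms(2) u(3,4)] by (auto simp: power2_eq_square)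
qed

text \<open>The cubes of the three coordinates are distinct, so 2p is not a flex. This keeps the
  cases of order two and order three of M apart.\<close>

lemma ninth_double:
  assumes "p \<in> ninth_power_points l"
  shows "p \<oplus>\<^sub>E p \<notin> flexes"
proof
  assume *: "p \<oplus>\<^sub>E p \<in> flexes"
  obtain a b c u where p: "on_hesse l (a, b, c)" "p = pt (a, b, c)" and nz: "a \<noteq> 0" "b \<noteq> 0" "c \<noteq> 0"
    and u: "b ^ 3 = u * a ^ 3" "c ^ 3 = u\<^sup>2 * a ^ 3" "u ^ 3 = 1" "u \<noteq> 1"
    using assms by (rule ninth_power_point_cases)
  have u2: "u\<^sup>2 \<noteq> 1" using u(3,4) by (auto simp: power2_eq_square power3_eq_cube)
  have "u \<noteq> 0" using u(3) by auto
  then have u3: "u \<noteq> u\<^sup>2" using u(4) by (simp add: power2_eq_square)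
  have "a ^ 3 = b ^ 3 \<or> b ^ 3 = c ^ 3 \<or> c ^ 3 = a ^ 3"
    using * double_flex_iff[OF p(1)] nz unfolding p(2) by blast
  then show False unfolding u(1,2) using nz(1) u(4) u2 u3 by auto
qed

text \<open>The square of \<open>negrot \<alpha>\<close> is a pure rotation and its third power is
  \<open>negE\<close>. The latter puts 2p into E[3], and then \<open>ninth_double\<close> leaves no
  nontrivial rotation.\<close>

lemma twisted_fix_negrot:
  assumes "\<alpha> ^ 3 = 1" "p \<in> E" "p \<notin> flexes" "twisted_fix p (negrot \<alpha>)"
  shows "p \<oplus>\<^sub>E p \<in> flexes" "\<alpha> = 1"
proof -
  have aa: "(\<alpha> * \<alpha>) ^ 3 = 1" by (rule power_mult_one[OF assms(1,1)])
  have aaa: "\<alpha> * (\<alpha> * \<alpha>) = 1" using assms(1) by (simp add: power3_eq_cube mult.assoc)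
  have sq: "twisted_fix p (rot (\<alpha> * \<alpha>))"
    using twisted_fix_comp[OF assms(2) negrot_stab[OF assms(1)] negrot_stab[OF assms(1)] assms(4,4)]
      rot_mult(3)[OF assms(1,1)] by simp
  then have "twisted_fix p negE"
    using twisted_fix_comp[OF assms(2) negrot_stab[OF assms(1)] rot_stab[OF aa] assms(4)]
      rot_mult(2)[OF assms(1) aa] aaa negrot_one by simp
  then show *: "p \<oplus>\<^sub>E p \<in> flexes" using twisted_fix_negE[OF assms(2)] by simp
  have "\<alpha> * \<alpha> = 1"
    using twisted_fix_rot_ninth[OF aa _ assms(2,3) sq] ninth_double * by blast
  then show "\<alpha> = 1" using aaa by simp
qed

lemma subgroup_generate_stab: "a \<in> stab \<Longrightarrow> subgroup (generate G {a}) G"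
  using G.generate_is_subgroup[of "{a}"] stab_carrier[of a] by simp

lemma negE_subgroup: "subgroup {\<one>\<^bsub>G\<^esub>, negE} G" "{\<one>\<^bsub>G\<^esub>, negE} \<subseteq> stab"
  using subgroup_generate_stab[OF negE_stab] G.generate_involution[OF stab_carrier[OF negE_stab] negE_square]
    one_stab negE_stab by simp_all

lemma fermat_Z_M:
  assumes p: "p \<in> E" "p \<notin> flexes"
  shows "neg p \<noteq> p \<Longrightarrow> restr_on E (Z_set E (tr p)) = translation_group l 3"
    "neg p = p \<Longrightarrow> is_semidirect G (restr_on E (Z_set E (tr p))) (translation_group l 3)
       (generate G {tau_E l e [^]\<^bsub>G\<^esub> (3::nat)})"
    "p \<notin> ninth_power_points l \<Longrightarrow> p \<oplus>\<^sub>E p \<notin> flexes \<Longrightarrow> restr_on E (M_set E (tr p)) = translation_group l 3"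
    "p \<in> ninth_power_points l \<Longrightarrow> is_semidirect G (restr_on E (M_set E (tr p))) (translation_group l 3)
       (generate G {tau_E l e [^]\<^bsub>G\<^esub> (2::nat)})"
    "p \<oplus>\<^sub>E p \<in> flexes \<Longrightarrow> is_semidirect G (restr_on E (M_set E (tr p))) (translation_group l 3)
       (generate G {tau_E l e [^]\<^bsub>G\<^esub> (3::nat)})"
proof -
  have one: "\<one>\<^bsub>G\<^esub> p = p" using p(1) by (simp add: BijGroup_one)
  note tw = twisted_fix_one[OF p(1)] and n = twisted_fix_negE[OF p(1)]
  have Z: "\<rho> = \<one>\<^bsub>G\<^esub> \<or> \<rho> = negE" if "\<rho> \<in> stab" "\<rho> p = p" for \<rho>
    using stab_fermat[OF that(1)] rot_fixed[OF _ p] that(2) rot_one negrot_one by metis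
  have M: "\<rho> = \<one>\<^bsub>G\<^esub> \<or> p \<in> ninth_power_points l \<and> (\<exists>\<alpha>. \<alpha> ^ 3 = 1 \<and> \<rho> = rot \<alpha>) \<or> p \<oplus>\<^sub>E p \<in> flexes \<and> \<rho> = negE"
    if "\<rho> \<in> stab" "twisted_fix p \<rho>" for \<rho>
    using stab_fermat[OF that(1)] twisted_fix_rot_ninth[OF _ _ p] twisted_fix_negrot[OF _ p] that(2) rot_one negrot_one
    by metis
  show "restr_on E (Z_set E (tr p)) = translation_group l 3" if "neg p \<noteq> p"
  proof -
    have "{\<rho> \<in> stab. \<rho> p = p} = {\<one>\<^bsub>G\<^esub>}" using Z that one one_stab negE_apply[OF p(1)] by fastforce
    then show ?thesis using restr_Z_set[OF p(1)] translation_group_3 by simp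
  qed
  show "is_semidirect G (restr_on E (Z_set E (tr p))) (translation_group l 3)
       (generate G {tau_E l e [^]\<^bsub>G\<^esub> (3::nat)})" if "neg p = p"
  proof -
    have "{\<rho> \<in> stab. \<rho> p = p} = {\<one>\<^bsub>G\<^esub>, negE}"
      using Z that one one_stab negE_stab negE_apply[OF p(1)] by auto
    then show ?thesis using restr_Z_set[OF p(1)] semidirect_combs[OF negE_subgroup] generate_tau_3 by simp
  qed
  show "restr_on E (M_set E (tr p)) = translation_group l 3"
    if "p \<notin> ninth_power_points l" "p \<oplus>\<^sub>E p \<notin> flexes"
  proof -
    have "{\<rho> \<in> stab. twisted_fix p \<rho>} = {\<one>\<^bsub>G\<^esub>}" using M that tw one_stab by blast
    then show ?thesis using restr_M_set[OF p(1)] translation_group_3 by simp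
  qed
  show "is_semidirect G (restr_on E (M_set E (tr p))) (translation_group l 3)
       (generate G {tau_E l e [^]\<^bsub>G\<^esub> (2::nat)})" if "p \<in> ninth_power_points l"
  proof -
    have "{\<rho> \<in> stab. twisted_fix p \<rho>} = {rot \<alpha> |\<alpha>. \<alpha> ^ 3 = 1}"
    proof
      show "{\<rho> \<in> stab. twisted_fix p \<rho>} \<subseteq> {rot \<alpha> |\<alpha>. \<alpha> ^ 3 = 1}"
        using M ninth_double[OF that] rot_one power_one[of 3] by (smt (verit) mem_Collect_eq subsetI)
      show "{rot \<alpha> |\<alpha>. \<alpha> ^ 3 = 1} \<subseteq> {\<rho> \<in> stab. twisted_fix p \<rho>}"
        using ninth_twisted_fix_rot[OF that] rot_stab by auto
    qed
    then have eq: "{\<rho> \<in> stab. twisted_fix p \<rho>} = generate G {tau_E l e [^]\<^bsub>G\<^esub> (2::nat)}"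
      using generate_tau_2 by simp
    have "is_semidirect G (combs {\<rho> \<in> stab. twisted_fix p \<rho>}) (translation_group l 3) {\<rho> \<in> stab. twisted_fix p \<rho>}"
      by (rule semidirect_combs[OF subgroup_twisted_fix[OF p(1)]]) blast
    then show ?thesis unfolding restr_M_set[OF p(1)] eq .
  qed
  show "is_semidirect G (restr_on E (M_set E (tr p))) (translation_group l 3)
       (generate G {tau_E l e [^]\<^bsub>G\<^esub> (3::nat)})" if "p \<oplus>\<^sub>E p \<in> flexes"
  proof -
    have "{\<rho> \<in> stab. twisted_fix p \<rho>} = {\<one>\<^bsub>G\<^esub>, negE}"
      using M that tw n one_stab negE_stab ninth_double by blast
    then show ?thesis using restr_M_set[OF p(1)] semidirect_combs[OF negE_subgroup] generate_tau_3 by simp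
  qed
qed

end

section \<open>Subgroups of the group of points\<close>

context hesse_cubic
begin

text \<open>The inverse is computed from its description, as the unique solution of x + y = o, since
  the full group axioms have not been established.\<close>

lemma inv_ec_group: "x \<in> E \<Longrightarrow> inv\<^bsub>ec_group l\<^esub> x = neg x"
  unfolding m_inv_def mult_ec_group carrier_ec_group
  using add_neg_self[of x] add_eq_origin_iff[of _ x] by (intro the_equality) (auto simp: neg_closed)

lemma subgroup_ec_groupI:
  assumes "S \<subseteq> E" "origin \<in> S" "\<And>x. x \<in> S \<Longrightarrow> neg x \<in> S" "\<And>x y. x \<in> S \<Longrightarrow> y \<in> S \<Longrightarrow> x \<oplus>\<^sub>E y \<in> S"
  shows "subgroup S (ec_group l)"
proof
  show "S \<subseteq> carrier (ec_group l)" using assms(1) by (simp add: carrier_ec_group)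
  show "x \<otimes>\<^bsub>ec_group l\<^esub> y \<in> S" if "x \<in> S" "y \<in> S" for x y using assms(4)[OF that] by (simp add: mult_ec_group)
  show "\<one>\<^bsub>ec_group l\<^esub> \<in> S" using assms(2) by (simp add: carrier_ec_group)
  show "inv\<^bsub>ec_group l\<^esub> x \<in> S" if "x \<in> S" for x using assms(1,3) that inv_ec_group[of x] by auto
qed

lemma subgroup_flexes: "subgroup flexes (ec_group l)"
  by (rule subgroup_ec_groupI) (use flexes_E flexes_origin flexes_neg flexes_add in blast)+

lemma two_torsion_subset_closed:
  assumes "w \<in> E" "neg w = w" "x \<in> {origin, w}" "y \<in> {origin, w}"
  shows "x \<oplus>\<^sub>E y \<in> {origin, w}" "neg x \<in> {origin, w}"
  using assms add_neg_self(1)[OF assms(1)] add_origin[OF assms(1)] add_origin_right[OF assms(1)]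
    add_origin[OF origin_in] neg_origin by auto

lemma generate_two_torsion:
  assumes "w \<in> E" "neg w = w"
  shows "generate (ec_group l) {w} = {origin, w}"
proof
  note c = two_torsion_subset_closed[OF assms]
  show "generate (ec_group l) {w} \<subseteq> {origin, w}"
  proof
    fix x assume "x \<in> generate (ec_group l) {w}"
    then show "x \<in> {origin, w}"
    proof (induction rule: generate.induct)
      case one
      then show ?case by (simp add: carrier_ec_group)
    next
      case (incl h)
      then show ?case by simp
    next
      case (inv h)
      then show ?case using assms inv_ec_group by simp
    next
      case (eng h1 h2)
      then show ?case using c(1) by (simp add: mult_ec_group)
    qed
  qed
  have "\<one>\<^bsub>ec_group l\<^esub> \<in> generate (ec_group l) {w}" "w \<in> generate (ec_group l) {w}"
    by (auto intro: generate.intros)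
  then show "{origin, w} \<subseteq> generate (ec_group l) {w}" by (simp add: carrier_ec_group)
qed

end

section \<open>The curve with \<open>j = 12\<^sup>3\<close>\<close>

locale square_cubic = hesse_cubic l for l :: "'k::{alg_closed_field, field_char_0}" +
  fixes s e :: 'k
  assumes l1: "l = 1 + s" and s: "s\<^sup>2 = 3" and e: "e ^ 3 = 1" "e \<noteq> 1"
begin

text \<open>Rewrite rules that bring polynomials in \<open>e\<close> to degree one; the last reaches
  nested products.\<close>

lemma e_mult: "e\<^sup>2 = - 1 - e" "e * e = - 1 - e" "e * (e * x) = - x - e * x"
proof -
  have "e\<^sup>2 = - (e + 1)"
    using cube_root_of_unity_sum[OF e] by (simp only: eq_neg_iff_add_eq_0 add.assoc)
  then show 1: "e\<^sup>2 = - 1 - e" by simp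
  then show 2: "e * e = - 1 - e" by (simp add: power2_eq_square)
  have "e * (e * x) = (e * e) * x" by (simp add: mult.assoc)
  then show "e * (e * x) = - x - e * x" unfolding 2 by (simp add: algebra_simps)
qed

lemma s_mult: "s * s = 3" "s * (s * x) = 3 * x"
  using s by (simp_all add: power2_eq_square mult.assoc[symmetric])

lemma s_neq: "s \<noteq> 0" "s \<noteq> - 1" "s \<noteq> 3"
  using s by auto

lemma l_mult: "l\<^sup>2 = 4 + 2 * s" "l ^ 3 = 10 + 6 * s"
  unfolding l1 by (simp_all add: power2_eq_square power3_eq_cube algebra_simps s_mult)

text \<open>For this parameter \<open>l ^ 6\<close> equals 208 + 120 s, which is
  \<open>20 * l ^ 3 + 8\<close>.\<close>

lemma wB_0: "wB = 0"
proof -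
  have "l ^ 6 = (l ^ 3)\<^sup>2" by (simp flip: power_mult)
  also have "\<dots> = 208 + 120 * s" unfolding l_mult(2) by (simp add: power2_eq_square algebra_simps s_mult)
  finally show ?thesis unfolding wB_def unfolding l_mult(2) by simp
qed

lemma wA_nonzero: "wA \<noteq> 0"
  using wAB_nonsingular by (auto simp: wB_0)

text \<open>The relation between \<open>kap\<close> and \<open>s\<close> by which
  \<open>tauL\<close> scales the first Weierstrass coordinate in \<open>to_w_tauL\<close>.\<close>

lemma kap_s: "2 * s * l\<^sup>2 * kap = 1"
proof -
  have "(- 3) * (2 * s * l\<^sup>2 * kap) = 4 * kap * (1 - l ^ 3)"
    unfolding l_mult by (simp add: algebra_simps s_mult)
  then have "(- 3) * (2 * s * l\<^sup>2 * kap) = (- 3) * 1" unfolding kap(2) by simp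
  then show ?thesis by (rule mult_left_cancel[THEN iffD1, rotated]) simp
qed

fun tauL :: "'k vec3 \<Rightarrow> 'k vec3" where
  "tauL (a, b, c) = (e\<^sup>2 * a + e * b + c, e * a + e\<^sup>2 * b + c, a + b + c)"

lemma tauL_linear: "lin3 tauL"
  unfolding lin3_def by (auto simp: algebra_simps)

lemma tauL_tauL: "tauL (tauL v) = smul3 3 (swap3 v)"
  by (cases v) (simp add: algebra_simps e_mult)

lemma tauL_swap3: "tauL (swap3 v) = swap3 (tauL v)"
  by (cases v) (simp add: algebra_simps)

text \<open>A square root of -1: the difference of the primitive cube roots of unity squares to -3,
  and \<open>s\<close> to 3.\<close>

definition bt :: 'k where "bt = (e\<^sup>2 - e) / s"

lemma bt_square: "bt\<^sup>2 = - 1"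
proof -
  have "(e\<^sup>2 - e)\<^sup>2 = - 3" unfolding e_mult(1) by (simp add: power2_eq_square algebra_simps e_mult(2,3))
  then show ?thesis using s by (simp add: bt_def power_divide)
qed

text \<open>In affine Weierstrass coordinates this is the complex multiplication (X, Y) -> (-X, iY),
  with i = \<open>bt\<close>.\<close>

lemma to_w_tauL:
  assumes "to_w v = (X, Y, Z)"
  shows "to_w (tauL v) = smul3 s (- 1 * X, bt * Y, Z)"
proof -
  obtain a b c where v: "v = (a, b, c)" by (cases v)
  define m where "m = a + b + l * c"
  have XYZ: "X = c - l\<^sup>2 * (kap * m)" "Y = a - b" "Z = kap * m" using assms by (auto simp: v m_def)
  \<comment> \<open>The tangent at the origin is mapped to itself with factor
    \<open>s\<close>.\<close>
  have m': "(e\<^sup>2 * a + e * b + c) + (e * a + e\<^sup>2 * b + c) + l * (a + b + c) = s * m"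
    unfolding e_mult(1) m_def l1 by (simp add: algebra_simps s_mult)
  have sb: "s * (bt * Y) = (e\<^sup>2 - e) * Y" using s_neq by (simp add: bt_def)
  have "a + b + c + s * c = m" unfolding m_def l1 by (simp add: algebra_simps)
  then have "a + b + c + s * c = (2 * s * l\<^sup>2 * kap) * m" unfolding kap_s by simp
  then have X': "a + b + c - l\<^sup>2 * (kap * (s * m)) = s * (- 1 * X)"
    unfolding XYZ by (simp add: algebra_simps eq_diff_eq diff_eq_eq)
  have "to_w (tauL v) = (a + b + c - l\<^sup>2 * (kap * (s * m)), (e\<^sup>2 - e) * (a - b), kap * (s * m))"
    using m' unfolding v by (simp add: algebra_simps)
  then have "to_w (tauL v) = (s * (- 1 * X), s * (bt * Y), s * Z)"
    unfolding X' sb unfolding XYZ(2,3) mult.left_commute[of s kap] .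
  then show ?thesis by simp
qed

text \<open>The factor of the form is read off in the Weierstrass model: as \<open>wB = 0\<close>,
  each remaining monomial is multiplied by the same constant, minus the cube of
  \<open>s\<close>.\<close>

lemma tauL_iso: "hesse_iso tauL"
proof (rule hesse_isoI[of _ "- (s ^ 3)"])
  have M: "lin3 (\<lambda>v. smul3 (1 / 3) (tauL (swap3 v)))"
    unfolding lin3_def by (auto simp: algebra_simps)
  show "lin_iso tauL"
  proof (rule lin_isoI[OF tauL_linear M])
    fix v :: "'k vec3"
    have "smul3 (1 / 3) (smul3 3 v) = v" by (cases v) simp
    then show "smul3 (1 / 3) (tauL (swap3 (tauL v))) = v" "tauL (smul3 (1 / 3) (tauL (swap3 v))) = v"
      using lin3_smul[OF tauL_linear] by (simp_all add: tauL_swap3[symmetric] tauL_tauL swap3_swap3 del: smul3.simps tauL.simps swap3.simps)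
  qed
  show "hesse_form l (tauL v) = - (s ^ 3) * hesse_form l v" for v
  proof -
    obtain X Y Z where w: "to_w v = (X, Y, Z)" by (cases "to_w v")
    have b: "bt * bt = - 1" "bt * (bt * x) = - x" for x
      using bt_square by (simp_all add: power2_eq_square mult.assoc[symmetric])
    have "weierstrass_form wA wB (to_w (tauL v)) = - (s ^ 3) * weierstrass_form wA wB (to_w v)"
      unfolding to_w_tauL[OF w] w by (simp add: wB_0 algebra_simps power2_eq_square power3_eq_cube b)
    then have "(4 * kap / 3) * hesse_form l (tauL v) = (4 * kap / 3) * (- (s ^ 3) * hesse_form l v)"
      unfolding weierstrass_form_to_w by (simp only: ac_simps)
    moreover have "4 * kap / 3 \<noteq> 0" using kap(1) by simp
    ultimately show ?thesis by (metis mult_left_cancel)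
  qed
qed (use s_neq in simp)

lemma negtauL_iso: "hesse_iso (\<lambda>v. swap3 (tauL v))"
  by (rule hesse_iso_comp[OF hesse_iso_swap3 tauL_iso])

abbreviation "tau \<equiv> lift tauL"
abbreviation "negtau \<equiv> lift (\<lambda>v. swap3 (tauL v))"

lemma tauL_origin: "pt (tauL (1, -1, 0)) = origin" "pt (swap3 (tauL (1, -1, 0))) = origin"
proof -
  have "e\<^sup>2 \<noteq> e" using e by (auto simp: power2_eq_square power3_eq_cube)
  then have d: "e\<^sup>2 - e \<noteq> 0" "e - e\<^sup>2 \<noteq> 0" by simp_all
  show "pt (tauL (1, -1, 0)) = origin" "pt (swap3 (tauL (1, -1, 0))) = origin"
    using pt_smul[of "(1, -1, 0)" "e\<^sup>2 - e"] pt_smul[of "(1, -1, 0)" "e - e\<^sup>2"] d by (simp_all add: origin_def algebra_simps)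
qed

lemma tau_stab: "tau \<in> stab"
  by (rule lift_stab[OF tauL_iso tauL_origin(1)])

lemma negtau_stab: "negtau \<in> stab"
  by (rule lift_stab[OF negtauL_iso tauL_origin(2)])

lemma tau_square: "tau \<otimes>\<^bsub>G\<^esub> tau = negE"
  by (rule lift_comp[OF tau_stab tau_stab tauL_iso tauL_iso negE_stab hesse_iso_swap3, of 3])
    (simp_all add: tauL_tauL del: tauL.simps swap3.simps smul3.simps)

lemma negtau_square: "negtau \<otimes>\<^bsub>G\<^esub> negtau = negE"
  by (rule lift_comp[OF negtau_stab negtau_stab negtauL_iso negtauL_iso negE_stab hesse_iso_swap3, of 3])
    (simp_all add: tauL_swap3 tauL_tauL swap3_swap3 del: tauL.simps swap3.simps smul3.simps)

lemma negE_negtau: "negE \<otimes>\<^bsub>G\<^esub> negtau = tau"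
  by (rule lift_comp[OF negE_stab negtau_stab hesse_iso_swap3 negtauL_iso tau_stab tauL_iso, of 1])
    (simp_all add: swap3_swap3 del: tauL.simps swap3.simps smul3.simps)

lemma negE_tau: "negE \<otimes>\<^bsub>G\<^esub> tau = negtau"
  by (rule lift_comp[OF negE_stab tau_stab hesse_iso_swap3 tauL_iso negtau_stab negtauL_iso, of 1])
    (simp_all del: tauL.simps swap3.simps smul3.simps)

lemma tau_E_eq: "tau_E l e = tau"
proof -
  have "l \<noteq> 0" "(l - 1)\<^sup>2 = 3" using s s_neq unfolding l1 by (simp_all add: add_eq_0_iff)
  then have "(\<lambda>(a, b, c). if l = 0 then (b, a, e * c)
     else if (l - 1) ^ 2 = 3 then (e ^ 2 * a + e * b + c, e * a + e ^ 2 * b + c, a + b + c)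
     else (b, a, c)) = tauL"
    by auto
  then show ?thesis unfolding tau_E_def lift_def by simp
qed

lemma generate_tau_square: "generate G {tau_E l e [^]\<^bsub>G\<^esub> (2::nat)} = {\<one>\<^bsub>G\<^esub>, negE}"
proof -
  have "tau_E l e [^]\<^bsub>G\<^esub> (2::nat) = negE"
    using tau_square stab_carrier[OF tau_stab] by (simp add: tau_E_eq numeral_2_eq_2)
  then show ?thesis using G.generate_involution[OF stab_carrier[OF negE_stab] negE_square] by simp
qed

lemma to_w_negtauL:
  assumes "to_w v = (X, Y, Z)"
  shows "to_w (swap3 (tauL v)) = smul3 s (- 1 * X, - bt * Y, Z)"
proof -
  have "to_w (tauL v) = (s * (- 1 * X), s * (bt * Y), s * Z)" using to_w_tauL[OF assms] by simp
  from to_w_swap3[OF this] show ?thesis by simp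
qed

lemma stab_square: "stab = {\<one>\<^bsub>G\<^esub>, negE, tau, negtau}"
proof
  show "stab \<subseteq> {\<one>\<^bsub>G\<^esub>, negE, tau, negtau}"
  proof
    fix \<rho> assume "\<rho> \<in> stab"
    then obtain \<alpha> \<beta> where *: "\<alpha> ^ 3 = \<beta>\<^sup>2" "wA * \<alpha> = \<beta>\<^sup>2 * wA" "\<beta> \<noteq> 0"
      "\<And>L c. hesse_iso L \<Longrightarrow> lift L \<in> stab \<Longrightarrow> c \<noteq> 0 \<Longrightarrow>
       (\<And>v X Y Z. to_w v = (X, Y, Z) \<Longrightarrow> to_w (L v) = smul3 c (\<alpha> * X, \<beta> * Y, Z)) \<Longrightarrow> \<rho> = lift L"
      using stab_diagonal by metis
    \<comment> \<open>With \<alpha>^3 = \<beta>^2 this gives \<alpha>^2 = 1, hence the four values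
      1, -1, \<open>bt\<close>, \<open>- bt\<close> of \<beta>.\<close>
    have a: "\<alpha> = \<beta>\<^sup>2" using *(2) wA_nonzero by simp
    then have "\<alpha> * (\<alpha> * \<alpha>) = \<alpha> * 1" "\<alpha> \<noteq> 0" using *(1,3) by (simp_all add: power3_eq_cube mult.assoc)
    then have "\<alpha>\<^sup>2 = 1" by (simp add: power2_eq_square)
    then consider "\<alpha> = 1" | "\<alpha> = - 1" by (auto simp: power2_eq_1_iff)
    then show "\<rho> \<in> {\<one>\<^bsub>G\<^esub>, negE, tau, negtau}"
    proof cases
      case 1
      then consider "\<beta> = 1" | "\<beta> = - 1" using a by (auto simp: power2_eq_1_iff)
      then show ?thesis
      proof cases
        case 1
        have "\<rho> = lift (\<lambda>v. v)"
          by (rule *(4)[OF hesse_iso_id lift_id(1), of 1]) (unfold \<open>\<alpha> = 1\<close> 1, simp, rule to_w_id)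
        then show ?thesis using lift_id(2) by simp
      next
        case 2
        have "\<rho> = negE"
          by (rule *(4)[OF hesse_iso_swap3 negE_stab, of 1]) (unfold \<open>\<alpha> = 1\<close> 2, simp, rule to_w_swap3)
        then show ?thesis by simp
      qed
    next
      case 2
      then have "(\<beta> - bt) * (\<beta> + bt) = 0" using a bt_square by (simp add: algebra_simps power2_eq_square)
      then consider "\<beta> = bt" | "\<beta> = - bt" by (auto simp: add_eq_0_iff2)
      then show ?thesis
      proof cases
        case 1
        have "\<rho> = tau"
          by (rule *(4)[OF tauL_iso tau_stab s_neq(1)]) (unfold \<open>\<alpha> = - 1\<close> 1, rule to_w_tauL)
        then show ?thesis by simp
      next
        case 2
        have "\<rho> = negtau"
          by (rule *(4)[OF negtauL_iso negtau_stab s_neq(1)]) (unfold \<open>\<alpha> = - 1\<close> 2, rule to_w_negtauL)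
        then show ?thesis by simp
      qed
    qed
  qed
  show "{\<one>\<^bsub>G\<^esub>, negE, tau, negtau} \<subseteq> stab" using one_stab negE_stab tau_stab negtau_stab by simp
qed

section \<open>Fixed points of the automorphism of order four\<close>

abbreviation "w \<equiv> pt (1, 1, l)"

lemma w_on: "on_hesse l (1, 1, l)"
proof -
  have "l * l = 4 + 2 * s" using l_mult(1) by (simp add: power2_eq_square)
  then have "3 * l * l = 12 + 6 * s" by (simp add: mult.assoc)
  then show ?thesis by (simp add: on_hesse_def l_mult(2))
qed

lemma w_E: "w \<in> E"
  using w_on by (rule pt_in_E)

lemma neg_w: "neg w = w"
  by (simp add: neg_pt)

lemma tau_w: "tau w = w"
proof -
  have "tauL (1, 1, l) = smul3 s (1, 1, l)" unfolding l1 by (simp add: algebra_simps e_mult s_mult)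
  then show ?thesis using lift_pt[OF tauL_iso w_on] pt_smul[of "(1, 1, l)" s] s_neq(1) by simp
qed

lemma w_not_flex: "w \<notin> flexes"
  using flexes_pt[OF w_on] s_neq unfolding l1 by (simp add: flex_iff add_eq_0_iff)

lemma tau_tau: "q \<in> E \<Longrightarrow> tau (tau q) = neg q"
  using stab_mult(2)[OF tau_stab tau_stab, of q] tau_square negE_apply by simp

lemma tau_origin: "tau origin = origin"
  using tau_stab by (simp add: stab_def)

text \<open>A fixed point of \<tau> is fixed by \<tau>^2 = -1, hence is the origin or of the form
  (a, a, c); in the latter case (c - a)^2 = 3 a^2.\<close>

lemma tau_fixed:
  assumes "q \<in> E" "tau q = q"
  shows "q \<in> {origin, w}"
proof -
  obtain P where P: "on_hesse l P" "q = pt P" using assms(1) by (rule hesse_curve_cases)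
  have "neg (pt P) = pt P" using tau_tau[OF assms(1)] assms(2) P(2) by simp
  with P(1) show ?thesis
  proof (cases rule: neg_fixed_cases)
    case 1
    then show ?thesis using P(2) by simp
  next
    case (2 a c)
    have n: "P \<noteq> null3" "tauL P \<noteq> null3" using P(1) hesse_isoD(2)[OF tauL_iso, of P] by (simp_all add: on_hesse_def)
    have "pt P = pt (tauL P)" using assms(2) P lift_pt[OF tauL_iso P(1)] by simp
    then have "cross3 P (tauL P) = null3" using pt_eq_iff_cross3[OF n] by blast
    then have "a * (a + a + c) = c * (e * a + e\<^sup>2 * a + c)" by (simp add: 2)
    then have "(c - a)\<^sup>2 = 3 * a\<^sup>2" unfolding e_mult(1) by (simp add: algebra_simps power2_eq_square)
    then have "(c - (a + s * a)) * (c - (a - s * a)) = 0"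
      by (simp add: algebra_simps power2_eq_square s_mult)
    then have "c = a + s * a \<or> c = a - s * a" by (simp del: diff_diff_eq)
    then consider "c = (1 + s) * a" | "c = (1 - s) * a" by (auto simp: algebra_simps)
    then show ?thesis
    proof cases
      case 1
      have "a \<noteq> 0" using n(1) 1 by (auto simp: 2)
      moreover have "P = smul3 a (1, 1, l)" by (simp add: 2 1 l1)
      ultimately show ?thesis using pt_smul[of "(1, 1, l)" a] P(2) by simp
    next
      \<comment> \<open>The conjugate solution (1, 1, 1 - s) lies on the Hesse cubic with parameter
        1 - s, not on this one.\<close>
      case c: 2
      have "a \<noteq> 0" using n(1) c by (auto simp: 2)
      have "hesse_form l P = a ^ 3 * (18 - 6 * s)"
        unfolding 2 c l1 by (simp add: algebra_simps power3_eq_cube s_mult)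
      moreover have "18 - 6 * s \<noteq> 0"
      proof
        assume "18 - 6 * s = 0"
        then have "6 * s = 6 * 3" by simp
        then show False using s_neq(3) by (subst (asm) mult_left_cancel) simp_all
      qed
      ultimately show ?thesis using P(1) \<open>a \<noteq> 0\<close> by (simp add: on_hesse_def)
    qed
  qed
qed

definition F :: "'k plane set" where
  "F = {origin, w} <#>\<^bsub>ec_group l\<^esub> flexes"

lemma F_iff: "p \<in> F \<longleftrightarrow> (\<exists>q\<in>{origin, w}. \<exists>t\<in>flexes. p = q \<oplus>\<^sub>E t)"
  unfolding F_def set_mult_def by (simp add: mult_ec_group)

lemma direct_sum_F: "is_direct_sum (ec_group l) F (generate (ec_group l) {w}) flexes"
proof -
  have "subgroup {origin, w} (ec_group l)"
    by (rule subgroup_ec_groupI) (use w_E origin_in two_torsion_subset_closed[OF w_E neg_w] in blast)+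
  moreover have "{origin, w} \<inter> flexes = {origin}" using flexes_origin w_not_flex by auto
  ultimately show ?thesis
    unfolding is_direct_sum_def generate_two_torsion[OF w_E neg_w]
    using subgroup_flexes by (simp add: F_def carrier_ec_group)
qed

lemma twisted_fix_tau:
  assumes "p \<in> E"
  shows "twisted_fix p tau \<longleftrightarrow> p \<in> F"
proof
  assume "twisted_fix p tau"
  then obtain t where t: "t \<in> flexes" "tau p = t \<oplus>\<^sub>E p" unfolding twisted_fix_def by blast
  \<comment> \<open>On E[3] one has (\<tau> - 1)(\<tau> + 1) = -2 = 1, so x = -(\<tau> + 1) t solves
    \<tau> x + t = x. Adding this x to p gives a fixed point of \<tau>.\<close>
  define t1 where "t1 = neg (tau t)"
  define x where "x = t1 \<oplus>\<^sub>E neg t"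
  have t1: "t1 \<in> flexes" unfolding t1_def by (rule flexes_neg[OF stab_flexes[OF tau_stab t(1)]])
  have x: "x \<in> flexes" unfolding x_def by (rule flexes_add[OF t1 flexes_neg[OF t(1)]])
  have tE: "t \<in> E" and t1E: "t1 \<in> E" and xE: "x \<in> E" using t(1) t1 x flexes_E by blast+
  have "tau t1 = t"
    unfolding t1_def using stab_neg[OF tau_stab stab_E[OF tau_stab tE]] tau_tau[OF tE] neg_neg by simp
  then have tx: "tau x = t \<oplus>\<^sub>E t1"
    unfolding x_def using stab_add[OF tau_stab t1E neg_closed[OF tE]] stab_neg[OF tau_stab tE] by (simp add: t1_def)
  have "tau x \<oplus>\<^sub>E t = t1 \<oplus>\<^sub>E (t \<oplus>\<^sub>E t)"
    unfolding tx using add_commute[OF tE t1E] flexes_assoc[OF t1 tE tE] by simp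
  also have "\<dots> = x" using t(1) by (simp add: x_def flexes_def)
  finally have *: "tau x \<oplus>\<^sub>E t = x" .
  define q where "q = x \<oplus>\<^sub>E p"
  have qE: "q \<in> E" unfolding q_def by (rule add_closed[OF xE assms])
  have "tau q = tau x \<oplus>\<^sub>E (t \<oplus>\<^sub>E p)" unfolding q_def using stab_add[OF tau_stab xE assms] t(2) by simp
  also have "\<dots> = q" unfolding flexes_assoc[OF stab_flexes[OF tau_stab x] tE assms] * q_def ..
  finally have q: "q \<in> {origin, w}" using tau_fixed[OF qE] by simp
  have "p = q \<oplus>\<^sub>E neg x"
    using neg_add_cancel(1)[OF xE assms] add_commute[OF qE neg_closed[OF xE]] by (simp add: q_def)
  then show "p \<in> F" unfolding F_iff using q flexes_neg[OF x] by blast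
next
  assume "p \<in> F"
  then obtain q t where q: "q \<in> {origin, w}" and t: "t \<in> flexes" "p = q \<oplus>\<^sub>E t" unfolding F_iff by blast
  have qE: "q \<in> E" using q w_E origin_in by blast
  have tE: "t \<in> E" using t(1) by (rule flexes_E)
  have tq: "tau q = q" using q tau_w tau_origin by blast
  have tt: "tau t \<in> flexes" by (rule stab_flexes[OF tau_stab t(1)])
  have p: "p = t \<oplus>\<^sub>E q" using t(2) add_commute[OF qE tE] by simp
  have "(tau t \<oplus>\<^sub>E neg t) \<oplus>\<^sub>E p = tau t \<oplus>\<^sub>E (neg t \<oplus>\<^sub>E (t \<oplus>\<^sub>E q))"
    unfolding p using flexes_assoc[OF tt neg_closed[OF tE] add_closed[OF tE qE]] by simp
  also have "\<dots> = tau p" unfolding neg_add_cancel(1)[OF tE qE] unfolding p using stab_add[OF tau_stab tE qE] tq by simp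
  finally show "twisted_fix p tau" unfolding twisted_fix_def using flexes_add[OF tt flexes_neg[OF t(1)]] by metis
qed

lemma square_Z_M:
  assumes p: "p \<in> E" "p \<notin> flexes"
  shows "neg p \<noteq> p \<Longrightarrow> restr_on E (Z_set E (tr p)) = translation_group l 3"
    "neg p = p \<Longrightarrow> p \<notin> {origin, w} \<Longrightarrow> is_semidirect G (restr_on E (Z_set E (tr p))) (translation_group l 3)
       (generate G {tau_E l e [^]\<^bsub>G\<^esub> (2::nat)})"
    "p = w \<Longrightarrow> Z_set E (tr p) = Aut_down E"
    "p \<oplus>\<^sub>E p \<notin> flexes \<Longrightarrow> restr_on E (M_set E (tr p)) = translation_group l 3"
    "p \<oplus>\<^sub>E p \<in> flexes \<Longrightarrow> p \<notin> F \<Longrightarrow> is_semidirect G (restr_on E (M_set E (tr p))) (translation_group l 3)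
       (generate G {tau_E l e [^]\<^bsub>G\<^esub> (2::nat)})"
    "p \<in> F \<Longrightarrow> M_set E (tr p) = Aut_down E"
proof -
  have one: "\<one>\<^bsub>G\<^esub> p = p" using p(1) by (simp add: BijGroup_one)
  note n = negE_apply[OF p(1)]
  \<comment> \<open>The fixing elements form a group, and \<open>tau\<close> and
    \<open>negtau\<close> each generate the cyclic group of order four: one of them fixes p only if
    all four do. The same pattern recurs for \<open>twisted_fix\<close>.\<close>
  have Zn: "negE p = p" if "negtau p = p"
    using stab_mult(2)[OF negtau_stab negtau_stab p(1)] negtau_square that by simp
  have Zt: "p = w" if "tau p = p" using tau_fixed[OF p(1) that] p(2) flexes_origin by blast
  have Znt: "tau p = p" if "negtau p = p"
    using stab_mult(2)[OF negE_stab negtau_stab p(1)] negE_negtau Zn[OF that] that by simp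
  have wneg: "neg p = p" if "tau p = p" using tau_tau[OF p(1)] that by simp
  have sub: "subgroup {\<one>\<^bsub>G\<^esub>, negE} G" "{\<one>\<^bsub>G\<^esub>, negE} \<subseteq> stab"
    using G.generate_is_subgroup[of "{negE}"] stab_carrier[OF negE_stab]
      G.generate_involution[OF stab_carrier[OF negE_stab] negE_square] one_stab negE_stab by simp_all
  note tw1 = twisted_fix_one[OF p(1)] and twn = twisted_fix_negE[OF p(1)] and twt = twisted_fix_tau[OF p(1)]
  have Mn: "twisted_fix p negE" if "twisted_fix p negtau"
    using twisted_fix_comp[OF p(1) negtau_stab negtau_stab that that] negtau_square by simp
  have Mnt: "twisted_fix p tau" if "twisted_fix p negtau"
    using twisted_fix_comp[OF p(1) negE_stab negtau_stab Mn[OF that] that] negE_negtau by simp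
  have Mt: "twisted_fix p negE" if "twisted_fix p tau"
    using twisted_fix_comp[OF p(1) tau_stab tau_stab that that] tau_square by simp
  have Mtn: "twisted_fix p negtau" if "twisted_fix p tau"
    using twisted_fix_comp[OF p(1) negE_stab tau_stab Mt[OF that] that] negE_tau by simp
  have stabE: "\<rho> = \<one>\<^bsub>G\<^esub> \<or> \<rho> = negE \<or> \<rho> = tau \<or> \<rho> = negtau" if "\<rho> \<in> stab" for \<rho>
    using that unfolding stab_square by blast
  show "restr_on E (Z_set E (tr p)) = translation_group l 3" if "neg p \<noteq> p"
  proof -
    have "\<rho> = \<one>\<^bsub>G\<^esub>" if "\<rho> \<in> stab" "\<rho> p = p" for \<rho>
      using stabE[OF that(1)] that(2) \<open>neg p \<noteq> p\<close> n Znt wneg by metis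
    then have "{\<rho> \<in> stab. \<rho> p = p} = {\<one>\<^bsub>G\<^esub>}" using one one_stab by blast
    then show ?thesis using restr_Z_set[OF p(1)] translation_group_3 by simp
  qed
  show "is_semidirect G (restr_on E (Z_set E (tr p))) (translation_group l 3)
       (generate G {tau_E l e [^]\<^bsub>G\<^esub> (2::nat)})" if "neg p = p" "p \<notin> {origin, w}"
  proof -
    have "\<rho> = \<one>\<^bsub>G\<^esub> \<or> \<rho> = negE" if "\<rho> \<in> stab" "\<rho> p = p" for \<rho>
      using stabE[OF that(1)] that(2) \<open>p \<notin> {origin, w}\<close> Znt Zt by blast
    moreover have "negE p = p" using n \<open>neg p = p\<close> by simp
    ultimately have "{\<rho> \<in> stab. \<rho> p = p} = {\<one>\<^bsub>G\<^esub>, negE}" using one one_stab negE_stab by blast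
    then show ?thesis using restr_Z_set[OF p(1)] semidirect_combs[OF sub] generate_tau_square by simp
  qed
  show "Z_set E (tr p) = Aut_down E" if "p = w"
  proof (rule Z_set_full[OF p(1)])
    have t: "tau p = p" using that tau_w by simp
    then have "negE p = p" using n wneg by simp
    then have "negtau p = p" using stab_mult(2)[OF negE_stab tau_stab p(1)] negE_tau t by simp
    then show "\<rho> p = p" if "\<rho> \<in> stab" for \<rho> using stabE[OF that] one t \<open>negE p = p\<close> by blast
  qed
  show "restr_on E (M_set E (tr p)) = translation_group l 3" if "p \<oplus>\<^sub>E p \<notin> flexes"
  proof -
    have "\<not> twisted_fix p negE" using that twn by simp
    then have "\<rho> = \<one>\<^bsub>G\<^esub>" if "\<rho> \<in> stab" "twisted_fix p \<rho>" for \<rho>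
      using stabE[OF that(1)] that(2) Mn Mt by blast
    then have "{\<rho> \<in> stab. twisted_fix p \<rho>} = {\<one>\<^bsub>G\<^esub>}" using tw1 one_stab by blast
    then show ?thesis using restr_M_set[OF p(1)] translation_group_3 by simp
  qed
  show "is_semidirect G (restr_on E (M_set E (tr p))) (translation_group l 3)
       (generate G {tau_E l e [^]\<^bsub>G\<^esub> (2::nat)})" if "p \<oplus>\<^sub>E p \<in> flexes" "p \<notin> F"
  proof -
    have "\<not> twisted_fix p tau" using that twt by simp
    then have "\<rho> = \<one>\<^bsub>G\<^esub> \<or> \<rho> = negE" if "\<rho> \<in> stab" "twisted_fix p \<rho>" for \<rho>
      using stabE[OF that(1)] that(2) Mnt by blast
    moreover have "twisted_fix p negE" using that twn by simp
    ultimately have "{\<rho> \<in> stab. twisted_fix p \<rho>} = {\<one>\<^bsub>G\<^esub>, negE}" using tw1 one_stab negE_stab by blast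
    then show ?thesis using restr_M_set[OF p(1)] semidirect_combs[OF sub] generate_tau_square by simp
  qed
  show "M_set E (tr p) = Aut_down E" if "p \<in> F"
  proof (rule M_set_full[OF p(1)])
    have t: "twisted_fix p tau" using that twt by simp
    show "twisted_fix p \<rho>" if "\<rho> \<in> stab" for \<rho> using stabE[OF that] tw1 t Mt[OF t] Mtn[OF t] by blast
  qed
qed

end

section \<open>The three cases by the j-invariant\<close>

theorem theorem4p11:
  fixes l s e :: "'k::{alg_closed_field, field_char_0}"
    and p :: "'k plane"
    and A :: "((gen3 list \<Rightarrow> 'k) set) ring"
  defines "E \<equiv> hesse_curve l"
    and "\<sigma> \<equiv> translation l p"
    and "G \<equiv> BijGroup (hesse_curve l)"
    and "\<tau> \<equiv> tau_E l e"
    and "j \<equiv> j_invariant (hesse_curve l) origin"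
    and "T3 \<equiv> translation_group l 3"
    and "w \<equiv> pt (1, 1, l)"
  assumes "l ^ 3 \<noteq> 1"
    and "e ^ 3 = 1" and "e \<noteq> 1"
    and "s ^ 2 = 3"
    and "j = 0 \<Longrightarrow> l = 0"
    and "j = 12 ^ 3 \<Longrightarrow> l = 1 + s"
    and "p \<in> E" and "p \<notin> torsion l 3"
    and "A = geometric_algebra E \<sigma>"
  shows
    "(j \<noteq> 0 \<and> j \<noteq> 12 ^ 3 \<longrightarrow>
        (p \<notin> torsion l 2 \<longrightarrow> restr_on E (Z_set E \<sigma>) = T3) \<and>
        (p \<in> torsion l 2 \<longrightarrow> Z_set E \<sigma> = Aut_down E) \<and>
        (p \<notin> torsion l 6 \<longrightarrow> restr_on E (M_set E \<sigma>) = T3) \<and>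
        (p \<in> torsion l 6 \<longrightarrow> M_set E \<sigma> = Aut_down E)) \<and>
     (j = 0 \<longrightarrow>
        (p \<notin> torsion l 2 \<longrightarrow> restr_on E (Z_set E \<sigma>) = T3) \<and>
        (p \<in> torsion l 2 \<longrightarrow>
           is_semidirect G (restr_on E (Z_set E \<sigma>)) T3 (generate G {\<tau> [^]\<^bsub>G\<^esub> (3::nat)})) \<and>
        (p \<notin> ninth_power_points l \<union> torsion l 6 \<longrightarrow> restr_on E (M_set E \<sigma>) = T3) \<and>
        (p \<in> ninth_power_points l \<longrightarrow>
           is_semidirect G (restr_on E (M_set E \<sigma>)) T3 (generate G {\<tau> [^]\<^bsub>G\<^esub> (2::nat)})) \<and>
        (p \<in> torsion l 6 \<longrightarrow>
           is_semidirect G (restr_on E (M_set E \<sigma>)) T3 (generate G {\<tau> [^]\<^bsub>G\<^esub> (3::nat)}))) \<and>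
     (j = 12 ^ 3 \<longrightarrow>
        (p \<notin> torsion l 2 \<longrightarrow> restr_on E (Z_set E \<sigma>) = T3) \<and>
        (p \<in> torsion l 2 - generate (ec_group l) {w} \<longrightarrow>
           is_semidirect G (restr_on E (Z_set E \<sigma>)) T3 (generate G {\<tau> [^]\<^bsub>G\<^esub> (2::nat)})) \<and>
        (p = w \<longrightarrow> Z_set E \<sigma> = Aut_down E) \<and>
        (p \<notin> torsion l 6 \<longrightarrow> restr_on E (M_set E \<sigma>) = T3) \<and>
        (\<exists>F. is_direct_sum (ec_group l) F (generate (ec_group l) {w}) (torsion l 3) \<and>
           (p \<in> torsion l 6 - F \<longrightarrow>
              is_semidirect G (restr_on E (M_set E \<sigma>)) T3 (generate G {\<tau> [^]\<^bsub>G\<^esub> (2::nat)})) \<and>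
           (p \<in> F \<longrightarrow> M_set E \<sigma> = Aut_down E)))"
proof -
  note defs = E_def \<sigma>_def G_def \<tau>_def j_def T3_def w_def
  interpret H: hesse_cubic l
    by unfold_locales (rule \<open>l ^ 3 \<noteq> 1\<close>)
  have p: "p \<in> hesse_curve l" "p \<notin> H.flexes"
    using \<open>p \<in> E\<close> \<open>p \<notin> torsion l 3\<close> by (simp_all add: E_def H.torsion_3)
  have t2: "p \<in> torsion l 2 \<longleftrightarrow> neg p = p" and t6: "p \<in> torsion l 6 \<longleftrightarrow> H.add p p \<in> H.flexes"
    using p(1) by (simp_all add: H.torsion_2 H.torsion_6)
  have j: "j = 12 ^ 3 * (4 * H.wA ^ 3) / (4 * H.wA ^ 3 + 27 * H.wB\<^sup>2)"
    unfolding j_def by (rule H.j_invariant_hesse)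
  \<comment> \<open>By the formula for j, \<open>wA = 0\<close> gives j = 0, and
    \<open>wB = 0\<close> gives j = 12^3 because the discriminant is nonzero.\<close>
  have wA: "H.wA \<noteq> 0" if "j \<noteq> 0"
    using that unfolding j by auto
  have wB: "H.wB \<noteq> 0" if "j \<noteq> 12 ^ 3"
  proof
    assume "H.wB = 0"
    then show False using that H.wAB_nonsingular unfolding j by simp
  qed
  have 1: "(p \<notin> torsion l 2 \<longrightarrow> restr_on E (Z_set E \<sigma>) = T3) \<and>
      (p \<in> torsion l 2 \<longrightarrow> Z_set E \<sigma> = Aut_down E) \<and>
      (p \<notin> torsion l 6 \<longrightarrow> restr_on E (M_set E \<sigma>) = T3) \<and>
      (p \<in> torsion l 6 \<longrightarrow> M_set E \<sigma> = Aut_down E)" if "j \<noteq> 0 \<and> j \<noteq> 12 ^ 3"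
    using H.generic_Z_M[OF wA wB p(1)] that unfolding defs t2 t6 by blast
  have 2: "(p \<notin> torsion l 2 \<longrightarrow> restr_on E (Z_set E \<sigma>) = T3) \<and>
      (p \<in> torsion l 2 \<longrightarrow>
         is_semidirect G (restr_on E (Z_set E \<sigma>)) T3 (generate G {\<tau> [^]\<^bsub>G\<^esub> (3::nat)})) \<and>
      (p \<notin> ninth_power_points l \<union> torsion l 6 \<longrightarrow> restr_on E (M_set E \<sigma>) = T3) \<and>
      (p \<in> ninth_power_points l \<longrightarrow>
         is_semidirect G (restr_on E (M_set E \<sigma>)) T3 (generate G {\<tau> [^]\<^bsub>G\<^esub> (2::nat)})) \<and>
      (p \<in> torsion l 6 \<longrightarrow>
         is_semidirect G (restr_on E (M_set E \<sigma>)) T3 (generate G {\<tau> [^]\<^bsub>G\<^esub> (3::nat)}))" if "j = 0"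
  proof -
    interpret C: fermat_cubic l e
      using \<open>j = 0 \<Longrightarrow> l = 0\<close> that \<open>e ^ 3 = 1\<close> \<open>e \<noteq> 1\<close> by unfold_locales
    show ?thesis using C.fermat_Z_M[OF p] unfolding defs Un_iff t2 t6 by blast
  qed
  have 3: "(p \<notin> torsion l 2 \<longrightarrow> restr_on E (Z_set E \<sigma>) = T3) \<and>
      (p \<in> torsion l 2 - generate (ec_group l) {w} \<longrightarrow>
         is_semidirect G (restr_on E (Z_set E \<sigma>)) T3 (generate G {\<tau> [^]\<^bsub>G\<^esub> (2::nat)})) \<and>
      (p = w \<longrightarrow> Z_set E \<sigma> = Aut_down E) \<and>
      (p \<notin> torsion l 6 \<longrightarrow> restr_on E (M_set E \<sigma>) = T3) \<and>
      (\<exists>F. is_direct_sum (ec_group l) F (generate (ec_group l) {w}) (torsion l 3) \<and>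
         (p \<in> torsion l 6 - F \<longrightarrow>
            is_semidirect G (restr_on E (M_set E \<sigma>)) T3 (generate G {\<tau> [^]\<^bsub>G\<^esub> (2::nat)})) \<and>
         (p \<in> F \<longrightarrow> M_set E \<sigma> = Aut_down E))" if "j = 12 ^ 3"
  proof -
    interpret C: square_cubic l s e
      using \<open>j = 12 ^ 3 \<Longrightarrow> l = 1 + s\<close> that \<open>s ^ 2 = 3\<close> \<open>e ^ 3 = 1\<close> \<open>e \<noteq> 1\<close> by unfold_locales
    note generate_w = H.generate_two_torsion[OF C.w_E C.neg_w]
    have F: "is_direct_sum (ec_group l) C.F (generate (ec_group l) {pt (1, 1, l)}) (torsion l 3)"
      unfolding H.torsion_3 by (rule C.direct_sum_F)
    show ?thesis
      using C.square_Z_M[OF p] F unfolding defs Diff_iff t2 t6 generate_w by blast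
  qed
  show ?thesis using 1 2 3 by blast
qed

end
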